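(* The construction $\mathrm{PD}$, with the structure maps, unit $\eta$ and multiplication $\mu$ described in the context, extends to a monad on each of the following categories: (1) the category of partition functors; (2) the category of lax symmetric monoidal partition functors; (3) the category of partition rings; (4) the category of partition power functors. (In particular, if $M$ is an object of one of these categories then $\mathrm{PD}(M)$ is again an object of it, functorially in $M$, and $\eta\colon M\to \mathrm{PD}(M)$ and $\mu\colon \mathrm{PD}(\mathrm{PD}(M))\to \mathrm{PD}(M)$ are natural morphisms of that category satisfying the monad axioms.)
   Context: Partitions. A partition $\Lambda=(X,\sim_\Lambda)$ is a finite set $X$ with an equivalence relation; its classes are called blocks. A morphism $f\colon\Lambda\to\Omega=(Y,\sim_\Omega)$ is a bijection $f\colon X\to Y$ with $x\sim_\Lambda x'\Rightarrow f(x)\sim_\Omega f(x')$. There is a (unique) 2-isomorphism $f\Rightarrow g$ between morphisms $f,g\colon\Lambda\to\Omega$ exactly when $f(x)\sim_\Omega g(x)$ for all $x\in X$. This defines a $(2,1)$-category $\mathcal P$; a functor from $\mathcal P$ to an ordinary category identifies 2-isomorphic morphisms. Write $\Lambda\le\Omega$ (refinement) if $X=Y$ and the identity is a morphism $\Lambda\to\Omega$; $\Lambda<\Omega$ if moreover $\Lambda\ne\Omega$. $\Lambda\cap\Gamma$ is the coarsest common refinement; $\Lambda\sqcup\Omega$ is the disjoint union partition. $\underline m$ is $[m]=\{1,\dots,m\}$ with the indiscrete equivalence relation ($\underline 0$ is the empty partition). $\underline i\sqcup\underline j\le\underline{i+j}$ denotes the morphism sending $\underline i$ to the first $i$ and $\underline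 j$ to the last $j$ elements. $\Sigma_\Lambda$ is the group of bijections of $X$ preserving every block; $\Sigma_m=\Sigma_{\underline m}$. For a morphism $f\colon\Lambda\to\Omega$ and $\Gamma\le\Lambda$, $f\Gamma$ is the partition of $Y$ transported from $\Gamma$ along $f$, and $f_\Gamma\colon\Gamma\to f\Gamma$ is the induced isomorphism. Partition functors. A partition functor $M$ consists of abelian groups $M(\Lambda)$ for all partitions $\Lambda$, a contravariant functor $M^*$ (restrictions) and a covariant functor $M_*$ (transfers) from $\mathcal P$ to abelian groups, both with value $M(\Lambda)$ at $\Lambda$, such that $M_*(f)=M^*(f^{-1})$ for $f$ an isomorphism, and for $\Gamma,\Lambda\le\Omega$ the double coset formula holds: $$M^*(\Gamma\le\Omega)M_*(\Lambda\le\Omega)=\sum_{[\sigma]\in\Sigma_\Gamma\backslash\Sigma_\Omega/\Sigma_\Lambda}M_*(\Gamma\cap\sigma\Lambda\le\Gamma)\,M_*(\sigma)\,M^*(\sigma^{-1}\Gamma\cap\Lambda\le\Lambda).$$ Morphisms are families of homomorphisms commuting with restrictions and transfers. We abbreviate $M(m)=M(\underline m)$. Multiplicative structures. A lax symmetric monoidal partition functor is a partition functor $R$ with a unit $\mathbb Z\to R(0)$ and external products $R(\Lambda)\otimes R(\Omega)\to R(\Lambda\sqcup\Omega)$, $x\otimes y\mapsto x\boxtimes y$, natural in pairs of restrictions and in pairs of transfers, and associative, unital and symmetric. A partition ring is a lax symmetric monoidal partition functor $R$ such that each $R(\Lambda)$ is a commutative ring, restrictions and external products are ring maps, and Frobenius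 reciprocity $R_*(f)(R^*(f)(a)\,b)=a\,R_*(f)(b)$ holds for $f\colon\Lambda\to\Omega$, $a\in R(\Omega)$, $b\in R(\Lambda)$. A partition power functor is a partition ring $R$ with multiplicative maps $P_m\colon R(1)\to R(m)$, $m\in\mathbb N$, such that $P_0$ is constant at $1$, $P_m(1)=1$, $P_1=\mathrm{id}$, $R^*(\underline i\sqcup\underline j\le\underline m)(P_m(a))=P_i(a)\boxtimes P_j(a)$ for $i+j=m$, and $P_m(a+b)=\sum_{i+j=m}R_*(\underline i\sqcup\underline j\le\underline m)(P_i(a)\boxtimes P_j(b))$. Morphisms preserve all structure. The construction $\mathrm{PD}$. For a partition functor $M$, let $I_\Gamma\subseteq M(\Gamma)$ be the sum of the images of $M_*(\Omega<\Gamma)$ over all $\Omega<\Gamma$, $\bar M(\Gamma)=M(\Gamma)/I_\Gamma$, $q_\Gamma\colon M(\Gamma)\to\bar M(\Gamma)$ the quotient map, and for an isomorphism $f$ let $\bar M_*(f)$ be the isomorphism induced by $M_*(f)$. Set $$\mathrm{PD}(M)(\Lambda)=\Big(\bigoplus_{\Gamma\le\Lambda}\bar M(\Gamma)\Big)^{\Sigma_\Lambda},\qquad (\sigma x)_\Gamma=\bar M_*(\sigma)(x_{\sigma^{-1}\Gamma}).$$ Restriction along $f\colon\Lambda\to\Theta$: $(\mathrm{PD}(M)^*(f)(x))_\Gamma=\bar M_*(f_\Gamma)^{-1}(x_{f\Gamma})$ for $\Gamma\le\Lambda$. Transfer along $f\colon\Psi\to\Lambda$: for $\Gamma\le\Lambda$,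 $$(\mathrm{PD}(M)_*(f)(x))_\Gamma=\sum_{[\sigma]\in\Sigma_\Gamma\backslash\Sigma_\Lambda/\Sigma_{f\Psi},\ \Gamma\le\sigma f\Psi}\bar M_*(\sigma f)(x_{(\sigma f)^{-1}\Gamma}),$$ where $\sigma f$ denotes the isomorphism $(\sigma f)^{-1}\Gamma\to\Gamma$. A map $M\to N$ induces $\mathrm{PD}(M)\to\mathrm{PD}(N)$ componentwise. The unit is $\eta_\Lambda\colon M(\Lambda)\to\mathrm{PD}(M)(\Lambda)$, $\eta_\Lambda(z)=(q_\Gamma M^*(\Gamma\le\Lambda)(z))_{\Gamma\le\Lambda}$. The projection $\mathrm{PD}(M)(\Gamma)\to\bar M(\Gamma)$ onto the summand indexed by $\Gamma$ itself factors through a map $\bar\pi_\Gamma\colon\overline{\mathrm{PD}(M)}(\Gamma)\to\bar M(\Gamma)$, and $\mu_\Omega\colon\mathrm{PD}(\mathrm{PD}(M))(\Omega)\to\mathrm{PD}(M)(\Omega)$ is $(x_\Gamma)_{\Gamma\le\Omega}\mapsto(\bar\pi_\Gamma(x_\Gamma))_{\Gamma\le\Omega}$. If $R$ is lax symmetric monoidal, the external product induces products $\bar R(\Gamma)\otimes\bar R(\Theta)\to\bar R(\Gamma\sqcup\Theta)$, and $\mathrm{PD}(R)$ has external product $(x\boxtimes y)_{\Gamma\sqcup\Theta}=x_\Gamma\boxtimes y_\Theta$ (every refinement of $\Lambda\sqcup\Omega$ is uniquely $\Gamma\sqcup\Theta$ with $\Gamma\le\Lambda$, $\Theta\le\Omega$)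 and the unit of $R(0)=\mathrm{PD}(R)(0)$. If $R$ is a partition ring, $\mathrm{PD}(R)(\Lambda)$ has the componentwise ring structure. If $R$ is a partition power functor, $\mathrm{PD}(R)$ has power operations $\eta_m\circ P_m$ on $\mathrm{PD}(R)(1)=R(1)$. *)

theory Defs
  imports "HOL-Algebra.QuotRing" "HOL-Algebra.IntRing" "HOL-Combinatorics.Permutations"
begin

section \<open>Partitions\<close>

text \<open>
  The points of the finite sets that carry partitions.  The type is strictly closed under binary
  disjoint unions (constructors \<open>Lft\<close> and \<open>Rgt\<close>) and contains the natural numbers; the atoms range
  over an arbitrary type \<open>'u\<close>, so that finite sets of any type occur.
\<close>

datatype 'u point = Num nat | Atom 'u | Lft "'u point" | Rgt "'u point"

record 'u set_partition =
  pts :: "'u point set"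
  rel :: "('u point \<times> 'u point) set"

definition is_partition :: "'u set_partition \<Rightarrow> bool" where
  "is_partition \<Lambda> \<longleftrightarrow> finite (pts \<Lambda>) \<and> equiv (pts \<Lambda>) (rel \<Lambda>)"

text \<open>
  Morphisms are represented by arbitrary functions on the type of points, of which only the values
  on \<open>pts \<Lambda>\<close> matter.  Two functions that agree on \<open>pts \<Lambda>\<close> are in particular 2-isomorphic, so
  partition functors do not distinguish them.
\<close>

definition is_mor :: "'u set_partition \<Rightarrow> 'u set_partition \<Rightarrow> ('u point \<Rightarrow> 'u point) \<Rightarrow> bool" where
  "is_mor \<Lambda> \<Omega> f \<longleftrightarrow> is_partition \<Lambda> \<and> is_partition \<Omega> \<and> bij_betw f (pts \<Lambda>) (pts \<Omega>) \<and>
     (\<forall>(x, x') \<in> rel \<Lambda>. (f x, f x') \<in> rel \<Omega>)"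

definition is_iso :: "'u set_partition \<Rightarrow> 'u set_partition \<Rightarrow> ('u point \<Rightarrow> 'u point) \<Rightarrow> bool" where
  "is_iso \<Lambda> \<Omega> f \<longleftrightarrow> is_mor \<Lambda> \<Omega> f \<and> is_mor \<Omega> \<Lambda> (inv_into (pts \<Lambda>) f)"

definition two_iso ::
    "'u set_partition \<Rightarrow> 'u set_partition \<Rightarrow> ('u point \<Rightarrow> 'u point) \<Rightarrow> ('u point \<Rightarrow> 'u point) \<Rightarrow> bool" where
  "two_iso \<Lambda> \<Omega> f g \<longleftrightarrow> is_mor \<Lambda> \<Omega> f \<and> is_mor \<Lambda> \<Omega> g \<and> (\<forall>x \<in> pts \<Lambda>. (f x, g x) \<in> rel \<Omega>)"

definition refines :: "'u set_partition \<Rightarrow> 'u set_partition \<Rightarrow> bool"  (infix \<open>\<preceq>\<close> 50) where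
  "\<Lambda> \<preceq> \<Omega> \<longleftrightarrow> pts \<Lambda> = pts \<Omega> \<and> is_mor \<Lambda> \<Omega> id"

definition strictly_refines :: "'u set_partition \<Rightarrow> 'u set_partition \<Rightarrow> bool"  (infix \<open>\<prec>\<close> 50) where
  "\<Lambda> \<prec> \<Omega> \<longleftrightarrow> \<Lambda> \<preceq> \<Omega> \<and> \<Lambda> \<noteq> \<Omega>"

definition meet :: "'u set_partition \<Rightarrow> 'u set_partition \<Rightarrow> 'u set_partition" where
  "meet \<Lambda> \<Gamma> = \<lparr>pts = pts \<Lambda> \<inter> pts \<Gamma>, rel = rel \<Lambda> \<inter> rel \<Gamma>\<rparr>"

definition transport :: "('u point \<Rightarrow> 'u point) \<Rightarrow> 'u set_partition \<Rightarrow> 'u set_partition" where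
  "transport f \<Gamma> = \<lparr>pts = f ` pts \<Gamma>, rel = map_prod f f ` rel \<Gamma>\<rparr>"

definition indiscrete :: "nat \<Rightarrow> 'u set_partition" where
  "indiscrete m = \<lparr>pts = Num ` {1..m}, rel = (Num ` {1..m}) \<times> (Num ` {1..m})\<rparr>"

text \<open>The group $\Sigma_\Lambda$, in the representation of permutations by functions fixing all
  points outside \<open>pts \<Lambda>\<close>.\<close>

definition block_perms :: "'u set_partition \<Rightarrow> ('u point \<Rightarrow> 'u point) set" where
  "block_perms \<Lambda> = {\<sigma>. \<sigma> permutes pts \<Lambda> \<and> (\<forall>x \<in> pts \<Lambda>. (x, \<sigma> x) \<in> rel \<Lambda>)}"

text \<open>\<open>dcosets \<Gamma> \<Omega> \<Lambda>\<close> is $\Sigma_\Gamma\backslash\Sigma_\Omega/\Sigma_\Lambda$.  Sums over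
  double cosets use the representatives chosen by \<open>dcoset_rep\<close>; the summands that occur below do
  not depend on this choice.\<close>

definition dcosets ::
    "'u set_partition \<Rightarrow> 'u set_partition \<Rightarrow> 'u set_partition \<Rightarrow> ('u point \<Rightarrow> 'u point) set set" where
  "dcosets \<Gamma> \<Omega> \<Lambda> = block_perms \<Omega> //
     {(\<sigma>, \<tau>). \<sigma> \<in> block_perms \<Omega> \<and> \<tau> \<in> block_perms \<Omega> \<and>
        (\<exists>\<gamma> \<in> block_perms \<Gamma>. \<exists>\<delta> \<in> block_perms \<Lambda>. \<tau> = \<gamma> \<circ> \<sigma> \<circ> \<delta>)}"

definition dcoset_rep :: "('u point \<Rightarrow> 'u point) set \<Rightarrow> ('u point \<Rightarrow> 'u point)" where
  "dcoset_rep C = (SOME \<sigma>. \<sigma> \<in> C)"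

subsection \<open>Disjoint unions\<close>

definition djunion :: "'u set_partition \<Rightarrow> 'u set_partition \<Rightarrow> 'u set_partition"  (infixr \<open>\<uplus>\<close> 65) where
  "\<Lambda> \<uplus> \<Omega> = \<lparr>pts = Lft ` pts \<Lambda> \<union> Rgt ` pts \<Omega>,
             rel = map_prod Lft Lft ` rel \<Lambda> \<union> map_prod Rgt Rgt ` rel \<Omega>\<rparr>"

text \<open>For $\Delta\le\Lambda\sqcup\Omega$ these are the unique $\Gamma\le\Lambda$ and $\Theta\le\Omega$
  with $\Delta=\Gamma\sqcup\Theta$.\<close>

definition left_part :: "'u set_partition \<Rightarrow> 'u set_partition" where
  "left_part \<Delta> = \<lparr>pts = Lft -` pts \<Delta>, rel = map_prod Lft Lft -` rel \<Delta>\<rparr>"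

definition right_part :: "'u set_partition \<Rightarrow> 'u set_partition" where
  "right_part \<Delta> = \<lparr>pts = Rgt -` pts \<Delta>, rel = map_prod Rgt Rgt -` rel \<Delta>\<rparr>"

text \<open>The maps of point sets underlying $f\sqcup g$, the associativity, unit and symmetry isomorphisms
  of $\sqcup$, and $\underline i\sqcup\underline j\le\underline{i+j}$.  The remaining equations only
  make the functions total.\<close>

fun sum_map ::
    "('u point \<Rightarrow> 'u point) \<Rightarrow> ('u point \<Rightarrow> 'u point) \<Rightarrow> 'u point \<Rightarrow> 'u point" where
  "sum_map f g (Lft x) = Lft (f x)"
| "sum_map f g (Rgt y) = Rgt (g y)"
| "sum_map f g p = p"

fun assoc_map :: "'u point \<Rightarrow> 'u point" where
  "assoc_map (Lft (Lft x)) = Lft x"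
| "assoc_map (Lft (Rgt y)) = Rgt (Lft y)"
| "assoc_map (Rgt z) = Rgt (Rgt z)"
| "assoc_map p = p"

fun unit_map :: "'u point \<Rightarrow> 'u point" where
  "unit_map (Lft x) = x"
| "unit_map (Rgt y) = y"
| "unit_map p = p"

fun swap_map :: "'u point \<Rightarrow> 'u point" where
  "swap_map (Lft x) = Rgt x"
| "swap_map (Rgt y) = Lft y"
| "swap_map p = p"

fun merge_map :: "nat \<Rightarrow> 'u point \<Rightarrow> 'u point" where
  "merge_map i (Lft p) = p"
| "merge_map i (Rgt (Num k)) = Num (i + k)"
| "merge_map i p = p"


section \<open>Partition functors\<close>

text \<open>
  The value at a partition is stored as a ring record.  As usual in HOL-Algebra, for mere abelian
  groups (\<open>abelian_group\<close>) only the additive part of the record is meaningful, and \<open>mult\<close> and \<open>one\<close>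
  are ignored; they are used from partition rings on.

  For \<open>f\<close> a morphism from \<open>\<Lambda>\<close> to \<open>\<Omega>\<close>, \<open>pf_res M \<Lambda> \<Omega> f\<close> is the restriction
  $M^*(f)\colon M(\Omega)\to M(\Lambda)$ and \<open>pf_tr M \<Lambda> \<Omega> f\<close> is the transfer
  $M_*(f)\colon M(\Lambda)\to M(\Omega)$.
\<close>

record ('u, 'a) pfun =
  pf_val :: "'u set_partition \<Rightarrow> 'a ring"
  pf_res :: "'u set_partition \<Rightarrow> 'u set_partition \<Rightarrow> ('u point \<Rightarrow> 'u point) \<Rightarrow> 'a \<Rightarrow> 'a"
  pf_tr  :: "'u set_partition \<Rightarrow> 'u set_partition \<Rightarrow> ('u point \<Rightarrow> 'u point) \<Rightarrow> 'a \<Rightarrow> 'a"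

abbreviation pf_carrier :: "('u, 'a, 'z) pfun_scheme \<Rightarrow> 'u set_partition \<Rightarrow> 'a set" where
  "pf_carrier M \<Lambda> \<equiv> carrier (pf_val M \<Lambda>)"

abbreviation add_hom :: "'a ring \<Rightarrow> 'b ring \<Rightarrow> ('a \<Rightarrow> 'b) set" where
  "add_hom G H \<equiv> hom (add_monoid G) (add_monoid H)"

text \<open>$M_*(\Gamma\cap\sigma\Lambda\le\Gamma)\,M_*(\sigma)\,M^*(\sigma^{-1}\Gamma\cap\Lambda\le\Lambda)$\<close>

definition dcoset_summand ::
    "('u, 'a, 'z) pfun_scheme \<Rightarrow> 'u set_partition \<Rightarrow> 'u set_partition \<Rightarrow> ('u point \<Rightarrow> 'u point) \<Rightarrow> 'a \<Rightarrow> 'a" where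
  "dcoset_summand M \<Gamma> \<Lambda> \<sigma> x =
     (let A = meet (transport (inv_into UNIV \<sigma>) \<Gamma>) \<Lambda>; B = meet \<Gamma> (transport \<sigma> \<Lambda>)
      in pf_tr M B \<Gamma> id (pf_tr M A B \<sigma> (pf_res M A \<Lambda> id x)))"

definition partition_functor :: "('u, 'a, 'z) pfun_scheme \<Rightarrow> bool" where
  "partition_functor M \<longleftrightarrow>
     (\<forall>\<Lambda>. is_partition \<Lambda> \<longrightarrow> abelian_group (pf_val M \<Lambda>)) \<and>
     (\<forall>\<Lambda> \<Omega> f. is_mor \<Lambda> \<Omega> f \<longrightarrow>
        pf_res M \<Lambda> \<Omega> f \<in> add_hom (pf_val M \<Omega>) (pf_val M \<Lambda>) \<and>
        pf_tr M \<Lambda> \<Omega> f \<in> add_hom (pf_val M \<Lambda>) (pf_val M \<Omega>)) \<and>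
     (\<forall>\<Lambda>. is_partition \<Lambda> \<longrightarrow> (\<forall>x \<in> pf_carrier M \<Lambda>.
        pf_res M \<Lambda> \<Lambda> id x = x \<and> pf_tr M \<Lambda> \<Lambda> id x = x)) \<and>
     (\<forall>\<Lambda> \<Omega> \<Theta> f g. is_mor \<Lambda> \<Omega> f \<and> is_mor \<Omega> \<Theta> g \<longrightarrow>
        (\<forall>x \<in> pf_carrier M \<Theta>. pf_res M \<Lambda> \<Theta> (g \<circ> f) x = pf_res M \<Lambda> \<Omega> f (pf_res M \<Omega> \<Theta> g x)) \<and>
        (\<forall>x \<in> pf_carrier M \<Lambda>. pf_tr M \<Lambda> \<Theta> (g \<circ> f) x = pf_tr M \<Omega> \<Theta> g (pf_tr M \<Lambda> \<Omega> f x))) \<and>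
     (\<forall>\<Lambda> \<Omega> f g. two_iso \<Lambda> \<Omega> f g \<longrightarrow>
        (\<forall>x \<in> pf_carrier M \<Omega>. pf_res M \<Lambda> \<Omega> f x = pf_res M \<Lambda> \<Omega> g x) \<and>
        (\<forall>x \<in> pf_carrier M \<Lambda>. pf_tr M \<Lambda> \<Omega> f x = pf_tr M \<Lambda> \<Omega> g x)) \<and>
     (\<forall>\<Lambda> \<Omega> f. is_iso \<Lambda> \<Omega> f \<longrightarrow> (\<forall>x \<in> pf_carrier M \<Lambda>.
        pf_tr M \<Lambda> \<Omega> f x = pf_res M \<Omega> \<Lambda> (inv_into (pts \<Lambda>) f) x)) \<and>
     (\<forall>\<Gamma> \<Lambda> \<Omega>. \<Gamma> \<preceq> \<Omega> \<and> \<Lambda> \<preceq> \<Omega> \<longrightarrow> (\<forall>x \<in> pf_carrier M \<Lambda>.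
        pf_res M \<Gamma> \<Omega> id (pf_tr M \<Lambda> \<Omega> id x) =
          (\<Oplus>\<^bsub>pf_val M \<Gamma>\<^esub> C \<in> dcosets \<Gamma> \<Omega> \<Lambda>. dcoset_summand M \<Gamma> \<Lambda> (dcoset_rep C) x)))"

text \<open>Morphisms are families of functions indexed by partitions; they are only relevant on the
  carriers, which is accounted for by the equality \<open>mor_eq\<close>.\<close>

definition pf_morphism ::
    "('u, 'a, 'y) pfun_scheme \<Rightarrow> ('u, 'b, 'z) pfun_scheme \<Rightarrow> ('u set_partition \<Rightarrow> 'a \<Rightarrow> 'b) \<Rightarrow> bool" where
  "pf_morphism M N \<phi> \<longleftrightarrow>
     (\<forall>\<Lambda>. is_partition \<Lambda> \<longrightarrow> \<phi> \<Lambda> \<in> add_hom (pf_val M \<Lambda>) (pf_val N \<Lambda>)) \<and>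
     (\<forall>\<Lambda> \<Omega> f. is_mor \<Lambda> \<Omega> f \<longrightarrow>
        (\<forall>x \<in> pf_carrier M \<Omega>. \<phi> \<Lambda> (pf_res M \<Lambda> \<Omega> f x) = pf_res N \<Lambda> \<Omega> f (\<phi> \<Omega> x)) \<and>
        (\<forall>x \<in> pf_carrier M \<Lambda>. \<phi> \<Omega> (pf_tr M \<Lambda> \<Omega> f x) = pf_tr N \<Lambda> \<Omega> f (\<phi> \<Lambda> x)))"

definition mor_eq ::
    "('u, 'a, 'z) pfun_scheme \<Rightarrow> ('u set_partition \<Rightarrow> 'a \<Rightarrow> 'b) \<Rightarrow> ('u set_partition \<Rightarrow> 'a \<Rightarrow> 'b) \<Rightarrow> bool" where
  "mor_eq M \<phi> \<psi> \<longleftrightarrow> (\<forall>\<Lambda>. is_partition \<Lambda> \<longrightarrow> (\<forall>x \<in> pf_carrier M \<Lambda>. \<phi> \<Lambda> x = \<psi> \<Lambda> x))"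

definition mor_id :: "'u set_partition \<Rightarrow> 'a \<Rightarrow> 'a" where
  "mor_id \<Lambda> x = x"

definition mor_comp ::
    "('u set_partition \<Rightarrow> 'b \<Rightarrow> 'c) \<Rightarrow> ('u set_partition \<Rightarrow> 'a \<Rightarrow> 'b) \<Rightarrow> 'u set_partition \<Rightarrow> 'a \<Rightarrow> 'c"
    (infixr \<open>\<bullet>\<close> 55) where
  "(\<psi> \<bullet> \<phi>) \<Lambda> x = \<psi> \<Lambda> (\<phi> \<Lambda> x)"


section \<open>Multiplicative structures\<close>

text \<open>The external product $R(\Lambda)\otimes R(\Omega)\to R(\Lambda\sqcup\Omega)$ is given as the
  corresponding biadditive map \<open>lx_prod R \<Lambda> \<Omega>\<close>.\<close>

record ('u, 'a) lax_pfun = "('u, 'a) pfun" +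
  lx_unit :: "int \<Rightarrow> 'a"
  lx_prod :: "'u set_partition \<Rightarrow> 'u set_partition \<Rightarrow> 'a \<Rightarrow> 'a \<Rightarrow> 'a"

definition lax_partition_functor :: "('u, 'a, 'z) lax_pfun_scheme \<Rightarrow> bool" where
  "lax_partition_functor R \<longleftrightarrow>
     partition_functor R \<and>
     lx_unit R \<in> add_hom \<Z> (pf_val R (indiscrete 0)) \<and>
     (\<forall>\<Lambda> \<Omega>. is_partition \<Lambda> \<and> is_partition \<Omega> \<longrightarrow>
        (\<forall>x \<in> pf_carrier R \<Lambda>. lx_prod R \<Lambda> \<Omega> x \<in> add_hom (pf_val R \<Omega>) (pf_val R (\<Lambda> \<uplus> \<Omega>))) \<and>
        (\<forall>y \<in> pf_carrier R \<Omega>.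
           (\<lambda>x. lx_prod R \<Lambda> \<Omega> x y) \<in> add_hom (pf_val R \<Lambda>) (pf_val R (\<Lambda> \<uplus> \<Omega>)))) \<and>
     (\<forall>\<Lambda> \<Lambda>' \<Omega> \<Omega>' f g. is_mor \<Lambda> \<Lambda>' f \<and> is_mor \<Omega> \<Omega>' g \<longrightarrow>
        (\<forall>x \<in> pf_carrier R \<Lambda>'. \<forall>y \<in> pf_carrier R \<Omega>'.
           pf_res R (\<Lambda> \<uplus> \<Omega>) (\<Lambda>' \<uplus> \<Omega>') (sum_map f g) (lx_prod R \<Lambda>' \<Omega>' x y) =
             lx_prod R \<Lambda> \<Omega> (pf_res R \<Lambda> \<Lambda>' f x) (pf_res R \<Omega> \<Omega>' g y)) \<and>
        (\<forall>x \<in> pf_carrier R \<Lambda>. \<forall>y \<in> pf_carrier R \<Omega>.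
           pf_tr R (\<Lambda> \<uplus> \<Omega>) (\<Lambda>' \<uplus> \<Omega>') (sum_map f g) (lx_prod R \<Lambda> \<Omega> x y) =
             lx_prod R \<Lambda>' \<Omega>' (pf_tr R \<Lambda> \<Lambda>' f x) (pf_tr R \<Omega> \<Omega>' g y))) \<and>
     (\<forall>\<Lambda> \<Omega> \<Theta>. is_partition \<Lambda> \<and> is_partition \<Omega> \<and> is_partition \<Theta> \<longrightarrow>
        (\<forall>x \<in> pf_carrier R \<Lambda>. \<forall>y \<in> pf_carrier R \<Omega>. \<forall>z \<in> pf_carrier R \<Theta>.
           pf_tr R ((\<Lambda> \<uplus> \<Omega>) \<uplus> \<Theta>) (\<Lambda> \<uplus> (\<Omega> \<uplus> \<Theta>)) assoc_map
               (lx_prod R (\<Lambda> \<uplus> \<Omega>) \<Theta> (lx_prod R \<Lambda> \<Omega> x y) z) =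
             lx_prod R \<Lambda> (\<Omega> \<uplus> \<Theta>) x (lx_prod R \<Omega> \<Theta> y z))) \<and>
     (\<forall>\<Lambda>. is_partition \<Lambda> \<longrightarrow> (\<forall>x \<in> pf_carrier R \<Lambda>.
        pf_tr R (indiscrete 0 \<uplus> \<Lambda>) \<Lambda> unit_map (lx_prod R (indiscrete 0) \<Lambda> (lx_unit R 1) x) = x \<and>
        pf_tr R (\<Lambda> \<uplus> indiscrete 0) \<Lambda> unit_map (lx_prod R \<Lambda> (indiscrete 0) x (lx_unit R 1)) = x)) \<and>
     (\<forall>\<Lambda> \<Omega>. is_partition \<Lambda> \<and> is_partition \<Omega> \<longrightarrow>
        (\<forall>x \<in> pf_carrier R \<Lambda>. \<forall>y \<in> pf_carrier R \<Omega>.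
           pf_tr R (\<Lambda> \<uplus> \<Omega>) (\<Omega> \<uplus> \<Lambda>) swap_map (lx_prod R \<Lambda> \<Omega> x y) = lx_prod R \<Omega> \<Lambda> y x))"

definition lax_morphism ::
    "('u, 'a, 'y) lax_pfun_scheme \<Rightarrow> ('u, 'b, 'z) lax_pfun_scheme \<Rightarrow> ('u set_partition \<Rightarrow> 'a \<Rightarrow> 'b) \<Rightarrow> bool" where
  "lax_morphism R S \<phi> \<longleftrightarrow>
     pf_morphism R S \<phi> \<and>
     (\<forall>k. \<phi> (indiscrete 0) (lx_unit R k) = lx_unit S k) \<and>
     (\<forall>\<Lambda> \<Omega>. is_partition \<Lambda> \<and> is_partition \<Omega> \<longrightarrow>
        (\<forall>x \<in> pf_carrier R \<Lambda>. \<forall>y \<in> pf_carrier R \<Omega>.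
           \<phi> (\<Lambda> \<uplus> \<Omega>) (lx_prod R \<Lambda> \<Omega> x y) = lx_prod S \<Lambda> \<Omega> (\<phi> \<Lambda> x) (\<phi> \<Omega> y)))"

definition partition_ring :: "('u, 'a, 'z) lax_pfun_scheme \<Rightarrow> bool" where
  "partition_ring R \<longleftrightarrow>
     lax_partition_functor R \<and>
     (\<forall>\<Lambda>. is_partition \<Lambda> \<longrightarrow> cring (pf_val R \<Lambda>)) \<and>
     (\<forall>\<Lambda> \<Omega> f. is_mor \<Lambda> \<Omega> f \<longrightarrow> pf_res R \<Lambda> \<Omega> f \<in> ring_hom (pf_val R \<Omega>) (pf_val R \<Lambda>)) \<and>
     (\<forall>\<Lambda> \<Omega>. is_partition \<Lambda> \<and> is_partition \<Omega> \<longrightarrow>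
        (\<forall>x \<in> pf_carrier R \<Lambda>. \<forall>x' \<in> pf_carrier R \<Lambda>. \<forall>y \<in> pf_carrier R \<Omega>. \<forall>y' \<in> pf_carrier R \<Omega>.
           lx_prod R \<Lambda> \<Omega> (x \<otimes>\<^bsub>pf_val R \<Lambda>\<^esub> x') (y \<otimes>\<^bsub>pf_val R \<Omega>\<^esub> y') =
             lx_prod R \<Lambda> \<Omega> x y \<otimes>\<^bsub>pf_val R (\<Lambda> \<uplus> \<Omega>)\<^esub> lx_prod R \<Lambda> \<Omega> x' y') \<and>
        lx_prod R \<Lambda> \<Omega> \<one>\<^bsub>pf_val R \<Lambda>\<^esub> \<one>\<^bsub>pf_val R \<Omega>\<^esub> = \<one>\<^bsub>pf_val R (\<Lambda> \<uplus> \<Omega>)\<^esub>) \<and>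
     (\<forall>\<Lambda> \<Omega> f. is_mor \<Lambda> \<Omega> f \<longrightarrow> (\<forall>a \<in> pf_carrier R \<Omega>. \<forall>b \<in> pf_carrier R \<Lambda>.
        pf_tr R \<Lambda> \<Omega> f (pf_res R \<Lambda> \<Omega> f a \<otimes>\<^bsub>pf_val R \<Lambda>\<^esub> b) =
          a \<otimes>\<^bsub>pf_val R \<Omega>\<^esub> pf_tr R \<Lambda> \<Omega> f b))"

definition ring_morphism ::
    "('u, 'a, 'y) lax_pfun_scheme \<Rightarrow> ('u, 'b, 'z) lax_pfun_scheme \<Rightarrow> ('u set_partition \<Rightarrow> 'a \<Rightarrow> 'b) \<Rightarrow> bool" where
  "ring_morphism R S \<phi> \<longleftrightarrow>
     lax_morphism R S \<phi> \<and>
     (\<forall>\<Lambda>. is_partition \<Lambda> \<longrightarrow> \<phi> \<Lambda> \<in> ring_hom (pf_val R \<Lambda>) (pf_val S \<Lambda>))"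

record ('u, 'a) power_pfun = "('u, 'a) lax_pfun" +
  pw_op :: "nat \<Rightarrow> 'a \<Rightarrow> 'a"

definition partition_power_functor :: "('u, 'a, 'z) power_pfun_scheme \<Rightarrow> bool" where
  "partition_power_functor R \<longleftrightarrow>
     partition_ring R \<and>
     (\<forall>m. pw_op R m \<in> pf_carrier R (indiscrete 1) \<rightarrow> pf_carrier R (indiscrete m)) \<and>
     (\<forall>m. \<forall>a \<in> pf_carrier R (indiscrete 1). \<forall>b \<in> pf_carrier R (indiscrete 1).
        pw_op R m (a \<otimes>\<^bsub>pf_val R (indiscrete 1)\<^esub> b) =
          pw_op R m a \<otimes>\<^bsub>pf_val R (indiscrete m)\<^esub> pw_op R m b) \<and>
     (\<forall>a \<in> pf_carrier R (indiscrete 1). pw_op R 0 a = \<one>\<^bsub>pf_val R (indiscrete 0)\<^esub>) \<and>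
     (\<forall>m. pw_op R m \<one>\<^bsub>pf_val R (indiscrete 1)\<^esub> = \<one>\<^bsub>pf_val R (indiscrete m)\<^esub>) \<and>
     (\<forall>a \<in> pf_carrier R (indiscrete 1). pw_op R 1 a = a) \<and>
     (\<forall>i j. \<forall>a \<in> pf_carrier R (indiscrete 1).
        pf_res R (indiscrete i \<uplus> indiscrete j) (indiscrete (i + j)) (merge_map i) (pw_op R (i + j) a) =
          lx_prod R (indiscrete i) (indiscrete j) (pw_op R i a) (pw_op R j a)) \<and>
     (\<forall>m. \<forall>a \<in> pf_carrier R (indiscrete 1). \<forall>b \<in> pf_carrier R (indiscrete 1).
        pw_op R m (a \<oplus>\<^bsub>pf_val R (indiscrete 1)\<^esub> b) =
          (\<Oplus>\<^bsub>pf_val R (indiscrete m)\<^esub> i \<in> {0..m}.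
             pf_tr R (indiscrete i \<uplus> indiscrete (m - i)) (indiscrete m) (merge_map i)
               (lx_prod R (indiscrete i) (indiscrete (m - i)) (pw_op R i a) (pw_op R (m - i) b))))"

definition power_morphism ::
    "('u, 'a, 'y) power_pfun_scheme \<Rightarrow> ('u, 'b, 'z) power_pfun_scheme \<Rightarrow> ('u set_partition \<Rightarrow> 'a \<Rightarrow> 'b) \<Rightarrow> bool" where
  "power_morphism R S \<phi> \<longleftrightarrow>
     ring_morphism R S \<phi> \<and>
     (\<forall>m. \<forall>a \<in> pf_carrier R (indiscrete 1).
        \<phi> (indiscrete m) (pw_op R m a) = pw_op S m (\<phi> (indiscrete 1) a))"


section \<open>The construction PD\<close>

text \<open>The sum of the images of the transfers along all $\Omega<\Gamma$ (a finite index set).\<close>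

definition tr_ideal :: "('u, 'a, 'z) pfun_scheme \<Rightarrow> 'u set_partition \<Rightarrow> 'a set" where
  "tr_ideal M \<Gamma> = {(\<Oplus>\<^bsub>pf_val M \<Gamma>\<^esub> \<Omega> \<in> {\<Omega>. \<Omega> \<prec> \<Gamma>}. pf_tr M \<Omega> \<Gamma> id (y \<Omega>)) | y.
                     \<forall>\<Omega>. \<Omega> \<prec> \<Gamma> \<longrightarrow> y \<Omega> \<in> pf_carrier M \<Omega>}"

text \<open>$\bar M(\Gamma)$; its additive part is the quotient group, and its multiplication is
  meaningful when \<open>tr_ideal\<close> is an ideal, which is the case for partition rings.\<close>

definition bar :: "('u, 'a, 'z) pfun_scheme \<Rightarrow> 'u set_partition \<Rightarrow> 'a set ring" where
  "bar M \<Gamma> = pf_val M \<Gamma> Quot tr_ideal M \<Gamma>"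

definition qmap :: "('u, 'a, 'z) pfun_scheme \<Rightarrow> 'u set_partition \<Rightarrow> 'a \<Rightarrow> 'a set" where
  "qmap M \<Gamma> x = tr_ideal M \<Gamma> +>\<^bsub>pf_val M \<Gamma>\<^esub> x"

text \<open>The map induced on cosets by a map \<open>h\<close> that is constant on each coset: the value at the coset
  \<open>C\<close> is the common value of \<open>h\<close> on \<open>C\<close>.\<close>

definition induced :: "('a \<Rightarrow> 'b) \<Rightarrow> 'a set \<Rightarrow> 'b" where
  "induced h C = the_elem (h ` C)"

definition bar_tr ::
    "('u, 'a, 'z) pfun_scheme \<Rightarrow> 'u set_partition \<Rightarrow> 'u set_partition \<Rightarrow> ('u point \<Rightarrow> 'u point) \<Rightarrow> 'a set \<Rightarrow> 'a set" where
  "bar_tr M \<Gamma> \<Gamma>' f = induced (\<lambda>x. qmap M \<Gamma>' (pf_tr M \<Gamma> \<Gamma>' f x))"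

definition bar_map ::
    "('u, 'b, 'z) pfun_scheme \<Rightarrow> ('u set_partition \<Rightarrow> 'a \<Rightarrow> 'b) \<Rightarrow> 'u set_partition \<Rightarrow> 'a set \<Rightarrow> 'b set" where
  "bar_map N \<phi> \<Gamma> = induced (\<lambda>x. qmap N \<Gamma> (\<phi> \<Gamma> x))"

definition bar_prod ::
    "('u, 'a, 'z) lax_pfun_scheme \<Rightarrow> 'u set_partition \<Rightarrow> 'u set_partition \<Rightarrow> 'a set \<Rightarrow> 'a set \<Rightarrow> 'a set" where
  "bar_prod R \<Gamma> \<Theta> C D =
     induced (\<lambda>(x, y). qmap R (\<Gamma> \<uplus> \<Theta>) (lx_prod R \<Gamma> \<Theta> x y)) (C \<times> D)"

text \<open>The index set is finite, so the direct sum is the full product.  Its elements are represented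
  by functions that are \<open>undefined\<close> outside the refinements of \<open>\<Lambda>\<close>, so that equality of elements is
  equality of functions.\<close>

definition PD_val ::
    "('u, 'a, 'z) pfun_scheme \<Rightarrow> 'u set_partition \<Rightarrow> ('u set_partition \<Rightarrow> 'a set) ring" where
  "PD_val M \<Lambda> =
     \<lparr>carrier = {x \<in> (\<Pi>\<^sub>E \<Gamma> \<in> {\<Gamma>. \<Gamma> \<preceq> \<Lambda>}. carrier (bar M \<Gamma>)).
        \<forall>\<sigma> \<in> block_perms \<Lambda>. \<forall>\<Gamma>. \<Gamma> \<preceq> \<Lambda> \<longrightarrow>
          bar_tr M (transport (inv_into UNIV \<sigma>) \<Gamma>) \<Gamma> \<sigma> (x (transport (inv_into UNIV \<sigma>) \<Gamma>)) = x \<Gamma>},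
      mult = (\<lambda>x y. \<lambda>\<Gamma> \<in> {\<Gamma>. \<Gamma> \<preceq> \<Lambda>}. x \<Gamma> \<otimes>\<^bsub>bar M \<Gamma>\<^esub> y \<Gamma>),
      one = (\<lambda>\<Gamma> \<in> {\<Gamma>. \<Gamma> \<preceq> \<Lambda>}. \<one>\<^bsub>bar M \<Gamma>\<^esub>),
      zero = (\<lambda>\<Gamma> \<in> {\<Gamma>. \<Gamma> \<preceq> \<Lambda>}. \<zero>\<^bsub>bar M \<Gamma>\<^esub>),
      add = (\<lambda>x y. \<lambda>\<Gamma> \<in> {\<Gamma>. \<Gamma> \<preceq> \<Lambda>}. x \<Gamma> \<oplus>\<^bsub>bar M \<Gamma>\<^esub> y \<Gamma>)\<rparr>"

definition PD_res ::
    "('u, 'a, 'z) pfun_scheme \<Rightarrow> 'u set_partition \<Rightarrow> 'u set_partition \<Rightarrow> ('u point \<Rightarrow> 'u point) \<Rightarrow>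
      ('u set_partition \<Rightarrow> 'a set) \<Rightarrow> ('u set_partition \<Rightarrow> 'a set)" where
  "PD_res M \<Lambda> \<Theta> f x = (\<lambda>\<Gamma> \<in> {\<Gamma>. \<Gamma> \<preceq> \<Lambda>}.
     inv_into (carrier (bar M \<Gamma>)) (bar_tr M \<Gamma> (transport f \<Gamma>) f) (x (transport f \<Gamma>)))"

text \<open>As \<open>\<sigma> \<circ> f\<close> is a bijection on \<open>pts \<Psi>\<close> only, $(\sigma f)^{-1}\Gamma$ is formed with
  \<open>inv_into (pts \<Psi>)\<close>.\<close>

definition PD_tr ::
    "('u, 'a, 'z) pfun_scheme \<Rightarrow> 'u set_partition \<Rightarrow> 'u set_partition \<Rightarrow> ('u point \<Rightarrow> 'u point) \<Rightarrow>
      ('u set_partition \<Rightarrow> 'a set) \<Rightarrow> ('u set_partition \<Rightarrow> 'a set)" where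
  "PD_tr M \<Psi> \<Lambda> f x = (\<lambda>\<Gamma> \<in> {\<Gamma>. \<Gamma> \<preceq> \<Lambda>}.
     (\<Oplus>\<^bsub>bar M \<Gamma>\<^esub> C \<in> {C \<in> dcosets \<Gamma> \<Lambda> (transport f \<Psi>).
                          \<Gamma> \<preceq> transport (dcoset_rep C) (transport f \<Psi>)}.
        (let h = dcoset_rep C \<circ> f; \<Gamma>' = transport (inv_into (pts \<Psi>) h) \<Gamma>
         in bar_tr M \<Gamma>' \<Gamma> h (x \<Gamma>'))))"

definition PD :: "('u, 'a, 'z) pfun_scheme \<Rightarrow> ('u, 'u set_partition \<Rightarrow> 'a set) pfun" where
  "PD M = \<lparr>pf_val = PD_val M, pf_res = PD_res M, pf_tr = PD_tr M\<rparr>"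

definition PD_map ::
    "('u, 'b, 'z) pfun_scheme \<Rightarrow> ('u set_partition \<Rightarrow> 'a \<Rightarrow> 'b) \<Rightarrow>
      'u set_partition \<Rightarrow> ('u set_partition \<Rightarrow> 'a set) \<Rightarrow> ('u set_partition \<Rightarrow> 'b set)" where
  "PD_map N \<phi> \<Lambda> x = (\<lambda>\<Gamma> \<in> {\<Gamma>. \<Gamma> \<preceq> \<Lambda>}. bar_map N \<phi> \<Gamma> (x \<Gamma>))"

definition PD_eta ::
    "('u, 'a, 'z) pfun_scheme \<Rightarrow> 'u set_partition \<Rightarrow> 'a \<Rightarrow> ('u set_partition \<Rightarrow> 'a set)" where
  "PD_eta M \<Lambda> z = (\<lambda>\<Gamma> \<in> {\<Gamma>. \<Gamma> \<preceq> \<Lambda>}. qmap M \<Gamma> (pf_res M \<Gamma> \<Lambda> id z))"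

text \<open>$\bar\pi_\Gamma\colon\overline{\mathrm{PD}(M)}(\Gamma)\to\bar M(\Gamma)$; the formulas for it and
  for \<open>PD_mu\<close> do not involve \<open>M\<close>, which only determines the domains.\<close>

definition bar_proj :: "'u set_partition \<Rightarrow> ('u set_partition \<Rightarrow> 'a set) set \<Rightarrow> 'a set" where
  "bar_proj \<Gamma> = induced (\<lambda>x. x \<Gamma>)"

definition PD_mu ::
    "'u set_partition \<Rightarrow> ('u set_partition \<Rightarrow> ('u set_partition \<Rightarrow> 'a set) set) \<Rightarrow> ('u set_partition \<Rightarrow> 'a set)" where
  "PD_mu \<Omega> x = (\<lambda>\<Gamma> \<in> {\<Gamma>. \<Gamma> \<preceq> \<Omega>}. bar_proj \<Gamma> (x \<Gamma>))"

text \<open>The identifications of $R(0)$ with $\mathrm{PD}(R)(0)$ and of $R(1)$ with $\mathrm{PD}(R)(1)$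
  are the bijections $\eta_0$ and $\eta_1$.\<close>

definition PD_unit :: "('u, 'a, 'z) lax_pfun_scheme \<Rightarrow> int \<Rightarrow> ('u set_partition \<Rightarrow> 'a set)" where
  "PD_unit R k = PD_eta R (indiscrete 0) (lx_unit R k)"

definition PD_prod ::
    "('u, 'a, 'z) lax_pfun_scheme \<Rightarrow> 'u set_partition \<Rightarrow> 'u set_partition \<Rightarrow>
      ('u set_partition \<Rightarrow> 'a set) \<Rightarrow> ('u set_partition \<Rightarrow> 'a set) \<Rightarrow> ('u set_partition \<Rightarrow> 'a set)" where
  "PD_prod R \<Lambda> \<Omega> x y = (\<lambda>\<Delta> \<in> {\<Delta>. \<Delta> \<preceq> \<Lambda> \<uplus> \<Omega>}.
     bar_prod R (left_part \<Delta>) (right_part \<Delta>) (x (left_part \<Delta>)) (y (right_part \<Delta>)))"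

definition PD_pow :: "('u, 'a, 'z) power_pfun_scheme \<Rightarrow> nat \<Rightarrow> ('u set_partition \<Rightarrow> 'a set) \<Rightarrow> ('u set_partition \<Rightarrow> 'a set)" where
  "PD_pow R m x = PD_eta R (indiscrete m) (pw_op R m
     (the_inv_into (pf_carrier R (indiscrete 1)) (PD_eta R (indiscrete 1)) x))"

text \<open>PD with its multiplicative structures, for lax symmetric monoidal partition functors and
  partition rings, and for partition power functors.\<close>

definition PD_lax :: "('u, 'a, 'z) lax_pfun_scheme \<Rightarrow> ('u, 'u set_partition \<Rightarrow> 'a set) lax_pfun" where
  "PD_lax R = \<lparr>pf_val = PD_val R, pf_res = PD_res R, pf_tr = PD_tr R,
     lx_unit = PD_unit R, lx_prod = PD_prod R\<rparr>"

definition PD_power :: "('u, 'a, 'z) power_pfun_scheme \<Rightarrow> ('u, 'u set_partition \<Rightarrow> 'a set) power_pfun" where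
  "PD_power R = \<lparr>pf_val = PD_val R, pf_res = PD_res R, pf_tr = PD_tr R,
     lx_unit = PD_unit R, lx_prod = PD_prod R, pw_op = PD_pow R\<rparr>"

end

theory Submission
  imports Defs
begin

text \<open>The invariants in the definition of $\mathrm{PD}(M)(\Lambda)$ are best read as families
  $x[k]\in\bar M(\Gamma)$ indexed by all morphisms $k\colon\Gamma\to\Lambda$, constant on
  2-isomorphism classes and natural in isomorphisms of \<open>\<Gamma>\<close>.  In these terms $(f^*x)[k]=x[fk]$ and
  $(f_*x)[k]=\sum_{[l],\ fl\simeq k}x[l]$, where \<open>[l]\<close> runs over the 2-isomorphism classes of lifts of
  \<open>k\<close> along \<open>f\<close>; the double cosets in the definition of the transfer are exactly these classes.
  Functoriality, the double coset formula, Frobenius reciprocity and the compatibility with external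
  products become comparisons of sums over fibres.  Modulo the images of proper transfers, only the
  double cosets with $\Gamma\le\sigma\Lambda$ survive in the double coset formula of \<open>M\<close>, which is why
  $\eta$ commutes with transfers.  The maps induced by morphisms and $\mu$ act componentwise by homomorphisms
  natural in isomorphisms, hence respect all structure.\<close>

section \<open>Partitions and their morphisms\<close>

text \<open>The defining formula of the transfer picks double coset representatives, so composing
  two transfers would mean comparing representatives in several groups. Lifts remove the choice: if
  f l is 2-isomorphic to k, some block permutation \<sigma> of the target satisfies \<sigma> f l =
  k, and the classes of l correspond to the double cosets of such \<sigma>. The price is that only
  values on the finite point set matter for a morphism, so there are infinitely many lifts as soon
  as there is one. Sums therefore run over encoded classes, and every reindexing is a bijection of
  classes, not of functions. \<mu> exists because a proper transfer vanishes in the top component: a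
  lift of the identity of \<Gamma> to a proper refinement would inject the relation of \<Gamma> into
  a smaller finite set. The power operations live on PD(R)(1), where \<eta> is bijective, so their
  axioms are images under \<eta> of the given ones. The monad laws are equations between maps of
  sets of elements and are proved once, for every structure whose values, restrictions and transfers
  are those of PD.\<close>

lemma is_partitionD:
  assumes "is_partition \<Lambda>"
  shows "finite (pts \<Lambda>)" "rel \<Lambda> \<subseteq> pts \<Lambda> \<times> pts \<Lambda>"
    "\<And>x. x \<in> pts \<Lambda> \<Longrightarrow> (x, x) \<in> rel \<Lambda>"
    "\<And>x y. (x, y) \<in> rel \<Lambda> \<Longrightarrow> (y, x) \<in> rel \<Lambda>"
    "\<And>x y z. (x, y) \<in> rel \<Lambda> \<Longrightarrow> (y, z) \<in> rel \<Lambda> \<Longrightarrow> (x, z) \<in> rel \<Lambda>"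
  using assms unfolding is_partition_def equiv_def refl_on_def sym_def trans_def by blast+

lemma is_partition_finite_rel: "is_partition \<Lambda> \<Longrightarrow> finite (rel \<Lambda>)"
  using finite_subset[OF is_partitionD(2)] is_partitionD(1) by blast

lemma is_partitionI:
  assumes "finite (pts \<Lambda>)" "rel \<Lambda> \<subseteq> pts \<Lambda> \<times> pts \<Lambda>"
    "\<And>x. x \<in> pts \<Lambda> \<Longrightarrow> (x, x) \<in> rel \<Lambda>"
    "\<And>x y. (x, y) \<in> rel \<Lambda> \<Longrightarrow> (y, x) \<in> rel \<Lambda>"
    "\<And>x y z. (x, y) \<in> rel \<Lambda> \<Longrightarrow> (y, z) \<in> rel \<Lambda> \<Longrightarrow> (x, z) \<in> rel \<Lambda>"
  shows "is_partition \<Lambda>"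
  using assms unfolding is_partition_def equiv_def refl_on_def sym_def trans_def by blast

lemma is_morD:
  assumes "is_mor \<Lambda> \<Omega> f"
  shows "is_partition \<Lambda>" "is_partition \<Omega>" "bij_betw f (pts \<Lambda>) (pts \<Omega>)" "inj_on f (pts \<Lambda>)"
    "f ` pts \<Lambda> = pts \<Omega>" "\<And>x. x \<in> pts \<Lambda> \<Longrightarrow> f x \<in> pts \<Omega>"
    "\<And>x y. (x, y) \<in> rel \<Lambda> \<Longrightarrow> (f x, f y) \<in> rel \<Omega>"
  using assms unfolding is_mor_def bij_betw_def by blast+

lemma is_morI:
  assumes "is_partition \<Lambda>" "is_partition \<Omega>" "bij_betw f (pts \<Lambda>) (pts \<Omega>)"
    "\<And>x y. (x, y) \<in> rel \<Lambda> \<Longrightarrow> (f x, f y) \<in> rel \<Omega>"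
  shows "is_mor \<Lambda> \<Omega> f"
  using assms unfolding is_mor_def by blast

lemma mor_inv_into:
  assumes "is_mor \<Lambda> \<Omega> f"
  shows "bij_betw (inv_into (pts \<Lambda>) f) (pts \<Omega>) (pts \<Lambda>)"
    "\<And>x. x \<in> pts \<Lambda> \<Longrightarrow> inv_into (pts \<Lambda>) f (f x) = x"
    "\<And>y. y \<in> pts \<Omega> \<Longrightarrow> f (inv_into (pts \<Lambda>) f y) = y"
    "\<And>y. y \<in> pts \<Omega> \<Longrightarrow> inv_into (pts \<Lambda>) f y \<in> pts \<Lambda>"
  using is_morD(3-5)[OF assms]
  by (auto simp: bij_betw_inv_into inv_into_into f_inv_into_f)

lemma mor_cong:
  assumes "is_mor \<Lambda> \<Omega> f" "\<And>x. x \<in> pts \<Lambda> \<Longrightarrow> f x = g x"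
  shows "is_mor \<Lambda> \<Omega> g"
proof (rule is_morI)
  show "is_partition \<Lambda>" "is_partition \<Omega>" using is_morD[OF assms(1)] by auto
  show "bij_betw g (pts \<Lambda>) (pts \<Omega>)"
    using is_morD(3)[OF assms(1)] assms(2) bij_betw_cong by metis
  fix x y assume xy: "(x, y) \<in> rel \<Lambda>"
  hence "x \<in> pts \<Lambda>" "y \<in> pts \<Lambda>" using is_partitionD(2)[OF is_morD(1)[OF assms(1)]] by auto
  thus "(g x, g y) \<in> rel \<Omega>" using is_morD(7)[OF assms(1) xy] assms(2) by simp
qed

lemma mor_id: "is_partition \<Lambda> \<Longrightarrow> is_mor \<Lambda> \<Lambda> id"
  by (simp add: is_mor_def)

lemma mor_comp:
  assumes "is_mor \<Lambda> \<Omega> f" "is_mor \<Omega> \<Theta> g"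
  shows "is_mor \<Lambda> \<Theta> (g \<circ> f)"
  using assms bij_betw_trans unfolding is_mor_def by fastforce

section \<open>The relation of 2-isomorphism between morphisms\<close>

lemma two_isoD:
  assumes "two_iso \<Lambda> \<Omega> f g"
  shows "is_mor \<Lambda> \<Omega> f" "is_mor \<Lambda> \<Omega> g" "\<And>x. x \<in> pts \<Lambda> \<Longrightarrow> (f x, g x) \<in> rel \<Omega>"
  using assms unfolding two_iso_def by auto

lemma two_iso_refl: "is_mor \<Lambda> \<Omega> f \<Longrightarrow> two_iso \<Lambda> \<Omega> f f"
  using is_partitionD(3) is_morD unfolding two_iso_def by blast

lemma two_iso_sym: "two_iso \<Lambda> \<Omega> f g \<Longrightarrow> two_iso \<Lambda> \<Omega> g f"
  using is_partitionD(4) is_morD unfolding two_iso_def by blast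

lemma two_iso_trans: "two_iso \<Lambda> \<Omega> f g \<Longrightarrow> two_iso \<Lambda> \<Omega> g h \<Longrightarrow> two_iso \<Lambda> \<Omega> f h"
  using is_partitionD(5) is_morD(2) unfolding two_iso_def by meson

lemma two_iso_comp_left:
  "two_iso \<Lambda> \<Omega> f g \<Longrightarrow> is_mor \<Omega> \<Theta> h \<Longrightarrow> two_iso \<Lambda> \<Theta> (h \<circ> f) (h \<circ> g)"
  unfolding two_iso_def using mor_comp is_morD(7) by fastforce

lemma two_iso_comp_right:
  "two_iso \<Lambda> \<Omega> f g \<Longrightarrow> is_mor \<Psi> \<Lambda> k \<Longrightarrow> two_iso \<Psi> \<Omega> (f \<circ> k) (g \<circ> k)"
  unfolding two_iso_def using mor_comp is_morD(6) by fastforce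

text \<open>Identities such as \<open>f (inv_into (pts \<Lambda>) f y) = y\<close> hold on points
  only, not as equations of total functions. Reflexivity of the block relation turns agreement on
  points into a 2-isomorphism, and partition functors do not distinguish 2-isomorphic
  morphisms.\<close>

lemma two_iso_cong:
  assumes "is_mor \<Lambda> \<Omega> f" "\<And>x. x \<in> pts \<Lambda> \<Longrightarrow> f x = g x"
  shows "two_iso \<Lambda> \<Omega> f g"
  unfolding two_iso_def using assms mor_cong[OF assms] is_morD[OF assms(1)]
    is_partitionD(3) by metis

section \<open>Transport of partitions along maps\<close>

lemma pts_transport [simp]: "pts (transport f \<Gamma>) = f ` pts \<Gamma>"
  and rel_transport: "rel (transport f \<Gamma>) = map_prod f f ` rel \<Gamma>"
  by (simp_all add: transport_def)

lemma transport_comp: "transport (g \<circ> f) \<Gamma> = transport g (transport f \<Gamma>)"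
  by (simp add: transport_def image_comp map_prod.comp)

lemma transport_id [simp]: "transport id \<Gamma> = \<Gamma>"
  by (simp add: transport_def map_prod.id)

lemma transport_cong:
  assumes "is_partition \<Gamma>" "\<And>x. x \<in> pts \<Gamma> \<Longrightarrow> f x = g x"
  shows "transport f \<Gamma> = transport g \<Gamma>"
proof -
  have "map_prod f f ` rel \<Gamma> = map_prod g g ` rel \<Gamma>"
    using is_partitionD(2)[OF assms(1)] assms(2) by (intro image_cong) auto
  thus ?thesis using assms(2) by (simp add: transport_def)
qed

lemma rel_transport_iff:
  assumes "is_partition \<Gamma>" "inj_on f (pts \<Gamma>)" "x \<in> pts \<Gamma>" "y \<in> pts \<Gamma>"
  shows "(f x, f y) \<in> rel (transport f \<Gamma>) \<longleftrightarrow> (x, y) \<in> rel \<Gamma>"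
proof
  assume "(f x, f y) \<in> rel (transport f \<Gamma>)"
  then obtain x' y' where "(x', y') \<in> rel \<Gamma>" "f x = f x'" "f y = f y'"
    by (auto simp: rel_transport)
  moreover from this have "x' \<in> pts \<Gamma>" "y' \<in> pts \<Gamma>" using is_partitionD(2)[OF assms(1)] by auto
  ultimately show "(x, y) \<in> rel \<Gamma>" using assms by (metis inj_onD)
qed (auto simp: rel_transport)

lemma transport_partition:
  assumes "is_partition \<Gamma>" "inj_on f (pts \<Gamma>)"
  shows "is_partition (transport f \<Gamma>)"
proof (rule is_partitionI)
  note D = is_partitionD[OF assms(1)]
  show "finite (pts (transport f \<Gamma>))" using D(1) by simp
  show sub: "rel (transport f \<Gamma>) \<subseteq> pts (transport f \<Gamma>) \<times> pts (transport f \<Gamma>)"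
    using D(2) by (auto simp: rel_transport)
  show "(x, x) \<in> rel (transport f \<Gamma>)" if "x \<in> pts (transport f \<Gamma>)" for x
    using that by (auto simp: rel_transport dest: D(3))
  show "(y, x) \<in> rel (transport f \<Gamma>)" if "(x, y) \<in> rel (transport f \<Gamma>)" for x y
  proof -
    from that obtain x' y' where xy: "(x', y') \<in> rel \<Gamma>" and [simp]: "x = f x'" "y = f y'"
      by (auto simp: rel_transport)
    show ?thesis using map_prod_imageI[OF D(4)[OF xy], of f f] by (simp add: rel_transport)
  qed
  show "(x, z) \<in> rel (transport f \<Gamma>)"
    if h: "(x, y) \<in> rel (transport f \<Gamma>)" "(y, z) \<in> rel (transport f \<Gamma>)" for x y z
  proof -
    obtain x' y' z' where "x = f x'" "y = f y'" "z = f z'" "x' \<in> pts \<Gamma>" "y' \<in> pts \<Gamma>" "z' \<in> pts \<Gamma>"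
      using subsetD[OF sub h(1)] subsetD[OF sub h(2)] by auto
    thus ?thesis using h rel_transport_iff[OF assms] D(5) by meson
  qed
qed

lemma transport_mor:
  assumes "is_partition \<Gamma>" "inj_on f (pts \<Gamma>)"
  shows "is_mor \<Gamma> (transport f \<Gamma>) f"
  using assms transport_partition[OF assms]
  by (auto intro!: is_morI simp: bij_betw_def rel_transport)

lemma partition_eqI: "pts \<Lambda> = pts \<Omega> \<Longrightarrow> rel \<Lambda> = rel \<Omega> \<Longrightarrow> \<Lambda> = (\<Omega> :: 'u set_partition)"
  by simp

section \<open>Refinement, images and isomorphisms\<close>

lemma refines_iff:
  "\<Lambda> \<preceq> \<Omega> \<longleftrightarrow> is_partition \<Lambda> \<and> is_partition \<Omega> \<and> pts \<Lambda> = pts \<Omega> \<and> rel \<Lambda> \<subseteq> rel \<Omega>"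
  unfolding refines_def is_mor_def by auto

lemma refinesD:
  assumes "\<Lambda> \<preceq> \<Omega>"
  shows "is_partition \<Lambda>" "is_partition \<Omega>" "pts \<Lambda> = pts \<Omega>" "rel \<Lambda> \<subseteq> rel \<Omega>" "is_mor \<Lambda> \<Omega> id"
  using assms unfolding refines_iff is_mor_def by auto

lemma refines_refl: "is_partition \<Lambda> \<Longrightarrow> \<Lambda> \<preceq> \<Lambda>"
  by (simp add: refines_iff)

lemma refines_trans: "\<Lambda> \<preceq> \<Omega> \<Longrightarrow> \<Omega> \<preceq> \<Theta> \<Longrightarrow> \<Lambda> \<preceq> \<Theta>"
  by (auto simp: refines_iff)

lemma refines_antisym: "\<Lambda> \<preceq> \<Omega> \<Longrightarrow> \<Omega> \<preceq> \<Lambda> \<Longrightarrow> \<Lambda> = \<Omega>"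
  by (simp add: refines_iff partition_eqI)

text \<open>A refinement has the same points as \<Lambda>, so it is determined by its relation, a
  subset of the finite relation of \<Lambda>. If \<Lambda> is not a partition, it has no refinements
  at all.\<close>

lemma finite_refines [simp]: "finite {\<Gamma>. \<Gamma> \<preceq> (\<Lambda> :: 'u set_partition)}"
proof (cases "is_partition \<Lambda>")
  case True
  have "{\<Gamma>. \<Gamma> \<preceq> \<Lambda>} \<subseteq> (\<lambda>r. \<lparr>pts = pts \<Lambda>, rel = r\<rparr>) ` Pow (rel \<Lambda>)"
  proof
    fix \<Gamma> assume "\<Gamma> \<in> {\<Gamma>. \<Gamma> \<preceq> \<Lambda>}"
    thus "\<Gamma> \<in> (\<lambda>r. \<lparr>pts = pts \<Lambda>, rel = r\<rparr>) ` Pow (rel \<Lambda>)"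
      by (intro image_eqI[of _ _ "rel \<Gamma>"]) (auto simp: refines_iff intro!: partition_eqI)
  qed
  thus ?thesis using is_partition_finite_rel[OF True] by (metis finite_Pow_iff finite_imageI finite_subset)
qed (simp add: refines_iff)

lemma finite_strictly_refines [simp]: "finite {\<Gamma>. \<Gamma> \<prec> \<Lambda>}"
  by (rule finite_subset[OF _ finite_refines[of \<Lambda>]]) (auto simp: strictly_refines_def)

lemma mor_refines: "is_mor \<Lambda> \<Omega> f \<Longrightarrow> \<Gamma> \<preceq> \<Lambda> \<Longrightarrow> is_mor \<Gamma> \<Omega> f"
  unfolding is_mor_def refines_iff by auto

lemma mor_coarsen: "is_mor \<Gamma> \<Lambda> f \<Longrightarrow> \<Lambda> \<preceq> \<Omega> \<Longrightarrow> is_mor \<Gamma> \<Omega> f"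
  unfolding is_mor_def refines_iff by auto

text \<open>Together with \<open>mor_iso_transport\<close> this factors a morphism as an isomorphism
  onto its image partition followed by a refinement. The components of an element of PD are indexed
  by such images.\<close>

lemma mor_transport_refines:
  assumes "is_mor \<Gamma> \<Lambda> f"
  shows "transport f \<Gamma> \<preceq> \<Lambda>"
  using transport_partition is_morD[OF assms] by (auto simp: refines_iff rel_transport)

lemma refines_transport:
  assumes "\<Gamma> \<preceq> \<Lambda>" "inj_on f (pts \<Lambda>)"
  shows "transport f \<Gamma> \<preceq> transport f \<Lambda>"
  using assms transport_partition[of \<Gamma> f] transport_partition[of \<Lambda> f]
  by (auto simp: refines_iff rel_transport)

text \<open>A bijective morphism can fail to be invertible only because its target relates more
  pairs than come from the source, and comparing the target with the transported source detects
  exactly this. In this form isomorphisms compose without any computation with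
  \<open>inv_into\<close>.\<close>

lemma is_iso_iff: "is_iso \<Gamma> \<Gamma>' f \<longleftrightarrow> is_mor \<Gamma> \<Gamma>' f \<and> transport f \<Gamma> = \<Gamma>'"
proof
  assume "is_iso \<Gamma> \<Gamma>' f"
  hence m: "is_mor \<Gamma> \<Gamma>' f" and m': "is_mor \<Gamma>' \<Gamma> (inv_into (pts \<Gamma>) f)" by (auto simp: is_iso_def)
  have "rel \<Gamma>' \<subseteq> rel (transport f \<Gamma>)"
  proof clarify
    fix x y assume xy: "(x, y) \<in> rel \<Gamma>'"
    hence p: "x \<in> pts \<Gamma>'" "y \<in> pts \<Gamma>'" using is_partitionD(2)[OF is_morD(2)[OF m]] by auto
    have "(f (inv_into (pts \<Gamma>) f x), f (inv_into (pts \<Gamma>) f y)) \<in> rel (transport f \<Gamma>)"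
      using is_morD(7)[OF m' xy] by (auto simp: rel_transport)
    thus "(x, y) \<in> rel (transport f \<Gamma>)" using p mor_inv_into(3)[OF m] by simp
  qed
  hence "transport f \<Gamma> = \<Gamma>'"
    using mor_transport_refines[OF m] by (intro partition_eqI) (auto simp: refines_iff)
  thus "is_mor \<Gamma> \<Gamma>' f \<and> transport f \<Gamma> = \<Gamma>'" using m by simp
next
  assume *: "is_mor \<Gamma> \<Gamma>' f \<and> transport f \<Gamma> = \<Gamma>'"
  hence m: "is_mor \<Gamma> \<Gamma>' f" by simp
  have "is_mor \<Gamma>' \<Gamma> (inv_into (pts \<Gamma>) f)"
  proof (rule is_morI)
    show "is_partition \<Gamma>'" "is_partition \<Gamma>" using is_morD[OF m] by auto
    show "bij_betw (inv_into (pts \<Gamma>) f) (pts \<Gamma>') (pts \<Gamma>)" using mor_inv_into[OF m] by simp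
    fix x y assume "(x, y) \<in> rel \<Gamma>'"
    then obtain x' y' where "x = f x'" "y = f y'" "(x', y') \<in> rel \<Gamma>"
      using * by (auto simp: rel_transport)
    moreover from this have "x' \<in> pts \<Gamma>" "y' \<in> pts \<Gamma>"
      using is_partitionD(2)[OF is_morD(1)[OF m]] by auto
    ultimately show "(inv_into (pts \<Gamma>) f x, inv_into (pts \<Gamma>) f y) \<in> rel \<Gamma>"
      using mor_inv_into(2)[OF m] by simp
  qed
  thus "is_iso \<Gamma> \<Gamma>' f" using m by (simp add: is_iso_def)
qed

lemma isoD: "is_iso \<Gamma> \<Gamma>' f \<Longrightarrow> is_mor \<Gamma> \<Gamma>' f" "is_iso \<Gamma> \<Gamma>' f \<Longrightarrow> transport f \<Gamma> = \<Gamma>'"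
  by (simp_all add: is_iso_iff)

lemma iso_id: "is_partition \<Lambda> \<Longrightarrow> is_iso \<Lambda> \<Lambda> id"
  by (simp add: is_iso_iff mor_id)

lemma iso_transport:
  "is_partition \<Gamma> \<Longrightarrow> inj_on f (pts \<Gamma>) \<Longrightarrow> is_iso \<Gamma> (transport f \<Gamma>) f"
  by (simp add: is_iso_iff transport_mor)

lemma mor_iso_transport: "is_mor \<Gamma> \<Lambda> f \<Longrightarrow> is_iso \<Gamma> (transport f \<Gamma>) f"
  using is_morD by (blast intro: iso_transport)

lemma iso_inv:
  assumes "is_iso \<Gamma> \<Gamma>' f"
  shows "is_iso \<Gamma>' \<Gamma> (inv_into (pts \<Gamma>) f)"
proof -
  note m = isoD(1)[OF assms]
  have "transport (inv_into (pts \<Gamma>) f) (transport f \<Gamma>) = transport id \<Gamma>"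
    unfolding transport_comp[symmetric]
    using is_morD(1)[OF m] mor_inv_into(2)[OF m] by (intro transport_cong) auto
  moreover have "is_mor \<Gamma>' \<Gamma> (inv_into (pts \<Gamma>) f)" using assms by (simp add: is_iso_def)
  ultimately show ?thesis using isoD(2)[OF assms] by (simp add: is_iso_iff)
qed

lemma iso_comp: "is_iso \<Gamma> \<Gamma>' f \<Longrightarrow> is_iso \<Gamma>' \<Gamma>'' g \<Longrightarrow> is_iso \<Gamma> \<Gamma>'' (g \<circ> f)"
  by (auto simp: is_iso_iff transport_comp intro: mor_comp)

lemma iso_cong:
  assumes "is_iso \<Gamma> \<Gamma>' f" "\<And>x. x \<in> pts \<Gamma> \<Longrightarrow> f x = g x"
  shows "is_iso \<Gamma> \<Gamma>' g"
  using assms mor_cong transport_cong[of \<Gamma> f g] is_morD(1) unfolding is_iso_iff by metis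

text \<open>This prepares the partition \<open>(\<sigma> f)^{-1} \<Gamma>\<close> of the transfer
  formula. As \<open>h\<close> is injective on the points of \<Psi> only, the inverse is taken
  there; moving \<Gamma> back along it lands in a refinement of \<Psi>, and \<open>h\<close> itself
  leads back to \<Gamma>.\<close>

lemma mor_refines_transport_inv:
  assumes "is_mor \<Psi> \<Omega> h" "\<Gamma> \<preceq> transport h \<Psi>"
  shows "is_iso \<Gamma> (transport (inv_into (pts \<Psi>) h) \<Gamma>) (inv_into (pts \<Psi>) h)"
    "is_mor \<Gamma> \<Psi> (inv_into (pts \<Psi>) h)"
    "transport (inv_into (pts \<Psi>) h) \<Gamma> \<preceq> \<Psi>"
    "is_iso (transport (inv_into (pts \<Psi>) h) \<Gamma>) \<Gamma> h"
proof -
  have i: "is_iso (transport h \<Psi>) \<Psi> (inv_into (pts \<Psi>) h)"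
    using iso_inv[OF mor_iso_transport[OF assms(1)]] .
  show m: "is_mor \<Gamma> \<Psi> (inv_into (pts \<Psi>) h)"
    using mor_refines[OF isoD(1)[OF i] assms(2)] .
  show "is_iso \<Gamma> (transport (inv_into (pts \<Psi>) h) \<Gamma>) (inv_into (pts \<Psi>) h)"
    using mor_iso_transport[OF m] .
  show r: "transport (inv_into (pts \<Psi>) h) \<Gamma> \<preceq> \<Psi>" using mor_transport_refines[OF m] .
  have p: "pts \<Gamma> = h ` pts \<Psi>" using assms(2) by (simp add: refines_iff)
  have "transport h (transport (inv_into (pts \<Psi>) h) \<Gamma>) = transport id \<Gamma>"
    unfolding transport_comp[symmetric]
    using refinesD(1)[OF assms(2)] p by (intro transport_cong) (auto simp: f_inv_into_f)
  moreover have "inj_on h (pts (transport (inv_into (pts \<Psi>) h) \<Gamma>))"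
    using is_morD(4)[OF assms(1)] refinesD(3)[OF r] by simp
  ultimately show "is_iso (transport (inv_into (pts \<Psi>) h) \<Gamma>) \<Gamma> h"
    using iso_transport[OF refinesD(1)[OF r]] by simp metis
qed

section \<open>The groups of block-preserving permutations\<close>

lemma id_in_block_perms: "is_partition \<Lambda> \<Longrightarrow> id \<in> block_perms \<Lambda>"
  by (auto simp: block_perms_def permutes_id intro: is_partitionD(3))

text \<open>Moving every point inside its own block preserves the relation, by symmetry and
  transitivity. With the converse \<open>two_iso_block_perms\<close>, the group of block
  permutations consists of the permutations that are 2-isomorphic to the identity, and every
  partition functor sends them to the identity.\<close>

lemma block_perms_two_iso:
  assumes "is_partition \<Lambda>" "\<sigma> \<in> block_perms \<Lambda>"
  shows "two_iso \<Lambda> \<Lambda> \<sigma> id"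
proof -
  have p: "\<sigma> permutes pts \<Lambda>" and r: "\<And>x. x \<in> pts \<Lambda> \<Longrightarrow> (x, \<sigma> x) \<in> rel \<Lambda>"
    using assms(2) by (auto simp: block_perms_def)
  have "is_mor \<Lambda> \<Lambda> \<sigma>"
  proof (rule is_morI[OF assms(1,1) permutes_imp_bij[OF p]])
    fix x y assume "(x, y) \<in> rel \<Lambda>"
    moreover from this have "x \<in> pts \<Lambda>" "y \<in> pts \<Lambda>" using is_partitionD(2)[OF assms(1)] by auto
    ultimately show "(\<sigma> x, \<sigma> y) \<in> rel \<Lambda>" using r is_partitionD(4,5)[OF assms(1)] by meson
  qed
  thus ?thesis using r mor_id[OF assms(1)] is_partitionD(4)[OF assms(1)] unfolding two_iso_def id_apply by blast
qed

lemma block_perms_mor: "is_partition \<Lambda> \<Longrightarrow> \<sigma> \<in> block_perms \<Lambda> \<Longrightarrow> is_mor \<Lambda> \<Lambda> \<sigma>"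
  using block_perms_two_iso two_isoD(1) by blast

lemma two_iso_block_perms:
  "\<sigma> permutes pts \<Lambda> \<Longrightarrow> two_iso \<Lambda> \<Lambda> \<sigma> id \<Longrightarrow> \<sigma> \<in> block_perms \<Lambda>"
  using is_partitionD(4)[of \<Lambda>] is_morD(1) unfolding block_perms_def two_iso_def id_apply by blast

lemma block_perms_comp:
  assumes "is_partition \<Lambda>" "\<sigma> \<in> block_perms \<Lambda>" "\<tau> \<in> block_perms \<Lambda>"
  shows "\<sigma> \<circ> \<tau> \<in> block_perms \<Lambda>"
proof (rule two_iso_block_perms)
  show "\<sigma> \<circ> \<tau> permutes pts \<Lambda>" using assms by (auto simp: block_perms_def permutes_compose)
  have "two_iso \<Lambda> \<Lambda> (\<sigma> \<circ> \<tau>) (id \<circ> \<tau>)"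
    using two_iso_comp_right[OF block_perms_two_iso block_perms_mor] assms by blast
  thus "two_iso \<Lambda> \<Lambda> (\<sigma> \<circ> \<tau>) id" using two_iso_trans block_perms_two_iso assms(1,3) by fastforce
qed

lemma block_perms_inv:
  assumes "is_partition \<Lambda>" "\<sigma> \<in> block_perms \<Lambda>"
  shows "inv_into UNIV \<sigma> \<in> block_perms \<Lambda>"
    "\<sigma> \<circ> inv_into UNIV \<sigma> = id" "inv_into UNIV \<sigma> \<circ> \<sigma> = id"
proof -
  have p: "\<sigma> permutes pts \<Lambda>" using assms by (simp add: block_perms_def)
  show 1: "\<sigma> \<circ> inv_into UNIV \<sigma> = id" "inv_into UNIV \<sigma> \<circ> \<sigma> = id"
    using permutes_inv_o[OF p] by auto
  show "inv_into UNIV \<sigma> \<in> block_perms \<Lambda>" unfolding block_perms_def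
  proof (intro CollectI conjI ballI)
    show q: "inv_into UNIV \<sigma> permutes pts \<Lambda>" using permutes_inv[OF p] .
    fix x assume x: "x \<in> pts \<Lambda>"
    hence "inv_into UNIV \<sigma> x \<in> pts \<Lambda>" using permutes_in_image[OF q] by blast
    hence "(inv_into UNIV \<sigma> x, \<sigma> (inv_into UNIV \<sigma> x)) \<in> rel \<Lambda>"
      using assms(2) by (simp add: block_perms_def)
    moreover have "\<sigma> (inv_into UNIV \<sigma> x) = x" using 1(1) by (metis comp_apply id_apply)
    ultimately show "(x, inv_into UNIV \<sigma> x) \<in> rel \<Lambda>" using is_partitionD(4)[OF assms(1)] by simp
  qed
qed

lemma block_perms_refines: "\<Gamma> \<preceq> \<Lambda> \<Longrightarrow> \<sigma> \<in> block_perms \<Gamma> \<Longrightarrow> \<sigma> \<in> block_perms \<Lambda>"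
  by (auto simp: block_perms_def refines_iff)

text \<open>Since \<open>k\<close> and \<open>k'\<close> are bijections onto the same points, the
  permutation has to be \<open>k'\<close> after the inverse of \<open>k\<close>, and the
  2-isomorphism says that it preserves every block. This is the passage from classes of morphisms to
  elements of the groups that form the double cosets.\<close>

lemma two_iso_perm_ex:
  assumes "two_iso \<Gamma> \<Lambda> k k'"
  obtains \<sigma> where "\<sigma> \<in> block_perms \<Lambda>" "\<And>x. x \<in> pts \<Gamma> \<Longrightarrow> \<sigma> (k x) = k' x"
proof -
  note k = two_isoD(1)[OF assms] and k' = two_isoD(2)[OF assms]
  \<comment> \<open>Extended by the identity outside \<Lambda>, because block permutations are
    represented by functions fixing all other points.\<close>
  define \<sigma> where "\<sigma> x = (if x \<in> pts \<Lambda> then k' (inv_into (pts \<Gamma>) k x) else x)" for x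
  have v: "\<sigma> (k x) = k' x" if "x \<in> pts \<Gamma>" for x
    using that is_morD(6)[OF k] mor_inv_into(2)[OF k] by (simp add: \<sigma>_def)
  have "bij_betw (k' \<circ> inv_into (pts \<Gamma>) k) (pts \<Lambda>) (pts \<Lambda>)"
    using bij_betw_trans[OF mor_inv_into(1)[OF k] is_morD(3)[OF k']] .
  hence "bij_betw \<sigma> (pts \<Lambda>) (pts \<Lambda>)"
    using bij_betw_cong[of "pts \<Lambda>" \<sigma> "k' \<circ> inv_into (pts \<Gamma>) k"] by (simp add: \<sigma>_def)
  hence p: "\<sigma> permutes pts \<Lambda>" by (rule bij_imp_permutes) (simp add: \<sigma>_def)
  have "(x, \<sigma> x) \<in> rel \<Lambda>" if "x \<in> pts \<Lambda>" for x
    using two_isoD(3)[OF assms mor_inv_into(4)[OF k that]] mor_inv_into(3)[OF k that] that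
    by (simp add: \<sigma>_def)
  hence "\<sigma> \<in> block_perms \<Lambda>" using p by (simp add: block_perms_def)
  thus ?thesis using v that by blast
qed

text \<open>The 2-isomorphism class of a morphism is determined by the blocks in which its values lie,
  so it is encoded by the induced map from points to blocks.\<close>

definition mor_class :: "'u set_partition \<Rightarrow> 'u set_partition \<Rightarrow> ('u point \<Rightarrow> 'u point) \<Rightarrow> 'u point \<Rightarrow> 'u point set" where
  "mor_class \<Gamma> \<Psi> l = (\<lambda>x \<in> pts \<Gamma>. rel \<Psi> `` {l x})"

lemma mor_class_eq_iff:
  assumes "is_mor \<Gamma> \<Psi> l" "is_mor \<Gamma> \<Psi> l'"
  shows "mor_class \<Gamma> \<Psi> l = mor_class \<Gamma> \<Psi> l' \<longleftrightarrow> two_iso \<Gamma> \<Psi> l l'"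
proof -
  have e: "equiv (pts \<Psi>) (rel \<Psi>)" using is_morD(2)[OF assms(1)] by (simp add: is_partition_def)
  have "mor_class \<Gamma> \<Psi> l = mor_class \<Gamma> \<Psi> l' \<longleftrightarrow> (\<forall>x \<in> pts \<Gamma>. rel \<Psi> `` {l x} = rel \<Psi> `` {l' x})"
    unfolding mor_class_def restrict_def fun_eq_iff by meson
  also have "\<dots> \<longleftrightarrow> (\<forall>x \<in> pts \<Gamma>. (l x, l' x) \<in> rel \<Psi>)"
    using eq_equiv_class_iff[OF e] is_morD(6) assms by blast
  finally show ?thesis using assms by (simp add: two_iso_def)
qed

text \<open>A set of morphisms between fixed partitions is usually infinite because of arbitrary
  values off the points, but the encoded classes are functions from a finite set into the power set
  of a finite set. Finiteness matters because \<open>finsum\<close> over an infinite set is zero by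
  convention.\<close>

lemma finite_mor_class:
  assumes "\<And>l. l \<in> L \<Longrightarrow> is_mor \<Gamma> \<Psi> l"
  shows "finite (mor_class \<Gamma> \<Psi> ` L)"
proof (cases "L = {}")
  case False
  hence p: "is_partition \<Gamma>" "is_partition \<Psi>" using assms is_morD by blast+
  have "mor_class \<Gamma> \<Psi> ` L \<subseteq> (\<Pi>\<^sub>E x \<in> pts \<Gamma>. Pow (pts \<Psi>))"
    using is_partitionD(2)[OF p(2)] by (auto simp: mor_class_def)
  moreover have "finite (\<Pi>\<^sub>E x \<in> pts \<Gamma>. Pow (pts \<Psi>))"
    using is_partitionD(1) p by (intro finite_PiE) auto
  ultimately show ?thesis by (rule finite_subset)
qed simp

text \<open>For partitions of one set the meet behaves like a fibre product over that set: for a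
  fixed underlying function, being a morphism or a 2-isomorphism into it can be tested in both
  partitions separately. In the double coset formula this separates the conditions over \<Gamma> and
  over \<sigma> \<Lambda>.\<close>

lemma meet_mor_iff:
  assumes "is_partition \<Gamma>" "is_partition \<Lambda>" "pts \<Gamma> = pts \<Lambda>"
  shows "is_partition (meet \<Gamma> \<Lambda>)" "meet \<Gamma> \<Lambda> \<preceq> \<Gamma>" "meet \<Gamma> \<Lambda> \<preceq> \<Lambda>"
    "is_mor \<Theta> (meet \<Gamma> \<Lambda>) m \<longleftrightarrow> is_mor \<Theta> \<Gamma> m \<and> is_mor \<Theta> \<Lambda> m"
    "two_iso \<Theta> (meet \<Gamma> \<Lambda>) m m' \<longleftrightarrow> two_iso \<Theta> \<Gamma> m m' \<and> two_iso \<Theta> \<Lambda> m m'"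
proof -
  note G = is_partitionD[OF assms(1)] and L = is_partitionD[OF assms(2)]
  show p: "is_partition (meet \<Gamma> \<Lambda>)"
  proof (rule is_partitionI)
    show "finite (pts (meet \<Gamma> \<Lambda>))" using G(1) by (simp add: meet_def)
    show "rel (meet \<Gamma> \<Lambda>) \<subseteq> pts (meet \<Gamma> \<Lambda>) \<times> pts (meet \<Gamma> \<Lambda>)" using G(2) L(2) by (auto simp: meet_def)
    show "(x, x) \<in> rel (meet \<Gamma> \<Lambda>)" if "x \<in> pts (meet \<Gamma> \<Lambda>)" for x
      using that by (auto simp: meet_def dest: G(3) L(3))
    show "(y, x) \<in> rel (meet \<Gamma> \<Lambda>)" if "(x, y) \<in> rel (meet \<Gamma> \<Lambda>)" for x y
      using that by (auto simp: meet_def dest: G(4) L(4))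
    show "(x, z) \<in> rel (meet \<Gamma> \<Lambda>)" if "(x, y) \<in> rel (meet \<Gamma> \<Lambda>)" "(y, z) \<in> rel (meet \<Gamma> \<Lambda>)" for x y z
      using that G(5)[of x y z] L(5)[of x y z] by (auto simp: meet_def)
  qed
  show "meet \<Gamma> \<Lambda> \<preceq> \<Gamma>" "meet \<Gamma> \<Lambda> \<preceq> \<Lambda>" using p assms by (auto simp: refines_iff meet_def)
  show m: "is_mor \<Theta> (meet \<Gamma> \<Lambda>) m \<longleftrightarrow> is_mor \<Theta> \<Gamma> m \<and> is_mor \<Theta> \<Lambda> m" for m
    using p assms by (auto simp: is_mor_def meet_def)
  show "two_iso \<Theta> (meet \<Gamma> \<Lambda>) m m' \<longleftrightarrow> two_iso \<Theta> \<Gamma> m m' \<and> two_iso \<Theta> \<Lambda> m m'"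
    unfolding two_iso_def m by (auto simp: meet_def)
qed

section \<open>Finite sums in abelian groups\<close>

lemma add_hom_closed: "h \<in> add_hom G H \<Longrightarrow> x \<in> carrier G \<Longrightarrow> h x \<in> carrier H"
  and add_hom_add: "h \<in> add_hom G H \<Longrightarrow> x \<in> carrier G \<Longrightarrow> y \<in> carrier G \<Longrightarrow>
    h (x \<oplus>\<^bsub>G\<^esub> y) = h x \<oplus>\<^bsub>H\<^esub> h y"
  by (auto simp: hom_def)

lemma add_homI:
  assumes "\<And>x. x \<in> carrier G \<Longrightarrow> h x \<in> carrier H"
    "\<And>x y. x \<in> carrier G \<Longrightarrow> y \<in> carrier G \<Longrightarrow> h (x \<oplus>\<^bsub>G\<^esub> y) = h x \<oplus>\<^bsub>H\<^esub> h y"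
  shows "h \<in> add_hom G H"
  using assms by (auto simp: hom_def)

lemma add_hom_group_hom:
  assumes "abelian_group G" "abelian_group H" "h \<in> add_hom G H"
  shows "abelian_group_hom G H h"
  using assms by (intro abelian_group_homI group_hom.intro group_hom_axioms.intro abelian_group.a_group)

lemma add_hom_zero:
  "abelian_group G \<Longrightarrow> abelian_group H \<Longrightarrow> h \<in> add_hom G H \<Longrightarrow> h \<zero>\<^bsub>G\<^esub> = \<zero>\<^bsub>H\<^esub>"
  using abelian_group_hom.hom_zero[OF add_hom_group_hom] .

lemma add_hom_comp: "g \<in> add_hom G H \<Longrightarrow> h \<in> add_hom H K \<Longrightarrow> (\<lambda>x. h (g x)) \<in> add_hom G K"
  by (intro add_homI) (auto simp: add_hom_closed add_hom_add)

lemma add_hom_finsum: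
  assumes "abelian_group G" "abelian_group H" "h \<in> add_hom G H" "\<And>a. a \<in> A \<Longrightarrow> f a \<in> carrier G"
  shows "h (finsum G f A) = finsum H (\<lambda>a. h (f a)) A"
proof (cases "finite A")
  case True
  interpret G: abelian_group G by fact
  interpret H: abelian_group H by fact
  show ?thesis using True assms(4)
  proof (induction A)
    case empty
    then show ?case using add_hom_zero[OF assms(1-3)] by simp
  next
    case (insert a A)
    hence "f \<in> A \<rightarrow> carrier G" "(\<lambda>a. h (f a)) \<in> A \<rightarrow> carrier H" "f a \<in> carrier G"
      using add_hom_closed[OF assms(3)] by auto
    thus ?case using insert add_hom_add[OF assms(3)] add_hom_closed[OF assms(3)] G.finsum_closed[of f A]
      by (simp add: G.finsum_insert H.finsum_insert)
  qed
next
  \<comment> \<open>Over an infinite index set both sums are zero by convention, and a homomorphism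
    preserves zero.\<close>
  case False
  thus ?thesis using add_hom_zero[OF assms(1-3)] assms(1,2)
    by (simp add: abelian_monoid.finsum_infinite abelian_group_def)
qed

lemma finsum_cong_set:
  assumes "abelian_group G" "A = B" "\<And>b. b \<in> B \<Longrightarrow> g b \<in> carrier G" "\<And>b. b \<in> B \<Longrightarrow> f b = g b"
  shows "finsum G f A = finsum G g B"
proof -
  interpret abelian_group G by fact
  show ?thesis using assms(2-4) by (intro finsum_cong') auto
qed

lemma finsum_mem:
  assumes "abelian_group G" "\<And>b. b \<in> A \<Longrightarrow> g b \<in> carrier G"
  shows "finsum G g A \<in> carrier G"
proof -
  interpret abelian_group G by fact
  show ?thesis using assms(2) by (intro finsum_closed) auto
qed

lemma finsum_bij:
  assumes "abelian_group G" "bij_betw \<phi> A B" "\<And>b. b \<in> B \<Longrightarrow> g b \<in> carrier G"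
    "\<And>a. a \<in> A \<Longrightarrow> f a = g (\<phi> a)"
  shows "finsum G f A = finsum G g B"
proof -
  interpret abelian_group G by fact
  have B: "B = \<phi> ` A" and i: "inj_on \<phi> A" using assms(2) by (auto simp: bij_betw_def)
  have "finsum G f A = finsum G (\<lambda>a. g (\<phi> a)) A"
    using assms(3,4) B by (intro finsum_cong') auto
  also have "\<dots> = finsum G g B" unfolding B using assms(3) B i by (subst finsum_reindex) auto
  finally show ?thesis .
qed

lemma finsum_UN_disjoint:
  assumes "abelian_group G" "finite I" "\<And>i. i \<in> I \<Longrightarrow> finite (A i)"
    "\<And>i j x. i \<in> I \<Longrightarrow> j \<in> I \<Longrightarrow> x \<in> A i \<Longrightarrow> x \<in> A j \<Longrightarrow> i = j"
    "\<And>i x. i \<in> I \<Longrightarrow> x \<in> A i \<Longrightarrow> g x \<in> carrier G"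
  shows "finsum G g (\<Union>i\<in>I. A i) = finsum G (\<lambda>i. finsum G g (A i)) I"
proof -
  interpret abelian_group G by fact
  have "pairwise (\<lambda>i j. disjnt (A i) (A j)) I"
    unfolding pairwise_def disjnt_def using assms(4) by blast
  thus ?thesis using assms(2,3,5) by (intro add.finprod_UN_disjoint) auto
qed

lemma finsum_single:
  assumes "abelian_group G" "finite A" "i \<in> A" "z \<in> carrier G"
  shows "finsum G (\<lambda>j. if j = i then z else \<zero>\<^bsub>G\<^esub>) A = z"
proof -
  interpret abelian_group G by fact
  show ?thesis using add.finprod_singleton_swap[OF assms(3,2), of "\<lambda>_. z"] assms(4)
    by simp
qed

lemma finsum_mono_neutral:
  assumes "abelian_group G" "finite B" "A \<subseteq> B" "\<And>i. i \<in> B - A \<Longrightarrow> f i = \<zero>\<^bsub>G\<^esub>"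
    "\<And>i. i \<in> A \<Longrightarrow> f i \<in> carrier G"
  shows "finsum G f B = finsum G f A"
proof -
  interpret abelian_group G by fact
  show ?thesis using assms(2-5)
    by (intro add.finprod_mono_neutral_cong_right) (auto, metis DiffI zero_closed)
qed

section \<open>The axioms of partition functors\<close>

locale part_functor =
  fixes M :: "('u, 'a, 'z) pfun_scheme"
  assumes pf: "partition_functor M"
begin

lemmas pf_ax = pf[unfolded partition_functor_def]

lemma val_group: "is_partition \<Lambda> \<Longrightarrow> abelian_group (pf_val M \<Lambda>)"
  using pf_ax[THEN conjunct1] by blast

lemma res_hom: "is_mor \<Lambda> \<Omega> f \<Longrightarrow> pf_res M \<Lambda> \<Omega> f \<in> add_hom (pf_val M \<Omega>) (pf_val M \<Lambda>)"
  and tr_hom: "is_mor \<Lambda> \<Omega> f \<Longrightarrow> pf_tr M \<Lambda> \<Omega> f \<in> add_hom (pf_val M \<Lambda>) (pf_val M \<Omega>)"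
  using pf_ax[THEN conjunct2, THEN conjunct1] by blast+

lemma res_id: "is_partition \<Lambda> \<Longrightarrow> x \<in> pf_carrier M \<Lambda> \<Longrightarrow> pf_res M \<Lambda> \<Lambda> id x = x"
  and tr_id: "is_partition \<Lambda> \<Longrightarrow> x \<in> pf_carrier M \<Lambda> \<Longrightarrow> pf_tr M \<Lambda> \<Lambda> id x = x"
  using pf_ax[THEN conjunct2, THEN conjunct2, THEN conjunct1] by blast+

lemma res_comp: "is_mor \<Lambda> \<Omega> f \<Longrightarrow> is_mor \<Omega> \<Theta> g \<Longrightarrow> x \<in> pf_carrier M \<Theta> \<Longrightarrow>
    pf_res M \<Lambda> \<Theta> (g \<circ> f) x = pf_res M \<Lambda> \<Omega> f (pf_res M \<Omega> \<Theta> g x)"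
  and tr_comp: "is_mor \<Lambda> \<Omega> f \<Longrightarrow> is_mor \<Omega> \<Theta> g \<Longrightarrow> y \<in> pf_carrier M \<Lambda> \<Longrightarrow>
    pf_tr M \<Lambda> \<Theta> (g \<circ> f) y = pf_tr M \<Omega> \<Theta> g (pf_tr M \<Lambda> \<Omega> f y)"
  using pf_ax[THEN conjunct2, THEN conjunct2, THEN conjunct2, THEN conjunct1] by blast+

lemma res_two_iso: "two_iso \<Lambda> \<Omega> f g \<Longrightarrow> x \<in> pf_carrier M \<Omega> \<Longrightarrow> pf_res M \<Lambda> \<Omega> f x = pf_res M \<Lambda> \<Omega> g x"
  and tr_two_iso: "two_iso \<Lambda> \<Omega> f g \<Longrightarrow> y \<in> pf_carrier M \<Lambda> \<Longrightarrow> pf_tr M \<Lambda> \<Omega> f y = pf_tr M \<Lambda> \<Omega> g y"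
  using pf_ax[THEN conjunct2, THEN conjunct2, THEN conjunct2, THEN conjunct2, THEN conjunct1] by blast+

lemma tr_iso: "is_iso \<Lambda> \<Omega> f \<Longrightarrow> x \<in> pf_carrier M \<Lambda> \<Longrightarrow>
    pf_tr M \<Lambda> \<Omega> f x = pf_res M \<Omega> \<Lambda> (inv_into (pts \<Lambda>) f) x"
  using pf_ax[THEN conjunct2, THEN conjunct2, THEN conjunct2, THEN conjunct2, THEN conjunct2, THEN conjunct1] by blast

lemma double_coset: "\<Gamma> \<preceq> \<Omega> \<Longrightarrow> \<Lambda> \<preceq> \<Omega> \<Longrightarrow> x \<in> pf_carrier M \<Lambda> \<Longrightarrow>
    pf_res M \<Gamma> \<Omega> id (pf_tr M \<Lambda> \<Omega> id x) =
      (\<Oplus>\<^bsub>pf_val M \<Gamma>\<^esub> C \<in> dcosets \<Gamma> \<Omega> \<Lambda>. dcoset_summand M \<Gamma> \<Lambda> (dcoset_rep C) x)"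
  using pf_ax[THEN conjunct2, THEN conjunct2, THEN conjunct2, THEN conjunct2, THEN conjunct2, THEN conjunct2] by blast

lemma res_closed: "is_mor \<Lambda> \<Omega> f \<Longrightarrow> x \<in> pf_carrier M \<Omega> \<Longrightarrow> pf_res M \<Lambda> \<Omega> f x \<in> pf_carrier M \<Lambda>"
  and tr_closed: "is_mor \<Lambda> \<Omega> f \<Longrightarrow> y \<in> pf_carrier M \<Lambda> \<Longrightarrow> pf_tr M \<Lambda> \<Omega> f y \<in> pf_carrier M \<Omega>"
  by (simp_all add: add_hom_closed[OF res_hom] add_hom_closed[OF tr_hom])

end

section \<open>The quotients by the images of proper transfers\<close>

text \<open>The relation of \<Omega> can be recovered from its transport along an injective map, so
  an isomorphism keeps a proper refinement proper. This is why isomorphisms act on the quotients by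
  the images of proper transfers.\<close>

lemma strictly_refines_transport:
  assumes "\<Omega> \<prec> \<Gamma>" "is_iso \<Gamma> \<Gamma>' f"
  shows "transport f \<Omega> \<prec> \<Gamma>'" "is_iso \<Omega> (transport f \<Omega>) f"
proof -
  have r: "\<Omega> \<preceq> \<Gamma>" "\<Omega> \<noteq> \<Gamma>" using assms(1) by (auto simp: strictly_refines_def)
  note m = isoD(1)[OF assms(2)]
  show i: "is_iso \<Omega> (transport f \<Omega>) f" using mor_refines[OF m r(1)] mor_iso_transport by blast
  have "transport f \<Omega> \<noteq> \<Gamma>'"
  proof
    assume "transport f \<Omega> = \<Gamma>'"
    hence e: "transport f \<Omega> = transport f \<Gamma>" using isoD(2)[OF assms(2)] by simp
    have "rel \<Gamma> \<subseteq> rel \<Omega>"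
    proof clarify
      fix x y assume xy: "(x, y) \<in> rel \<Gamma>"
      hence p: "x \<in> pts \<Omega>" "y \<in> pts \<Omega>"
        using is_partitionD(2)[OF refinesD(2)[OF r(1)]] refinesD(3)[OF r(1)] by auto
      have "(f x, f y) \<in> rel (transport f \<Omega>)" using xy unfolding e by (auto simp: rel_transport)
      thus "(x, y) \<in> rel \<Omega>"
        using rel_transport_iff[OF refinesD(1)[OF r(1)] is_morD(4)[OF isoD(1)[OF i]] p] by blast
    qed
    hence "\<Gamma> \<preceq> \<Omega>" using r(1) by (simp add: refines_iff)
    thus False using refines_antisym r by blast
  qed
  moreover have "transport f \<Omega> \<preceq> \<Gamma>'"
    using mor_transport_refines[OF mor_refines[OF m r(1)]] .
  ultimately show "transport f \<Omega> \<prec> \<Gamma>'" by (simp add: strictly_refines_def)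
qed

lemma strictly_refinesD: "\<Omega> \<prec> \<Gamma> \<Longrightarrow> \<Omega> \<preceq> \<Gamma>" "\<Omega> \<prec> \<Gamma> \<Longrightarrow> is_mor \<Omega> \<Gamma> id"
  by (auto simp: strictly_refines_def refinesD)

lemma finsum_in_subgroup:
  assumes "abelian_group G" "additive_subgroup J G" "\<And>a. a \<in> A \<Longrightarrow> f a \<in> J"
  shows "finsum G f A \<in> J"
proof (cases "finite A")
  case True
  interpret G: abelian_group G by fact
  interpret J: additive_subgroup J G by fact
  show ?thesis using True assms(3)
  proof (induction A)
    case (insert a A)
    hence "f \<in> A \<rightarrow> carrier G" "f a \<in> carrier G" using J.a_subset by auto
    thus ?case using insert by (simp add: G.finsum_insert)
  qed simp
next
  case False
  thus ?thesis using assms(1) additive_subgroup.zero_closed[OF assms(2)]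
    by (simp add: abelian_monoid.finsum_infinite abelian_group_def)
qed

lemma zero_additive_subgroup: "abelian_group G \<Longrightarrow> additive_subgroup {\<zero>\<^bsub>G\<^esub>} G"
  by (intro additive_subgroupI) (metis abelian_group.a_group group.triv_subgroup monoid.simps(2) monoid_record_simps(2))

context part_functor begin

lemma tr_in_tr_ideal:
  assumes "\<Omega> \<prec> \<Gamma>" "y \<in> pf_carrier M \<Omega>"
  shows "pf_tr M \<Omega> \<Gamma> id y \<in> tr_ideal M \<Gamma>"
proof -
  have g: "abelian_group (pf_val M \<Gamma>)" using val_group refinesD strictly_refinesD assms(1) by blast
  \<comment> \<open>The ideal is defined by sums over all proper refinements at once; a single
    transfer is the family that is zero at every other refinement.\<close>
  define w where "w = (\<lambda>\<Omega>'. if \<Omega>' = \<Omega> then y else \<zero>\<^bsub>pf_val M \<Omega>'\<^esub>)"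
  have w: "w \<Omega>' \<in> pf_carrier M \<Omega>'" if "\<Omega>' \<prec> \<Gamma>" for \<Omega>'
    using abelian_groupE(2)[OF val_group] refinesD(1)[OF strictly_refinesD(1)[OF that]] assms(2)
    by (simp add: w_def)
  have "(\<Oplus>\<^bsub>pf_val M \<Gamma>\<^esub> \<Omega>' \<in> {\<Omega>. \<Omega> \<prec> \<Gamma>}. pf_tr M \<Omega>' \<Gamma> id (w \<Omega>'))
      = (\<Oplus>\<^bsub>pf_val M \<Gamma>\<^esub> \<Omega>' \<in> {\<Omega>. \<Omega> \<prec> \<Gamma>}.
          if \<Omega>' = \<Omega> then pf_tr M \<Omega> \<Gamma> id y else \<zero>\<^bsub>pf_val M \<Gamma>\<^esub>)"
  proof (rule finsum_cong_set[OF g refl])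
    fix \<Omega>' assume "\<Omega>' \<in> {\<Omega>. \<Omega> \<prec> \<Gamma>}"
    hence "\<Omega>' \<prec> \<Gamma>" by simp
    note o = strictly_refinesD[OF this]
    show "(if \<Omega>' = \<Omega> then pf_tr M \<Omega> \<Gamma> id y else \<zero>\<^bsub>pf_val M \<Gamma>\<^esub>) \<in> pf_carrier M \<Gamma>"
      using tr_closed strictly_refinesD(2)[OF assms(1)] assms(2) abelian_groupE(2)[OF g] by simp
    show "pf_tr M \<Omega>' \<Gamma> id (w \<Omega>') =
        (if \<Omega>' = \<Omega> then pf_tr M \<Omega> \<Gamma> id y else \<zero>\<^bsub>pf_val M \<Gamma>\<^esub>)"
      using add_hom_zero[OF val_group g tr_hom] o refinesD(1)[OF o(1)] by (simp add: w_def)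
  qed
  also have "\<dots> = pf_tr M \<Omega> \<Gamma> id y"
    using assms(1) tr_closed[OF strictly_refinesD(2)[OF assms(1)] assms(2)]
    by (intro finsum_single[OF g]) auto
  finally show ?thesis unfolding tr_ideal_def using w by (intro CollectI exI[of _ w]) auto
qed

text \<open>The elimination principle for the image of proper transfers: by additivity, a condition
  given by a subgroup needs to be checked on single transfers only. With the zero subgroup it lets
  homomorphisms descend to the quotient; with the image of transfer itself it yields the ideal
  property for partition rings.\<close>

lemma tr_ideal_map:
  assumes "is_partition \<Gamma>" "abelian_group H" "h \<in> add_hom (pf_val M \<Gamma>) H" "additive_subgroup J H"
    "\<And>\<Omega> y. \<Omega> \<prec> \<Gamma> \<Longrightarrow> y \<in> pf_carrier M \<Omega> \<Longrightarrow> h (pf_tr M \<Omega> \<Gamma> id y) \<in> J" "x \<in> tr_ideal M \<Gamma>"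
  shows "h x \<in> J"
proof -
  obtain y where y: "\<And>\<Omega>. \<Omega> \<prec> \<Gamma> \<Longrightarrow> y \<Omega> \<in> pf_carrier M \<Omega>"
    and x: "x = (\<Oplus>\<^bsub>pf_val M \<Gamma>\<^esub> \<Omega> \<in> {\<Omega>. \<Omega> \<prec> \<Gamma>}. pf_tr M \<Omega> \<Gamma> id (y \<Omega>))"
    using assms(6) unfolding tr_ideal_def by blast
  have "h x = (\<Oplus>\<^bsub>H\<^esub> \<Omega> \<in> {\<Omega>. \<Omega> \<prec> \<Gamma>}. h (pf_tr M \<Omega> \<Gamma> id (y \<Omega>)))"
    unfolding x by (intro add_hom_finsum[OF val_group[OF assms(1)] assms(2,3)])
      (auto intro: y tr_closed strictly_refinesD(2))
  also have "\<dots> \<in> J" using assms(5) y by (intro finsum_in_subgroup[OF assms(2,4)]) simp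
  finally show ?thesis .
qed

text \<open>Transfers are additive, so zero, negatives and sums can be formed in the families of
  arguments, one refinement at a time.\<close>

lemma tr_ideal_subgroup:
  assumes "is_partition \<Gamma>"
  shows "additive_subgroup (tr_ideal M \<Gamma>) (pf_val M \<Gamma>)"
proof -
  interpret G: abelian_group "pf_val M \<Gamma>" using val_group[OF assms] .
  let ?S = "{\<Omega>. \<Omega> \<prec> \<Gamma>}"
  have cl: "pf_tr M \<Omega> \<Gamma> id y \<in> pf_carrier M \<Gamma>" if "\<Omega> \<in> ?S" "y \<in> pf_carrier M \<Omega>" for \<Omega> y
    using that by (auto intro: tr_closed strictly_refinesD(2))
  have gr: "abelian_group (pf_val M \<Omega>)" if "\<Omega> \<in> ?S" for \<Omega>
    using that by (auto intro: val_group refinesD(1) strictly_refinesD(1))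
  have "subgroup (tr_ideal M \<Gamma>) (add_monoid (pf_val M \<Gamma>))"
  proof (rule group.subgroupI[OF G.a_group])
    show "tr_ideal M \<Gamma> \<subseteq> carrier (add_monoid (pf_val M \<Gamma>))"
      unfolding tr_ideal_def using cl by (auto intro!: G.finsum_closed)
    show "tr_ideal M \<Gamma> \<noteq> {}"
      unfolding tr_ideal_def using abelian_groupE(2)[OF gr]
      by (auto intro!: exI[of _ "\<lambda>\<Omega>. \<zero>\<^bsub>pf_val M \<Omega>\<^esub>"])
    fix a assume "a \<in> tr_ideal M \<Gamma>"
    then obtain y where y: "\<And>\<Omega>. \<Omega> \<in> ?S \<Longrightarrow> y \<Omega> \<in> pf_carrier M \<Omega>"
      and a: "a = (\<Oplus>\<^bsub>pf_val M \<Gamma>\<^esub> \<Omega> \<in> ?S. pf_tr M \<Omega> \<Gamma> id (y \<Omega>))" by (auto simp: tr_ideal_def)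
    have ny: "\<ominus>\<^bsub>pf_val M \<Omega>\<^esub> y \<Omega> \<in> pf_carrier M \<Omega>" if "\<Omega> \<in> ?S" for \<Omega>
      using abelian_group.a_inv_closed[OF gr[OF that] y[OF that]] .
    have "(\<lambda>x. \<ominus>\<^bsub>pf_val M \<Gamma>\<^esub> x) \<in> add_hom (pf_val M \<Gamma>) (pf_val M \<Gamma>)"
      by (intro add_homI) (auto simp: G.minus_add)
    hence "\<ominus>\<^bsub>pf_val M \<Gamma>\<^esub> a = (\<Oplus>\<^bsub>pf_val M \<Gamma>\<^esub> \<Omega> \<in> ?S. \<ominus>\<^bsub>pf_val M \<Gamma>\<^esub> pf_tr M \<Omega> \<Gamma> id (y \<Omega>))"
      unfolding a using cl y by (intro add_hom_finsum[OF G.abelian_group_axioms G.abelian_group_axioms]) auto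
    also have "\<dots> = (\<Oplus>\<^bsub>pf_val M \<Gamma>\<^esub> \<Omega> \<in> ?S. pf_tr M \<Omega> \<Gamma> id (\<ominus>\<^bsub>pf_val M \<Omega>\<^esub> y \<Omega>))"
    proof (rule finsum_cong_set[OF G.abelian_group_axioms refl])
      fix \<Omega> assume S: "\<Omega> \<in> ?S"
      show "pf_tr M \<Omega> \<Gamma> id (\<ominus>\<^bsub>pf_val M \<Omega>\<^esub> y \<Omega>) \<in> pf_carrier M \<Gamma>" using cl[OF S ny[OF S]] .
      have "pf_tr M \<Omega> \<Gamma> id \<in> add_hom (pf_val M \<Omega>) (pf_val M \<Gamma>)" using S tr_hom[OF strictly_refinesD(2)] by blast
      from abelian_group_hom.hom_a_inv[OF add_hom_group_hom[OF gr[OF S] G.abelian_group_axioms this] y[OF S]]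
      show "\<ominus>\<^bsub>pf_val M \<Gamma>\<^esub> pf_tr M \<Omega> \<Gamma> id (y \<Omega>) = pf_tr M \<Omega> \<Gamma> id (\<ominus>\<^bsub>pf_val M \<Omega>\<^esub> y \<Omega>)" by simp
    qed
    finally have "\<ominus>\<^bsub>pf_val M \<Gamma>\<^esub> a \<in> tr_ideal M \<Gamma>"
      unfolding tr_ideal_def using ny by (intro CollectI exI[of _ "\<lambda>\<Omega>. \<ominus>\<^bsub>pf_val M \<Omega>\<^esub> y \<Omega>"]) auto
    thus "inv\<^bsub>add_monoid (pf_val M \<Gamma>)\<^esub> a \<in> tr_ideal M \<Gamma>" by (simp add: a_inv_def)
    fix b assume "b \<in> tr_ideal M \<Gamma>"
    then obtain z where z: "\<And>\<Omega>. \<Omega> \<in> ?S \<Longrightarrow> z \<Omega> \<in> pf_carrier M \<Omega>"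
      and b: "b = (\<Oplus>\<^bsub>pf_val M \<Gamma>\<^esub> \<Omega> \<in> ?S. pf_tr M \<Omega> \<Gamma> id (z \<Omega>))" by (auto simp: tr_ideal_def)
    have yz: "y \<Omega> \<oplus>\<^bsub>pf_val M \<Omega>\<^esub> z \<Omega> \<in> pf_carrier M \<Omega>" if "\<Omega> \<in> ?S" for \<Omega>
      using abelian_groupE(1)[OF gr[OF that] y[OF that] z[OF that]] .
    have "a \<oplus>\<^bsub>pf_val M \<Gamma>\<^esub> b = (\<Oplus>\<^bsub>pf_val M \<Gamma>\<^esub> \<Omega> \<in> ?S.
        pf_tr M \<Omega> \<Gamma> id (y \<Omega>) \<oplus>\<^bsub>pf_val M \<Gamma>\<^esub> pf_tr M \<Omega> \<Gamma> id (z \<Omega>))"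
      unfolding a b using cl y z by (intro G.finsum_addf[symmetric]) auto
    also have "\<dots> = (\<Oplus>\<^bsub>pf_val M \<Gamma>\<^esub> \<Omega> \<in> ?S. pf_tr M \<Omega> \<Gamma> id (y \<Omega> \<oplus>\<^bsub>pf_val M \<Omega>\<^esub> z \<Omega>))"
    proof (rule finsum_cong_set[OF G.abelian_group_axioms refl])
      fix \<Omega> assume S: "\<Omega> \<in> ?S"
      show "pf_tr M \<Omega> \<Gamma> id (y \<Omega> \<oplus>\<^bsub>pf_val M \<Omega>\<^esub> z \<Omega>) \<in> pf_carrier M \<Gamma>" using cl[OF S yz[OF S]] .
      have "pf_tr M \<Omega> \<Gamma> id \<in> add_hom (pf_val M \<Omega>) (pf_val M \<Gamma>)" using S tr_hom[OF strictly_refinesD(2)] by blast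
      from add_hom_add[OF this y[OF S] z[OF S]]
      show "pf_tr M \<Omega> \<Gamma> id (y \<Omega>) \<oplus>\<^bsub>pf_val M \<Gamma>\<^esub> pf_tr M \<Omega> \<Gamma> id (z \<Omega>) =
        pf_tr M \<Omega> \<Gamma> id (y \<Omega> \<oplus>\<^bsub>pf_val M \<Omega>\<^esub> z \<Omega>)" by simp
    qed
    finally have "a \<oplus>\<^bsub>pf_val M \<Gamma>\<^esub> b \<in> tr_ideal M \<Gamma>"
      unfolding tr_ideal_def using yz by (intro CollectI exI[of _ "\<lambda>\<Omega>. y \<Omega> \<oplus>\<^bsub>pf_val M \<Omega>\<^esub> z \<Omega>"]) auto
    thus "a \<otimes>\<^bsub>add_monoid (pf_val M \<Gamma>)\<^esub> b \<in> tr_ideal M \<Gamma>" by simp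
  qed
  thus ?thesis by (rule additive_subgroupI)
qed

section \<open>The quotient groups and the maps out of them\<close>

lemma tr_ideal_abelian_subgroup:
  "is_partition \<Gamma> \<Longrightarrow> abelian_subgroup (tr_ideal M \<Gamma>) (pf_val M \<Gamma>)"
  using abelian_subgroupI3 tr_ideal_subgroup val_group by blast

text \<open>The cosets and their addition in the quotient ring record involve only the additive
  structure, so its additive monoid is the usual quotient group even when the multiplication carries
  no meaning.\<close>

lemma bar_group:
  assumes "is_partition \<Gamma>"
  shows "abelian_group (bar M \<Gamma>)"
proof -
  have "add_monoid (bar M \<Gamma>) = pf_val M \<Gamma> A_Mod tr_ideal M \<Gamma>"
    by (simp add: bar_def FactRing_def A_FactGroup_def')
  thus ?thesis
    using abelian_subgroup.a_factorgroup_is_comm_group[OF tr_ideal_abelian_subgroup[OF assms]]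
    by (intro comm_group_abelian_groupI) simp
qed

lemma carrier_bar: "carrier (bar M \<Gamma>) = qmap M \<Gamma> ` pf_carrier M \<Gamma>"
  by (auto simp: bar_def FactRing_def A_RCOSETS_defs qmap_def a_r_coset_def)

lemma qmap_hom:
  assumes "is_partition \<Gamma>"
  shows "qmap M \<Gamma> \<in> add_hom (pf_val M \<Gamma>) (bar M \<Gamma>)"
proof (rule add_homI)
  fix x y assume "x \<in> pf_carrier M \<Gamma>" "y \<in> pf_carrier M \<Gamma>"
  thus "qmap M \<Gamma> (x \<oplus>\<^bsub>pf_val M \<Gamma>\<^esub> y) = qmap M \<Gamma> x \<oplus>\<^bsub>bar M \<Gamma>\<^esub> qmap M \<Gamma> y"
    using abelian_subgroup.a_rcos_sum[OF tr_ideal_abelian_subgroup[OF assms]]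
    by (simp add: qmap_def bar_def FactRing_def)
qed (auto simp: carrier_bar)

lemma qmap_closed: "x \<in> pf_carrier M \<Gamma> \<Longrightarrow> qmap M \<Gamma> x \<in> carrier (bar M \<Gamma>)"
  by (simp add: carrier_bar)

lemma bar_cases:
  assumes "y \<in> carrier (bar M \<Gamma>)"
  obtains x where "x \<in> pf_carrier M \<Gamma>" "y = qmap M \<Gamma> x"
  using assms carrier_bar by blast

lemma qmap_self: "is_partition \<Gamma> \<Longrightarrow> x \<in> pf_carrier M \<Gamma> \<Longrightarrow> x \<in> qmap M \<Gamma> x"
  unfolding qmap_def by (rule abelian_subgroup.a_rcos_self[OF tr_ideal_abelian_subgroup])

lemma qmap_ideal:
  assumes "is_partition \<Gamma>" "x \<in> tr_ideal M \<Gamma>"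
  shows "qmap M \<Gamma> x = \<zero>\<^bsub>bar M \<Gamma>\<^esub>"
  unfolding qmap_def bar_def FactRing_def
  using abelian_subgroup.a_rcos_const[OF tr_ideal_abelian_subgroup[OF assms(1)] assms(2)] by simp

lemma qmap_mem:
  assumes "is_partition \<Gamma>" "x \<in> pf_carrier M \<Gamma>" "x' \<in> qmap M \<Gamma> x"
  obtains i where "i \<in> tr_ideal M \<Gamma>" "x' = i \<oplus>\<^bsub>pf_val M \<Gamma>\<^esub> x"
  using assms(3) unfolding qmap_def a_r_coset_def r_coset_def by auto

lemma qmap_tr:
  "\<Omega> \<prec> \<Gamma> \<Longrightarrow> y \<in> pf_carrier M \<Omega> \<Longrightarrow> qmap M \<Gamma> (pf_tr M \<Omega> \<Gamma> id y) = \<zero>\<^bsub>bar M \<Gamma>\<^esub>"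
  using qmap_ideal tr_in_tr_ideal strictly_refinesD(1) refinesD(2) by blast

lemma qmap_subset:
  assumes "is_partition \<Gamma>" "x \<in> pf_carrier M \<Gamma>"
  shows "qmap M \<Gamma> x \<subseteq> pf_carrier M \<Gamma>"
  unfolding qmap_def
  using abelian_monoid.a_r_coset_subset_G[OF abelian_group.axioms(1)[OF val_group[OF assms(1)]]]
    additive_subgroup.a_subset[OF tr_ideal_subgroup[OF assms(1)]] assms(2) by blast

lemma qmap_const:
  assumes "is_partition \<Gamma>" "abelian_group H" "h \<in> add_hom (pf_val M \<Gamma>) H"
    "\<And>\<Omega> y. \<Omega> \<prec> \<Gamma> \<Longrightarrow> y \<in> pf_carrier M \<Omega> \<Longrightarrow> h (pf_tr M \<Omega> \<Gamma> id y) = \<zero>\<^bsub>H\<^esub>" "x \<in> pf_carrier M \<Gamma>"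
    "x' \<in> qmap M \<Gamma> x"
  shows "h x' = h x"
proof -
  interpret H: abelian_group H by fact
  from qmap_mem[OF assms(1,5,6)] obtain i
    where i: "i \<in> tr_ideal M \<Gamma>" "x' = i \<oplus>\<^bsub>pf_val M \<Gamma>\<^esub> x" by blast
  have "h i \<in> {\<zero>\<^bsub>H\<^esub>}"
    using tr_ideal_map[OF assms(1-3) zero_additive_subgroup[OF assms(2)]] assms(4) i(1) by blast
  moreover have "i \<in> pf_carrier M \<Gamma>"
    using additive_subgroup.a_subset[OF tr_ideal_subgroup[OF assms(1)]] i(1) by blast
  ultimately show ?thesis
    using add_hom_add[OF assms(3)] assms(5) add_hom_closed[OF assms(3,5)] i(2) by simp
qed

text \<open>The universal property of the quotient in the form required by \<open>induced\<close>:
  \<open>h\<close> is constant on the coset because elements of a coset differ by something that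
  \<open>h\<close> kills, and the coset contains \<open>x\<close>, so its image is a singleton.
  Transfers along isomorphisms, maps induced by morphisms and the projections used by \<mu> are all
  evaluated on representatives in this way.\<close>

lemma induced_qmap:
  assumes "is_partition \<Gamma>" "abelian_group H" "h \<in> add_hom (pf_val M \<Gamma>) H"
    "\<And>\<Omega> y. \<Omega> \<prec> \<Gamma> \<Longrightarrow> y \<in> pf_carrier M \<Omega> \<Longrightarrow> h (pf_tr M \<Omega> \<Gamma> id y) = \<zero>\<^bsub>H\<^esub>" "x \<in> pf_carrier M \<Gamma>"
  shows "induced h (qmap M \<Gamma> x) = h x"
proof -
  have "h ` qmap M \<Gamma> x = {h x}" using qmap_const[OF assms] qmap_self[OF assms(1,5)] by blast
  thus ?thesis by (simp add: induced_def)
qed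

lemma induced_hom:
  assumes "is_partition \<Gamma>" "abelian_group H" "h \<in> add_hom (pf_val M \<Gamma>) H"
    "\<And>\<Omega> y. \<Omega> \<prec> \<Gamma> \<Longrightarrow> y \<in> pf_carrier M \<Omega> \<Longrightarrow> h (pf_tr M \<Omega> \<Gamma> id y) = \<zero>\<^bsub>H\<^esub>"
  shows "induced h \<in> add_hom (bar M \<Gamma>) H"
proof (rule add_homI)
  fix a assume "a \<in> carrier (bar M \<Gamma>)"
  then obtain x where x: "x \<in> pf_carrier M \<Gamma>" "a = qmap M \<Gamma> x" by (rule bar_cases)
  show "induced h a \<in> carrier H"
    using x induced_qmap[OF assms] add_hom_closed[OF assms(3)] by simp
  fix b assume "b \<in> carrier (bar M \<Gamma>)"
  then obtain y where y: "y \<in> pf_carrier M \<Gamma>" "b = qmap M \<Gamma> y" by (rule bar_cases)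
  have "x \<oplus>\<^bsub>pf_val M \<Gamma>\<^esub> y \<in> pf_carrier M \<Gamma>" using abelian_groupE(1)[OF val_group[OF assms(1)] x(1) y(1)] .
  thus "induced h (a \<oplus>\<^bsub>bar M \<Gamma>\<^esub> b) = induced h a \<oplus>\<^bsub>H\<^esub> induced h b"
    using x y induced_qmap[OF assms] add_hom_add[OF assms(3)]
      add_hom_add[OF qmap_hom[OF assms(1)] x(1) y(1), symmetric] by simp
qed

text \<open>Following the refinement \<Omega> < \<Gamma> by the isomorphism \<open>f\<close> is the
  same as first applying the restricted isomorphism and then the refinement f \<Omega> < \<Gamma>'.
  Thus transfer along \<open>f\<close> maps proper transfers to proper transfers and factors through
  the quotients.\<close>

lemma
  assumes "is_iso \<Gamma> \<Gamma>' f"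
  shows bar_tr_qmap: "x \<in> pf_carrier M \<Gamma> \<Longrightarrow> bar_tr M \<Gamma> \<Gamma>' f (qmap M \<Gamma> x) = qmap M \<Gamma>' (pf_tr M \<Gamma> \<Gamma>' f x)"
  and bar_tr_hom: "bar_tr M \<Gamma> \<Gamma>' f \<in> add_hom (bar M \<Gamma>) (bar M \<Gamma>')"
proof -
  note m = isoD(1)[OF assms(1)]
  note p = is_morD(1)[OF m] and p' = is_morD(2)[OF m]
  have h: "(\<lambda>x. qmap M \<Gamma>' (pf_tr M \<Gamma> \<Gamma>' f x)) \<in> add_hom (pf_val M \<Gamma>) (bar M \<Gamma>')"
    using add_hom_comp[OF tr_hom[OF m] qmap_hom[OF p']] .
  have z: "qmap M \<Gamma>' (pf_tr M \<Gamma> \<Gamma>' f (pf_tr M \<Omega> \<Gamma> id y)) = \<zero>\<^bsub>bar M \<Gamma>'\<^esub>"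
    if "\<Omega> \<prec> \<Gamma>" "y \<in> pf_carrier M \<Omega>" for \<Omega> y
  proof -
    note t = strictly_refines_transport[OF that(1) assms(1)]
    have "pf_tr M \<Gamma> \<Gamma>' f (pf_tr M \<Omega> \<Gamma> id y) = pf_tr M \<Omega> \<Gamma>' (f \<circ> id) y"
      using tr_comp[OF strictly_refinesD(2)[OF that(1)] m that(2)] by simp
    also have "\<dots> = pf_tr M \<Omega> \<Gamma>' (id \<circ> f) y" by simp
    also have "\<dots> = pf_tr M (transport f \<Omega>) \<Gamma>' id (pf_tr M \<Omega> (transport f \<Omega>) f y)"
      using tr_comp[OF isoD(1)[OF t(2)] strictly_refinesD(2)[OF t(1)] that(2)] .
    finally show ?thesis
      using qmap_tr[OF t(1)] tr_closed[OF isoD(1)[OF t(2)] that(2)] by simp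
  qed
  show "x \<in> pf_carrier M \<Gamma> \<Longrightarrow> bar_tr M \<Gamma> \<Gamma>' f (qmap M \<Gamma> x) = qmap M \<Gamma>' (pf_tr M \<Gamma> \<Gamma>' f x)"
    unfolding bar_tr_def using induced_qmap[OF p bar_group[OF p'] h z] .
  show "bar_tr M \<Gamma> \<Gamma>' f \<in> add_hom (bar M \<Gamma>) (bar M \<Gamma>')"
    unfolding bar_tr_def using induced_hom[OF p bar_group[OF p'] h z] .
qed

lemma bar_tr_closed:
  "is_iso \<Gamma> \<Gamma>' f \<Longrightarrow> y \<in> carrier (bar M \<Gamma>) \<Longrightarrow> bar_tr M \<Gamma> \<Gamma>' f y \<in> carrier (bar M \<Gamma>')"
  using bar_tr_qmap qmap_closed tr_closed isoD(1) by (metis bar_cases)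

lemma bar_tr_id:
  assumes "is_partition \<Gamma>" "y \<in> carrier (bar M \<Gamma>)"
  shows "bar_tr M \<Gamma> \<Gamma> id y = y"
  using assms(2) by (rule bar_cases) (simp add: bar_tr_qmap iso_id assms(1) tr_id)

lemma bar_tr_comp:
  assumes "is_iso \<Gamma> \<Gamma>' f" "is_iso \<Gamma>' \<Gamma>'' g" "y \<in> carrier (bar M \<Gamma>)"
  shows "bar_tr M \<Gamma> \<Gamma>'' (g \<circ> f) y = bar_tr M \<Gamma>' \<Gamma>'' g (bar_tr M \<Gamma> \<Gamma>' f y)"
  using assms(3) by (rule bar_cases)
    (simp add: bar_tr_qmap assms iso_comp[OF assms(1,2)] tr_comp[OF isoD(1)[OF assms(1)] isoD(1)[OF assms(2)]]
      tr_closed isoD(1)[OF assms(1)])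

lemma bar_tr_two_iso:
  assumes "two_iso \<Gamma> \<Gamma>' f g" "is_iso \<Gamma> \<Gamma>' f" "is_iso \<Gamma> \<Gamma>' g" "y \<in> carrier (bar M \<Gamma>)"
  shows "bar_tr M \<Gamma> \<Gamma>' f y = bar_tr M \<Gamma> \<Gamma>' g y"
  using assms(4) by (rule bar_cases) (simp add: bar_tr_qmap assms tr_two_iso[OF assms(1)])

lemma bar_tr_cong:
  assumes "is_iso \<Gamma> \<Gamma>' f" "\<And>x. x \<in> pts \<Gamma> \<Longrightarrow> f x = g x" "y \<in> carrier (bar M \<Gamma>)"
  shows "bar_tr M \<Gamma> \<Gamma>' f y = bar_tr M \<Gamma> \<Gamma>' g y"
  using bar_tr_two_iso[OF two_iso_cong[OF isoD(1)[OF assms(1)] assms(2)] assms(1) iso_cong[OF assms(1,2)] assms(3)] .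

lemma bar_tr_inv:
  assumes "is_iso \<Gamma> \<Gamma>' f"
  shows "y \<in> carrier (bar M \<Gamma>) \<Longrightarrow> bar_tr M \<Gamma>' \<Gamma> (inv_into (pts \<Gamma>) f) (bar_tr M \<Gamma> \<Gamma>' f y) = y"
    and "z \<in> carrier (bar M \<Gamma>') \<Longrightarrow> bar_tr M \<Gamma> \<Gamma>' f (bar_tr M \<Gamma>' \<Gamma> (inv_into (pts \<Gamma>) f) z) = z"
proof -
  note i = iso_inv[OF assms] and m = isoD(1)[OF assms]
  assume y: "y \<in> carrier (bar M \<Gamma>)"
  have "bar_tr M \<Gamma>' \<Gamma> (inv_into (pts \<Gamma>) f) (bar_tr M \<Gamma> \<Gamma>' f y) = bar_tr M \<Gamma> \<Gamma> (inv_into (pts \<Gamma>) f \<circ> f) y"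
    using bar_tr_comp[OF assms i y] by simp
  also have "\<dots> = bar_tr M \<Gamma> \<Gamma> id y"
    using mor_inv_into(2)[OF m] by (intro bar_tr_cong[OF iso_comp[OF assms i] _ y]) simp
  finally show "bar_tr M \<Gamma>' \<Gamma> (inv_into (pts \<Gamma>) f) (bar_tr M \<Gamma> \<Gamma>' f y) = y"
    using bar_tr_id[OF is_morD(1)[OF m] y] by simp
next
  note i = iso_inv[OF assms] and m = isoD(1)[OF assms]
  assume z: "z \<in> carrier (bar M \<Gamma>')"
  have "bar_tr M \<Gamma> \<Gamma>' f (bar_tr M \<Gamma>' \<Gamma> (inv_into (pts \<Gamma>) f) z) = bar_tr M \<Gamma>' \<Gamma>' (f \<circ> inv_into (pts \<Gamma>) f) z"
    using bar_tr_comp[OF i assms z] by simp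
  also have "\<dots> = bar_tr M \<Gamma>' \<Gamma>' id z"
    using mor_inv_into(3)[OF m] by (intro bar_tr_cong[OF iso_comp[OF i assms] _ z]) simp
  finally show "bar_tr M \<Gamma> \<Gamma>' f (bar_tr M \<Gamma>' \<Gamma> (inv_into (pts \<Gamma>) f) z) = z"
    using bar_tr_id[OF is_morD(2)[OF m] z] by simp
qed

text \<open>Restriction in PD is defined with the set-theoretic inverse of an isomorphism of groups.
  Functoriality turns that inverse into the transfer along the inverse isomorphism, which can be
  composed with other transfers.\<close>

lemma inv_into_bar_tr:
  assumes "is_iso \<Gamma> \<Gamma>' f" "z \<in> carrier (bar M \<Gamma>')"
  shows "inv_into (carrier (bar M \<Gamma>)) (bar_tr M \<Gamma> \<Gamma>' f) z = bar_tr M \<Gamma>' \<Gamma> (inv_into (pts \<Gamma>) f) z"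
proof (rule inv_into_f_eq)
  show "inj_on (bar_tr M \<Gamma> \<Gamma>' f) (carrier (bar M \<Gamma>))"
    by (rule inj_on_inverseI[of _ "bar_tr M \<Gamma>' \<Gamma> (inv_into (pts \<Gamma>) f)"]) (rule bar_tr_inv(1)[OF assms(1)])
qed (use bar_tr_inv(2)[OF assms(1)] bar_tr_closed[OF iso_inv[OF assms(1)]] assms(2) in auto)

end

section \<open>Sums over classes\<close>

text \<open>The sum of \<open>v\<close> over the fibres of \<open>\<kappa>\<close> on \<open>L\<close>, for \<open>v\<close> constant on these fibres.\<close>

definition class_sum :: "'b ring \<Rightarrow> ('l \<Rightarrow> 'c) \<Rightarrow> 'l set \<Rightarrow> ('l \<Rightarrow> 'b) \<Rightarrow> 'b" where
  "class_sum G \<kappa> L v = (\<Oplus>\<^bsub>G\<^esub> c \<in> \<kappa> ` L. v (inv_into L \<kappa> c))"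

lemma
  shows class_rep_mem [simp]: "l \<in> L \<Longrightarrow> inv_into L \<kappa> (\<kappa> l) \<in> L"
    and class_rep_eq: "l \<in> L \<Longrightarrow> \<kappa> (inv_into L \<kappa> (\<kappa> l)) = \<kappa> l"
  by (auto intro: inv_into_into f_inv_into_f)

text \<open>Singleton classes make an ordinary sum, such as one over double cosets, comparable with
  the sums over classes of lifts.\<close>

lemma finsum_class_sum:
  assumes "abelian_group G" "\<And>l. l \<in> L \<Longrightarrow> v l \<in> carrier G"
  shows "finsum G v L = class_sum G id L v"
  unfolding class_sum_def using assms(2) inv_into_f_f[of id L]
  by (intro finsum_cong_set[OF assms(1)]) (auto simp: inv_into_into)

lemma class_sum_closed:
  assumes "abelian_group G" "\<And>l. l \<in> L \<Longrightarrow> v l \<in> carrier G"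
  shows "class_sum G \<kappa> L v \<in> carrier G"
  unfolding class_sum_def using assms(2) by (intro finsum_mem[OF assms(1)]) auto

lemma class_sum_cong:
  assumes "abelian_group G" "\<And>l. l \<in> L \<Longrightarrow> v l = w l" "\<And>l. l \<in> L \<Longrightarrow> w l \<in> carrier G"
  shows "class_sum G \<kappa> L v = class_sum G \<kappa> L w"
  unfolding class_sum_def using assms(2,3) by (intro finsum_cong_set[OF assms(1)]) auto

lemma class_sum_hom:
  assumes "abelian_group G" "abelian_group H" "h \<in> add_hom G H" "\<And>l. l \<in> L \<Longrightarrow> v l \<in> carrier G"
  shows "h (class_sum G \<kappa> L v) = class_sum H \<kappa> L (\<lambda>l. h (v l))"
  unfolding class_sum_def using assms(4) by (intro add_hom_finsum[OF assms(1-3)]) auto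

lemma class_sum_add:
  assumes "abelian_group G" "\<And>l. l \<in> L \<Longrightarrow> v l \<in> carrier G" "\<And>l. l \<in> L \<Longrightarrow> w l \<in> carrier G"
  shows "class_sum G \<kappa> L (\<lambda>l. v l \<oplus>\<^bsub>G\<^esub> w l) = class_sum G \<kappa> L v \<oplus>\<^bsub>G\<^esub> class_sum G \<kappa> L w"
proof -
  interpret abelian_group G by fact
  show ?thesis
    unfolding class_sum_def using assms(2,3) by (intro finsum_addf) auto
qed

text \<open>Only the induced map on classes has to be bijective. The representative chosen in a
  class of \<open>L'\<close> may differ from the image under \<open>F\<close> of the one chosen in
  \<open>L\<close>; the invariance of \<open>v'\<close> on classes bridges this difference.\<close>

lemma class_sum_bij:
  assumes "abelian_group G"
    "\<And>l. l \<in> L \<Longrightarrow> F l \<in> L'"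
    "\<And>l m. l \<in> L \<Longrightarrow> m \<in> L \<Longrightarrow> \<kappa> l = \<kappa> m \<Longrightarrow> \<kappa>' (F l) = \<kappa>' (F m)"
    "\<And>l m. l \<in> L \<Longrightarrow> m \<in> L \<Longrightarrow> \<kappa>' (F l) = \<kappa>' (F m) \<Longrightarrow> \<kappa> l = \<kappa> m"
    "\<And>l'. l' \<in> L' \<Longrightarrow> \<exists>l \<in> L. \<kappa>' (F l) = \<kappa>' l'"
    "\<And>l. l \<in> L \<Longrightarrow> v l = v' (F l)"
    "\<And>l m. l \<in> L' \<Longrightarrow> m \<in> L' \<Longrightarrow> \<kappa>' l = \<kappa>' m \<Longrightarrow> v' l = v' m"
    "\<And>l. l \<in> L' \<Longrightarrow> v' l \<in> carrier G"
  shows "class_sum G \<kappa> L v = class_sum G \<kappa>' L' v'"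
proof -
  define \<phi> where "\<phi> c = \<kappa>' (F (inv_into L \<kappa> c))" for c
  have i: "inv_into L \<kappa> (\<kappa> l) \<in> L" "\<kappa> (inv_into L \<kappa> (\<kappa> l)) = \<kappa> l" if "l \<in> L" for l
    using that by (auto intro: inv_into_into f_inv_into_f)
  have i': "inv_into L' \<kappa>' (\<kappa>' l) \<in> L'" "\<kappa>' (inv_into L' \<kappa>' (\<kappa>' l)) = \<kappa>' l" if "l \<in> L'" for l
    using that by (auto intro: inv_into_into f_inv_into_f)
  have \<phi>: "\<phi> (\<kappa> l) = \<kappa>' (F l)" if "l \<in> L" for l
    unfolding \<phi>_def using assms(3) i[OF that] that by blast
  have "bij_betw \<phi> (\<kappa> ` L) (\<kappa>' ` L')"
  proof (rule bij_betw_imageI)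
    show "inj_on \<phi> (\<kappa> ` L)" using \<phi> assms(4) by (intro inj_onI) (metis imageE)
    show "\<phi> ` \<kappa> ` L = \<kappa>' ` L'"
    proof
      show "\<phi> ` \<kappa> ` L \<subseteq> \<kappa>' ` L'" using \<phi> assms(2) by auto
      show "\<kappa>' ` L' \<subseteq> \<phi> ` \<kappa> ` L"
      proof clarify
        fix l' assume "l' \<in> L'"
        then obtain l where "l \<in> L" "\<kappa>' (F l) = \<kappa>' l'" using assms(5) by blast
        thus "\<kappa>' l' \<in> \<phi> ` \<kappa> ` L" using \<phi> by (metis imageI)
      qed
    qed
  qed
  thus ?thesis unfolding class_sum_def
  proof (rule finsum_bij[OF assms(1)])
    show "v' (inv_into L' \<kappa>' c) \<in> carrier G" if "c \<in> \<kappa>' ` L'" for c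
      using that i' assms(8) by blast
    show "v (inv_into L \<kappa> c) = v' (inv_into L' \<kappa>' (\<phi> c))" if c: "c \<in> \<kappa> ` L" for c
    proof -
      from c obtain l where l: "l \<in> L" "c = \<kappa> l" by blast
      have "v (inv_into L \<kappa> c) = v' (F (inv_into L \<kappa> c))" using assms(6) i l by simp
      also have "\<dots> = v' (inv_into L' \<kappa>' (\<kappa>' (F (inv_into L \<kappa> c))))"
        using assms(2,7) i i' l by metis
      finally show ?thesis by (simp add: \<phi>_def)
    qed
  qed
qed

text \<open>A Fubini rule: the classes in \<open>L\<close> are distributed according to the class of
  \<open>P l\<close>, which is well defined on classes. A class of \<open>L'\<close> that is not hit
  has an empty fibre and contributes zero.\<close>

lemma class_sum_fibres:
  assumes "abelian_group G" "finite (\<kappa>' ` L')" "finite (\<kappa> ` L)"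
    "\<And>l. l \<in> L \<Longrightarrow> P l \<in> L'"
    "\<And>l m. l \<in> L \<Longrightarrow> m \<in> L \<Longrightarrow> \<kappa> l = \<kappa> m \<Longrightarrow> \<kappa>' (P l) = \<kappa>' (P m)"
    "\<And>l m. l \<in> L \<Longrightarrow> m \<in> L \<Longrightarrow> \<kappa> l = \<kappa> m \<Longrightarrow> v l = v m"
    "\<And>l. l \<in> L \<Longrightarrow> v l \<in> carrier G"
  shows "class_sum G \<kappa> L v = class_sum G \<kappa>' L' (\<lambda>m. class_sum G \<kappa> {l \<in> L. \<kappa>' (P l) = \<kappa>' m} v)"
proof -
  let ?A = "\<lambda>d. {l \<in> L. \<kappa>' (P l) = d}"
  define g where "g c = v (inv_into L \<kappa> c)" for c
  have i: "inv_into L \<kappa> (\<kappa> l) \<in> L" "\<kappa> (inv_into L \<kappa> (\<kappa> l)) = \<kappa> l" if "l \<in> L" for l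
    using that by (auto intro: inv_into_into f_inv_into_f)
  have g: "g (\<kappa> l) = v l" if "l \<in> L" for l unfolding g_def using assms(6) i that by blast
  have un: "\<kappa> ` L = (\<Union>d \<in> \<kappa>' ` L'. \<kappa> ` ?A d)" using assms(4) by blast
  \<comment> \<open>The representative chosen inside a fibre need not be the one chosen in the whole
    of \<open>L\<close>, so both values are replaced by the function \<open>g\<close> of the
    class.\<close>
  have eq: "class_sum G \<kappa> (?A d) v = finsum G g (\<kappa> ` ?A d)" for d
    unfolding class_sum_def
  proof (rule finsum_cong_set[OF assms(1) refl])
    fix c assume "c \<in> \<kappa> ` ?A d"
    then obtain l where l: "l \<in> ?A d" "c = \<kappa> l" by blast
    hence j: "inv_into (?A d) \<kappa> c \<in> ?A d" "\<kappa> (inv_into (?A d) \<kappa> c) = c"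
      using class_rep_mem[OF l(1), of \<kappa>] class_rep_eq[OF l(1), of \<kappa>] by blast+
    show "g c \<in> carrier G" using l g assms(7) by auto
    show "v (inv_into (?A d) \<kappa> c) = g c" using j g by (metis (lifting) mem_Collect_eq)
  qed
  have "class_sum G \<kappa> L v = finsum G g (\<kappa> ` L)" by (simp add: class_sum_def g_def[abs_def])
  also have "\<dots> = (\<Oplus>\<^bsub>G\<^esub> d \<in> \<kappa>' ` L'. finsum G g (\<kappa> ` ?A d))" unfolding un
  proof (rule finsum_UN_disjoint[OF assms(1,2)])
    show "finite (\<kappa> ` ?A d)" for d using assms(3) by (rule finite_subset[rotated]) auto
    show "d = d'" if "x \<in> \<kappa> ` ?A d" "x \<in> \<kappa> ` ?A d'" for d d' x using that assms(5) by auto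
    show "g x \<in> carrier G" if "x \<in> \<kappa> ` ?A d" for d x using that g assms(7) by auto
  qed
  also have "\<dots> = class_sum G \<kappa>' L' (\<lambda>m. class_sum G \<kappa> (?A (\<kappa>' m)) v)"
    unfolding class_sum_def[of G \<kappa>' L']
  proof (rule finsum_cong_set[OF assms(1) refl])
    fix d assume d: "d \<in> \<kappa>' ` L'"
    hence "\<kappa>' (inv_into L' \<kappa>' d) = d" by (rule f_inv_into_f)
    thus "finsum G g (\<kappa> ` ?A d) = class_sum G \<kappa> (?A (\<kappa>' (inv_into L' \<kappa>' d))) v" by (simp add: eq)
    show "class_sum G \<kappa> (?A (\<kappa>' (inv_into L' \<kappa>' d))) v \<in> carrier G"
      using assms(7) by (intro class_sum_closed[OF assms(1)]) auto
  qed
  finally show ?thesis .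
qed

lemma class_sum_single:
  assumes "abelian_group G" "l \<in> L" "\<And>m. m \<in> L \<Longrightarrow> \<kappa> m = \<kappa> l" "\<And>m. m \<in> L \<Longrightarrow> v m = v l" "v l \<in> carrier G"
  shows "class_sum G \<kappa> L v = v l"
proof -
  interpret abelian_group G by fact
  have 1: "\<kappa> ` L = {\<kappa> l}" using assms(2,3) by blast
  have 2: "v (inv_into L \<kappa> (\<kappa> l)) = v l" by (rule assms(4)) (simp add: assms(2))
  show ?thesis unfolding class_sum_def 1 using 2 assms(5) by simp
qed

lemma class_sum_empty: "abelian_group G \<Longrightarrow> class_sum G \<kappa> {} v = \<zero>\<^bsub>G\<^esub>"
  by (simp add: class_sum_def abelian_monoid.finsum_empty abelian_group_def)

section \<open>Double cosets\<close>

lemma block_perms_eqI: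
  assumes "\<sigma> \<in> block_perms \<Lambda>" "\<tau> \<in> block_perms \<Lambda>" "\<And>x. x \<in> pts \<Lambda> \<Longrightarrow> \<sigma> x = \<tau> x"
  shows "\<sigma> = \<tau>"
proof
  fix x show "\<sigma> x = \<tau> x"
    using assms permutes_not_in[of \<sigma> "pts \<Lambda>" x] permutes_not_in[of \<tau> "pts \<Lambda>" x]
    by (cases "x \<in> pts \<Lambda>") (auto simp: block_perms_def)
qed

lemma finite_block_perms: "is_partition \<Lambda> \<Longrightarrow> finite (block_perms \<Lambda>)"
  using finite_permutations[OF is_partitionD(1)]
  by (rule finite_subset[rotated]) (auto simp: block_perms_def)

lemma block_perms_transport:
  assumes "is_partition \<Lambda>" "\<sigma> \<in> block_perms \<Lambda>"
  shows "transport \<sigma> \<Lambda> = \<Lambda>"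
proof (rule refines_antisym)
  show "transport \<sigma> \<Lambda> \<preceq> \<Lambda>" using mor_transport_refines[OF block_perms_mor[OF assms]] .
  note i = block_perms_inv[OF assms]
  have "transport \<sigma> (transport (inv_into UNIV \<sigma>) \<Lambda>) \<preceq> transport \<sigma> \<Lambda>"
    using refines_transport[OF mor_transport_refines[OF block_perms_mor[OF assms(1) i(1)]]]
      is_morD(4)[OF block_perms_mor[OF assms]] .
  thus "\<Lambda> \<preceq> transport \<sigma> \<Lambda>" by (simp add: transport_comp[symmetric] i)
qed

context
  fixes \<Gamma> \<Omega> \<Lambda> :: "'u set_partition"
  assumes refs: "\<Gamma> \<preceq> \<Omega>" "\<Lambda> \<preceq> \<Omega>"
begin

private abbreviation (input) "R \<equiv> {(\<sigma>, \<tau>). \<sigma> \<in> block_perms \<Omega> \<and> \<tau> \<in> block_perms \<Omega> \<and>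
        (\<exists>\<gamma> \<in> block_perms \<Gamma>. \<exists>\<delta> \<in> block_perms \<Lambda>. \<tau> = \<gamma> \<circ> \<sigma> \<circ> \<delta>)}"

private lemma equiv_R: "equiv (block_perms \<Omega>) R"
proof (rule equivI)
  note p = refinesD(1)[OF refs(1)] refinesD(1)[OF refs(2)]
  show "R \<subseteq> block_perms \<Omega> \<times> block_perms \<Omega>" by blast
  show "refl_on (block_perms \<Omega>) R"
    using id_in_block_perms p by (auto simp: refl_on_def intro!: bexI[of _ id])
  show "sym R"
  proof (rule symI)
    fix \<sigma> \<tau> assume "(\<sigma>, \<tau>) \<in> R"
    then obtain \<gamma> \<delta> where *: "\<gamma> \<in> block_perms \<Gamma>" "\<delta> \<in> block_perms \<Lambda>" "\<tau> = \<gamma> \<circ> \<sigma> \<circ> \<delta>"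
      "\<sigma> \<in> block_perms \<Omega>" "\<tau> \<in> block_perms \<Omega>" by blast
    note g = block_perms_inv[OF p(1) *(1)] and d = block_perms_inv[OF p(2) *(2)]
    have "inv_into UNIV \<gamma> \<circ> \<tau> \<circ> inv_into UNIV \<delta> = (inv_into UNIV \<gamma> \<circ> \<gamma>) \<circ> \<sigma> \<circ> (\<delta> \<circ> inv_into UNIV \<delta>)"
      using *(3) by (simp add: comp_assoc)
    hence "\<sigma> = inv_into UNIV \<gamma> \<circ> \<tau> \<circ> inv_into UNIV \<delta>" using g d by simp
    thus "(\<tau>, \<sigma>) \<in> R" using * g(1) d(1) by blast
  qed
  show "trans R"
  proof (rule transI)
    fix \<sigma> \<tau> \<rho> assume "(\<sigma>, \<tau>) \<in> R" "(\<tau>, \<rho>) \<in> R"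
    then obtain \<gamma> \<delta> \<gamma>' \<delta>' where *: "\<gamma> \<in> block_perms \<Gamma>" "\<delta> \<in> block_perms \<Lambda>" "\<tau> = \<gamma> \<circ> \<sigma> \<circ> \<delta>"
      "\<gamma>' \<in> block_perms \<Gamma>" "\<delta>' \<in> block_perms \<Lambda>" "\<rho> = \<gamma>' \<circ> \<tau> \<circ> \<delta>'"
      "\<sigma> \<in> block_perms \<Omega>" "\<rho> \<in> block_perms \<Omega>" by blast
    have "\<rho> = (\<gamma>' \<circ> \<gamma>) \<circ> \<sigma> \<circ> (\<delta> \<circ> \<delta>')" using * by (simp add: comp_assoc)
    thus "(\<sigma>, \<rho>) \<in> R" using * block_perms_comp p by blast
  qed
qed

lemma dcoset_rep_mem:
  assumes "C \<in> dcosets \<Gamma> \<Omega> \<Lambda>"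
  shows "dcoset_rep C \<in> C" "dcoset_rep C \<in> block_perms \<Omega>"
proof -
  have q: "C \<in> block_perms \<Omega> // R" using assms by (simp add: dcosets_def)
  hence "\<exists>\<sigma>. \<sigma> \<in> C" using in_quotient_imp_non_empty[OF equiv_R] by blast
  thus "dcoset_rep C \<in> C" unfolding dcoset_rep_def by (rule someI_ex)
  thus "dcoset_rep C \<in> block_perms \<Omega>" using in_quotient_imp_subset[OF equiv_R q] by blast
qed

text \<open>Comparing the chosen representatives suffices. The equation is asked on the points of
  \<Omega> only, because lifts provide nothing more; off these points all the permutations involved
  are the identity.\<close>

lemma dcoset_eqI:
  assumes "C \<in> dcosets \<Gamma> \<Omega> \<Lambda>" "C' \<in> dcosets \<Gamma> \<Omega> \<Lambda>" "\<gamma> \<in> block_perms \<Gamma>" "\<delta> \<in> block_perms \<Lambda>"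
    "\<And>x. x \<in> pts \<Omega> \<Longrightarrow> dcoset_rep C' x = \<gamma> (dcoset_rep C (\<delta> x))"
  shows "C = C'"
proof -
  have q: "C \<in> block_perms \<Omega> // R" "C' \<in> block_perms \<Omega> // R" using assms by (simp_all add: dcosets_def)
  have "dcoset_rep C' = \<gamma> \<circ> dcoset_rep C \<circ> \<delta>"
    using assms(3-5) dcoset_rep_mem(2) assms(1,2) block_perms_refines refs refinesD(2)
    by (intro block_perms_eqI[of _ \<Omega>] block_perms_comp) auto
  hence "(dcoset_rep C, dcoset_rep C') \<in> R" using assms dcoset_rep_mem(2) by blast
  thus ?thesis by (rule quotient_eqI[OF equiv_R q dcoset_rep_mem(1)[OF assms(1)] dcoset_rep_mem(1)[OF assms(2)]])
qed

text \<open>The chosen representative of the double coset of \<sigma> is known only up to \<gamma>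
  on the left and \<delta> on the right. Both have to be carried along wherever a permutation built
  from a lift is compared with it.\<close>

lemma dcoset_ex:
  assumes "\<sigma> \<in> block_perms \<Omega>"
  obtains C \<gamma> \<delta> where "C \<in> dcosets \<Gamma> \<Omega> \<Lambda>" "\<gamma> \<in> block_perms \<Gamma>" "\<delta> \<in> block_perms \<Lambda>"
    "dcoset_rep C = \<gamma> \<circ> \<sigma> \<circ> \<delta>"
proof -
  have C: "R `` {\<sigma>} \<in> dcosets \<Gamma> \<Omega> \<Lambda>" unfolding dcosets_def using assms by (rule quotientI)
  have "dcoset_rep (R `` {\<sigma>}) \<in> R `` {\<sigma>}" using dcoset_rep_mem(1)[OF C] .
  thus ?thesis using that C by blast
qed

lemma finite_dcosets: "finite (dcosets \<Gamma> \<Omega> \<Lambda>)"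
  unfolding dcosets_def using finite_block_perms[OF refinesD(2)[OF refs(1)]]
  by (rule finite_quotient) auto

end

section \<open>Elements of PD as families indexed by morphisms\<close>

text \<open>\<open>PD_at M \<Gamma> k x\<close> is $x[k]=\bar M_*(k_\Gamma)^{-1}(x_{k\Gamma})$.\<close>

definition PD_at :: "('u, 'a, 'z) pfun_scheme \<Rightarrow> 'u set_partition \<Rightarrow> ('u point \<Rightarrow> 'u point) \<Rightarrow>
    ('u set_partition \<Rightarrow> 'a set) \<Rightarrow> 'a set" where
  "PD_at M \<Gamma> k x = inv_into (carrier (bar M \<Gamma>)) (bar_tr M \<Gamma> (transport k \<Gamma>) k) (x (transport k \<Gamma>))"

text \<open>Invariance under block permutations becomes invariance under 2-isomorphism, and
  naturality determines all values from those at refinements. Naturality is written with the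
  transfer applied to the value at \<open>k \<circ> j\<close>, so that no inverse map
  occurs.\<close>

definition PD_family :: "('u, 'a, 'z) pfun_scheme \<Rightarrow> 'u set_partition \<Rightarrow>
    ('u set_partition \<Rightarrow> ('u point \<Rightarrow> 'u point) \<Rightarrow> 'a set) \<Rightarrow> bool" where
  "PD_family M \<Lambda> v \<longleftrightarrow>
     (\<forall>\<Gamma> k. is_mor \<Gamma> \<Lambda> k \<longrightarrow> v \<Gamma> k \<in> carrier (bar M \<Gamma>)) \<and>
     (\<forall>\<Gamma> k k'. two_iso \<Gamma> \<Lambda> k k' \<longrightarrow> v \<Gamma> k = v \<Gamma> k') \<and>
     (\<forall>\<Delta> \<Gamma> j k. is_iso \<Delta> \<Gamma> j \<and> is_mor \<Gamma> \<Lambda> k \<longrightarrow> bar_tr M \<Delta> \<Gamma> j (v \<Delta> (k \<circ> j)) = v \<Gamma> k)"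

definition of_family :: "'u set_partition \<Rightarrow>
    ('u set_partition \<Rightarrow> ('u point \<Rightarrow> 'u point) \<Rightarrow> 'a set) \<Rightarrow> ('u set_partition \<Rightarrow> 'a set)" where
  "of_family \<Lambda> v = (\<lambda>\<Gamma> \<in> {\<Gamma>. \<Gamma> \<preceq> \<Lambda>}. v \<Gamma> id)"

text \<open>The homotopy fibre over \<open>k\<close> of composition with \<open>f\<close>, before
  passing to 2-isomorphism classes.\<close>

definition lifts :: "'u set_partition \<Rightarrow> 'u set_partition \<Rightarrow> 'u set_partition \<Rightarrow> ('u point \<Rightarrow> 'u point) \<Rightarrow>
    ('u point \<Rightarrow> 'u point) \<Rightarrow> ('u point \<Rightarrow> 'u point) set" where
  "lifts \<Gamma> \<Psi> \<Lambda> f k = {l. is_mor \<Gamma> \<Psi> l \<and> two_iso \<Gamma> \<Lambda> (f \<circ> l) k}"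

definition lift_sum :: "('u, 'a, 'z) pfun_scheme \<Rightarrow> 'u set_partition \<Rightarrow> 'u set_partition \<Rightarrow> 'u set_partition \<Rightarrow>
    ('u point \<Rightarrow> 'u point) \<Rightarrow> ('u point \<Rightarrow> 'u point) \<Rightarrow> ('u set_partition \<Rightarrow> 'a set) \<Rightarrow> 'a set" where
  "lift_sum M \<Gamma> \<Psi> \<Lambda> f k x = class_sum (bar M \<Gamma>) (mor_class \<Gamma> \<Psi>) (lifts \<Gamma> \<Psi> \<Lambda> f k) (\<lambda>l. PD_at M \<Gamma> l x)"

lemma PD_familyD:
  assumes "PD_family M \<Lambda> v"
  shows "is_mor \<Gamma> \<Lambda> k \<Longrightarrow> v \<Gamma> k \<in> carrier (bar M \<Gamma>)"
    "two_iso \<Gamma> \<Lambda> k k' \<Longrightarrow> v \<Gamma> k = v \<Gamma> k'"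
    "is_iso \<Delta> \<Gamma> j \<Longrightarrow> is_mor \<Gamma> \<Lambda> k \<Longrightarrow> bar_tr M \<Delta> \<Gamma> j (v \<Delta> (k \<circ> j)) = v \<Gamma> k"
  using assms unfolding PD_family_def by blast+

lemma liftsD:
  assumes "l \<in> lifts \<Gamma> \<Psi> \<Lambda> f k"
  shows "is_mor \<Gamma> \<Psi> l" "two_iso \<Gamma> \<Lambda> (f \<circ> l) k"
  using assms by (auto simp: lifts_def)

lemma PD_val_memD:
  assumes "x \<in> carrier (PD_val M \<Lambda>)"
  shows "x \<in> extensional {\<Gamma>. \<Gamma> \<preceq> \<Lambda>}" "\<Gamma> \<preceq> \<Lambda> \<Longrightarrow> x \<Gamma> \<in> carrier (bar M \<Gamma>)"
    "\<sigma> \<in> block_perms \<Lambda> \<Longrightarrow> \<Gamma> \<preceq> \<Lambda> \<Longrightarrow>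
       bar_tr M (transport (inv_into UNIV \<sigma>) \<Gamma>) \<Gamma> \<sigma> (x (transport (inv_into UNIV \<sigma>) \<Gamma>)) = x \<Gamma>"
  using assms by (auto simp: PD_val_def PiE_def)

lemma PD_val_memI:
  assumes "x \<in> extensional {\<Gamma>. \<Gamma> \<preceq> \<Lambda>}" "\<And>\<Gamma>. \<Gamma> \<preceq> \<Lambda> \<Longrightarrow> x \<Gamma> \<in> carrier (bar M \<Gamma>)"
    "\<And>\<sigma> \<Gamma>. \<sigma> \<in> block_perms \<Lambda> \<Longrightarrow> \<Gamma> \<preceq> \<Lambda> \<Longrightarrow>
       bar_tr M (transport (inv_into UNIV \<sigma>) \<Gamma>) \<Gamma> \<sigma> (x (transport (inv_into UNIV \<sigma>) \<Gamma>)) = x \<Gamma>"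
  shows "x \<in> carrier (PD_val M \<Lambda>)"
  using assms by (auto simp: PD_val_def PiE_def)

lemma PD_val_ops:
  "\<zero>\<^bsub>PD_val M \<Lambda>\<^esub> = (\<lambda>\<Gamma> \<in> {\<Gamma>. \<Gamma> \<preceq> \<Lambda>}. \<zero>\<^bsub>bar M \<Gamma>\<^esub>)"
  "x \<oplus>\<^bsub>PD_val M \<Lambda>\<^esub> y = (\<lambda>\<Gamma> \<in> {\<Gamma>. \<Gamma> \<preceq> \<Lambda>}. x \<Gamma> \<oplus>\<^bsub>bar M \<Gamma>\<^esub> y \<Gamma>)"
  "\<one>\<^bsub>PD_val M \<Lambda>\<^esub> = (\<lambda>\<Gamma> \<in> {\<Gamma>. \<Gamma> \<preceq> \<Lambda>}. \<one>\<^bsub>bar M \<Gamma>\<^esub>)"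
  "x \<otimes>\<^bsub>PD_val M \<Lambda>\<^esub> y = (\<lambda>\<Gamma> \<in> {\<Gamma>. \<Gamma> \<preceq> \<Lambda>}. x \<Gamma> \<otimes>\<^bsub>bar M \<Gamma>\<^esub> y \<Gamma>)"
  by (simp_all add: PD_val_def)

lemma PD_val_eqI:
  assumes "x \<in> extensional {\<Gamma>. \<Gamma> \<preceq> \<Lambda>}" "y \<in> extensional {\<Gamma>. \<Gamma> \<preceq> \<Lambda>}" "\<And>\<Gamma>. \<Gamma> \<preceq> \<Lambda> \<Longrightarrow> x \<Gamma> = y \<Gamma>"
  shows "x = y"
  using assms by (intro extensionalityI) auto

lemma block_perm_iso:
  assumes "\<sigma> \<in> block_perms \<Lambda>" "\<Gamma> \<preceq> \<Lambda>"
  shows "transport (inv_into UNIV \<sigma>) \<Gamma> \<preceq> \<Lambda>" "is_iso (transport (inv_into UNIV \<sigma>) \<Gamma>) \<Gamma> \<sigma>"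
proof -
  note p = refinesD(2)[OF assms(2)]
  note i = block_perms_inv[OF p assms(1)]
  have m: "is_mor \<Gamma> \<Lambda> (inv_into UNIV \<sigma>)" using mor_refines[OF block_perms_mor[OF p i(1)] assms(2)] .
  show r: "transport (inv_into UNIV \<sigma>) \<Gamma> \<preceq> \<Lambda>" using mor_transport_refines[OF m] .
  show "is_iso (transport (inv_into UNIV \<sigma>) \<Gamma>) \<Gamma> \<sigma>"
    using mor_iso_transport[OF mor_refines[OF block_perms_mor[OF p assms(1)] r]]
    by (simp add: transport_comp[symmetric] i)
qed

section \<open>Elements of PD and natural families determine each other\<close>

context part_functor begin

lemma PD_at_eq:
  assumes "x \<in> carrier (PD_val M \<Lambda>)" "is_mor \<Gamma> \<Lambda> k"
  shows "PD_at M \<Gamma> k x = bar_tr M (transport k \<Gamma>) \<Gamma> (inv_into (pts \<Gamma>) k) (x (transport k \<Gamma>))"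
  unfolding PD_at_def
  using inv_into_bar_tr[OF mor_iso_transport[OF assms(2)]] PD_val_memD(2)[OF assms(1) mor_transport_refines[OF assms(2)]]
  by blast

lemma PD_at_closed:
  assumes "x \<in> carrier (PD_val M \<Lambda>)" "is_mor \<Gamma> \<Lambda> k"
  shows "PD_at M \<Gamma> k x \<in> carrier (bar M \<Gamma>)"
  unfolding PD_at_eq[OF assms]
  using bar_tr_closed[OF iso_inv[OF mor_iso_transport[OF assms(2)]]] PD_val_memD(2)[OF assms(1) mor_transport_refines[OF assms(2)]]
  by blast

lemma bar_tr_PD_at:
  assumes "x \<in> carrier (PD_val M \<Lambda>)" "is_mor \<Gamma> \<Lambda> k"
  shows "bar_tr M \<Gamma> (transport k \<Gamma>) k (PD_at M \<Gamma> k x) = x (transport k \<Gamma>)"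
  unfolding PD_at_eq[OF assms]
  using bar_tr_inv(2)[OF mor_iso_transport[OF assms(2)]] PD_val_memD(2)[OF assms(1) mor_transport_refines[OF assms(2)]]
  by blast

text \<open>The value at \<open>k\<close> is the only solution of the equation that transfers it to
  the component at the image of \<open>k\<close>. Values are computed by checking this equation
  instead of handling the inverse in the definition.\<close>

lemma PD_at_unique:
  assumes "is_iso \<Gamma> (transport k \<Gamma>) k" "y \<in> carrier (bar M \<Gamma>)"
    "bar_tr M \<Gamma> (transport k \<Gamma>) k y = x (transport k \<Gamma>)"
  shows "PD_at M \<Gamma> k x = y"
  unfolding PD_at_def assms(3)[symmetric]
  using inv_into_bar_tr[OF assms(1) bar_tr_closed[OF assms(1,2)]] bar_tr_inv(1)[OF assms(1,2)] by simp

lemma PD_at_id: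
  assumes "x \<in> carrier (PD_val M \<Lambda>)" "\<Gamma> \<preceq> \<Lambda>"
  shows "PD_at M \<Gamma> id x = x \<Gamma>"
  using refinesD[OF assms(2)] PD_val_memD(2)[OF assms]
  by (intro PD_at_unique) (simp_all add: iso_id bar_tr_id)

text \<open>Two 2-isomorphic morphisms differ by a block permutation \<sigma> of \<Lambda>, which
  carries one image of \<Gamma> to the other. Invariance of \<open>x\<close> under \<sigma> relates
  the components at these two images, and uniqueness of the value finishes the argument.\<close>

lemma PD_at_two_iso:
  assumes "x \<in> carrier (PD_val M \<Lambda>)" "two_iso \<Gamma> \<Lambda> k k'"
  shows "PD_at M \<Gamma> k x = PD_at M \<Gamma> k' x"
proof (rule PD_at_unique)
  note k = two_isoD(1)[OF assms(2)] and k' = two_isoD(2)[OF assms(2)]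
  show "is_iso \<Gamma> (transport k \<Gamma>) k" using mor_iso_transport[OF k] .
  show c: "PD_at M \<Gamma> k' x \<in> carrier (bar M \<Gamma>)" using PD_at_closed[OF assms(1) k'] .
  obtain \<sigma> where \<sigma>: "\<sigma> \<in> block_perms \<Lambda>" "\<And>y. y \<in> pts \<Gamma> \<Longrightarrow> \<sigma> (k' y) = k y"
    using two_iso_perm_ex[OF two_iso_sym[OF assms(2)]] by blast
  note p = is_morD(1)[OF k] and pL = is_morD(2)[OF k]
  note inv = block_perms_inv[OF pL \<sigma>(1)]
  have "transport \<sigma> (transport k' \<Gamma>) = transport k \<Gamma>"
    unfolding transport_comp[symmetric] using \<sigma>(2) by (intro transport_cong[OF p]) simp
  hence "transport (inv_into UNIV \<sigma>) (transport \<sigma> (transport k' \<Gamma>)) = transport (inv_into UNIV \<sigma>) (transport k \<Gamma>)"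
    by simp
  \<comment> \<open>The invariance condition is indexed by the image of a refinement under the
    inverse of \<sigma>; here it is identified with the image under \<open>k'\<close>.\<close>
  hence t: "transport (inv_into UNIV \<sigma>) (transport k \<Gamma>) = transport k' \<Gamma>"
    by (simp add: transport_comp[symmetric] inv comp_assoc[symmetric])
  note b = block_perm_iso[OF \<sigma>(1) mor_transport_refines[OF k], unfolded t]
  have "x (transport k \<Gamma>) = bar_tr M (transport k' \<Gamma>) (transport k \<Gamma>) \<sigma> (x (transport k' \<Gamma>))"
    using PD_val_memD(3)[OF assms(1) \<sigma>(1) mor_transport_refines[OF k]] t by simp
  also have "x (transport k' \<Gamma>) = bar_tr M \<Gamma> (transport k' \<Gamma>) k' (PD_at M \<Gamma> k' x)"
    using bar_tr_PD_at[OF assms(1) k'] by simp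
  also have "bar_tr M (transport k' \<Gamma>) (transport k \<Gamma>) \<sigma> \<dots> = bar_tr M \<Gamma> (transport k \<Gamma>) (\<sigma> \<circ> k') (PD_at M \<Gamma> k' x)"
    using bar_tr_comp[OF mor_iso_transport[OF k'] b(2) c] by simp
  also have "\<dots> = bar_tr M \<Gamma> (transport k \<Gamma>) k (PD_at M \<Gamma> k' x)"
    using \<sigma>(2) by (intro bar_tr_cong[OF iso_comp[OF mor_iso_transport[OF k'] b(2)] _ c]) simp
  finally show "bar_tr M \<Gamma> (transport k \<Gamma>) k (PD_at M \<Gamma> k' x) = x (transport k \<Gamma>)" by simp
qed

lemma PD_at_iso:
  assumes "x \<in> carrier (PD_val M \<Lambda>)" "is_iso \<Delta> \<Gamma> j" "is_mor \<Gamma> \<Lambda> k"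
  shows "bar_tr M \<Delta> \<Gamma> j (PD_at M \<Delta> (k \<circ> j) x) = PD_at M \<Gamma> k x"
proof (rule PD_at_unique[symmetric])
  note kj = mor_comp[OF isoD(1)[OF assms(2)] assms(3)]
  note c = PD_at_closed[OF assms(1) kj]
  show i: "is_iso \<Gamma> (transport k \<Gamma>) k" using mor_iso_transport[OF assms(3)] .
  show "bar_tr M \<Delta> \<Gamma> j (PD_at M \<Delta> (k \<circ> j) x) \<in> carrier (bar M \<Gamma>)" using bar_tr_closed[OF assms(2) c] .
  have t: "transport (k \<circ> j) \<Delta> = transport k \<Gamma>" using isoD(2)[OF assms(2)] by (simp add: transport_comp)
  show "bar_tr M \<Gamma> (transport k \<Gamma>) k (bar_tr M \<Delta> \<Gamma> j (PD_at M \<Delta> (k \<circ> j) x)) = x (transport k \<Gamma>)"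
    using bar_tr_comp[OF assms(2) i c] bar_tr_PD_at[OF assms(1) kj] t by simp
qed

lemma of_family_apply: "\<Gamma> \<preceq> \<Lambda> \<Longrightarrow> of_family \<Lambda> v \<Gamma> = v \<Gamma> id"
  by (simp add: of_family_def)

text \<open>A block permutation \<sigma> is 2-isomorphic to the identity, so the family has the same
  value at both. Naturality along \<sigma>, viewed as an isomorphism between two refinements, is
  then the invariance required in PD.\<close>

lemma of_family_closed:
  assumes "PD_family M \<Lambda> v"
  shows "of_family \<Lambda> v \<in> carrier (PD_val M \<Lambda>)"
proof (rule PD_val_memI)
  show "of_family \<Lambda> v \<in> extensional {\<Gamma>. \<Gamma> \<preceq> \<Lambda>}" by (simp add: of_family_def)
  fix \<Gamma> assume r: "\<Gamma> \<preceq> \<Lambda>"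
  show "of_family \<Lambda> v \<Gamma> \<in> carrier (bar M \<Gamma>)"
    using PD_familyD(1)[OF assms refinesD(5)[OF r]] r by (simp add: of_family_apply)
  fix \<sigma> assume \<sigma>: "\<sigma> \<in> block_perms \<Lambda>"
  note b = block_perm_iso[OF \<sigma> r] and p = refinesD(2)[OF r]
  let ?\<Gamma>' = "transport (inv_into UNIV \<sigma>) \<Gamma>"
  have "two_iso ?\<Gamma>' \<Lambda> id \<sigma>"
    using two_iso_sym[OF two_iso_comp_right[OF block_perms_two_iso[OF p \<sigma>] refinesD(5)[OF b(1)]]] by simp
  hence "v ?\<Gamma>' id = v ?\<Gamma>' \<sigma>" by (rule PD_familyD(2)[OF assms])
  thus "bar_tr M ?\<Gamma>' \<Gamma> \<sigma> (of_family \<Lambda> v ?\<Gamma>') = of_family \<Lambda> v \<Gamma>"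
    using PD_familyD(3)[OF assms b(2) refinesD(5)[OF r]] r b(1) by (simp add: of_family_apply)
qed

text \<open>Naturality is applied to the isomorphism of \<Gamma> onto its image under
  \<open>k\<close>, followed by the refinement of \<Lambda> by that image. Thus the values at
  identities already encode the whole family.\<close>

lemma PD_at_of_family:
  assumes "PD_family M \<Lambda> v" "is_mor \<Gamma> \<Lambda> k"
  shows "PD_at M \<Gamma> k (of_family \<Lambda> v) = v \<Gamma> k"
  using mor_iso_transport[OF assms(2)] PD_familyD(1)[OF assms]
    PD_familyD(3)[OF assms(1) mor_iso_transport[OF assms(2)] refinesD(5)[OF mor_transport_refines[OF assms(2)]]]
  by (intro PD_at_unique) (simp_all add: of_family_apply mor_transport_refines[OF assms(2)])

text \<open>The values at identities are the components, hence equality in PD needs to be tested at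
  refinements only. In the comparisons below the base morphism is therefore the identity, while its
  lifts are arbitrary.\<close>

lemma PD_at_eqI:
  assumes "x \<in> carrier (PD_val M \<Lambda>)" "y \<in> carrier (PD_val M \<Lambda>)"
    "\<And>\<Gamma>. \<Gamma> \<preceq> \<Lambda> \<Longrightarrow> PD_at M \<Gamma> id x = PD_at M \<Gamma> id y"
  shows "x = y"
  using assms PD_at_id PD_val_memD(1) by (intro PD_val_eqI[of x \<Lambda> y]) auto

lemma PD_group:
  assumes "is_partition \<Lambda>"
  shows "abelian_group (PD_val M \<Lambda>)"
proof (rule abelian_groupI)
  have g: "abelian_group (bar M \<Gamma>)" if "\<Gamma> \<preceq> \<Lambda>" for \<Gamma> using bar_group refinesD(1)[OF that] .
  note E = abelian_groupE
  fix x y z assume x: "x \<in> carrier (PD_val M \<Lambda>)" and y: "y \<in> carrier (PD_val M \<Lambda>)" and z: "z \<in> carrier (PD_val M \<Lambda>)"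
  note X = PD_val_memD[OF x] and Y = PD_val_memD[OF y] and Z = PD_val_memD[OF z]
  show "x \<oplus>\<^bsub>PD_val M \<Lambda>\<^esub> y \<in> carrier (PD_val M \<Lambda>)"
  proof (rule PD_val_memI)
    fix \<sigma> \<Gamma> assume \<sigma>: "\<sigma> \<in> block_perms \<Lambda>" and r: "\<Gamma> \<preceq> \<Lambda>"
    note b = block_perm_iso[OF \<sigma> r]
    show "bar_tr M (transport (inv_into UNIV \<sigma>) \<Gamma>) \<Gamma> \<sigma>
        ((x \<oplus>\<^bsub>PD_val M \<Lambda>\<^esub> y) (transport (inv_into UNIV \<sigma>) \<Gamma>)) = (x \<oplus>\<^bsub>PD_val M \<Lambda>\<^esub> y) \<Gamma>"
      using add_hom_add[OF bar_tr_hom[OF b(2)] X(2)[OF b(1)] Y(2)[OF b(1)]] X(3)[OF \<sigma> r] Y(3)[OF \<sigma> r] r b(1)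
      by (simp add: PD_val_ops)
  qed (auto simp: PD_val_ops intro!: E(1)[OF g] X(2) Y(2))
  show "x \<oplus>\<^bsub>PD_val M \<Lambda>\<^esub> y \<oplus>\<^bsub>PD_val M \<Lambda>\<^esub> z = x \<oplus>\<^bsub>PD_val M \<Lambda>\<^esub> (y \<oplus>\<^bsub>PD_val M \<Lambda>\<^esub> z)"
    by (rule PD_val_eqI[of _ \<Lambda>]) (simp_all add: PD_val_ops E(3)[OF g] X(2) Y(2) Z(2))
  show "x \<oplus>\<^bsub>PD_val M \<Lambda>\<^esub> y = y \<oplus>\<^bsub>PD_val M \<Lambda>\<^esub> x"
    using E(4)[OF g X(2) Y(2)] by (intro PD_val_eqI[of _ \<Lambda>]) (simp_all add: PD_val_ops)
  show "\<zero>\<^bsub>PD_val M \<Lambda>\<^esub> \<oplus>\<^bsub>PD_val M \<Lambda>\<^esub> x = x"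
    by (rule PD_val_eqI[OF _ X(1)]) (simp_all add: PD_val_ops E(5)[OF g] X(2))
  show "\<exists>y\<in>carrier (PD_val M \<Lambda>). y \<oplus>\<^bsub>PD_val M \<Lambda>\<^esub> x = \<zero>\<^bsub>PD_val M \<Lambda>\<^esub>"
  proof (rule bexI[of _ "\<lambda>\<Gamma> \<in> {\<Gamma>. \<Gamma> \<preceq> \<Lambda>}. \<ominus>\<^bsub>bar M \<Gamma>\<^esub> x \<Gamma>"])
    show "(\<lambda>\<Gamma> \<in> {\<Gamma>. \<Gamma> \<preceq> \<Lambda>}. \<ominus>\<^bsub>bar M \<Gamma>\<^esub> x \<Gamma>) \<oplus>\<^bsub>PD_val M \<Lambda>\<^esub> x = \<zero>\<^bsub>PD_val M \<Lambda>\<^esub>"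
      by (rule PD_val_eqI[of _ \<Lambda>]) (simp_all add: PD_val_ops abelian_group.l_neg[OF g] X(2))
    show "(\<lambda>\<Gamma> \<in> {\<Gamma>. \<Gamma> \<preceq> \<Lambda>}. \<ominus>\<^bsub>bar M \<Gamma>\<^esub> x \<Gamma>) \<in> carrier (PD_val M \<Lambda>)"
    proof (rule PD_val_memI)
      fix \<sigma> \<Gamma> assume \<sigma>: "\<sigma> \<in> block_perms \<Lambda>" and r: "\<Gamma> \<preceq> \<Lambda>"
      note b = block_perm_iso[OF \<sigma> r]
      show "bar_tr M (transport (inv_into UNIV \<sigma>) \<Gamma>) \<Gamma> \<sigma>
          ((\<lambda>\<Gamma> \<in> {\<Gamma>. \<Gamma> \<preceq> \<Lambda>}. \<ominus>\<^bsub>bar M \<Gamma>\<^esub> x \<Gamma>) (transport (inv_into UNIV \<sigma>) \<Gamma>)) =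
          (\<lambda>\<Gamma> \<in> {\<Gamma>. \<Gamma> \<preceq> \<Lambda>}. \<ominus>\<^bsub>bar M \<Gamma>\<^esub> x \<Gamma>) \<Gamma>"
        using abelian_group_hom.hom_a_inv[OF add_hom_group_hom[OF g[OF b(1)] g[OF r] bar_tr_hom[OF b(2)]] X(2)[OF b(1)]]
          X(3)[OF \<sigma> r] r b(1) by simp
    qed (auto intro!: abelian_group.a_inv_closed[OF g] X(2))
  qed
next
  have g: "abelian_group (bar M \<Gamma>)" if "\<Gamma> \<preceq> \<Lambda>" for \<Gamma> using bar_group refinesD(1)[OF that] .
  show "\<zero>\<^bsub>PD_val M \<Lambda>\<^esub> \<in> carrier (PD_val M \<Lambda>)"
  proof (rule PD_val_memI)
    fix \<sigma> \<Gamma> assume \<sigma>: "\<sigma> \<in> block_perms \<Lambda>" and r: "\<Gamma> \<preceq> \<Lambda>"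
    note b = block_perm_iso[OF \<sigma> r]
    show "bar_tr M (transport (inv_into UNIV \<sigma>) \<Gamma>) \<Gamma> \<sigma>
        (\<zero>\<^bsub>PD_val M \<Lambda>\<^esub> (transport (inv_into UNIV \<sigma>) \<Gamma>)) = \<zero>\<^bsub>PD_val M \<Lambda>\<^esub> \<Gamma>"
      using add_hom_zero[OF g[OF b(1)] g[OF r] bar_tr_hom[OF b(2)]] r b(1) by (simp add: PD_val_ops)
  qed (auto simp: PD_val_ops intro!: abelian_groupE(2)[OF g])
qed

lemma PD_at_hom:
  assumes "is_mor \<Gamma> \<Lambda> k"
  shows "PD_at M \<Gamma> k \<in> add_hom (PD_val M \<Lambda>) (bar M \<Gamma>)"
proof (rule add_homI)
  fix x y assume x: "x \<in> carrier (PD_val M \<Lambda>)" and y: "y \<in> carrier (PD_val M \<Lambda>)"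
  show "PD_at M \<Gamma> k x \<in> carrier (bar M \<Gamma>)" using PD_at_closed[OF x assms] .
  note r = mor_transport_refines[OF assms]
  have xy: "x \<oplus>\<^bsub>PD_val M \<Lambda>\<^esub> y \<in> carrier (PD_val M \<Lambda>)"
    using abelian_groupE(1)[OF PD_group[OF is_morD(2)[OF assms]] x y] .
  show "PD_at M \<Gamma> k (x \<oplus>\<^bsub>PD_val M \<Lambda>\<^esub> y) = PD_at M \<Gamma> k x \<oplus>\<^bsub>bar M \<Gamma>\<^esub> PD_at M \<Gamma> k y"
    unfolding PD_at_eq[OF xy assms] PD_at_eq[OF x assms] PD_at_eq[OF y assms]
    using add_hom_add[OF bar_tr_hom[OF iso_inv[OF mor_iso_transport[OF assms]]] PD_val_memD(2)[OF x r] PD_val_memD(2)[OF y r]] r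
    by (simp add: PD_val_ops)
qed

section \<open>Restriction and transfer in terms of families\<close>

lemma PD_res_family:
  assumes "x \<in> carrier (PD_val M \<Theta>)" "is_mor \<Lambda> \<Theta> f"
  shows "PD_family M \<Lambda> (\<lambda>\<Gamma> k. PD_at M \<Gamma> (f \<circ> k) x)"
  unfolding PD_family_def
  using PD_at_closed[OF assms(1) mor_comp[OF _ assms(2)]] PD_at_two_iso[OF assms(1) two_iso_comp_left[OF _ assms(2)]]
    PD_at_iso[OF assms(1) _ mor_comp[OF _ assms(2)]] by (auto simp: comp_assoc)

lemma PD_res_eq: "PD_res M \<Lambda> \<Theta> f x = of_family \<Lambda> (\<lambda>\<Gamma> k. PD_at M \<Gamma> (f \<circ> k) x)"
  by (simp add: PD_res_def of_family_def PD_at_def)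

lemma PD_res_closed:
  "x \<in> carrier (PD_val M \<Theta>) \<Longrightarrow> is_mor \<Lambda> \<Theta> f \<Longrightarrow> PD_res M \<Lambda> \<Theta> f x \<in> carrier (PD_val M \<Lambda>)"
  unfolding PD_res_eq using of_family_closed PD_res_family by blast

lemma PD_at_res:
  "x \<in> carrier (PD_val M \<Theta>) \<Longrightarrow> is_mor \<Lambda> \<Theta> f \<Longrightarrow> is_mor \<Gamma> \<Lambda> k \<Longrightarrow>
    PD_at M \<Gamma> k (PD_res M \<Lambda> \<Theta> f x) = PD_at M \<Gamma> (f \<circ> k) x"
  unfolding PD_res_eq by (simp add: PD_at_of_family[OF PD_res_family])

lemma PD_at_class:
  assumes "x \<in> carrier (PD_val M \<Psi>)" "is_mor \<Gamma> \<Psi> l" "is_mor \<Gamma> \<Psi> m" "mor_class \<Gamma> \<Psi> l = mor_class \<Gamma> \<Psi> m"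
  shows "PD_at M \<Gamma> l x = PD_at M \<Gamma> m x"
  using PD_at_two_iso[OF assms(1)] mor_class_eq_iff[OF assms(2,3)] assms(4) by blast

text \<open>The lifts depend on \<open>k\<close> only through its 2-isomorphism class, because
  2-isomorphism is transitive. For an isomorphism \<open>j\<close>, composing with its inverse gives
  a bijection between classes of lifts of \<open>k \<circ> j\<close> and of \<open>k\<close>,
  compatible with the values of \<open>x\<close> by their own naturality.\<close>

lemma lift_sum_family:
  assumes "x \<in> carrier (PD_val M \<Psi>)" "is_mor \<Psi> \<Lambda> f"
  shows "PD_family M \<Lambda> (\<lambda>\<Gamma> k. lift_sum M \<Gamma> \<Psi> \<Lambda> f k x)"
  unfolding PD_family_def
proof (intro conjI allI impI)
  have g: "abelian_group (bar M \<Gamma>)" if "is_mor \<Gamma> \<Lambda> k" for \<Gamma> k using bar_group is_morD(1)[OF that] .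
  fix \<Gamma> k
  show "lift_sum M \<Gamma> \<Psi> \<Lambda> f k x \<in> carrier (bar M \<Gamma>)" if "is_mor \<Gamma> \<Lambda> k"
    unfolding lift_sum_def using PD_at_closed[OF assms(1)] liftsD(1)
    by (intro class_sum_closed[OF g[OF that]]) blast
  show "lift_sum M \<Gamma> \<Psi> \<Lambda> f k x = lift_sum M \<Gamma> \<Psi> \<Lambda> f k' x" if "two_iso \<Gamma> \<Lambda> k k'" for k'
  proof -
    have "lifts \<Gamma> \<Psi> \<Lambda> f k = lifts \<Gamma> \<Psi> \<Lambda> f k'"
      unfolding lifts_def using two_iso_trans that two_iso_sym[OF that] by blast
    thus ?thesis by (simp add: lift_sum_def)
  qed
  fix \<Delta> j assume "is_iso \<Delta> \<Gamma> j \<and> is_mor \<Gamma> \<Lambda> k"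
  hence j: "is_iso \<Delta> \<Gamma> j" and k: "is_mor \<Gamma> \<Lambda> k" by auto
  note jm = isoD(1)[OF j] and ji = isoD(1)[OF iso_inv[OF j]]
  \<comment> \<open>The isomorphism and its chosen inverse cancel on points only, so cancellation is
    available as a 2-isomorphism.\<close>
  have bwd: "two_iso \<Delta> X (l \<circ> inv_into (pts \<Delta>) j \<circ> j) l" if "is_mor \<Delta> X l" for X l
    using mor_inv_into(2)[OF jm] by (intro two_iso_sym[OF two_iso_cong[OF that]]) simp
  have fwd: "two_iso \<Gamma> X (l \<circ> j \<circ> inv_into (pts \<Delta>) j) l" if "is_mor \<Gamma> X l" for X l
    using mor_inv_into(3)[OF jm] by (intro two_iso_sym[OF two_iso_cong[OF that]]) simp
  have "bar_tr M \<Delta> \<Gamma> j (lift_sum M \<Delta> \<Psi> \<Lambda> f (k \<circ> j) x) =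
      class_sum (bar M \<Gamma>) (mor_class \<Delta> \<Psi>) (lifts \<Delta> \<Psi> \<Lambda> f (k \<circ> j)) (\<lambda>l. bar_tr M \<Delta> \<Gamma> j (PD_at M \<Delta> l x))"
    unfolding lift_sum_def using PD_at_closed[OF assms(1)] liftsD(1)
    by (intro class_sum_hom[OF bar_group[OF is_morD(1)[OF jm]] bar_group[OF is_morD(2)[OF jm]] bar_tr_hom[OF j]]) blast
  also have "\<dots> = lift_sum M \<Gamma> \<Psi> \<Lambda> f k x"
    unfolding lift_sum_def
  proof (rule class_sum_bij[OF g[OF k], where F = "\<lambda>l. l \<circ> inv_into (pts \<Delta>) j"])
    fix l assume "l \<in> lifts \<Delta> \<Psi> \<Lambda> f (k \<circ> j)"
    note l = liftsD[OF this]
    note li = mor_comp[OF ji l(1)]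
    show "l \<circ> inv_into (pts \<Delta>) j \<in> lifts \<Gamma> \<Psi> \<Lambda> f k"
      using li two_iso_trans[OF two_iso_comp_right[OF l(2) ji] fwd[OF k]] by (simp add: lifts_def comp_assoc)
    have "bar_tr M \<Delta> \<Gamma> j (PD_at M \<Delta> l x) = bar_tr M \<Delta> \<Gamma> j (PD_at M \<Delta> (l \<circ> inv_into (pts \<Delta>) j \<circ> j) x)"
      using PD_at_two_iso[OF assms(1) bwd[OF l(1)]] by simp
    thus "bar_tr M \<Delta> \<Gamma> j (PD_at M \<Delta> l x) = PD_at M \<Gamma> (l \<circ> inv_into (pts \<Delta>) j) x"
      using PD_at_iso[OF assms(1) j li] by simp
    fix m assume "m \<in> lifts \<Delta> \<Psi> \<Lambda> f (k \<circ> j)"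
    note m = liftsD[OF this]
    note mi = mor_comp[OF ji m(1)]
    show "mor_class \<Gamma> \<Psi> (l \<circ> inv_into (pts \<Delta>) j) = mor_class \<Gamma> \<Psi> (m \<circ> inv_into (pts \<Delta>) j)"
      if "mor_class \<Delta> \<Psi> l = mor_class \<Delta> \<Psi> m"
      using that two_iso_comp_right[OF _ ji] by (simp add: mor_class_eq_iff l m li mi)
    show "mor_class \<Delta> \<Psi> l = mor_class \<Delta> \<Psi> m"
      if "mor_class \<Gamma> \<Psi> (l \<circ> inv_into (pts \<Delta>) j) = mor_class \<Gamma> \<Psi> (m \<circ> inv_into (pts \<Delta>) j)"
    proof -
      have "two_iso \<Gamma> \<Psi> (l \<circ> inv_into (pts \<Delta>) j) (m \<circ> inv_into (pts \<Delta>) j)"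
        using that by (simp add: mor_class_eq_iff li mi)
      from two_iso_comp_right[OF this jm] have "two_iso \<Delta> \<Psi> l m"
        using bwd[OF l(1)] bwd[OF m(1)] two_iso_trans two_iso_sym by meson
      thus ?thesis by (simp add: mor_class_eq_iff l m)
    qed
  next
    fix l assume "l \<in> lifts \<Gamma> \<Psi> \<Lambda> f k"
    note l = liftsD[OF this]
    show "PD_at M \<Gamma> l x \<in> carrier (bar M \<Gamma>)" using PD_at_closed[OF assms(1) l(1)] .
    have "l \<circ> j \<in> lifts \<Delta> \<Psi> \<Lambda> f (k \<circ> j)"
      using mor_comp[OF jm l(1)] two_iso_comp_right[OF l(2) jm] by (simp add: lifts_def comp_assoc)
    moreover have "mor_class \<Gamma> \<Psi> (l \<circ> j \<circ> inv_into (pts \<Delta>) j) = mor_class \<Gamma> \<Psi> l"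
      using fwd[OF l(1)] mor_class_eq_iff[OF mor_comp[OF ji mor_comp[OF jm l(1)]] l(1)] by blast
    ultimately show "\<exists>l' \<in> lifts \<Delta> \<Psi> \<Lambda> f (k \<circ> j). mor_class \<Gamma> \<Psi> (l' \<circ> inv_into (pts \<Delta>) j) = mor_class \<Gamma> \<Psi> l"
      by blast
    fix m assume "m \<in> lifts \<Gamma> \<Psi> \<Lambda> f k" "mor_class \<Gamma> \<Psi> l = mor_class \<Gamma> \<Psi> m"
    thus "PD_at M \<Gamma> l x = PD_at M \<Gamma> m x" using PD_at_class[OF assms(1) l(1)] liftsD(1) by blast
  qed
  finally show "bar_tr M \<Delta> \<Gamma> j (lift_sum M \<Delta> \<Psi> \<Lambda> f (k \<circ> j) x) = lift_sum M \<Gamma> \<Psi> \<Lambda> f k x" .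
qed

text \<open>Every admissible permutation \<sigma> yields a lift of the refinement of \<Lambda> by
  \<Gamma>, namely the inverse of \<sigma> f on \<Gamma>. Its composite with \<open>f\<close> is the
  inverse of \<sigma> and hence 2-isomorphic to the identity, and the summand of the transfer
  formula is the value of \<open>x\<close> at this lift.\<close>

lemma PD_tr_summand:
  assumes f: "is_mor \<Psi> \<Lambda> f" and r: "\<Gamma> \<preceq> \<Lambda>" and \<sigma>: "\<sigma> \<in> block_perms \<Lambda>"
    and ref: "\<Gamma> \<preceq> transport \<sigma> (transport f \<Psi>)"
  defines "h \<equiv> \<sigma> \<circ> f"
  defines "k \<equiv> inv_into (pts \<Psi>) h"
  shows "is_mor \<Psi> \<Lambda> h" "k \<in> lifts \<Gamma> \<Psi> \<Lambda> f id" "\<And>y. y \<in> pts \<Lambda> \<Longrightarrow> \<sigma> (f (k y)) = y"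
    "transport k \<Gamma> \<preceq> \<Psi>" "is_iso (transport k \<Gamma>) \<Gamma> h"
    "x \<in> carrier (PD_val M \<Psi>) \<Longrightarrow> bar_tr M (transport k \<Gamma>) \<Gamma> h (x (transport k \<Gamma>)) = PD_at M \<Gamma> k x"
proof -
  note p = refinesD(2)[OF r]
  show h: "is_mor \<Psi> \<Lambda> h" unfolding h_def using mor_comp[OF f block_perms_mor[OF p \<sigma>]] .
  have "\<Gamma> \<preceq> transport h \<Psi>" using ref by (simp add: h_def transport_comp)
  note mr = mor_refines_transport_inv[OF h this, folded k_def]
  show y: "\<sigma> (f (k y)) = y" if "y \<in> pts \<Lambda>" for y
    using mor_inv_into(3)[OF h that] by (simp add: k_def h_def)
  have "two_iso \<Gamma> \<Lambda> (f \<circ> k) id"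
    unfolding two_iso_def
  proof (intro conjI ballI)
    show "is_mor \<Gamma> \<Lambda> (f \<circ> k)" using mor_comp[OF mr(2) f] .
    show "is_mor \<Gamma> \<Lambda> id" using refinesD(5)[OF r] .
    fix y assume "y \<in> pts \<Gamma>"
    hence y': "y \<in> pts \<Lambda>" using refinesD(3)[OF r] by simp
    have "f (k y) \<in> pts \<Lambda>" using mor_inv_into(4)[OF h y'] is_morD(6)[OF f] by (simp add: k_def)
    hence "(f (k y), \<sigma> (f (k y))) \<in> rel \<Lambda>" using \<sigma> by (simp add: block_perms_def)
    thus "((f \<circ> k) y, id y) \<in> rel \<Lambda>" using y[OF y'] by simp
  qed
  thus "k \<in> lifts \<Gamma> \<Psi> \<Lambda> f id" using mr(2) by (simp add: lifts_def)
  show "transport k \<Gamma> \<preceq> \<Psi>" "is_iso (transport k \<Gamma>) \<Gamma> h" using mr by auto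
  assume x: "x \<in> carrier (PD_val M \<Psi>)"
  \<comment> \<open>The value at \<open>k\<close> is formed with the inverse of \<open>k\<close> on
    its image, and there this inverse agrees with \<open>h\<close>.\<close>
  have "bar_tr M (transport k \<Gamma>) \<Gamma> (inv_into (pts \<Gamma>) k) (x (transport k \<Gamma>)) = bar_tr M (transport k \<Gamma>) \<Gamma> h (x (transport k \<Gamma>))"
  proof (rule bar_tr_cong[OF iso_inv[OF mr(1)] _ PD_val_memD(2)[OF x mr(3)]])
    fix z assume "z \<in> pts (transport k \<Gamma>)"
    then obtain w where w: "w \<in> pts \<Gamma>" "z = k w" by auto
    thus "inv_into (pts \<Gamma>) k z = h z"
      using mor_inv_into(2)[OF mr(2) w(1)] y[of w] refinesD(3)[OF r] by (simp add: h_def)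
  qed
  thus "bar_tr M (transport k \<Gamma>) \<Gamma> h (x (transport k \<Gamma>)) = PD_at M \<Gamma> k x" using PD_at_eq[OF x mr(2)] by simp
qed

text \<open>Sending a double coset to the inverse of its representative after \<open>f\<close> is a
  bijection from admissible double cosets to classes of lifts. Injectivity holds because
  2-isomorphic lifts differ by a block permutation of f \<Psi>. For surjectivity a lift is completed
  to a permutation of \<Lambda>; replacing that by the representative of its double coset changes
  the lift only inside blocks.\<close>

lemma PD_tr_eq:
  assumes x: "x \<in> carrier (PD_val M \<Psi>)" and f: "is_mor \<Psi> \<Lambda> f"
  shows "PD_tr M \<Psi> \<Lambda> f x = of_family \<Lambda> (\<lambda>\<Gamma> k. lift_sum M \<Gamma> \<Psi> \<Lambda> f k x)"
proof (rule PD_val_eqI)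
  show "PD_tr M \<Psi> \<Lambda> f x \<in> extensional {\<Gamma>. \<Gamma> \<preceq> \<Lambda>}" by (simp add: PD_tr_def)
  show "of_family \<Lambda> (\<lambda>\<Gamma> k. lift_sum M \<Gamma> \<Psi> \<Lambda> f k x) \<in> extensional {\<Gamma>. \<Gamma> \<preceq> \<Lambda>}" by (simp add: of_family_def)
  fix \<Gamma> assume r: "\<Gamma> \<preceq> \<Lambda>"
  let ?\<Psi>' = "transport f \<Psi>"
  note r' = mor_transport_refines[OF f]
  note g = bar_group[OF refinesD(1)[OF r]]
  let ?L = "{C \<in> dcosets \<Gamma> \<Lambda> ?\<Psi>'. \<Gamma> \<preceq> transport (dcoset_rep C) ?\<Psi>'}"
  let ?k = "\<lambda>C. inv_into (pts \<Psi>) (dcoset_rep C \<circ> f)"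
  note S = PD_tr_summand[OF f r]
  have b: "dcoset_rep C \<in> block_perms \<Lambda>" if "C \<in> ?L" for C using that dcoset_rep_mem(2)[OF r r'] by blast
  have s: "(let h = dcoset_rep C \<circ> f; \<Gamma>' = transport (inv_into (pts \<Psi>) h) \<Gamma> in bar_tr M \<Gamma>' \<Gamma> h (x \<Gamma>')) = PD_at M \<Gamma> (?k C) x"
    if "C \<in> ?L" for C using S(6)[OF b[OF that] _ x] that by (simp add: Let_def)
  have "PD_tr M \<Psi> \<Lambda> f x \<Gamma> = (\<Oplus>\<^bsub>bar M \<Gamma>\<^esub> C \<in> ?L. PD_at M \<Gamma> (?k C) x)"
  proof -
    have "PD_tr M \<Psi> \<Lambda> f x \<Gamma> = (\<Oplus>\<^bsub>bar M \<Gamma>\<^esub> C \<in> ?L. (let h = dcoset_rep C \<circ> f;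
        \<Gamma>' = transport (inv_into (pts \<Psi>) h) \<Gamma> in bar_tr M \<Gamma>' \<Gamma> h (x \<Gamma>')))"
      unfolding PD_tr_def using r by simp
    also have "\<dots> = (\<Oplus>\<^bsub>bar M \<Gamma>\<^esub> C \<in> ?L. PD_at M \<Gamma> (?k C) x)"
      using PD_at_closed[OF x liftsD(1)[OF S(2)]] b by (intro finsum_cong_set[OF g refl _ s]) blast+
    finally show ?thesis .
  qed
  also have "\<dots> = class_sum (bar M \<Gamma>) id ?L (\<lambda>C. PD_at M \<Gamma> (?k C) x)"
    using PD_at_closed[OF x liftsD(1)[OF S(2)]] b by (intro finsum_class_sum[OF g]) blast
  also have "\<dots> = lift_sum M \<Gamma> \<Psi> \<Lambda> f id x"
    unfolding lift_sum_def
  proof (rule class_sum_bij[OF g, where F = ?k])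
    fix C assume C: "C \<in> ?L"
    hence C': "C \<in> dcosets \<Gamma> \<Lambda> ?\<Psi>'" "\<Gamma> \<preceq> transport (dcoset_rep C) ?\<Psi>'" by auto
    note SC = S[OF b[OF C] C'(2)]
    show "?k C \<in> lifts \<Gamma> \<Psi> \<Lambda> f id" using SC(2) .
    fix D assume D: "D \<in> ?L"
    hence D': "D \<in> dcosets \<Gamma> \<Lambda> ?\<Psi>'" "\<Gamma> \<preceq> transport (dcoset_rep D) ?\<Psi>'" by auto
    note SD = S[OF b[OF D] D'(2)]
    show "mor_class \<Gamma> \<Psi> (?k C) = mor_class \<Gamma> \<Psi> (?k D)" if "id C = id D" using that by simp
    assume "mor_class \<Gamma> \<Psi> (?k C) = mor_class \<Gamma> \<Psi> (?k D)"
    hence "two_iso \<Gamma> \<Psi> (?k C) (?k D)" using mor_class_eq_iff liftsD(1)[OF SC(2)] liftsD(1)[OF SD(2)] by blast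
    \<comment> \<open>The lifts are compared in f \<Psi>, not in \<Lambda>: only then does the
      permutation \<delta> preserve the blocks of f \<Psi>, which makes it an element of the
      right-hand group of the double coset.\<close>
    hence "two_iso \<Gamma> ?\<Psi>' (f \<circ> ?k C) (f \<circ> ?k D)" using two_iso_comp_left isoD(1)[OF mor_iso_transport[OF f]] by blast
    then obtain \<delta> where \<delta>: "\<delta> \<in> block_perms ?\<Psi>'" "\<And>y. y \<in> pts \<Gamma> \<Longrightarrow> \<delta> (f (?k C y)) = f (?k D y)"
      by (rule two_iso_perm_ex) simp
    show "id C = id D"
    proof -
      \<comment> \<open>Evaluate \<delta> at the point y = \<open>dcoset_rep C z\<close>. The lift
        of \<open>C\<close> sends y to the preimage of z under \<open>f\<close>, so \<delta> z is
        the image under \<open>f\<close> of the lift of \<open>D\<close> at y, and the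
        representative of \<open>D\<close> returns y.\<close>
      have "dcoset_rep C z = id (dcoset_rep D (\<delta> z))" if z: "z \<in> pts \<Lambda>" for z
      proof -
        have y: "dcoset_rep C z \<in> pts \<Lambda>"
          using is_morD(6)[OF block_perms_mor[OF refinesD(2)[OF r] b[OF C]]] z .
        obtain w where w: "w \<in> pts \<Psi>" "z = f w" using is_morD(5)[OF f] z by blast
        have "?k C (dcoset_rep C z) = w" using mor_inv_into(2)[OF SC(1) w(1)] w(2) by simp
        hence "f (?k C (dcoset_rep C z)) = z" using w by simp
        thus ?thesis using \<delta>(2)[of "dcoset_rep C z"] SD(3)[OF y] y refinesD(3)[OF r] by simp
      qed
      from dcoset_eqI[OF r r' D'(1) C'(1) id_in_block_perms[OF refinesD(1)[OF r]] \<delta>(1) this]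
      show ?thesis by simp
    qed
  next
    fix l assume "l \<in> lifts \<Gamma> \<Psi> \<Lambda> f id"
    note l = liftsD[OF this]
    show "PD_at M \<Gamma> l x \<in> carrier (bar M \<Gamma>)" using PD_at_closed[OF x l(1)] .
    show "PD_at M \<Gamma> l x = PD_at M \<Gamma> m x" if "m \<in> lifts \<Gamma> \<Psi> \<Lambda> f id" "mor_class \<Gamma> \<Psi> l = mor_class \<Gamma> \<Psi> m" for m
      using PD_at_class[OF x l(1)] liftsD(1) that by blast
    obtain \<sigma> where \<sigma>: "\<sigma> \<in> block_perms \<Lambda>" "\<And>y. y \<in> pts \<Gamma> \<Longrightarrow> \<sigma> (f (l y)) = y"
      using two_iso_perm_ex[OF l(2)] by (metis comp_apply id_apply)
    obtain C \<gamma> \<delta> where C: "C \<in> dcosets \<Gamma> \<Lambda> ?\<Psi>'" "\<gamma> \<in> block_perms \<Gamma>" "\<delta> \<in> block_perms ?\<Psi>'"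
      "dcoset_rep C = \<gamma> \<circ> \<sigma> \<circ> \<delta>" using dcoset_ex[OF r r' \<sigma>(1)] .
    note p\<Gamma> = refinesD(1)[OF r] and p\<Lambda> = refinesD(2)[OF r] and p' = refinesD(1)[OF r']
    \<comment> \<open>Admissibility is first shown for \<sigma>, from \<sigma> f l = id on \<Gamma>.
      It passes to the chosen representative because \<gamma> preserves \<Gamma> and \<delta>
      preserves f \<Psi> as partitions.\<close>
    have "\<Gamma> = transport (\<sigma> \<circ> f \<circ> l) \<Gamma>" using \<sigma>(2) transport_cong[OF p\<Gamma>, of id "\<sigma> \<circ> f \<circ> l"] by simp
    also have "\<dots> = transport (\<sigma> \<circ> f) (transport l \<Gamma>)" by (simp add: transport_comp)
    also have "\<dots> \<preceq> transport (\<sigma> \<circ> f) \<Psi>"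
      using refines_transport[OF mor_transport_refines[OF l(1)]] is_morD(4)[OF mor_comp[OF f block_perms_mor[OF p\<Lambda> \<sigma>(1)]]] .
    finally have "transport \<gamma> \<Gamma> \<preceq> transport \<gamma> (transport (\<sigma> \<circ> f) \<Psi>)"
      using refines_transport is_morD(4)[OF block_perms_mor[OF p\<Gamma> C(2)]] refinesD(3) by metis
    hence ref: "\<Gamma> \<preceq> transport (dcoset_rep C) ?\<Psi>'"
      using block_perms_transport[OF p\<Gamma> C(2)] block_perms_transport[OF p' C(3)] C(4) by (simp add: transport_comp)
    hence CL: "C \<in> ?L" using C(1) by simp
    note SC = S[OF b[OF CL] ref]
    note ginv = block_perms_inv[OF p\<Gamma> C(2)]
    have "two_iso \<Gamma> \<Psi> (?k C) l"
      unfolding two_iso_def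
    proof (intro conjI ballI liftsD(1)[OF SC(2)] l(1))
      fix y assume y: "y \<in> pts \<Gamma>"
      hence y': "y \<in> pts \<Lambda>" using refinesD(3)[OF r] by simp
      \<comment> \<open>Shifting the point by the inverse of \<gamma> compensates for the left
        factor of the representative. After cancelling \<gamma> and \<sigma>, the two lifts differ
        by \<delta> in f \<Psi> and by the move from y to z inside a block of \<Gamma>.\<close>
      define z where "z = inv_into UNIV \<gamma> y"
      have z: "\<gamma> z = y" unfolding z_def using ginv(2) by (metis comp_apply id_apply)
      have yz: "(y, z) \<in> rel \<Gamma>" using ginv(1) y by (simp add: block_perms_def z_def)
      hence zG: "z \<in> pts \<Gamma>" using is_partitionD(2)[OF p\<Gamma>] by auto
      have inj: "inj \<gamma>" "inj \<sigma>" using C(2) \<sigma>(1) by (auto simp: block_perms_def permutes_inj)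
      have kP: "?k C y \<in> pts \<Psi>" using mor_inv_into(4)[OF SC(1) y'] .
      have "\<gamma> (\<sigma> (\<delta> (f (?k C y)))) = \<gamma> (\<sigma> (f (l z)))" using SC(3)[OF y'] C(4) \<sigma>(2)[OF zG] z by simp
      hence e: "\<delta> (f (?k C y)) = f (l z)" using inj by (simp add: inj_eq)
      have "f (?k C y) \<in> pts ?\<Psi>'" using kP by simp
      hence "(f (?k C y), f (l z)) \<in> rel ?\<Psi>'" using C(3) e unfolding block_perms_def by auto
      hence "(?k C y, l z) \<in> rel \<Psi>"
        using rel_transport_iff[OF is_morD(1)[OF f] is_morD(4)[OF f] kP is_morD(6)[OF l(1) zG]] by blast
      moreover have "(l z, l y) \<in> rel \<Psi>"
        using is_morD(7)[OF l(1)] is_partitionD(4)[OF p\<Gamma> yz] by blast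
      ultimately show "(?k C y, l y) \<in> rel \<Psi>" using is_partitionD(5)[OF is_morD(1)[OF f]] by blast
    qed
    thus "\<exists>C \<in> ?L. mor_class \<Gamma> \<Psi> (?k C) = mor_class \<Gamma> \<Psi> l"
      using CL mor_class_eq_iff[OF liftsD(1)[OF SC(2)] l(1)] by blast
  qed simp
  finally show "PD_tr M \<Psi> \<Lambda> f x \<Gamma> = of_family \<Lambda> (\<lambda>\<Gamma> k. lift_sum M \<Gamma> \<Psi> \<Lambda> f k x) \<Gamma>"
    using r by (simp add: of_family_apply)
qed

lemma PD_tr_closed:
  "x \<in> carrier (PD_val M \<Psi>) \<Longrightarrow> is_mor \<Psi> \<Lambda> f \<Longrightarrow> PD_tr M \<Psi> \<Lambda> f x \<in> carrier (PD_val M \<Lambda>)"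
  using PD_tr_eq of_family_closed lift_sum_family by metis

lemma PD_at_tr:
  "x \<in> carrier (PD_val M \<Psi>) \<Longrightarrow> is_mor \<Psi> \<Lambda> f \<Longrightarrow> is_mor \<Gamma> \<Lambda> k \<Longrightarrow>
    PD_at M \<Gamma> k (PD_tr M \<Psi> \<Lambda> f x) = lift_sum M \<Gamma> \<Psi> \<Lambda> f k x"
  by (simp add: PD_tr_eq PD_at_of_family[OF lift_sum_family])

end

section \<open>PD of a partition functor\<close>

text \<open>Covers the three records \<open>PD\<close>, \<open>PD_lax\<close> and \<open>PD_power\<close> at once.\<close>

definition is_PD :: "('u, 'a, 'y) pfun_scheme \<Rightarrow> ('u, 'u set_partition \<Rightarrow> 'a set, 'z) pfun_scheme \<Rightarrow> bool" where
  "is_PD M N \<longleftrightarrow> pf_val N = PD_val M \<and> pf_res N = PD_res M \<and> pf_tr N = PD_tr M"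

lemma is_PD_simps:
  assumes "is_PD M N"
  shows "pf_val N = PD_val M" "pf_res N = PD_res M" "pf_tr N = PD_tr M"
  using assms by (auto simp: is_PD_def)

lemma transport_meet:
  assumes "inj \<sigma>"
  shows "transport \<sigma> (meet \<Gamma> \<Lambda>) = meet (transport \<sigma> \<Gamma>) (transport \<sigma> \<Lambda>)"
  using assms by (simp add: transport_def meet_def image_Int prod.inj_map)

text \<open>The permutation \<sigma> is an isomorphism between the two intersections, the middle map
  of a summand in the double coset formula; transport along the injective \<sigma> commutes with
  intersections.\<close>

lemma dcoset_meets:
  assumes "\<Gamma> \<preceq> \<Omega>" "\<Lambda> \<preceq> \<Omega>" "\<sigma> \<in> block_perms \<Omega>"
  defines "A \<equiv> meet (transport (inv_into UNIV \<sigma>) \<Gamma>) \<Lambda>"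
  defines "B \<equiv> meet \<Gamma> (transport \<sigma> \<Lambda>)"
  shows "A \<preceq> \<Lambda>" "B \<preceq> \<Gamma>" "is_iso A B \<sigma>"
    "is_mor \<Theta> B m \<longleftrightarrow> is_mor \<Theta> \<Gamma> m \<and> is_mor \<Theta> (transport \<sigma> \<Lambda>) m"
    "two_iso \<Theta> B m m' \<longleftrightarrow> two_iso \<Theta> \<Gamma> m m' \<and> two_iso \<Theta> (transport \<sigma> \<Lambda>) m m'"
proof -
  note p = refinesD[OF assms(1)] and q = refinesD[OF assms(2)]
  note i = block_perms_inv[OF p(2) assms(3)]
  have per: "\<sigma> permutes pts \<Omega>" "inv_into UNIV \<sigma> permutes pts \<Omega>"
    using assms(3) i(1) by (auto simp: block_perms_def)
  have inj: "inj \<sigma>" "inj (inv_into UNIV \<sigma>)" using per by (auto simp: permutes_inj)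
  have t: "is_partition (transport (inv_into UNIV \<sigma>) \<Gamma>)" "is_partition (transport \<sigma> \<Lambda>)"
    using transport_partition p(1) q(1) inj inj_on_subset[OF _ subset_UNIV] by blast+
  have e: "pts (transport (inv_into UNIV \<sigma>) \<Gamma>) = pts \<Lambda>" "pts \<Gamma> = pts (transport \<sigma> \<Lambda>)"
    using permutes_image per p(3) q(3) by auto
  note m1 = meet_mor_iff[OF t(1) q(1) e(1), folded A_def] and m2 = meet_mor_iff[OF p(1) t(2) e(2), folded B_def]
  show "A \<preceq> \<Lambda>" "B \<preceq> \<Gamma>" using m1 m2 by auto
  show "is_mor \<Theta> B m \<longleftrightarrow> is_mor \<Theta> \<Gamma> m \<and> is_mor \<Theta> (transport \<sigma> \<Lambda>) m"
    "two_iso \<Theta> B m m' \<longleftrightarrow> two_iso \<Theta> \<Gamma> m m' \<and> two_iso \<Theta> (transport \<sigma> \<Lambda>) m m'" using m2 by auto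
  have "transport \<sigma> A = B"
    unfolding A_def B_def transport_meet[OF inj(1)] by (simp add: transport_comp[symmetric] i)
  thus "is_iso A B \<sigma>"
    using iso_transport[OF m1(1) inj_on_subset[OF inj(1) subset_UNIV]] by simp
qed

section \<open>Additivity, functoriality and the double coset formula on PD\<close>

context part_functor begin

lemma PD_res_hom:
  assumes "is_mor \<Lambda> \<Omega> f"
  shows "PD_res M \<Lambda> \<Omega> f \<in> add_hom (PD_val M \<Omega>) (PD_val M \<Lambda>)"
proof (rule add_homI)
  note p = is_morD(1)[OF assms] and q = is_morD(2)[OF assms]
  fix x y assume x: "x \<in> carrier (PD_val M \<Omega>)" and y: "y \<in> carrier (PD_val M \<Omega>)"
  show "PD_res M \<Lambda> \<Omega> f x \<in> carrier (PD_val M \<Lambda>)" using PD_res_closed[OF x assms] .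
  note xy = abelian_groupE(1)[OF PD_group[OF q] x y]
  note rx = PD_res_closed[OF x assms] and ry = PD_res_closed[OF y assms] and rxy = PD_res_closed[OF xy assms]
  show "PD_res M \<Lambda> \<Omega> f (x \<oplus>\<^bsub>PD_val M \<Omega>\<^esub> y) = PD_res M \<Lambda> \<Omega> f x \<oplus>\<^bsub>PD_val M \<Lambda>\<^esub> PD_res M \<Lambda> \<Omega> f y"
  proof (rule PD_at_eqI[OF rxy abelian_groupE(1)[OF PD_group[OF p] rx ry]])
    fix \<Gamma> assume "\<Gamma> \<preceq> \<Lambda>"
    note k = refinesD(5)[OF this]
    show "PD_at M \<Gamma> id (PD_res M \<Lambda> \<Omega> f (x \<oplus>\<^bsub>PD_val M \<Omega>\<^esub> y)) =
        PD_at M \<Gamma> id (PD_res M \<Lambda> \<Omega> f x \<oplus>\<^bsub>PD_val M \<Lambda>\<^esub> PD_res M \<Lambda> \<Omega> f y)"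
      using add_hom_add[OF PD_at_hom[OF k] rx ry] add_hom_add[OF PD_at_hom[OF mor_comp[OF k assms]] x y]
      by (simp add: PD_at_res[OF _ assms k] x y xy)
  qed
qed

lemma lift_sum_hom:
  assumes "is_mor \<Gamma> \<Lambda> k" "is_mor \<Psi> \<Lambda> f"
  shows "lift_sum M \<Gamma> \<Psi> \<Lambda> f k \<in> add_hom (PD_val M \<Psi>) (bar M \<Gamma>)"
proof (rule add_homI)
  note g = bar_group[OF is_morD(1)[OF assms(1)]]
  fix x y assume x: "x \<in> carrier (PD_val M \<Psi>)" and y: "y \<in> carrier (PD_val M \<Psi>)"
  have cx: "PD_at M \<Gamma> l x \<in> carrier (bar M \<Gamma>)" and cy: "PD_at M \<Gamma> l y \<in> carrier (bar M \<Gamma>)"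
    if "l \<in> lifts \<Gamma> \<Psi> \<Lambda> f k" for l using PD_at_closed x y liftsD(1)[OF that] by blast+
  show "lift_sum M \<Gamma> \<Psi> \<Lambda> f k x \<in> carrier (bar M \<Gamma>)"
    unfolding lift_sum_def using cx by (intro class_sum_closed[OF g])
  show "lift_sum M \<Gamma> \<Psi> \<Lambda> f k (x \<oplus>\<^bsub>PD_val M \<Psi>\<^esub> y) =
      lift_sum M \<Gamma> \<Psi> \<Lambda> f k x \<oplus>\<^bsub>bar M \<Gamma>\<^esub> lift_sum M \<Gamma> \<Psi> \<Lambda> f k y"
  proof -
    have "lift_sum M \<Gamma> \<Psi> \<Lambda> f k (x \<oplus>\<^bsub>PD_val M \<Psi>\<^esub> y) = class_sum (bar M \<Gamma>) (mor_class \<Gamma> \<Psi>)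
        (lifts \<Gamma> \<Psi> \<Lambda> f k) (\<lambda>l. PD_at M \<Gamma> l x \<oplus>\<^bsub>bar M \<Gamma>\<^esub> PD_at M \<Gamma> l y)"
      unfolding lift_sum_def
    proof (rule class_sum_cong[OF g])
      fix l assume l: "l \<in> lifts \<Gamma> \<Psi> \<Lambda> f k"
      show "PD_at M \<Gamma> l (x \<oplus>\<^bsub>PD_val M \<Psi>\<^esub> y) = PD_at M \<Gamma> l x \<oplus>\<^bsub>bar M \<Gamma>\<^esub> PD_at M \<Gamma> l y"
        using add_hom_add[OF PD_at_hom[OF liftsD(1)[OF l]] x y] .
      show "PD_at M \<Gamma> l x \<oplus>\<^bsub>bar M \<Gamma>\<^esub> PD_at M \<Gamma> l y \<in> carrier (bar M \<Gamma>)"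
        using abelian_groupE(1)[OF g cx[OF l] cy[OF l]] .
    qed
    thus ?thesis unfolding lift_sum_def using class_sum_add[OF g cx cy] by simp
  qed
qed

lemma PD_tr_hom:
  assumes "is_mor \<Lambda> \<Omega> f"
  shows "PD_tr M \<Lambda> \<Omega> f \<in> add_hom (PD_val M \<Lambda>) (PD_val M \<Omega>)"
proof (rule add_homI)
  note p = is_morD(1)[OF assms] and q = is_morD(2)[OF assms]
  fix x y assume x: "x \<in> carrier (PD_val M \<Lambda>)" and y: "y \<in> carrier (PD_val M \<Lambda>)"
  show "PD_tr M \<Lambda> \<Omega> f x \<in> carrier (PD_val M \<Omega>)" using PD_tr_closed[OF x assms] .
  note xy = abelian_groupE(1)[OF PD_group[OF p] x y]
  note rx = PD_tr_closed[OF x assms] and ry = PD_tr_closed[OF y assms] and rxy = PD_tr_closed[OF xy assms]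
  show "PD_tr M \<Lambda> \<Omega> f (x \<oplus>\<^bsub>PD_val M \<Lambda>\<^esub> y) = PD_tr M \<Lambda> \<Omega> f x \<oplus>\<^bsub>PD_val M \<Omega>\<^esub> PD_tr M \<Lambda> \<Omega> f y"
  proof (rule PD_at_eqI[OF rxy abelian_groupE(1)[OF PD_group[OF q] rx ry]])
    fix \<Gamma> assume "\<Gamma> \<preceq> \<Omega>"
    note k = refinesD(5)[OF this]
    show "PD_at M \<Gamma> id (PD_tr M \<Lambda> \<Omega> f (x \<oplus>\<^bsub>PD_val M \<Lambda>\<^esub> y)) =
        PD_at M \<Gamma> id (PD_tr M \<Lambda> \<Omega> f x \<oplus>\<^bsub>PD_val M \<Omega>\<^esub> PD_tr M \<Lambda> \<Omega> f y)"
      using add_hom_add[OF PD_at_hom[OF k] rx ry] add_hom_add[OF lift_sum_hom[OF k assms] x y]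
      by (simp add: PD_at_tr[OF _ assms k] x y xy)
  qed
qed

lemma lift_sum_single:
  assumes "x \<in> carrier (PD_val M \<Psi>)" "is_partition \<Gamma>" "l \<in> lifts \<Gamma> \<Psi> \<Lambda> f k"
    "\<And>m. m \<in> lifts \<Gamma> \<Psi> \<Lambda> f k \<Longrightarrow> two_iso \<Gamma> \<Psi> m l"
  shows "lift_sum M \<Gamma> \<Psi> \<Lambda> f k x = PD_at M \<Gamma> l x"
  unfolding lift_sum_def
proof (rule class_sum_single[OF bar_group[OF assms(2)] assms(3)])
  note l = liftsD(1)[OF assms(3)]
  show "PD_at M \<Gamma> l x \<in> carrier (bar M \<Gamma>)" using PD_at_closed[OF assms(1) l] .
  fix m assume "m \<in> lifts \<Gamma> \<Psi> \<Lambda> f k"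
  note m = liftsD(1)[OF this] and ml = assms(4)[OF this]
  show "mor_class \<Gamma> \<Psi> m = mor_class \<Gamma> \<Psi> l" using mor_class_eq_iff[OF m l] ml by simp
  show "PD_at M \<Gamma> m x = PD_at M \<Gamma> l x" using PD_at_two_iso[OF assms(1) ml] .
qed

text \<open>A lift \<open>m\<close> of \<open>k\<close> along an isomorphism is 2-isomorphic to the
  inverse of \<open>f\<close> after f m, hence to the inverse of \<open>f\<close> after
  \<open>k\<close>. There is exactly one class of lifts, and the sum has one term.\<close>

lemma PD_at_tr_iso:
  assumes "x \<in> carrier (PD_val M \<Lambda>)" "is_iso \<Lambda> \<Omega> f" "is_mor \<Gamma> \<Omega> k"
  shows "PD_at M \<Gamma> k (PD_tr M \<Lambda> \<Omega> f x) = PD_at M \<Gamma> (inv_into (pts \<Lambda>) f \<circ> k) x"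
proof -
  note f = isoD(1)[OF assms(2)] and i = isoD(1)[OF iso_inv[OF assms(2)]]
  let ?g = "inv_into (pts \<Lambda>) f"
  note gk = mor_comp[OF assms(3) i]
  have "two_iso \<Gamma> \<Omega> (f \<circ> (?g \<circ> k)) k"
    using mor_inv_into(3)[OF f] is_morD(6)[OF assms(3)]
    by (intro two_iso_sym[OF two_iso_cong[OF assms(3)]]) simp
  hence l: "?g \<circ> k \<in> lifts \<Gamma> \<Lambda> \<Omega> f k" using gk by (simp add: lifts_def)
  have "two_iso \<Gamma> \<Lambda> m (?g \<circ> k)" if "m \<in> lifts \<Gamma> \<Lambda> \<Omega> f k" for m
  proof -
    note m = liftsD[OF that]
    have "two_iso \<Gamma> \<Lambda> m (?g \<circ> (f \<circ> m))"
      using mor_inv_into(2)[OF f] is_morD(6)[OF m(1)] by (intro two_iso_cong[OF m(1)]) simp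
    thus ?thesis using two_iso_comp_left[OF m(2) i] two_iso_trans by blast
  qed
  thus ?thesis using lift_sum_single[OF assms(1) is_morD(1)[OF assms(3)] l] PD_at_tr[OF assms(1) f assms(3)] by simp
qed

lemma PD_id:
  assumes "x \<in> carrier (PD_val M \<Lambda>)" "is_partition \<Lambda>"
  shows "PD_res M \<Lambda> \<Lambda> id x = x" "PD_tr M \<Lambda> \<Lambda> id x = x"
proof -
  note i = mor_id[OF assms(2)]
  show "PD_res M \<Lambda> \<Lambda> id x = x"
    using PD_at_res[OF assms(1) i refinesD(5)] by (intro PD_at_eqI[OF PD_res_closed[OF assms(1) i] assms(1)]) simp
  have "PD_at M \<Gamma> id (PD_tr M \<Lambda> \<Lambda> id x) = PD_at M \<Gamma> id x" if "\<Gamma> \<preceq> \<Lambda>" for \<Gamma>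
  proof -
    have "two_iso \<Gamma> \<Lambda> id (inv_into (pts \<Lambda>) id)"
      using refinesD(3)[OF that] by (intro two_iso_cong[OF refinesD(5)[OF that]]) (simp add: inv_into_f_eq)
    thus ?thesis
      using PD_at_tr_iso[OF assms(1) iso_id[OF assms(2)] refinesD(5)[OF that]] PD_at_two_iso[OF assms(1)] by simp
  qed
  thus "PD_tr M \<Lambda> \<Lambda> id x = x" by (intro PD_at_eqI[OF PD_tr_closed[OF assms(1) i] assms(1)])
qed

lemma PD_res_comp:
  assumes "x \<in> carrier (PD_val M \<Theta>)" "is_mor \<Lambda> \<Omega> f" "is_mor \<Omega> \<Theta> g"
  shows "PD_res M \<Lambda> \<Theta> (g \<circ> f) x = PD_res M \<Lambda> \<Omega> f (PD_res M \<Omega> \<Theta> g x)"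
proof -
  note gf = mor_comp[OF assms(2,3)] and c = PD_res_closed[OF assms(1,3)]
  show ?thesis
    using PD_at_res[OF assms(1) gf] PD_at_res[OF c assms(2)] PD_at_res[OF assms(1,3) mor_comp[OF _ assms(2)]]
    by (intro PD_at_eqI[OF PD_res_closed[OF assms(1) gf] PD_res_closed[OF c assms(2)]])
      (simp add: refinesD(5) comp_assoc)
qed

text \<open>Lifts along g f are grouped by the class of f l, which is a lift along \<open>g\<close>.
  The lifts in the group of \<open>m\<close> are exactly the lifts of \<open>m\<close> along
  \<open>f\<close>, so the double sum is the iterated transfer.\<close>

lemma PD_tr_comp:
  assumes x: "x \<in> carrier (PD_val M \<Psi>)" and f: "is_mor \<Psi> \<Lambda> f" and g: "is_mor \<Lambda> \<Theta> g"
  shows "PD_tr M \<Psi> \<Theta> (g \<circ> f) x = PD_tr M \<Lambda> \<Theta> g (PD_tr M \<Psi> \<Lambda> f x)"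
proof -
  note gf = mor_comp[OF f g] and c = PD_tr_closed[OF x f]
  show ?thesis
  proof (rule PD_at_eqI[OF PD_tr_closed[OF x gf] PD_tr_closed[OF c g]])
    fix \<Gamma> assume r: "\<Gamma> \<preceq> \<Theta>"
    note k = refinesD(5)[OF r] and G = bar_group[OF refinesD(1)[OF r]]
    let ?L = "lifts \<Gamma> \<Psi> \<Theta> (g \<circ> f) id" and ?L' = "lifts \<Gamma> \<Lambda> \<Theta> g id"
    have fib: "{l \<in> ?L. mor_class \<Gamma> \<Lambda> (f \<circ> l) = mor_class \<Gamma> \<Lambda> m} = lifts \<Gamma> \<Psi> \<Lambda> f m" if "m \<in> ?L'" for m
    proof -
      note m = liftsD[OF that]
      have "two_iso \<Gamma> \<Theta> (g \<circ> f \<circ> l) id \<and> mor_class \<Gamma> \<Lambda> (f \<circ> l) = mor_class \<Gamma> \<Lambda> m \<longleftrightarrow> two_iso \<Gamma> \<Lambda> (f \<circ> l) m"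
        if l: "is_mor \<Gamma> \<Psi> l" for l
        using mor_class_eq_iff[OF mor_comp[OF l f] m(1)] two_iso_trans[OF two_iso_comp_left[OF _ g] m(2)]
        by (auto simp: comp_assoc)
      thus ?thesis unfolding lifts_def by blast
    qed
    have "lift_sum M \<Gamma> \<Psi> \<Theta> (g \<circ> f) id x =
        class_sum (bar M \<Gamma>) (mor_class \<Gamma> \<Lambda>) ?L'
          (\<lambda>m. class_sum (bar M \<Gamma>) (mor_class \<Gamma> \<Psi>) {l \<in> ?L. mor_class \<Gamma> \<Lambda> (f \<circ> l) = mor_class \<Gamma> \<Lambda> m} (\<lambda>l. PD_at M \<Gamma> l x))"
      unfolding lift_sum_def
    proof (rule class_sum_fibres[OF G finite_mor_class[OF liftsD(1)] finite_mor_class[OF liftsD(1)]])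
      fix l assume "l \<in> ?L"
      note l = liftsD[OF this]
      show "f \<circ> l \<in> ?L'" using mor_comp[OF l(1) f] l(2) by (simp add: lifts_def comp_assoc)
      show "PD_at M \<Gamma> l x \<in> carrier (bar M \<Gamma>)" using PD_at_closed[OF x l(1)] .
      fix m assume "m \<in> ?L" and eq: "mor_class \<Gamma> \<Psi> l = mor_class \<Gamma> \<Psi> m"
      note m = liftsD[OF this(1)]
      show "PD_at M \<Gamma> l x = PD_at M \<Gamma> m x" using PD_at_class[OF x l(1) m(1) eq] .
      show "mor_class \<Gamma> \<Lambda> (f \<circ> l) = mor_class \<Gamma> \<Lambda> (f \<circ> m)"
        using eq two_iso_comp_left[OF _ f]
        by (simp add: mor_class_eq_iff l(1) m(1) mor_comp[OF l(1) f] mor_comp[OF m(1) f])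
    qed
    also have "\<dots> = lift_sum M \<Gamma> \<Lambda> \<Theta> g id (PD_tr M \<Psi> \<Lambda> f x)"
      unfolding lift_sum_def[of M \<Gamma> \<Lambda> \<Theta> g]
    proof (rule class_sum_cong[OF G])
      fix m assume m: "m \<in> ?L'"
      show "class_sum (bar M \<Gamma>) (mor_class \<Gamma> \<Psi>) {l \<in> ?L. mor_class \<Gamma> \<Lambda> (f \<circ> l) = mor_class \<Gamma> \<Lambda> m} (\<lambda>l. PD_at M \<Gamma> l x)
          = PD_at M \<Gamma> m (PD_tr M \<Psi> \<Lambda> f x)"
        unfolding fib[OF m] PD_at_tr[OF x f liftsD(1)[OF m]] lift_sum_def ..
      show "PD_at M \<Gamma> m (PD_tr M \<Psi> \<Lambda> f x) \<in> carrier (bar M \<Gamma>)" using PD_at_closed[OF c liftsD(1)[OF m]] .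
    qed
    finally show "PD_at M \<Gamma> id (PD_tr M \<Psi> \<Theta> (g \<circ> f) x) = PD_at M \<Gamma> id (PD_tr M \<Lambda> \<Theta> g (PD_tr M \<Psi> \<Lambda> f x))"
      by (simp add: PD_at_tr[OF x gf k] PD_at_tr[OF c g k])
  qed
qed

text \<open>For the transfers, 2-isomorphic morphisms have literally the same sets of lifts, so the
  sums coincide. For the restrictions, the values of \<open>x\<close> are compared at 2-isomorphic
  composites.\<close>

lemma PD_two_iso:
  assumes "two_iso \<Lambda> \<Omega> f g"
  shows "x \<in> carrier (PD_val M \<Omega>) \<Longrightarrow> PD_res M \<Lambda> \<Omega> f x = PD_res M \<Lambda> \<Omega> g x"
    "y \<in> carrier (PD_val M \<Lambda>) \<Longrightarrow> PD_tr M \<Lambda> \<Omega> f y = PD_tr M \<Lambda> \<Omega> g y"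
proof -
  note f = two_isoD(1)[OF assms] and g = two_isoD(2)[OF assms]
  show "PD_res M \<Lambda> \<Omega> f x = PD_res M \<Lambda> \<Omega> g x" if x: "x \<in> carrier (PD_val M \<Omega>)"
    using PD_at_two_iso[OF x two_iso_comp_right[OF assms refinesD(5)]]
    by (intro PD_at_eqI[OF PD_res_closed[OF x f] PD_res_closed[OF x g]])
      (simp add: PD_at_res[OF x f refinesD(5)] PD_at_res[OF x g refinesD(5)])
  have "lifts \<Gamma> \<Lambda> \<Omega> f id = lifts \<Gamma> \<Lambda> \<Omega> g id" for \<Gamma>
    unfolding lifts_def using two_iso_trans two_iso_comp_right[OF assms] two_iso_comp_right[OF two_iso_sym[OF assms]] by blast
  thus "PD_tr M \<Lambda> \<Omega> f y = PD_tr M \<Lambda> \<Omega> g y" if y: "y \<in> carrier (PD_val M \<Lambda>)"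
    by (intro PD_at_eqI[OF PD_tr_closed[OF y f] PD_tr_closed[OF y g]])
      (simp add: PD_at_tr[OF y f refinesD(5)] PD_at_tr[OF y g refinesD(5)] lift_sum_def)
qed

lemma PD_tr_iso:
  assumes "x \<in> carrier (PD_val M \<Lambda>)" "is_iso \<Lambda> \<Omega> f"
  shows "PD_tr M \<Lambda> \<Omega> f x = PD_res M \<Omega> \<Lambda> (inv_into (pts \<Lambda>) f) x"
  using PD_at_tr_iso[OF assms refinesD(5)] PD_at_res[OF assms(1) isoD(1)[OF iso_inv[OF assms(2)]] refinesD(5)]
  by (intro PD_at_eqI[OF PD_tr_closed[OF assms(1) isoD(1)[OF assms(2)]] PD_res_closed[OF assms(1) isoD(1)[OF iso_inv[OF assms(2)]]]])
    simp

text \<open>The middle transfer is along an isomorphism and only composes with the inverse of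
  \<sigma>. What remains is the sum over classes of morphisms into the intersection that are
  2-isomorphic to the identity over \<Gamma>.\<close>

lemma PD_dcoset_summand:
  assumes x: "x \<in> carrier (PD_val M \<Lambda>)" and r: "\<Gamma> \<preceq> \<Omega>" "\<Lambda> \<preceq> \<Omega>" and \<sigma>: "\<sigma> \<in> block_perms \<Omega>"
    and N: "is_PD M N"
  shows "dcoset_summand N \<Gamma> \<Lambda> \<sigma> x \<in> carrier (PD_val M \<Gamma>)"
    "\<Theta> \<preceq> \<Gamma> \<Longrightarrow> PD_at M \<Theta> id (dcoset_summand N \<Gamma> \<Lambda> \<sigma> x) =
      class_sum (bar M \<Theta>) (mor_class \<Theta> (meet \<Gamma> (transport \<sigma> \<Lambda>))) (lifts \<Theta> (meet \<Gamma> (transport \<sigma> \<Lambda>)) \<Gamma> id id)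
        (\<lambda>m. PD_at M \<Theta> (inv_into UNIV \<sigma> \<circ> m) x)"
proof -
  define A where "A = meet (transport (inv_into UNIV \<sigma>) \<Gamma>) \<Lambda>"
  define B where "B = meet \<Gamma> (transport \<sigma> \<Lambda>)"
  note AB = dcoset_meets[OF r \<sigma>, folded A_def B_def]
  note s = isoD(1)[OF AB(3)]
  note c1 = PD_res_closed[OF x refinesD(5)[OF AB(1)]]
  note c2 = PD_tr_closed[OF c1 s]
  have d: "dcoset_summand N \<Gamma> \<Lambda> \<sigma> x = PD_tr M B \<Gamma> id (PD_tr M A B \<sigma> (PD_res M A \<Lambda> id x))"
    by (simp add: dcoset_summand_def A_def B_def Let_def is_PD_simps[OF N])
  show "dcoset_summand N \<Gamma> \<Lambda> \<sigma> x \<in> carrier (PD_val M \<Gamma>)"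
    unfolding d using PD_tr_closed[OF c2 refinesD(5)[OF AB(2)]] .
  assume t: "\<Theta> \<preceq> \<Gamma>"
  have "PD_at M \<Theta> m (PD_tr M A B \<sigma> (PD_res M A \<Lambda> id x)) = PD_at M \<Theta> (inv_into UNIV \<sigma> \<circ> m) x"
    "PD_at M \<Theta> (inv_into UNIV \<sigma> \<circ> m) x \<in> carrier (bar M \<Theta>)"
    if "m \<in> lifts \<Theta> B \<Gamma> id id" for m
  proof -
    note m = liftsD(1)[OF that]
    note mA = mor_comp[OF m isoD(1)[OF iso_inv[OF AB(3)]]]
    note mL = mor_coarsen[OF mA AB(1)]
    \<comment> \<open>Transfer along \<sigma> uses its inverse on the points of the intersection,
      whereas the statement uses the inverse of the whole permutation; injectivity of \<sigma>
      identifies the two at the values of \<open>m\<close>.\<close>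
    have e: "inv_into (pts A) \<sigma> (m y) = inv_into UNIV \<sigma> (m y)" if "y \<in> pts \<Theta>" for y
    proof -
      have "\<sigma> (inv_into (pts A) \<sigma> (m y)) = m y" using mor_inv_into(3)[OF s] is_morD(6)[OF m that] .
      moreover have "inj \<sigma>" using \<sigma> by (auto simp: block_perms_def permutes_inj)
      ultimately show ?thesis by (metis inv_f_f)
    qed
    have "two_iso \<Theta> \<Lambda> (inv_into (pts A) \<sigma> \<circ> m) (inv_into UNIV \<sigma> \<circ> m)"
      using e by (intro two_iso_cong[OF mL]) simp
    note ti = this PD_at_two_iso[OF x this]
    show "PD_at M \<Theta> m (PD_tr M A B \<sigma> (PD_res M A \<Lambda> id x)) = PD_at M \<Theta> (inv_into UNIV \<sigma> \<circ> m) x"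
      using PD_at_tr_iso[OF c1 AB(3) m] PD_at_res[OF x refinesD(5)[OF AB(1)] mA] ti by simp
    show "PD_at M \<Theta> (inv_into UNIV \<sigma> \<circ> m) x \<in> carrier (bar M \<Theta>)" using PD_at_closed[OF x two_isoD(2)[OF ti(1)]] .
  qed
  thus "PD_at M \<Theta> id (dcoset_summand N \<Gamma> \<Lambda> \<sigma> x) =
      class_sum (bar M \<Theta>) (mor_class \<Theta> (meet \<Gamma> (transport \<sigma> \<Lambda>))) (lifts \<Theta> (meet \<Gamma> (transport \<sigma> \<Lambda>)) \<Gamma> id id)
        (\<lambda>m. PD_at M \<Theta> (inv_into UNIV \<sigma> \<circ> m) x)"
    unfolding d PD_at_tr[OF c2 refinesD(5)[OF AB(2)] refinesD(5)[OF t]] lift_sum_def B_def[symmetric]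
    by (intro class_sum_cong[OF bar_group[OF refinesD(1)[OF t]]])
qed

text \<open>At a refinement \<Theta> of \<Gamma> the left side sums over lifts l of \<Theta> to
  \<Lambda> that are 2-isomorphic to the identity over \<Omega>. Each extends to a permutation
  \<tau> of \<Omega> with \<tau> l = id on points, whose double coset depends only on the class of
  l. Grouping by double cosets and writing the lifts over \<open>C\<close> as the inverse of its
  representative after maps into the intersection gives the right side term by term.\<close>

lemma PD_double_coset:
  assumes x: "x \<in> carrier (PD_val M \<Lambda>)" and r: "\<Gamma> \<preceq> \<Omega>" "\<Lambda> \<preceq> \<Omega>" and N: "is_PD M N"
  shows "PD_res M \<Gamma> \<Omega> id (PD_tr M \<Lambda> \<Omega> id x) =
    (\<Oplus>\<^bsub>PD_val M \<Gamma>\<^esub> C \<in> dcosets \<Gamma> \<Omega> \<Lambda>. dcoset_summand N \<Gamma> \<Lambda> (dcoset_rep C) x)"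
proof -
  note pG = refinesD(1)[OF r(1)] and pL = refinesD(1)[OF r(2)] and pO = refinesD(2)[OF r(1)]
  note mG = refinesD(5)[OF r(1)] and mL = refinesD(5)[OF r(2)]
  note c = PD_tr_closed[OF x mL]
  have \<sigma>: "dcoset_rep C \<in> block_perms \<Omega>" if "C \<in> dcosets \<Gamma> \<Omega> \<Lambda>" for C using dcoset_rep_mem(2)[OF r that] .
  have sc: "dcoset_summand N \<Gamma> \<Lambda> (dcoset_rep C) x \<in> carrier (PD_val M \<Gamma>)" if "C \<in> dcosets \<Gamma> \<Omega> \<Lambda>" for C
    using PD_dcoset_summand(1)[OF x r \<sigma>[OF that] N] .
  show ?thesis
  proof (rule PD_at_eqI[OF PD_res_closed[OF c mG] finsum_mem[OF PD_group[OF pG] sc]])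
    fix \<Theta> assume t: "\<Theta> \<preceq> \<Gamma>"
    note G = bar_group[OF refinesD(1)[OF t]]
    note tO = refines_trans[OF t r(1)]
    let ?L = "lifts \<Theta> \<Lambda> \<Omega> id id" and ?D = "dcosets \<Gamma> \<Omega> \<Lambda>"
    \<comment> \<open>This says that l belongs to the double coset \<open>C\<close>, phrased through
      its fixed representative: after a correction of l by \<delta>, the representative carries l to
      a permutation of \<Gamma>.\<close>
    define D where "D C l \<longleftrightarrow> C \<in> ?D \<and> (\<exists>\<gamma> \<in> block_perms \<Gamma>. \<exists>\<delta> \<in> block_perms \<Lambda>.
        \<forall>y \<in> pts \<Theta>. dcoset_rep C (\<delta> (l y)) = \<gamma> y)" for C l
    have ex: "\<exists>C. D C l" if "l \<in> ?L" for l
    proof -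
      note l = liftsD[OF that]
      obtain \<tau> where \<tau>: "\<tau> \<in> block_perms \<Omega>" "\<And>y. y \<in> pts \<Theta> \<Longrightarrow> \<tau> (l y) = y"
        using two_iso_perm_ex[OF l(2)] by (metis comp_apply id_apply)
      obtain C \<gamma> \<delta> where C: "C \<in> ?D" "\<gamma> \<in> block_perms \<Gamma>" "\<delta> \<in> block_perms \<Lambda>"
        "dcoset_rep C = \<gamma> \<circ> \<tau> \<circ> \<delta>" using dcoset_ex[OF r \<tau>(1)] .
      note i = block_perms_inv[OF pL C(3)]
      have "dcoset_rep C (inv_into UNIV \<delta> (l y)) = \<gamma> y" if "y \<in> pts \<Theta>" for y
        using C(4) i(2) \<tau>(2)[OF that] by (metis comp_apply id_apply)
      thus ?thesis unfolding D_def using C(1,2) i(1) by blast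
    qed
    \<comment> \<open>Every point of \<Omega> is \<delta>' l' y for some y. There the representative
      of \<open>C'\<close> takes the value \<gamma>' y, and y is expressed through the
      representative of \<open>C\<close> by means of l y, which \<epsilon> maps to l' y. This
      exhibits the left and right factors relating the two representatives.\<close>
    have unique: "C = C'" if h: "D C l" "D C' l'" "two_iso \<Theta> \<Lambda> l l'" for C C' l l'
    proof -
      obtain \<gamma> \<delta> where C: "C \<in> ?D" "\<gamma> \<in> block_perms \<Gamma>" "\<delta> \<in> block_perms \<Lambda>"
        "\<And>y. y \<in> pts \<Theta> \<Longrightarrow> dcoset_rep C (\<delta> (l y)) = \<gamma> y" using h(1) unfolding D_def by blast
      obtain \<gamma>' \<delta>' where C': "C' \<in> ?D" "\<gamma>' \<in> block_perms \<Gamma>" "\<delta>' \<in> block_perms \<Lambda>"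
        "\<And>y. y \<in> pts \<Theta> \<Longrightarrow> dcoset_rep C' (\<delta>' (l' y)) = \<gamma>' y" using h(2) unfolding D_def by blast
      obtain \<epsilon> where \<epsilon>: "\<epsilon> \<in> block_perms \<Lambda>" "\<And>y. y \<in> pts \<Theta> \<Longrightarrow> \<epsilon> (l y) = l' y"
        using two_iso_perm_ex[OF h(3)] by blast
      note ig = block_perms_inv[OF pG C(2)] and id' = block_perms_inv[OF pL C'(3)] and ie = block_perms_inv[OF pL \<epsilon>(1)]
      show ?thesis
      proof (rule dcoset_eqI[OF r C(1) C'(1)])
        show "\<gamma>' \<circ> inv_into UNIV \<gamma> \<in> block_perms \<Gamma>" using block_perms_comp[OF pG C'(2) ig(1)] .
        show "\<delta> \<circ> inv_into UNIV \<epsilon> \<circ> inv_into UNIV \<delta>' \<in> block_perms \<Lambda>"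
          using block_perms_comp[OF pL block_perms_comp[OF pL C(3) ie(1)] id'(1)] .
        fix w assume w: "w \<in> pts \<Omega>"
        hence "inv_into UNIV \<delta>' w \<in> pts \<Lambda>"
          using is_morD(6)[OF block_perms_mor[OF pL id'(1)]] refinesD(3)[OF r(2)] by simp
        then obtain y where y: "y \<in> pts \<Theta>" "inv_into UNIV \<delta>' w = l' y"
          using is_morD(5)[OF two_isoD(2)[OF h(3)]] by blast
        have "\<delta>' (l' y) = w" using y(2) id'(2) by (metis comp_apply id_apply)
        hence "dcoset_rep C' w = \<gamma>' y" using C'(4)[OF y(1)] by simp
        moreover have "inv_into UNIV \<epsilon> (l' y) = l y" using \<epsilon>(2)[OF y(1)] ie(3) by (metis comp_apply id_apply)
        moreover have "inv_into UNIV \<gamma> (\<gamma> y) = y" using ig(3) by (metis comp_apply id_apply)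
        ultimately show "dcoset_rep C' w = (\<gamma>' \<circ> inv_into UNIV \<gamma>) (dcoset_rep C ((\<delta> \<circ> inv_into UNIV \<epsilon> \<circ> inv_into UNIV \<delta>') w))"
          using y C(4)[OF y(1)] by simp
      qed
    qed
    \<comment> \<open>The choice is harmless: by \<open>unique\<close>, the double coset of a lift
      is determined and agrees on 2-isomorphic lifts.\<close>
    define P where "P l = (SOME C. D C l)" for l
    have P: "D (P l) l" if "l \<in> ?L" for l unfolding P_def using someI_ex[OF ex[OF that]] .
    have "PD_at M \<Theta> id (PD_res M \<Gamma> \<Omega> id (PD_tr M \<Lambda> \<Omega> id x)) = lift_sum M \<Theta> \<Lambda> \<Omega> id id x"
      using PD_at_res[OF c mG refinesD(5)[OF t]] PD_at_tr[OF x mL refinesD(5)[OF tO]] by simp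
    also have "\<dots> = class_sum (bar M \<Theta>) id ?D
        (\<lambda>C. class_sum (bar M \<Theta>) (mor_class \<Theta> \<Lambda>) {l \<in> ?L. id (P l) = id C} (\<lambda>l. PD_at M \<Theta> l x))"
      unfolding lift_sum_def
    proof (rule class_sum_fibres[OF G _ finite_mor_class[OF liftsD(1)]])
      show "finite (id ` ?D)" using finite_dcosets[OF r] by simp
      fix l assume L: "l \<in> ?L"
      note l = liftsD[OF L]
      show "P l \<in> ?D" using P[OF L] by (simp add: D_def)
      show "PD_at M \<Theta> l x \<in> carrier (bar M \<Theta>)" using PD_at_closed[OF x l(1)] .
      fix m assume L': "m \<in> ?L" and eq: "mor_class \<Theta> \<Lambda> l = mor_class \<Theta> \<Lambda> m"
      note m = liftsD[OF L']
      show "PD_at M \<Theta> l x = PD_at M \<Theta> m x" using PD_at_class[OF x l(1) m(1) eq] .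
      have "two_iso \<Theta> \<Lambda> l m" using eq mor_class_eq_iff[OF l(1) m(1)] by simp
      thus "id (P l) = id (P m)" using unique[OF P[OF L] P[OF L']] by simp
    qed
    also have "\<dots> = class_sum (bar M \<Theta>) id ?D (\<lambda>C. PD_at M \<Theta> id (dcoset_summand N \<Gamma> \<Lambda> (dcoset_rep C) x))"
    proof (rule class_sum_cong[OF G])
      fix C assume C: "C \<in> ?D"
      show "PD_at M \<Theta> id (dcoset_summand N \<Gamma> \<Lambda> (dcoset_rep C) x) \<in> carrier (bar M \<Theta>)"
        using PD_at_closed[OF sc[OF C] refinesD(5)[OF t]] .
      define s where "s = dcoset_rep C"
      define B where "B = meet \<Gamma> (transport s \<Lambda>)"
      have s: "s \<in> block_perms \<Omega>" using \<sigma>[OF C] by (simp add: s_def)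
      note si = block_perms_inv[OF pO s]
      note AB = dcoset_meets[OF r s, folded B_def]
      have injs: "inj_on s (pts \<Lambda>)" using s by (auto simp: block_perms_def permutes_inj_on)
      note ts = transport_mor[OF pL injs]
      let ?F = "\<lambda>m. inv_into UNIV s \<circ> m"
      have ti: "is_mor (transport s \<Lambda>) \<Lambda> (inv_into UNIV s)"
      proof (rule mor_cong[OF isoD(1)[OF iso_inv[OF iso_transport[OF pL injs]]]])
        fix y assume "y \<in> pts (transport s \<Lambda>)"
        then obtain z where z: "z \<in> pts \<Lambda>" "y = s z" by auto
        have "inv_into UNIV s (s z) = z" using si(3) by (metis comp_apply id_apply)
        thus "inv_into (pts \<Lambda>) s y = inv_into UNIV s y" using inv_into_f_f[OF injs z(1)] z(2) by simp
      qed
      \<comment> \<open>Over the fixed double coset the lifts are parametrised by maps m into the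
        intersection of \<Gamma> and s \<Lambda> that are 2-isomorphic to the identity over
        \<Gamma>; m corresponds to the inverse of s after m.\<close>
      have "class_sum (bar M \<Theta>) (mor_class \<Theta> B) (lifts \<Theta> B \<Gamma> id id) (\<lambda>m. PD_at M \<Theta> (?F m) x)
          = class_sum (bar M \<Theta>) (mor_class \<Theta> \<Lambda>) {l \<in> ?L. id (P l) = id C} (\<lambda>l. PD_at M \<Theta> l x)"
      proof (rule class_sum_bij[OF G, where F = ?F])
        fix m assume "m \<in> lifts \<Theta> B \<Gamma> id id"
        hence m: "is_mor \<Theta> B m" "two_iso \<Theta> \<Gamma> m id" by (auto simp: lifts_def)
        have m': "is_mor \<Theta> (transport s \<Lambda>) m" using m(1) AB(4) by blast
        note F = mor_comp[OF m' ti]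
        have "two_iso \<Theta> \<Omega> (?F m) (id \<circ> m)"
          using two_iso_comp_right[OF block_perms_two_iso[OF pO si(1)] mor_coarsen[OF two_isoD(1)[OF m(2)] r(1)]] .
        moreover have "two_iso \<Theta> \<Omega> m id" using two_iso_comp_left[OF m(2) mG] by simp
        ultimately have FL: "?F m \<in> ?L" using F two_iso_trans by (fastforce simp: lifts_def)
        obtain \<gamma> where \<gamma>: "\<gamma> \<in> block_perms \<Gamma>" "\<And>y. y \<in> pts \<Theta> \<Longrightarrow> \<gamma> y = m y"
          using two_iso_perm_ex[OF two_iso_sym[OF m(2)]] by (metis id_apply)
        have "s (inv_into UNIV s (m y)) = m y" for y using si(2) by (metis comp_apply id_apply)
        hence "D C (?F m)" unfolding D_def s_def[symmetric]
          using C \<gamma> by (intro conjI bexI[of _ \<gamma>] bexI[OF _ id_in_block_perms[OF pL]]) auto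
        hence "P (?F m) = C" using unique[OF P[OF FL] _ two_iso_refl[OF F]] by blast
        thus "?F m \<in> {l \<in> ?L. id (P l) = id C}" using FL by simp
        fix m2 assume "m2 \<in> lifts \<Theta> B \<Gamma> id id"
        hence n: "is_mor \<Theta> B m2" "two_iso \<Theta> \<Gamma> m2 id" by (auto simp: lifts_def)
        have n': "is_mor \<Theta> (transport s \<Lambda>) m2" using n(1) AB(4) by blast
        note F2 = mor_comp[OF n' ti]
        show "mor_class \<Theta> \<Lambda> (?F m) = mor_class \<Theta> \<Lambda> (?F m2)" if "mor_class \<Theta> B m = mor_class \<Theta> B m2"
        proof -
          have "two_iso \<Theta> (transport s \<Lambda>) m m2" using that mor_class_eq_iff[OF m(1) n(1)] AB(5) by blast
          thus ?thesis using two_iso_comp_left[OF _ ti] mor_class_eq_iff[OF F F2] by blast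
        qed
        \<comment> \<open>Composing with s recovers the relation of the two maps over s \<Lambda>.
          Over \<Gamma> they are related in any case, both being 2-isomorphic to the identity, so
          they are related in the intersection.\<close>
        show "mor_class \<Theta> B m = mor_class \<Theta> B m2" if "mor_class \<Theta> \<Lambda> (?F m) = mor_class \<Theta> \<Lambda> (?F m2)"
        proof -
          have "two_iso \<Theta> \<Lambda> (?F m) (?F m2)" using that mor_class_eq_iff[OF F F2] by blast
          from two_iso_comp_left[OF this ts] have "two_iso \<Theta> (transport s \<Lambda>) m m2"
            by (simp add: comp_assoc[symmetric] si)
          moreover have "two_iso \<Theta> \<Gamma> m m2" using m(2) n(2) two_iso_trans two_iso_sym by blast
          ultimately show ?thesis using AB(5) mor_class_eq_iff[OF m(1) n(1)] by blast
        qed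
      next
        fix l assume "l \<in> {l \<in> ?L. id (P l) = id C}"
        hence L: "l \<in> ?L" and PC: "P l = C" by auto
        note l = liftsD[OF L]
        show "PD_at M \<Theta> l x \<in> carrier (bar M \<Theta>)" using PD_at_closed[OF x l(1)] .
        show "PD_at M \<Theta> l x = PD_at M \<Theta> m x"
          if "m \<in> {l \<in> ?L. id (P l) = id C}" "mor_class \<Theta> \<Lambda> l = mor_class \<Theta> \<Lambda> m" for m
          using PD_at_class[OF x l(1) _ that(2)] that(1) liftsD(1) by blast
        obtain \<gamma> \<delta> where gd: "\<gamma> \<in> block_perms \<Gamma>" "\<delta> \<in> block_perms \<Lambda>"
          "\<And>y. y \<in> pts \<Theta> \<Longrightarrow> s (\<delta> (l y)) = \<gamma> y" using P[OF L] unfolding D_def PC s_def by blast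
        \<comment> \<open>The preimage of the class of l. By the choice of \<gamma> and \<delta>
          this map agrees with \<gamma> on points and so is 2-isomorphic to the identity over
          \<Gamma>, and undoing s leaves \<delta> l, which is in the class of l.\<close>
        define m where "m = s \<circ> (\<delta> \<circ> l)"
        note dl = mor_comp[OF l(1) block_perms_mor[OF pL gd(2)]]
        have m1: "is_mor \<Theta> (transport s \<Lambda>) m" unfolding m_def using mor_comp[OF dl ts] .
        have "two_iso \<Theta> \<Gamma> \<gamma> id" using two_iso_comp_right[OF block_perms_two_iso[OF pG gd(1)] refinesD(5)[OF t]] by simp
        moreover have "two_iso \<Theta> \<Gamma> \<gamma> m"
          using gd(3) by (intro two_iso_cong[OF mor_refines[OF block_perms_mor[OF pG gd(1)] t]]) (simp add: m_def)
        ultimately have m2: "two_iso \<Theta> \<Gamma> m id" using two_iso_trans two_iso_sym by blast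
        have mL: "m \<in> lifts \<Theta> B \<Gamma> id id" using m1 m2 AB(4) two_isoD(1)[OF m2] by (simp add: lifts_def)
        have "?F m = \<delta> \<circ> l" by (simp add: m_def comp_assoc[symmetric] si)
        moreover have "two_iso \<Theta> \<Lambda> (\<delta> \<circ> l) l"
          using two_iso_comp_right[OF block_perms_two_iso[OF pL gd(2)] l(1)] by simp
        ultimately have "mor_class \<Theta> \<Lambda> (?F m) = mor_class \<Theta> \<Lambda> l" using mor_class_eq_iff[OF dl l(1)] by simp
        thus "\<exists>m \<in> lifts \<Theta> B \<Gamma> id id. mor_class \<Theta> \<Lambda> (?F m) = mor_class \<Theta> \<Lambda> l" using mL by blast
      qed simp
      thus "class_sum (bar M \<Theta>) (mor_class \<Theta> \<Lambda>) {l \<in> ?L. id (P l) = id C} (\<lambda>l. PD_at M \<Theta> l x)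
          = PD_at M \<Theta> id (dcoset_summand N \<Gamma> \<Lambda> (dcoset_rep C) x)"
        using PD_dcoset_summand(2)[OF x r s N t] by (simp add: s_def B_def)
    qed
    also have "\<dots> = (\<Oplus>\<^bsub>bar M \<Theta>\<^esub> C \<in> ?D. PD_at M \<Theta> id (dcoset_summand N \<Gamma> \<Lambda> (dcoset_rep C) x))"
      using PD_at_closed[OF sc refinesD(5)[OF t]] by (intro finsum_class_sum[OF G, symmetric])
    also have "\<dots> = PD_at M \<Theta> id (\<Oplus>\<^bsub>PD_val M \<Gamma>\<^esub> C \<in> ?D. dcoset_summand N \<Gamma> \<Lambda> (dcoset_rep C) x)"
      using sc by (intro add_hom_finsum[OF PD_group[OF pG] G PD_at_hom[OF refinesD(5)[OF t]], symmetric])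
    finally show "PD_at M \<Theta> id (PD_res M \<Gamma> \<Omega> id (PD_tr M \<Lambda> \<Omega> id x)) =
      PD_at M \<Theta> id (\<Oplus>\<^bsub>PD_val M \<Gamma>\<^esub> C \<in> ?D. dcoset_summand N \<Gamma> \<Lambda> (dcoset_rep C) x)" .
  qed
qed

theorem PD_partition_functor:
  assumes N: "is_PD M N"
  shows "partition_functor N"
  unfolding partition_functor_def is_PD_simps[OF N]
  by (intro conjI allI impI ballI; (elim conjE)?)
    (rule PD_group PD_res_hom PD_tr_hom PD_id PD_res_comp PD_tr_comp PD_two_iso PD_tr_iso
      PD_double_coset[OF _ _ _ N]; assumption)+

end

section \<open>Morphisms and the monad axioms\<close>

lemma part_functorD: "partition_functor M \<Longrightarrow> part_functor M"
  by (simp add: part_functor_def)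

lemma pf_morphismD:
  assumes "pf_morphism M N \<phi>"
  shows "is_partition \<Lambda> \<Longrightarrow> \<phi> \<Lambda> \<in> add_hom (pf_val M \<Lambda>) (pf_val N \<Lambda>)"
    "is_partition \<Lambda> \<Longrightarrow> z \<in> pf_carrier M \<Lambda> \<Longrightarrow> \<phi> \<Lambda> z \<in> pf_carrier N \<Lambda>"
    "is_mor \<Lambda> \<Omega> f \<Longrightarrow> x \<in> pf_carrier M \<Omega> \<Longrightarrow> \<phi> \<Lambda> (pf_res M \<Lambda> \<Omega> f x) = pf_res N \<Lambda> \<Omega> f (\<phi> \<Omega> x)"
    "is_mor \<Lambda> \<Omega> f \<Longrightarrow> y \<in> pf_carrier M \<Lambda> \<Longrightarrow> \<phi> \<Omega> (pf_tr M \<Lambda> \<Omega> f y) = pf_tr N \<Lambda> \<Omega> f (\<phi> \<Lambda> y)"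
proof -
  note A = assms[unfolded pf_morphism_def]
  show 1: "is_partition \<Lambda> \<Longrightarrow> \<phi> \<Lambda> \<in> add_hom (pf_val M \<Lambda>) (pf_val N \<Lambda>)" using A by blast
  show "is_partition \<Lambda> \<Longrightarrow> z \<in> pf_carrier M \<Lambda> \<Longrightarrow> \<phi> \<Lambda> z \<in> pf_carrier N \<Lambda>"
    using add_hom_closed[OF 1] .
  show "is_mor \<Lambda> \<Omega> f \<Longrightarrow> x \<in> pf_carrier M \<Omega> \<Longrightarrow> \<phi> \<Lambda> (pf_res M \<Lambda> \<Omega> f x) = pf_res N \<Lambda> \<Omega> f (\<phi> \<Omega> x)"
    using A[THEN conjunct2] by blast
  show "is_mor \<Lambda> \<Omega> f \<Longrightarrow> y \<in> pf_carrier M \<Lambda> \<Longrightarrow> \<phi> \<Omega> (pf_tr M \<Lambda> \<Omega> f y) = pf_tr N \<Lambda> \<Omega> f (\<phi> \<Lambda> y)"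
    using A[THEN conjunct2] by blast
qed

text \<open>Both \<open>PD_map\<close> and \<open>PD_mu\<close> are of this form, for a family \<open>\<alpha>\<close> of homomorphisms
  $\bar M(\Gamma)\to\bar N(\Gamma)$ that is natural in isomorphisms.\<close>

definition comp_map :: "('u set_partition \<Rightarrow> 'a \<Rightarrow> 'b) \<Rightarrow> 'u set_partition \<Rightarrow>
    ('u set_partition \<Rightarrow> 'a) \<Rightarrow> ('u set_partition \<Rightarrow> 'b)" where
  "comp_map \<alpha> \<Lambda> x = (\<lambda>\<Gamma> \<in> {\<Gamma>. \<Gamma> \<preceq> \<Lambda>}. \<alpha> \<Gamma> (x \<Gamma>))"

lemma PD_map_comp_map: "PD_map N \<phi> = comp_map (bar_map N \<phi>)"
  and PD_mu_comp_map: "PD_mu = comp_map bar_proj"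
  by (simp_all add: fun_eq_iff PD_map_def PD_mu_def comp_map_def)

definition bar_natural :: "('u, 'a, 'y) pfun_scheme \<Rightarrow> ('u, 'b, 'z) pfun_scheme \<Rightarrow>
    ('u set_partition \<Rightarrow> 'a set \<Rightarrow> 'b set) \<Rightarrow> bool" where
  "bar_natural M N \<alpha> \<longleftrightarrow>
     (\<forall>\<Gamma>. is_partition \<Gamma> \<longrightarrow> \<alpha> \<Gamma> \<in> add_hom (bar M \<Gamma>) (bar N \<Gamma>)) \<and>
     (\<forall>\<Gamma> \<Gamma>' f. is_iso \<Gamma> \<Gamma>' f \<longrightarrow> (\<forall>y \<in> carrier (bar M \<Gamma>).
        \<alpha> \<Gamma>' (bar_tr M \<Gamma> \<Gamma>' f y) = bar_tr N \<Gamma> \<Gamma>' f (\<alpha> \<Gamma> y)))"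

lemma bar_naturalD:
  assumes "bar_natural M N \<alpha>"
  shows "is_partition \<Gamma> \<Longrightarrow> \<alpha> \<Gamma> \<in> add_hom (bar M \<Gamma>) (bar N \<Gamma>)"
    "is_partition \<Gamma> \<Longrightarrow> z \<in> carrier (bar M \<Gamma>) \<Longrightarrow> \<alpha> \<Gamma> z \<in> carrier (bar N \<Gamma>)"
    "is_iso \<Gamma> \<Gamma>' f \<Longrightarrow> y \<in> carrier (bar M \<Gamma>) \<Longrightarrow> \<alpha> \<Gamma>' (bar_tr M \<Gamma> \<Gamma>' f y) = bar_tr N \<Gamma> \<Gamma>' f (\<alpha> \<Gamma> y)"
proof -
  show 1: "is_partition \<Gamma> \<Longrightarrow> \<alpha> \<Gamma> \<in> add_hom (bar M \<Gamma>) (bar N \<Gamma>)"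
    using assms unfolding bar_natural_def by blast
  show "is_partition \<Gamma> \<Longrightarrow> z \<in> carrier (bar M \<Gamma>) \<Longrightarrow> \<alpha> \<Gamma> z \<in> carrier (bar N \<Gamma>)"
    using add_hom_closed[OF 1] .
  show "is_iso \<Gamma> \<Gamma>' f \<Longrightarrow> y \<in> carrier (bar M \<Gamma>) \<Longrightarrow> \<alpha> \<Gamma>' (bar_tr M \<Gamma> \<Gamma>' f y) = bar_tr N \<Gamma> \<Gamma>' f (\<alpha> \<Gamma> y)"
    using assms unfolding bar_natural_def by blast
qed

locale comp_map_morphism = M: part_functor M + N: part_functor N
  for M :: "('u, 'a, 'y) pfun_scheme" and N :: "('u, 'b, 'z) pfun_scheme" +
  fixes \<alpha> :: "'u set_partition \<Rightarrow> 'a set \<Rightarrow> 'b set"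
  assumes nat: "bar_natural M N \<alpha>"
begin

lemma closed:
  assumes "x \<in> carrier (PD_val M \<Lambda>)"
  shows "comp_map \<alpha> \<Lambda> x \<in> carrier (PD_val N \<Lambda>)"
proof (rule PD_val_memI)
  fix \<Gamma> assume r: "\<Gamma> \<preceq> \<Lambda>"
  show "comp_map \<alpha> \<Lambda> x \<Gamma> \<in> carrier (bar N \<Gamma>)"
    using r bar_naturalD(2)[OF nat refinesD(1)[OF r]] PD_val_memD(2)[OF assms r] by (simp add: comp_map_def)
  fix \<sigma> assume \<sigma>: "\<sigma> \<in> block_perms \<Lambda>"
  note b = block_perm_iso[OF \<sigma> r]
  show "bar_tr N (transport (inv_into UNIV \<sigma>) \<Gamma>) \<Gamma> \<sigma> (comp_map \<alpha> \<Lambda> x (transport (inv_into UNIV \<sigma>) \<Gamma>)) = comp_map \<alpha> \<Lambda> x \<Gamma>"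
    using bar_naturalD(3)[OF nat b(2) PD_val_memD(2)[OF assms b(1)]] PD_val_memD(3)[OF assms \<sigma> r] b(1) r
    by (simp add: comp_map_def)
qed (simp add: comp_map_def)

lemma at:
  assumes "x \<in> carrier (PD_val M \<Lambda>)" "is_mor \<Gamma> \<Lambda> k"
  shows "PD_at N \<Gamma> k (comp_map \<alpha> \<Lambda> x) = \<alpha> \<Gamma> (PD_at M \<Gamma> k x)"
proof (rule N.PD_at_unique)
  note c = M.PD_at_closed[OF assms]
  show i: "is_iso \<Gamma> (transport k \<Gamma>) k" using mor_iso_transport[OF assms(2)] .
  show "\<alpha> \<Gamma> (PD_at M \<Gamma> k x) \<in> carrier (bar N \<Gamma>)" using bar_naturalD(2)[OF nat is_morD(1)[OF assms(2)] c] .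
  show "bar_tr N \<Gamma> (transport k \<Gamma>) k (\<alpha> \<Gamma> (PD_at M \<Gamma> k x)) = comp_map \<alpha> \<Lambda> x (transport k \<Gamma>)"
    using bar_naturalD(3)[OF nat i c] M.bar_tr_PD_at[OF assms] mor_transport_refines[OF assms(2)]
    by (simp add: comp_map_def)
qed

lemma hom:
  assumes "is_partition \<Lambda>"
  shows "comp_map \<alpha> \<Lambda> \<in> add_hom (PD_val M \<Lambda>) (PD_val N \<Lambda>)"
proof (rule add_homI)
  fix x y assume x: "x \<in> carrier (PD_val M \<Lambda>)" and y: "y \<in> carrier (PD_val M \<Lambda>)"
  show "comp_map \<alpha> \<Lambda> x \<in> carrier (PD_val N \<Lambda>)" using closed[OF x] .
  show "comp_map \<alpha> \<Lambda> (x \<oplus>\<^bsub>PD_val M \<Lambda>\<^esub> y) = comp_map \<alpha> \<Lambda> x \<oplus>\<^bsub>PD_val N \<Lambda>\<^esub> comp_map \<alpha> \<Lambda> y"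
  proof (rule PD_val_eqI[of _ \<Lambda>])
    fix \<Gamma> assume r: "\<Gamma> \<preceq> \<Lambda>"
    show "comp_map \<alpha> \<Lambda> (x \<oplus>\<^bsub>PD_val M \<Lambda>\<^esub> y) \<Gamma> = (comp_map \<alpha> \<Lambda> x \<oplus>\<^bsub>PD_val N \<Lambda>\<^esub> comp_map \<alpha> \<Lambda> y) \<Gamma>"
      using add_hom_add[OF bar_naturalD(1)[OF nat refinesD(1)[OF r]] PD_val_memD(2)[OF x r] PD_val_memD(2)[OF y r]] r
      by (simp add: comp_map_def PD_val_ops)
  qed (simp_all add: comp_map_def PD_val_ops)
qed

lemma res:
  assumes "x \<in> carrier (PD_val M \<Omega>)" "is_mor \<Lambda> \<Omega> f"
  shows "comp_map \<alpha> \<Lambda> (PD_res M \<Lambda> \<Omega> f x) = PD_res N \<Lambda> \<Omega> f (comp_map \<alpha> \<Omega> x)"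
proof -
  note c = closed[OF assms(1)] and d = M.PD_res_closed[OF assms]
  show ?thesis
  proof (rule N.PD_at_eqI[OF closed[OF d] N.PD_res_closed[OF c assms(2)]])
    fix \<Gamma> assume "\<Gamma> \<preceq> \<Lambda>"
    note k = refinesD(5)[OF this]
    show "PD_at N \<Gamma> id (comp_map \<alpha> \<Lambda> (PD_res M \<Lambda> \<Omega> f x)) = PD_at N \<Gamma> id (PD_res N \<Lambda> \<Omega> f (comp_map \<alpha> \<Omega> x))"
      unfolding at[OF d k] M.PD_at_res[OF assms k] N.PD_at_res[OF c assms(2) k] at[OF assms(1) mor_comp[OF k assms(2)]] ..
  qed
qed

lemma tr:
  assumes "x \<in> carrier (PD_val M \<Lambda>)" "is_mor \<Lambda> \<Omega> f"
  shows "comp_map \<alpha> \<Omega> (PD_tr M \<Lambda> \<Omega> f x) = PD_tr N \<Lambda> \<Omega> f (comp_map \<alpha> \<Lambda> x)"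
proof -
  note c = closed[OF assms(1)] and d = M.PD_tr_closed[OF assms]
  show ?thesis
  proof (rule N.PD_at_eqI[OF closed[OF d] N.PD_tr_closed[OF c assms(2)]])
    fix \<Gamma> assume "\<Gamma> \<preceq> \<Omega>"
    note k = refinesD(5)[OF this] and p = refinesD(1)[OF this]
    have "\<alpha> \<Gamma> (lift_sum M \<Gamma> \<Lambda> \<Omega> f id x) =
        class_sum (bar N \<Gamma>) (mor_class \<Gamma> \<Lambda>) (lifts \<Gamma> \<Lambda> \<Omega> f id) (\<lambda>l. \<alpha> \<Gamma> (PD_at M \<Gamma> l x))"
      unfolding lift_sum_def using M.PD_at_closed[OF assms(1) liftsD(1)]
      by (rule class_sum_hom[OF M.bar_group[OF p] N.bar_group[OF p] bar_naturalD(1)[OF nat p]])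
    also have "\<dots> = lift_sum N \<Gamma> \<Lambda> \<Omega> f id (comp_map \<alpha> \<Lambda> x)"
      unfolding lift_sum_def
      by (rule class_sum_cong[OF N.bar_group[OF p] at[OF assms(1) liftsD(1), symmetric] N.PD_at_closed[OF c liftsD(1)]])
    finally show "PD_at N \<Gamma> id (comp_map \<alpha> \<Omega> (PD_tr M \<Lambda> \<Omega> f x)) = PD_at N \<Gamma> id (PD_tr N \<Lambda> \<Omega> f (comp_map \<alpha> \<Lambda> x))"
      unfolding at[OF d k] M.PD_at_tr[OF assms k] N.PD_at_tr[OF c assms(2) k] .
  qed
qed

lemma morphism:
  assumes M': "is_PD M M'" and N': "is_PD N N'"
  shows "pf_morphism M' N' (comp_map \<alpha>)"
  unfolding pf_morphism_def is_PD_simps[OF M'] is_PD_simps[OF N'] using hom res tr by blast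

end

text \<open>A morphism commutes with transfers, so it maps the image of proper transfers of
  \<open>M\<close> into that of \<open>N\<close> and factors through the quotients.\<close>

lemma (in part_functor)
  assumes "partition_functor N" "pf_morphism M N \<phi>" "is_partition \<Gamma>"
  shows bar_map_qmap: "x \<in> pf_carrier M \<Gamma> \<Longrightarrow> bar_map N \<phi> \<Gamma> (qmap M \<Gamma> x) = qmap N \<Gamma> (\<phi> \<Gamma> x)"
    and bar_map_hom: "bar_map N \<phi> \<Gamma> \<in> add_hom (bar M \<Gamma>) (bar N \<Gamma>)"
proof -
  interpret N: part_functor N using part_functorD[OF assms(1)] .
  have h: "(\<lambda>x. qmap N \<Gamma> (\<phi> \<Gamma> x)) \<in> add_hom (pf_val M \<Gamma>) (bar N \<Gamma>)"
    using add_hom_comp[OF pf_morphismD(1)[OF assms(2,3)] N.qmap_hom[OF assms(3)]] .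
  have z: "qmap N \<Gamma> (\<phi> \<Gamma> (pf_tr M \<Omega> \<Gamma> id y)) = \<zero>\<^bsub>bar N \<Gamma>\<^esub>" if "\<Omega> \<prec> \<Gamma>" "y \<in> pf_carrier M \<Omega>" for \<Omega> y
    using pf_morphismD(4)[OF assms(2) strictly_refinesD(2)[OF that(1)] that(2)] N.qmap_tr[OF that(1)]
      pf_morphismD(2)[OF assms(2) refinesD(1)[OF strictly_refinesD(1)[OF that(1)]] that(2)] by simp
  show "x \<in> pf_carrier M \<Gamma> \<Longrightarrow> bar_map N \<phi> \<Gamma> (qmap M \<Gamma> x) = qmap N \<Gamma> (\<phi> \<Gamma> x)"
    unfolding bar_map_def by (rule induced_qmap[OF assms(3) N.bar_group[OF assms(3)] h z])
  show "bar_map N \<phi> \<Gamma> \<in> add_hom (bar M \<Gamma>) (bar N \<Gamma>)"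
    unfolding bar_map_def by (rule induced_hom[OF assms(3) N.bar_group[OF assms(3)] h z])
qed

lemma (in part_functor) bar_map_natural:
  assumes "partition_functor N" "pf_morphism M N \<phi>"
  shows "bar_natural M N (bar_map N \<phi>)"
  unfolding bar_natural_def
proof (intro conjI allI impI ballI)
  interpret N: part_functor N using part_functorD[OF assms(1)] .
  show "bar_map N \<phi> \<Gamma> \<in> add_hom (bar M \<Gamma>) (bar N \<Gamma>)" if "is_partition \<Gamma>" for \<Gamma>
    using bar_map_hom[OF assms that] .
  fix \<Gamma> \<Gamma>' f y assume f: "is_iso \<Gamma> \<Gamma>' f" and "y \<in> carrier (bar M \<Gamma>)"
  then obtain x where x: "x \<in> pf_carrier M \<Gamma>" "y = qmap M \<Gamma> x" using bar_cases by blast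
  note m = isoD(1)[OF f]
  show "bar_map N \<phi> \<Gamma>' (bar_tr M \<Gamma> \<Gamma>' f y) = bar_tr N \<Gamma> \<Gamma>' f (bar_map N \<phi> \<Gamma> y)"
    using x bar_map_qmap[OF assms is_morD(1)[OF m]] bar_map_qmap[OF assms is_morD(2)[OF m] tr_closed[OF m x(1)]]
      bar_tr_qmap[OF f x(1)] N.bar_tr_qmap[OF f pf_morphismD(2)[OF assms(2) is_morD(1)[OF m] x(1)]]
      pf_morphismD(4)[OF assms(2) m x(1)] by simp
qed

theorem PD_map_morphism:
  assumes "partition_functor M" "partition_functor N" "pf_morphism M N \<phi>" "is_PD M M'" "is_PD N N'"
  shows "pf_morphism M' N' (PD_map N \<phi>)"
proof -
  interpret comp_map_morphism M N "bar_map N \<phi>"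
    using part_functor.bar_map_natural[OF part_functorD[OF assms(1)] assms(2,3)]
      part_functorD[OF assms(1)] part_functorD[OF assms(2)]
    by (intro comp_map_morphism.intro comp_map_morphism_axioms.intro)
  show ?thesis unfolding PD_map_comp_map using morphism[OF assms(4,5)] .
qed

text \<open>A counting argument: any morphism maps related pairs injectively to related pairs, but a
  proper refinement has strictly fewer of them in the same finite relation. It covers all morphisms,
  not just the identity, as is needed to exclude lifts.\<close>

lemma no_mor_to_strict_refinement:
  assumes "\<Omega> \<prec> \<Gamma>"
  shows "\<not> is_mor \<Gamma> \<Omega> l"
proof
  assume l: "is_mor \<Gamma> \<Omega> l"
  note r = strictly_refinesD(1)[OF assms]
  have f: "finite (rel \<Gamma>)" using is_partition_finite_rel[OF refinesD(2)[OF r]] .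
  have "rel \<Omega> \<noteq> rel \<Gamma>" using assms refinesD(3)[OF r] by (auto simp: strictly_refines_def)
  hence "card (rel \<Omega>) < card (rel \<Gamma>)" using refinesD(4)[OF r] f by (intro psubset_card_mono) auto
  moreover have "card (rel \<Gamma>) \<le> card (rel \<Omega>)"
  proof (rule card_inj_on_le)
    show "inj_on (map_prod l l) (rel \<Gamma>)"
      using map_prod_inj_on[OF is_morD(4)[OF l] is_morD(4)[OF l]] is_partitionD(2)[OF is_morD(1)[OF l]]
      by (rule inj_on_subset)
    show "map_prod l l ` rel \<Gamma> \<subseteq> rel \<Omega>" using is_morD(7)[OF l] by auto
    show "finite (rel \<Omega>)" using is_partition_finite_rel[OF refinesD(1)[OF r]] .
  qed
  ultimately show False by simp
qed

context part_functor begin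

text \<open>The identity of \<Gamma> has no lift to a proper refinement, so the top component of the
  transfer is an empty sum. This is why projection to the top component factors through the quotient
  and \<mu> is well defined.\<close>

lemma PD_tr_top:
  assumes "\<Omega> \<prec> \<Gamma>" "y \<in> carrier (PD_val M \<Omega>)"
  shows "PD_tr M \<Omega> \<Gamma> id y \<Gamma> = \<zero>\<^bsub>bar M \<Gamma>\<^esub>"
proof -
  note r = strictly_refinesD(1)[OF assms(1)] and m = strictly_refinesD(2)[OF assms(1)]
  note p = refinesD(2)[OF r]
  have "lifts \<Gamma> \<Omega> \<Gamma> id id = {}" using no_mor_to_strict_refinement[OF assms(1)] by (simp add: lifts_def)
  thus ?thesis
    using PD_at_id[OF PD_tr_closed[OF assms(2) m] refines_refl[OF p]] PD_at_tr[OF assms(2) m mor_id[OF p]]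
    by (simp add: lift_sum_def class_sum_empty bar_group[OF p])
qed

lemma
  assumes "is_PD M M'" "is_partition \<Gamma>"
  shows bar_proj_qmap: "x \<in> carrier (PD_val M \<Gamma>) \<Longrightarrow> bar_proj \<Gamma> (qmap M' \<Gamma> x) = x \<Gamma>"
    and bar_proj_hom: "bar_proj \<Gamma> \<in> add_hom (bar M' \<Gamma>) (bar M \<Gamma>)"
proof -
  interpret M': part_functor M' using part_functorD[OF PD_partition_functor[OF assms(1)]] .
  note S = is_PD_simps[OF assms(1)]
  have h: "(\<lambda>x. x \<Gamma>) \<in> add_hom (pf_val M' \<Gamma>) (bar M \<Gamma>)"
    unfolding S using PD_val_memD(2)[OF _ refines_refl[OF assms(2)]] refines_refl[OF assms(2)]
    by (intro add_homI) (auto simp: PD_val_ops)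
  have z: "pf_tr M' \<Omega> \<Gamma> id y \<Gamma> = \<zero>\<^bsub>bar M \<Gamma>\<^esub>" if "\<Omega> \<prec> \<Gamma>" "y \<in> pf_carrier M' \<Omega>" for \<Omega> y
    using PD_tr_top that unfolding S by blast
  show "x \<in> carrier (PD_val M \<Gamma>) \<Longrightarrow> bar_proj \<Gamma> (qmap M' \<Gamma> x) = x \<Gamma>"
    unfolding bar_proj_def using M'.induced_qmap[OF assms(2) bar_group[OF assms(2)] h z] unfolding S by blast
  show "bar_proj \<Gamma> \<in> add_hom (bar M' \<Gamma>) (bar M \<Gamma>)"
    unfolding bar_proj_def by (rule M'.induced_hom[OF assms(2) bar_group[OF assms(2)] h z])
qed

text \<open>The top component of the transfer along an isomorphism is the value of \<open>x\<close>
  at the inverse of \<open>f\<close>, by uniqueness of lifts. Naturality of the family along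
  \<open>f\<close> turns it into the transfer of the value at the identity, the top component of
  \<open>x\<close>.\<close>

lemma bar_proj_natural:
  assumes M': "is_PD M M'"
  shows "bar_natural M' M bar_proj"
  unfolding bar_natural_def
proof (intro conjI allI impI ballI)
  interpret M': part_functor M' using part_functorD[OF PD_partition_functor[OF M']] .
  note S = is_PD_simps[OF M']
  show "bar_proj \<Gamma> \<in> add_hom (bar M' \<Gamma>) (bar M \<Gamma>)" if "is_partition \<Gamma>" for \<Gamma> using bar_proj_hom[OF M' that] .
  fix \<Gamma> \<Gamma>' f y assume f: "is_iso \<Gamma> \<Gamma>' f" and "y \<in> carrier (bar M' \<Gamma>)"
  then obtain x where x: "x \<in> carrier (PD_val M \<Gamma>)" "y = qmap M' \<Gamma> x" using M'.bar_cases unfolding S by blast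
  note m = isoD(1)[OF f]
  note p = is_morD(1)[OF m] and p' = is_morD(2)[OF m]
  note im = isoD(1)[OF iso_inv[OF f]]
  have x': "x \<in> pf_carrier M' \<Gamma>" using x S by simp
  note c = PD_tr_closed[OF x(1) m]
  have "bar_tr M' \<Gamma> \<Gamma>' f y = qmap M' \<Gamma>' (PD_tr M \<Gamma> \<Gamma>' f x)" using M'.bar_tr_qmap[OF f x'] x(2) S by simp
  hence "bar_proj \<Gamma>' (bar_tr M' \<Gamma> \<Gamma>' f y) = PD_tr M \<Gamma> \<Gamma>' f x \<Gamma>'" using bar_proj_qmap[OF M' p' c] by simp
  also have "\<dots> = PD_at M \<Gamma>' (inv_into (pts \<Gamma>) f) x"
    using PD_at_id[OF c refines_refl[OF p']] PD_at_tr_iso[OF x(1) f mor_id[OF p']] by simp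
  also have "\<dots> = bar_tr M \<Gamma> \<Gamma>' f (PD_at M \<Gamma> (inv_into (pts \<Gamma>) f \<circ> f) x)"
    using PD_at_iso[OF x(1) f im] by simp
  also have "PD_at M \<Gamma> (inv_into (pts \<Gamma>) f \<circ> f) x = PD_at M \<Gamma> id x"
    using mor_inv_into(2)[OF m]
    by (intro PD_at_two_iso[OF x(1)] two_iso_sym[OF two_iso_cong[OF mor_id[OF p]]]) simp
  also have "\<dots> = bar_proj \<Gamma> y" using PD_at_id[OF x(1) refines_refl[OF p]] bar_proj_qmap[OF M' p x(1)] x(2) by simp
  finally show "bar_proj \<Gamma>' (bar_tr M' \<Gamma> \<Gamma>' f y) = bar_tr M \<Gamma> \<Gamma>' f (bar_proj \<Gamma> y)" .
qed

end

theorem PD_mu_morphism: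
  assumes "partition_functor M" "is_PD M M'" "is_PD M' M''"
  shows "pf_morphism M'' M' PD_mu"
proof -
  note M = part_functorD[OF assms(1)]
  interpret comp_map_morphism M' M bar_proj
    using part_functor.bar_proj_natural[OF M assms(2)] part_functorD[OF part_functor.PD_partition_functor[OF M assms(2)]] M
    by (intro comp_map_morphism.intro comp_map_morphism_axioms.intro)
  show ?thesis unfolding PD_mu_comp_map using morphism[OF assms(3,2)] .
qed

section \<open>The unit as a morphism of partition functors\<close>

context part_functor begin

text \<open>The family of \<eta> z assigns to \<open>k\<close> the class of the restriction of z
  along \<open>k\<close>. Its naturality is the identity that restriction along an isomorphism
  followed by transfer along it does nothing, because this transfer is restriction along the
  inverse.\<close>

lemma PD_eta_family:
  assumes "z \<in> pf_carrier M \<Lambda>"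
  shows "PD_family M \<Lambda> (\<lambda>\<Gamma> k. qmap M \<Gamma> (pf_res M \<Gamma> \<Lambda> k z))"
  unfolding PD_family_def
proof (intro conjI allI impI)
  fix \<Gamma> k
  show "qmap M \<Gamma> (pf_res M \<Gamma> \<Lambda> k z) \<in> carrier (bar M \<Gamma>)" if "is_mor \<Gamma> \<Lambda> k"
    using qmap_closed res_closed[OF that assms] by blast
  show "qmap M \<Gamma> (pf_res M \<Gamma> \<Lambda> k z) = qmap M \<Gamma> (pf_res M \<Gamma> \<Lambda> k' z)" if "two_iso \<Gamma> \<Lambda> k k'" for k'
    using res_two_iso[OF that assms] by simp
  fix \<Delta> j assume "is_iso \<Delta> \<Gamma> j \<and> is_mor \<Gamma> \<Lambda> k"
  hence j: "is_iso \<Delta> \<Gamma> j" and k: "is_mor \<Gamma> \<Lambda> k" by auto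
  note m = isoD(1)[OF j] and i = isoD(1)[OF iso_inv[OF j]]
  note w = res_closed[OF k assms]
  have "pf_tr M \<Delta> \<Gamma> j (pf_res M \<Delta> \<Gamma> j w') = w'" if "w' \<in> pf_carrier M \<Gamma>" for w'
  proof -
    have "pf_tr M \<Delta> \<Gamma> j (pf_res M \<Delta> \<Gamma> j w') = pf_res M \<Gamma> \<Gamma> (j \<circ> inv_into (pts \<Delta>) j) w'"
      using tr_iso[OF j res_closed[OF m that]] res_comp[OF i m that] by simp
    also have "\<dots> = pf_res M \<Gamma> \<Gamma> id w'"
      using mor_inv_into(3)[OF m]
      by (intro res_two_iso[OF two_iso_sym[OF two_iso_cong[OF mor_id[OF is_morD(2)[OF m]]]] that]) simp
    finally show ?thesis using res_id[OF is_morD(2)[OF m] that] by simp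
  qed
  thus "bar_tr M \<Delta> \<Gamma> j (qmap M \<Delta> (pf_res M \<Delta> \<Lambda> (k \<circ> j) z)) = qmap M \<Gamma> (pf_res M \<Gamma> \<Lambda> k z)"
    using bar_tr_qmap[OF j res_closed[OF m w]] res_comp[OF m k assms] w by simp
qed

lemma PD_eta_eq: "PD_eta M \<Lambda> z = of_family \<Lambda> (\<lambda>\<Gamma> k. qmap M \<Gamma> (pf_res M \<Gamma> \<Lambda> k z))"
  by (simp add: PD_eta_def of_family_def)

lemma PD_eta_closed: "z \<in> pf_carrier M \<Lambda> \<Longrightarrow> PD_eta M \<Lambda> z \<in> carrier (PD_val M \<Lambda>)"
  unfolding PD_eta_eq by (rule of_family_closed[OF PD_eta_family])

lemma PD_at_eta:
  "z \<in> pf_carrier M \<Lambda> \<Longrightarrow> is_mor \<Gamma> \<Lambda> k \<Longrightarrow> PD_at M \<Gamma> k (PD_eta M \<Lambda> z) = qmap M \<Gamma> (pf_res M \<Gamma> \<Lambda> k z)"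
  unfolding PD_eta_eq by (rule PD_at_of_family[OF PD_eta_family])

lemma PD_eta_apply:
  "\<Gamma> \<preceq> \<Lambda> \<Longrightarrow> PD_eta M \<Lambda> z \<Gamma> = qmap M \<Gamma> (pf_res M \<Gamma> \<Lambda> id z)"
  by (simp add: PD_eta_def)

lemma PD_eta_hom:
  assumes "is_partition \<Lambda>"
  shows "PD_eta M \<Lambda> \<in> add_hom (pf_val M \<Lambda>) (PD_val M \<Lambda>)"
proof (rule add_homI)
  fix x y assume x: "x \<in> pf_carrier M \<Lambda>" and y: "y \<in> pf_carrier M \<Lambda>"
  show "PD_eta M \<Lambda> x \<in> carrier (PD_val M \<Lambda>)" using PD_eta_closed[OF x] .
  show "PD_eta M \<Lambda> (x \<oplus>\<^bsub>pf_val M \<Lambda>\<^esub> y) = PD_eta M \<Lambda> x \<oplus>\<^bsub>PD_val M \<Lambda>\<^esub> PD_eta M \<Lambda> y"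
  proof (rule PD_val_eqI[of _ \<Lambda>])
    fix \<Gamma> assume r: "\<Gamma> \<preceq> \<Lambda>"
    note h = add_hom_comp[OF res_hom[OF refinesD(5)[OF r]] qmap_hom[OF refinesD(1)[OF r]]]
    show "PD_eta M \<Lambda> (x \<oplus>\<^bsub>pf_val M \<Lambda>\<^esub> y) \<Gamma> = (PD_eta M \<Lambda> x \<oplus>\<^bsub>PD_val M \<Lambda>\<^esub> PD_eta M \<Lambda> y) \<Gamma>"
      using add_hom_add[OF h x y] r by (simp add: PD_eta_apply PD_val_ops)
  qed (simp_all add: PD_eta_def PD_val_ops)
qed

lemma PD_eta_res:
  assumes "z \<in> pf_carrier M \<Omega>" "is_mor \<Lambda> \<Omega> f"
  shows "PD_eta M \<Lambda> (pf_res M \<Lambda> \<Omega> f z) = PD_res M \<Lambda> \<Omega> f (PD_eta M \<Omega> z)"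
proof (rule PD_at_eqI)
  note c = res_closed[OF assms(2,1)]
  show "PD_eta M \<Lambda> (pf_res M \<Lambda> \<Omega> f z) \<in> carrier (PD_val M \<Lambda>)" using PD_eta_closed[OF c] .
  show "PD_res M \<Lambda> \<Omega> f (PD_eta M \<Omega> z) \<in> carrier (PD_val M \<Lambda>)" using PD_res_closed[OF PD_eta_closed[OF assms(1)] assms(2)] .
  fix \<Gamma> assume "\<Gamma> \<preceq> \<Lambda>"
  note k = refinesD(5)[OF this]
  show "PD_at M \<Gamma> id (PD_eta M \<Lambda> (pf_res M \<Lambda> \<Omega> f z)) = PD_at M \<Gamma> id (PD_res M \<Lambda> \<Omega> f (PD_eta M \<Omega> z))"
    using PD_at_eta[OF c k] PD_at_res[OF PD_eta_closed[OF assms(1)] assms(2) k]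
      PD_at_eta[OF assms(1) mor_comp[OF k assms(2)]] res_comp[OF k assms(2,1)] by simp
qed

text \<open>Transfers along isomorphisms are restrictions along their inverses. Both sides thus
  become the restriction of z along one and the same function.\<close>

lemma res_tr_iso:
  assumes "is_iso \<Psi> \<Psi>' f" "\<Gamma> \<preceq> \<Psi>" "z \<in> pf_carrier M \<Psi>"
  shows "pf_res M (transport f \<Gamma>) \<Psi>' id (pf_tr M \<Psi> \<Psi>' f z) = pf_tr M \<Gamma> (transport f \<Gamma>) f (pf_res M \<Gamma> \<Psi> id z)"
proof -
  note f = isoD(1)[OF assms(1)] and fi = isoD(1)[OF iso_inv[OF assms(1)]] and g = refinesD(5)[OF assms(2)]
  note i = mor_iso_transport[OF mor_refines[OF f assms(2)]]
  note im = isoD(1)[OF iso_inv[OF i]]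
  have A: "transport f \<Gamma> \<preceq> \<Psi>'" using mor_transport_refines[OF mor_refines[OF f assms(2)]] .
  have "pf_res M (transport f \<Gamma>) \<Psi>' id (pf_tr M \<Psi> \<Psi>' f z) = pf_res M (transport f \<Gamma>) \<Psi> (inv_into (pts \<Psi>) f \<circ> id) z"
    using tr_iso[OF assms(1,3)] res_comp[OF refinesD(5)[OF A] fi assms(3)] by simp
  also have "\<dots> = pf_res M (transport f \<Gamma>) \<Psi> (id \<circ> inv_into (pts \<Gamma>) f) z"
    using refinesD(3)[OF assms(2)] by simp
  also have "\<dots> = pf_tr M \<Gamma> (transport f \<Gamma>) f (pf_res M \<Gamma> \<Psi> id z)"
    using res_comp[OF im g assms(3)] tr_iso[OF i res_closed[OF g assms(3)]] by simp
  finally show ?thesis .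
qed

text \<open>The double coset axiom speaks about refinements only, so the morphism is first replaced
  by its image: an isomorphism onto f \<Psi> followed by a refinement. The surviving summands are
  then matched directly with those in the definition of the transfer on PD, which uses the same
  double cosets and the same representatives.\<close>

lemma PD_eta_tr:
  assumes z: "z \<in> pf_carrier M \<Psi>" and f: "is_mor \<Psi> \<Lambda> f"
  shows "PD_eta M \<Lambda> (pf_tr M \<Psi> \<Lambda> f z) = PD_tr M \<Psi> \<Lambda> f (PD_eta M \<Psi> z)"
proof (rule PD_val_eqI[of _ \<Lambda>])
  show "PD_tr M \<Psi> \<Lambda> f (PD_eta M \<Psi> z) \<in> extensional {\<Gamma>. \<Gamma> \<preceq> \<Lambda>}" by (simp add: PD_tr_def)
  show "PD_eta M \<Lambda> (pf_tr M \<Psi> \<Lambda> f z) \<in> extensional {\<Gamma>. \<Gamma> \<preceq> \<Lambda>}" by (simp add: PD_eta_def)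
  fix \<Gamma> assume r: "\<Gamma> \<preceq> \<Lambda>"
  note p = refinesD(1)[OF r] and pL = refinesD(2)[OF r]
  note g = bar_group[OF p]
  \<comment> \<open>The image of \<open>f\<close>, splitting off the isomorphism so that the
    remaining transfer is along a refinement.\<close>
  define \<Psi>' where "\<Psi>' = transport f \<Psi>"
  have r': "\<Psi>' \<preceq> \<Lambda>" unfolding \<Psi>'_def using mor_transport_refines[OF f] .
  have fi: "is_iso \<Psi> \<Psi>' f" unfolding \<Psi>'_def using mor_iso_transport[OF f] .
  define z' where "z' = pf_tr M \<Psi> \<Psi>' f z"
  have z': "z' \<in> pf_carrier M \<Psi>'" unfolding z'_def using tr_closed[OF isoD(1)[OF fi] z] .
  have trz: "pf_tr M \<Psi> \<Lambda> f z = pf_tr M \<Psi>' \<Lambda> id z'"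
    using tr_comp[OF isoD(1)[OF fi] refinesD(5)[OF r'] z] by (simp add: z'_def)
  let ?D = "dcosets \<Gamma> \<Lambda> \<Psi>'"
  let ?L = "{C \<in> ?D. \<Gamma> \<preceq> transport (dcoset_rep C) \<Psi>'}"
  let ?s = "\<lambda>C. qmap M \<Gamma> (dcoset_summand M \<Gamma> \<Psi>' (dcoset_rep C) z')"
  have S: "dcoset_summand M \<Gamma> \<Psi>' (dcoset_rep C) z' \<in> pf_carrier M \<Gamma>"
    "\<not> \<Gamma> \<preceq> transport (dcoset_rep C) \<Psi>' \<Longrightarrow> ?s C = \<zero>\<^bsub>bar M \<Gamma>\<^esub>"
    "\<Gamma> \<preceq> transport (dcoset_rep C) \<Psi>' \<Longrightarrow> ?s C =
      (let h = dcoset_rep C \<circ> f; \<Gamma>' = transport (inv_into (pts \<Psi>) h) \<Gamma> in bar_tr M \<Gamma>' \<Gamma> h (PD_eta M \<Psi> z \<Gamma>'))"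
    if C: "C \<in> ?D" for C
  proof -
    define \<sigma> where "\<sigma> = dcoset_rep C"
    have \<sigma>: "\<sigma> \<in> block_perms \<Lambda>" using dcoset_rep_mem(2)[OF r r' C] by (simp add: \<sigma>_def)
    define A where "A = meet (transport (inv_into UNIV \<sigma>) \<Gamma>) \<Psi>'"
    define B where "B = meet \<Gamma> (transport \<sigma> \<Psi>')"
    note AB = dcoset_meets[OF r r' \<sigma>, folded A_def B_def]
    have d: "dcoset_summand M \<Gamma> \<Psi>' \<sigma> z' = pf_tr M B \<Gamma> id (pf_tr M A B \<sigma> (pf_res M A \<Psi>' id z'))"
      by (simp add: dcoset_summand_def A_def B_def Let_def)
    note c1 = res_closed[OF refinesD(5)[OF AB(1)] z']
    note c2 = tr_closed[OF isoD(1)[OF AB(3)] c1]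
    show "dcoset_summand M \<Gamma> \<Psi>' (dcoset_rep C) z' \<in> pf_carrier M \<Gamma>"
      using tr_closed[OF refinesD(5)[OF AB(2)] c2] d by (simp add: \<sigma>_def)
    \<comment> \<open>The intersection refines both \<Gamma> and the moved partition. If \<Gamma>
      does not refine the latter, the intersection is a proper refinement of \<Gamma>, and the
      summand, being a transfer from it, dies in the quotient.\<close>
    show "?s C = \<zero>\<^bsub>bar M \<Gamma>\<^esub>" if "\<not> \<Gamma> \<preceq> transport (dcoset_rep C) \<Psi>'"
    proof -
      have "is_mor B (transport \<sigma> \<Psi>') id" using AB(4)[of B id] mor_id[OF refinesD(1)[OF AB(2)]] by blast
      hence "B \<preceq> transport \<sigma> \<Psi>'" by (auto simp: refines_def is_mor_def bij_betw_def)
      hence "B \<prec> \<Gamma>" using that AB(2) by (auto simp: strictly_refines_def \<sigma>_def)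
      thus ?thesis using qmap_tr[OF _ c2] d by (simp add: \<sigma>_def)
    qed
    assume ref: "\<Gamma> \<preceq> transport (dcoset_rep C) \<Psi>'"
    \<comment> \<open>In the admissible case the intersection is \<Gamma> itself, so the last
      transfer of the summand is along the identity.\<close>
    have BG: "B = \<Gamma>"
    proof (rule refines_antisym[OF AB(2)])
      have "is_mor \<Gamma> B id" using AB(4)[of \<Gamma> id] mor_id[OF p] refinesD(5)[OF ref] by (simp add: \<sigma>_def)
      thus "\<Gamma> \<preceq> B" by (auto simp: refines_def is_mor_def bij_betw_def)
    qed
    define h where "h = \<sigma> \<circ> f"
    define \<Gamma>' where "\<Gamma>' = transport (inv_into (pts \<Psi>) h) \<Gamma>"
    note T = PD_tr_summand[OF f r \<sigma> ref[folded \<sigma>_def, unfolded \<Psi>'_def], folded h_def, folded \<Gamma>'_def]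
    have G': "is_mor \<Gamma>' \<Psi>' f" using mor_refines[OF isoD(1)[OF fi] T(4)] .
    have inj: "inj \<sigma>" using \<sigma> by (auto simp: block_perms_def permutes_inj)
    \<comment> \<open>Both sides are carried to \<Gamma> by \<sigma>, which can be cancelled. The
      restriction to \<open>A\<close> can therefore be moved across the isomorphism \<open>f\<close>
      and becomes the restriction of z to \<Gamma>', the datum that \<eta> z records.\<close>
    have tA: "transport f \<Gamma>' = A"
    proof -
      have "transport \<sigma> (transport f \<Gamma>') = transport \<sigma> A"
        using isoD(2)[OF T(5)] isoD(2)[OF AB(3)] BG by (simp add: h_def transport_comp)
      hence "transport (inv_into UNIV \<sigma>) (transport \<sigma> (transport f \<Gamma>')) = transport (inv_into UNIV \<sigma>) (transport \<sigma> A)" by simp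
      thus ?thesis using block_perms_inv(3)[OF pL \<sigma>] by (simp add: transport_comp[symmetric] comp_assoc[symmetric])
    qed
    note w = res_closed[OF refinesD(5)[OF T(4)] z]
    have "pf_res M A \<Psi>' id z' = pf_tr M \<Gamma>' A f (pf_res M \<Gamma>' \<Psi> id z)"
      using res_tr_iso[OF fi T(4) z] tA by (simp add: z'_def)
    hence "pf_tr M A B \<sigma> (pf_res M A \<Psi>' id z') = pf_tr M \<Gamma>' \<Gamma> h (pf_res M \<Gamma>' \<Psi> id z)"
      using tr_comp[OF isoD(1)[OF mor_iso_transport[OF G', unfolded tA]] isoD(1)[OF AB(3)] w] BG by (simp add: h_def)
    hence "dcoset_summand M \<Gamma> \<Psi>' \<sigma> z' = pf_tr M \<Gamma>' \<Gamma> h (pf_res M \<Gamma>' \<Psi> id z)"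
      using d BG tr_id[OF p] tr_closed[OF isoD(1)[OF T(5)] w] by simp
    hence "?s C = bar_tr M \<Gamma>' \<Gamma> h (PD_eta M \<Psi> z \<Gamma>')"
      using bar_tr_qmap[OF T(5) w] PD_eta_apply[OF T(4)] by (simp add: \<sigma>_def)
    thus "?s C = (let h = dcoset_rep C \<circ> f; \<Gamma>' = transport (inv_into (pts \<Psi>) h) \<Gamma> in bar_tr M \<Gamma>' \<Gamma> h (PD_eta M \<Psi> z \<Gamma>'))"
      by (simp add: Let_def \<Gamma>'_def h_def \<sigma>_def)
  qed
  have "PD_eta M \<Lambda> (pf_tr M \<Psi> \<Lambda> f z) \<Gamma> = qmap M \<Gamma> (\<Oplus>\<^bsub>pf_val M \<Gamma>\<^esub> C \<in> ?D. dcoset_summand M \<Gamma> \<Psi>' (dcoset_rep C) z')"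
    using double_coset[OF r r' z'] trz r by (simp add: PD_eta_apply)
  also have "\<dots> = finsum (bar M \<Gamma>) ?s ?D"
    using S(1) by (intro add_hom_finsum[OF val_group[OF p] g qmap_hom[OF p]])
  \<comment> \<open>Dropping the vanishing summands leaves exactly the index set in the definition
    of the transfer on PD.\<close>
  also have "\<dots> = finsum (bar M \<Gamma>) ?s ?L"
    using S(2) qmap_closed[OF S(1)] by (intro finsum_mono_neutral[OF g finite_dcosets[OF r r']]) blast+
  also have "\<dots> = PD_tr M \<Psi> \<Lambda> f (PD_eta M \<Psi> z) \<Gamma>"
  proof -
    have "finsum (bar M \<Gamma>) ?s ?L = (\<Oplus>\<^bsub>bar M \<Gamma>\<^esub> C \<in> ?L.
        (let h = dcoset_rep C \<circ> f; \<Gamma>' = transport (inv_into (pts \<Psi>) h) \<Gamma> in bar_tr M \<Gamma>' \<Gamma> h (PD_eta M \<Psi> z \<Gamma>')))"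
    proof (rule finsum_cong_set[OF g refl])
      fix C assume "C \<in> ?L"
      hence C: "C \<in> ?D" "\<Gamma> \<preceq> transport (dcoset_rep C) \<Psi>'" by auto
      show eq: "?s C = (let h = dcoset_rep C \<circ> f; \<Gamma>' = transport (inv_into (pts \<Psi>) h) \<Gamma> in bar_tr M \<Gamma>' \<Gamma> h (PD_eta M \<Psi> z \<Gamma>'))"
        using S(3)[OF C] .
      show "(let h = dcoset_rep C \<circ> f; \<Gamma>' = transport (inv_into (pts \<Psi>) h) \<Gamma> in bar_tr M \<Gamma>' \<Gamma> h (PD_eta M \<Psi> z \<Gamma>')) \<in> carrier (bar M \<Gamma>)"
        unfolding eq[symmetric] using qmap_closed[OF S(1)[OF C(1)]] .
    qed
    thus ?thesis using r by (simp add: PD_tr_def \<Psi>'_def)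
  qed
  finally show "PD_eta M \<Lambda> (pf_tr M \<Psi> \<Lambda> f z) \<Gamma> = PD_tr M \<Psi> \<Lambda> f (PD_eta M \<Psi> z) \<Gamma>" .
qed

theorem PD_eta_morphism:
  assumes "is_PD M M'"
  shows "pf_morphism M M' (PD_eta M)"
  unfolding pf_morphism_def is_PD_simps[OF assms] using PD_eta_hom PD_eta_res PD_eta_tr by blast

end

section \<open>Functoriality of the construction, naturality and the monad laws\<close>

lemma mor_id_morphism:
  assumes "partition_functor M"
  shows "pf_morphism M M mor_id"
  unfolding pf_morphism_def by (auto simp: mor_id_def hom_def)

lemma mor_eqI:
  assumes "\<And>\<Lambda> x. is_partition \<Lambda> \<Longrightarrow> x \<in> pf_carrier M \<Lambda> \<Longrightarrow> \<phi> \<Lambda> x = \<psi> \<Lambda> x"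
  shows "mor_eq M \<phi> \<psi>"
  using assms by (simp add: mor_eq_def)

lemma pf_morphism_comp:
  assumes "pf_morphism M N \<phi>" "pf_morphism N L \<psi>"
  shows "pf_morphism M L (\<psi> \<bullet> \<phi>)"
proof -
  note F = pf_morphismD[OF assms(1)] and G = pf_morphismD[OF assms(2)]
  have "(\<psi> \<bullet> \<phi>) \<Lambda> \<in> add_hom (pf_val M \<Lambda>) (pf_val L \<Lambda>)" if "is_partition \<Lambda>" for \<Lambda>
    using add_hom_comp[OF F(1)[OF that] G(1)[OF that]] by (simp add: mor_comp_def[abs_def])
  moreover have "(\<psi> \<bullet> \<phi>) \<Lambda> (pf_res M \<Lambda> \<Omega> f x) = pf_res L \<Lambda> \<Omega> f ((\<psi> \<bullet> \<phi>) \<Omega> x)"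
    if "is_mor \<Lambda> \<Omega> f" "x \<in> pf_carrier M \<Omega>" for \<Lambda> \<Omega> f x
    using F(3)[OF that] G(3)[OF that(1) F(2)[OF is_morD(2)[OF that(1)] that(2)]] by (simp add: mor_comp_def)
  moreover have "(\<psi> \<bullet> \<phi>) \<Omega> (pf_tr M \<Lambda> \<Omega> f x) = pf_tr L \<Lambda> \<Omega> f ((\<psi> \<bullet> \<phi>) \<Lambda> x)"
    if "is_mor \<Lambda> \<Omega> f" "x \<in> pf_carrier M \<Lambda>" for \<Lambda> \<Omega> f x
    using F(4)[OF that] G(4)[OF that(1) F(2)[OF is_morD(1)[OF that(1)] that(2)]] by (simp add: mor_comp_def)
  ultimately show ?thesis unfolding pf_morphism_def by blast
qed

lemma comp_map_apply: "\<Gamma> \<preceq> \<Lambda> \<Longrightarrow> comp_map \<alpha> \<Lambda> x \<Gamma> = \<alpha> \<Gamma> (x \<Gamma>)"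
  by (simp add: comp_map_def)

lemma comp_map_extensional: "comp_map \<alpha> \<Lambda> x \<in> extensional {\<Gamma>. \<Gamma> \<preceq> \<Lambda>}"
  by (simp add: comp_map_def)

lemma (in part_functor) PD_map_id:
  assumes "is_PD M M'"
  shows "mor_eq M' (PD_map M mor_id) mor_id"
proof (rule mor_eqI)
  fix \<Lambda> x assume "x \<in> pf_carrier M' \<Lambda>"
  hence x: "x \<in> carrier (PD_val M \<Lambda>)" by (simp add: is_PD_simps[OF assms])
  show "PD_map M mor_id \<Lambda> x = mor_id \<Lambda> x"
    unfolding PD_map_comp_map mor_id_def[of \<Lambda> x]
  proof (rule PD_val_eqI[OF comp_map_extensional PD_val_memD(1)[OF x]])
    fix \<Gamma> assume r: "\<Gamma> \<preceq> \<Lambda>"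
    show "comp_map (bar_map M mor_id) \<Lambda> x \<Gamma> = x \<Gamma>"
      unfolding comp_map_apply[OF r] using PD_val_memD(2)[OF x r]
      by (rule bar_cases) (simp add: bar_map_qmap[OF pf mor_id_morphism[OF pf] refinesD(1)[OF r]] mor_id_def)
  qed
qed

lemma (in part_functor) PD_map_comp:
  assumes M': "is_PD M M'" and N: "partition_functor N" and L: "partition_functor L"
    and \<phi>: "pf_morphism M N \<phi>" and \<psi>: "pf_morphism N L \<psi>"
  shows "mor_eq M' (PD_map L (\<psi> \<bullet> \<phi>)) (PD_map L \<psi> \<bullet> PD_map N \<phi>)"
proof (rule mor_eqI)
  fix \<Lambda> x assume "x \<in> pf_carrier M' \<Lambda>"
  hence x: "x \<in> carrier (PD_val M \<Lambda>)" by (simp add: is_PD_simps[OF M'])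
  show "PD_map L (\<psi> \<bullet> \<phi>) \<Lambda> x = (PD_map L \<psi> \<bullet> PD_map N \<phi>) \<Lambda> x"
    unfolding PD_map_comp_map mor_comp_def[of _ _ \<Lambda> x]
  proof (rule PD_val_eqI[OF comp_map_extensional comp_map_extensional])
    fix \<Gamma> assume r: "\<Gamma> \<preceq> \<Lambda>"
    note p = refinesD(1)[OF r]
    obtain z where z: "z \<in> pf_carrier M \<Gamma>" "x \<Gamma> = qmap M \<Gamma> z" using PD_val_memD(2)[OF x r] by (rule bar_cases)
    show "comp_map (bar_map L (\<psi> \<bullet> \<phi>)) \<Lambda> x \<Gamma> = comp_map (bar_map L \<psi>) \<Lambda> (comp_map (bar_map N \<phi>) \<Lambda> x) \<Gamma>"
      unfolding comp_map_apply[OF r] z(2) bar_map_qmap[OF L pf_morphism_comp[OF \<phi> \<psi>] p z(1)]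
        bar_map_qmap[OF N \<phi> p z(1)]
        part_functor.bar_map_qmap[OF part_functorD[OF N] L \<psi> p pf_morphismD(2)[OF \<phi> p z(1)]]
      by (simp add: mor_comp_def)
  qed
qed

lemma (in part_functor) PD_eta_natural:
  assumes N: "partition_functor N" and \<phi>: "pf_morphism M N \<phi>"
  shows "mor_eq M (PD_eta N \<bullet> \<phi>) (PD_map N \<phi> \<bullet> PD_eta M)"
proof (rule mor_eqI)
  fix \<Lambda> z assume z: "z \<in> pf_carrier M \<Lambda>"
  interpret N: part_functor N using part_functorD[OF N] .
  show "(PD_eta N \<bullet> \<phi>) \<Lambda> z = (PD_map N \<phi> \<bullet> PD_eta M) \<Lambda> z"
    unfolding PD_map_comp_map mor_comp_def[of _ _ \<Lambda> z]
  proof (rule PD_val_eqI[OF _ comp_map_extensional])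
    fix \<Gamma> assume r: "\<Gamma> \<preceq> \<Lambda>"
    note k = refinesD(5)[OF r]
    show "PD_eta N \<Lambda> (\<phi> \<Lambda> z) \<Gamma> = comp_map (bar_map N \<phi>) \<Lambda> (PD_eta M \<Lambda> z) \<Gamma>"
      unfolding comp_map_apply[OF r] PD_eta_apply[OF r] N.PD_eta_apply[OF r]
        bar_map_qmap[OF N \<phi> refinesD(1)[OF r] res_closed[OF k z]] pf_morphismD(3)[OF \<phi> k z] ..
  qed (simp add: PD_eta_def)
qed

text \<open>On a representative z of the component at \<Gamma>, both composites apply the map
  induced by \<phi> to the top component of z.\<close>

lemma (in part_functor) PD_mu_natural:
  assumes N: "partition_functor N" and \<phi>: "pf_morphism M N \<phi>"
    and M': "is_PD M M'" and M'': "is_PD M' M''" and N': "is_PD N N'"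
  shows "mor_eq M'' (PD_mu \<bullet> PD_map N' (PD_map N \<phi>)) (PD_map N \<phi> \<bullet> PD_mu)"
proof (rule mor_eqI)
  interpret N: part_functor N using part_functorD[OF N] .
  interpret M': part_functor M' using part_functorD[OF PD_partition_functor[OF M']] .
  note S = is_PD_simps[OF M'] and S2 = is_PD_simps[OF M'']
  note Nf = N.PD_partition_functor[OF N'] and phi' = PD_map_morphism[OF pf N \<phi> M' N']
  fix \<Lambda> x assume "x \<in> pf_carrier M'' \<Lambda>"
  hence x: "x \<in> carrier (PD_val M' \<Lambda>)" by (simp add: S2)
  show "(PD_mu \<bullet> PD_map N' (PD_map N \<phi>)) \<Lambda> x = (PD_map N \<phi> \<bullet> PD_mu) \<Lambda> x"
    unfolding PD_mu_comp_map mor_comp_def[of _ _ \<Lambda> x] PD_map_comp_map[of N'] PD_map_comp_map[of N \<phi>, THEN fun_cong, of \<Lambda>]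
  proof (rule PD_val_eqI[OF comp_map_extensional comp_map_extensional])
    fix \<Gamma> assume r: "\<Gamma> \<preceq> \<Lambda>"
    note p = refinesD(1)[OF r]
    obtain z where z: "z \<in> pf_carrier M' \<Gamma>" "x \<Gamma> = qmap M' \<Gamma> z"
      using PD_val_memD(2)[OF x r] by (rule M'.bar_cases)
    have z': "z \<in> carrier (PD_val M \<Gamma>)" using z(1) by (simp add: S)
    have c: "PD_map N \<phi> \<Gamma> z \<in> carrier (PD_val N \<Gamma>)"
      using pf_morphismD(2)[OF phi' p z(1)] by (simp add: is_PD_simps[OF N'])
    show "comp_map bar_proj \<Lambda> (comp_map (bar_map N' (PD_map N \<phi>)) \<Lambda> x) \<Gamma> =
        comp_map (bar_map N \<phi>) \<Lambda> (comp_map bar_proj \<Lambda> x) \<Gamma>"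
      unfolding comp_map_apply[OF r] z(2) M'.bar_map_qmap[OF Nf phi' p z(1)] bar_proj_qmap[OF M' p z'] N.bar_proj_qmap[OF N' p c]
      by (simp add: PD_map_comp_map comp_map_apply refines_refl[OF p])
  qed
qed

text \<open>On a representative z of the component at \<Gamma>, both composites amount to taking the
  top component of z and projecting it once more.\<close>

lemma (in part_functor) PD_mu_assoc:
  assumes M': "is_PD M M'" and M'': "is_PD M' M''" and M''': "is_PD M'' M'''"
  shows "mor_eq M''' (PD_mu \<bullet> PD_map M' PD_mu) (PD_mu \<bullet> PD_mu)"
proof (rule mor_eqI)
  interpret M': part_functor M' using part_functorD[OF PD_partition_functor[OF M']] .
  interpret M'': part_functor M'' using part_functorD[OF M'.PD_partition_functor[OF M'']] .
  note mu = PD_mu_morphism[OF pf M' M'']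
  fix \<Lambda> x assume "x \<in> pf_carrier M''' \<Lambda>"
  hence x: "x \<in> carrier (PD_val M'' \<Lambda>)" by (simp add: is_PD_simps[OF M'''])
  show "(PD_mu \<bullet> PD_map M' PD_mu) \<Lambda> x = (PD_mu \<bullet> PD_mu) \<Lambda> x"
    unfolding mor_comp_def[of _ _ \<Lambda> x] PD_map_comp_map[of M'] PD_mu_comp_map[THEN fun_cong, of \<Lambda>]
  proof (rule PD_val_eqI[OF comp_map_extensional comp_map_extensional])
    fix \<Gamma> assume r: "\<Gamma> \<preceq> \<Lambda>"
    note p = refinesD(1)[OF r]
    obtain z where z: "z \<in> pf_carrier M'' \<Gamma>" "x \<Gamma> = qmap M'' \<Gamma> z"
      using PD_val_memD(2)[OF x r] by (rule M''.bar_cases)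
    have z': "z \<in> carrier (PD_val M' \<Gamma>)" using z(1) by (simp add: is_PD_simps[OF M''])
    have c: "PD_mu \<Gamma> z \<in> carrier (PD_val M \<Gamma>)"
      using pf_morphismD(2)[OF mu p z(1)] by (simp add: is_PD_simps[OF M'])
    show "comp_map bar_proj \<Lambda> (comp_map (bar_map M' PD_mu) \<Lambda> x) \<Gamma> = comp_map bar_proj \<Lambda> (comp_map bar_proj \<Lambda> x) \<Gamma>"
      unfolding comp_map_apply[OF r] z(2) M''.bar_map_qmap[OF M'.pf mu p z(1)] bar_proj_qmap[OF M' p c] M'.bar_proj_qmap[OF M'' p z']
      by (simp add: PD_mu_comp_map comp_map_apply refines_refl[OF p])
  qed
qed

text \<open>The top component of \<eta> z is the class of z itself, because restriction along the
  identity of \<Gamma> is trivial.\<close>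

lemma (in part_functor) PD_mu_map_eta:
  assumes M': "is_PD M M'"
  shows "mor_eq M' (PD_mu \<bullet> PD_map M' (PD_eta M)) mor_id"
proof (rule mor_eqI)
  interpret M': part_functor M' using part_functorD[OF PD_partition_functor[OF M']] .
  fix \<Lambda> x assume "x \<in> pf_carrier M' \<Lambda>"
  hence x: "x \<in> carrier (PD_val M \<Lambda>)" by (simp add: is_PD_simps[OF M'])
  show "(PD_mu \<bullet> PD_map M' (PD_eta M)) \<Lambda> x = mor_id \<Lambda> x"
    unfolding mor_comp_def[of _ _ \<Lambda> x] PD_map_comp_map PD_mu_comp_map mor_id_def
  proof (rule PD_val_eqI[OF comp_map_extensional PD_val_memD(1)[OF x]])
    fix \<Gamma> assume r: "\<Gamma> \<preceq> \<Lambda>"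
    note p = refinesD(1)[OF r]
    obtain z where z: "z \<in> pf_carrier M \<Gamma>" "x \<Gamma> = qmap M \<Gamma> z"
      using PD_val_memD(2)[OF x r] by (rule bar_cases)
    show "comp_map bar_proj \<Lambda> (comp_map (bar_map M' (PD_eta M)) \<Lambda> x) \<Gamma> = x \<Gamma>"
      unfolding comp_map_apply[OF r] z(2) bar_map_qmap[OF M'.pf PD_eta_morphism[OF M'] p z(1)]
        bar_proj_qmap[OF M' p PD_eta_closed[OF z(1)]] PD_eta_apply[OF refines_refl[OF p]] res_id[OF p z(1)] ..
  qed
qed

text \<open>The component of the unit at \<Gamma> is the class of the restriction of x to \<Gamma>,
  and the top component of this restriction is the \<Gamma>-component of x.\<close>

lemma (in part_functor) PD_mu_eta:
  assumes M': "is_PD M M'"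
  shows "mor_eq M' (PD_mu \<bullet> PD_eta M') mor_id"
proof (rule mor_eqI)
  interpret M': part_functor M' using part_functorD[OF PD_partition_functor[OF M']] .
  fix \<Lambda> x assume "x \<in> pf_carrier M' \<Lambda>"
  hence x: "x \<in> carrier (PD_val M \<Lambda>)" by (simp add: is_PD_simps[OF M'])
  show "(PD_mu \<bullet> PD_eta M') \<Lambda> x = mor_id \<Lambda> x"
    unfolding mor_comp_def[of _ _ \<Lambda> x] PD_mu_comp_map mor_id_def
  proof (rule PD_val_eqI[OF comp_map_extensional PD_val_memD(1)[OF x]])
    fix \<Gamma> assume r: "\<Gamma> \<preceq> \<Lambda>"
    note p = refinesD(1)[OF r]
    have "bar_proj \<Gamma> (qmap M' \<Gamma> (PD_res M \<Gamma> \<Lambda> id x)) = PD_res M \<Gamma> \<Lambda> id x \<Gamma>"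
      using bar_proj_qmap[OF M' p PD_res_closed[OF x refinesD(5)[OF r]]] .
    also have "\<dots> = x \<Gamma>"
      using PD_at_id[OF PD_res_closed[OF x refinesD(5)[OF r]] refines_refl[OF p]] PD_at_id[OF x r]
        PD_at_res[OF x refinesD(5)[OF r] mor_id[OF p]] by simp
    finally show "comp_map bar_proj \<Lambda> (PD_eta M' \<Lambda> x) \<Gamma> = x \<Gamma>"
      unfolding comp_map_apply[OF r] M'.PD_eta_apply[OF r] by (simp add: is_PD_simps[OF M'])
  qed
qed

section \<open>Disjoint unions\<close>

lemma djunion_simps:
  "Lft x \<in> pts (\<Lambda> \<uplus> \<Omega>) \<longleftrightarrow> x \<in> pts \<Lambda>" "Rgt y \<in> pts (\<Lambda> \<uplus> \<Omega>) \<longleftrightarrow> y \<in> pts \<Omega>"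
  "(Lft x, Lft x') \<in> rel (\<Lambda> \<uplus> \<Omega>) \<longleftrightarrow> (x, x') \<in> rel \<Lambda>"
  "(Rgt y, Rgt y') \<in> rel (\<Lambda> \<uplus> \<Omega>) \<longleftrightarrow> (y, y') \<in> rel \<Omega>"
  "(Lft x, Rgt y) \<notin> rel (\<Lambda> \<uplus> \<Omega>)" "(Rgt y, Lft x) \<notin> rel (\<Lambda> \<uplus> \<Omega>)"
  by (auto simp: djunion_def)

lemma djunion_ptsE:
  assumes "p \<in> pts (\<Lambda> \<uplus> \<Omega>)"
  obtains x where "x \<in> pts \<Lambda>" "p = Lft x" | y where "y \<in> pts \<Omega>" "p = Rgt y"
  using assms by (auto simp: djunion_def)

lemma djunion_relE:
  assumes "(p, q) \<in> rel (\<Lambda> \<uplus> \<Omega>)"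
  obtains x x' where "(x, x') \<in> rel \<Lambda>" "p = Lft x" "q = Lft x'"
    | y y' where "(y, y') \<in> rel \<Omega>" "p = Rgt y" "q = Rgt y'"
  using assms by (auto simp: djunion_def)

lemma djunion_partition:
  assumes "is_partition \<Lambda>" "is_partition \<Omega>"
  shows "is_partition (\<Lambda> \<uplus> \<Omega>)"
proof (rule is_partitionI)
  note L = is_partitionD[OF assms(1)] and O = is_partitionD[OF assms(2)]
  show "finite (pts (\<Lambda> \<uplus> \<Omega>))" using L(1) O(1) by (simp add: djunion_def)
  show "rel (\<Lambda> \<uplus> \<Omega>) \<subseteq> pts (\<Lambda> \<uplus> \<Omega>) \<times> pts (\<Lambda> \<uplus> \<Omega>)" using L(2) O(2) by (auto simp: djunion_def)
  show "(p, p) \<in> rel (\<Lambda> \<uplus> \<Omega>)" if "p \<in> pts (\<Lambda> \<uplus> \<Omega>)" for p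
    using that by (rule djunion_ptsE) (simp_all add: djunion_simps L(3) O(3))
  show "(q, p) \<in> rel (\<Lambda> \<uplus> \<Omega>)" if "(p, q) \<in> rel (\<Lambda> \<uplus> \<Omega>)" for p q
    using that
  proof (cases rule: djunion_relE)
    case (1 x x') thus ?thesis using L(4)[of x x'] by (simp add: djunion_simps)
  next
    case (2 y y') thus ?thesis using O(4)[of y y'] by (simp add: djunion_simps)
  qed
  show "(p, r) \<in> rel (\<Lambda> \<uplus> \<Omega>)" if h: "(p, q) \<in> rel (\<Lambda> \<uplus> \<Omega>)" "(q, r) \<in> rel (\<Lambda> \<uplus> \<Omega>)" for p q r
    using h(1)
  proof (cases rule: djunion_relE)
    case (1 x x')
    with h(2) obtain x'' where "(x', x'') \<in> rel \<Lambda>" "r = Lft x''" by (auto elim: djunion_relE)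
    thus ?thesis using 1 L(5)[of x x' x''] by (simp add: djunion_simps)
  next
    case (2 y y')
    with h(2) obtain y'' where "(y', y'') \<in> rel \<Omega>" "r = Rgt y''" by (auto elim: djunion_relE)
    thus ?thesis using 2 O(5)[of y y' y''] by (simp add: djunion_simps)
  qed
qed

lemma sum_map_id [simp]: "sum_map id id = id"
proof
  fix p :: "'u point" show "sum_map id id p = id p" by (cases p) auto
qed

lemma sum_map_comp: "sum_map f g \<circ> sum_map f' g' = sum_map (f \<circ> f') (g \<circ> g')"
proof
  fix p show "(sum_map f g \<circ> sum_map f' g') p = sum_map (f \<circ> f') (g \<circ> g') p" by (cases p) auto
qed

lemma sum_map_mor:
  assumes "is_mor \<Lambda> \<Lambda>' f" "is_mor \<Omega> \<Omega>' g"
  shows "is_mor (\<Lambda> \<uplus> \<Omega>) (\<Lambda>' \<uplus> \<Omega>') (sum_map f g)"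
proof (rule is_morI)
  note F = is_morD[OF assms(1)] and G = is_morD[OF assms(2)]
  show "is_partition (\<Lambda> \<uplus> \<Omega>)" "is_partition (\<Lambda>' \<uplus> \<Omega>')" using djunion_partition F(1,2) G(1,2) by auto
  show "bij_betw (sum_map f g) (pts (\<Lambda> \<uplus> \<Omega>)) (pts (\<Lambda>' \<uplus> \<Omega>'))"
  proof (rule bij_betw_imageI)
    show "inj_on (sum_map f g) (pts (\<Lambda> \<uplus> \<Omega>))"
      by (rule inj_onI) (auto elim!: djunion_ptsE dest: inj_onD[OF F(4)] inj_onD[OF G(4)])
    show "sum_map f g ` pts (\<Lambda> \<uplus> \<Omega>) = pts (\<Lambda>' \<uplus> \<Omega>')"
      unfolding F(5)[symmetric] G(5)[symmetric] djunion_def by (simp add: image_Un image_image)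
  qed
  fix p q assume "(p, q) \<in> rel (\<Lambda> \<uplus> \<Omega>)"
  thus "(sum_map f g p, sum_map f g q) \<in> rel (\<Lambda>' \<uplus> \<Omega>')"
    by (rule djunion_relE) (simp_all add: djunion_simps F(7) G(7))
qed

lemma transport_sum_map: "transport (sum_map f g) (\<Gamma> \<uplus> \<Theta>) = transport f \<Gamma> \<uplus> transport g \<Theta>"
  by (simp add: transport_def djunion_def image_Un image_image prod.map_comp comp_def
      map_prod_def case_prod_unfold)

lemma sum_map_iso:
  "is_iso \<Gamma> \<Gamma>' f \<Longrightarrow> is_iso \<Theta> \<Theta>' g \<Longrightarrow> is_iso (\<Gamma> \<uplus> \<Theta>) (\<Gamma>' \<uplus> \<Theta>') (sum_map f g)"
  by (auto simp: is_iso_iff transport_sum_map intro: sum_map_mor)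

lemma djunion_parts [simp]: "left_part (\<Gamma> \<uplus> \<Theta>) = \<Gamma>" "right_part (\<Gamma> \<uplus> \<Theta>) = \<Theta>"
  by (auto simp: left_part_def right_part_def djunion_def intro!: partition_eqI)

lemma djunion_refines: "\<Gamma> \<preceq> \<Lambda> \<Longrightarrow> \<Theta> \<preceq> \<Omega> \<Longrightarrow> \<Gamma> \<uplus> \<Theta> \<preceq> \<Lambda> \<uplus> \<Omega>"
  using djunion_partition[of \<Gamma> \<Theta>] djunion_partition[of \<Lambda> \<Omega>]
  by (auto simp: refines_iff djunion_def)

lemma djunion_strictly_refines:
  assumes "is_partition \<Theta>" "\<Omega> \<prec> \<Gamma>"
  shows "\<Omega> \<uplus> \<Theta> \<prec> \<Gamma> \<uplus> \<Theta>" "\<Theta> \<uplus> \<Omega> \<prec> \<Theta> \<uplus> \<Gamma>"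
  using djunion_refines[OF strictly_refinesD(1)[OF assms(2)] refines_refl[OF assms(1)]]
    djunion_refines[OF refines_refl[OF assms(1)] strictly_refinesD(1)[OF assms(2)]]
    djunion_parts(1)[of \<Omega> \<Theta>] djunion_parts(1)[of \<Gamma> \<Theta>] djunion_parts(2)[of \<Theta> \<Omega>] djunion_parts(2)[of \<Theta> \<Gamma>] assms(2)
  unfolding strictly_refines_def by metis+

text \<open>No block of a disjoint union meets both sides, so neither does a block of a refinement;
  the refinement is therefore the disjoint union of its preimages under the two inclusions.\<close>

lemma refines_djunionE:
  assumes "\<Delta> \<preceq> \<Lambda> \<uplus> \<Omega>" "is_partition \<Lambda>" "is_partition \<Omega>"
  obtains \<Gamma> \<Theta> where "\<Gamma> \<preceq> \<Lambda>" "\<Theta> \<preceq> \<Omega>" "\<Delta> = \<Gamma> \<uplus> \<Theta>"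
proof -
  note r = refinesD[OF assms(1)]
  note D = is_partitionD[OF r(1)]
  have pL: "x \<in> pts (left_part \<Delta>) \<longleftrightarrow> x \<in> pts \<Lambda>" and pR: "x \<in> pts (right_part \<Delta>) \<longleftrightarrow> x \<in> pts \<Omega>" for x
    using r(3) by (auto simp: left_part_def right_part_def djunion_simps)
  have "is_partition (left_part \<Delta>)"
  proof (rule is_partitionI)
    have "pts (left_part \<Delta>) = pts \<Lambda>" using pL by blast
    thus "finite (pts (left_part \<Delta>))" using is_partitionD(1)[OF assms(2)] by simp
    show "rel (left_part \<Delta>) \<subseteq> pts (left_part \<Delta>) \<times> pts (left_part \<Delta>)"
      using D(2) by (auto simp: left_part_def)
    show "(x, z) \<in> rel (left_part \<Delta>)" if "(x, y) \<in> rel (left_part \<Delta>)" "(y, z) \<in> rel (left_part \<Delta>)" for x y z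
      using that D(5)[of "Lft x" "Lft y" "Lft z"] by (simp add: left_part_def)
  qed (auto simp: left_part_def intro: D(3) D(4))
  moreover have "rel (left_part \<Delta>) \<subseteq> rel \<Lambda>"
  proof clarify
    fix x y assume "(x, y) \<in> rel (left_part \<Delta>)"
    hence "(Lft x, Lft y) \<in> rel (\<Lambda> \<uplus> \<Omega>)" using r(4) by (auto simp: left_part_def)
    thus "(x, y) \<in> rel \<Lambda>" by (simp add: djunion_simps)
  qed
  moreover have "pts (left_part \<Delta>) = pts \<Lambda>" using pL by blast
  ultimately have L: "left_part \<Delta> \<preceq> \<Lambda>" using assms(2) by (simp add: refines_iff)
  have "is_partition (right_part \<Delta>)"
  proof (rule is_partitionI)
    have "pts (right_part \<Delta>) = pts \<Omega>" using pR by blast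
    thus "finite (pts (right_part \<Delta>))" using is_partitionD(1)[OF assms(3)] by simp
    show "rel (right_part \<Delta>) \<subseteq> pts (right_part \<Delta>) \<times> pts (right_part \<Delta>)"
      using D(2) by (auto simp: right_part_def)
    show "(x, z) \<in> rel (right_part \<Delta>)" if "(x, y) \<in> rel (right_part \<Delta>)" "(y, z) \<in> rel (right_part \<Delta>)" for x y z
      using that D(5)[of "Rgt x" "Rgt y" "Rgt z"] by (simp add: right_part_def)
  qed (auto simp: right_part_def intro: D(3) D(4))
  moreover have "rel (right_part \<Delta>) \<subseteq> rel \<Omega>"
  proof clarify
    fix x y assume "(x, y) \<in> rel (right_part \<Delta>)"
    hence "(Rgt x, Rgt y) \<in> rel (\<Lambda> \<uplus> \<Omega>)" using r(4) by (auto simp: right_part_def)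
    thus "(x, y) \<in> rel \<Omega>" by (simp add: djunion_simps)
  qed
  moreover have "pts (right_part \<Delta>) = pts \<Omega>" using pR by blast
  ultimately have R: "right_part \<Delta> \<preceq> \<Omega>" using assms(3) by (simp add: refines_iff)
  have "\<Delta> = left_part \<Delta> \<uplus> right_part \<Delta>"
  proof (rule partition_eqI)
    show "pts \<Delta> = pts (left_part \<Delta> \<uplus> right_part \<Delta>)"
      using r(3) by (auto simp: left_part_def right_part_def djunion_def)
    show "rel \<Delta> = rel (left_part \<Delta> \<uplus> right_part \<Delta>)"
      using r(4) by (force simp: left_part_def right_part_def djunion_def)
  qed
  thus ?thesis using that L R by blast
qed

lemma sum_map_two_iso_iff:
  assumes "is_mor \<Gamma> \<Lambda> l" "is_mor \<Gamma> \<Lambda> m" "is_mor \<Theta> \<Omega> l'" "is_mor \<Theta> \<Omega> m'"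
  shows "two_iso (\<Gamma> \<uplus> \<Theta>) (\<Lambda> \<uplus> \<Omega>) (sum_map l l') (sum_map m m') \<longleftrightarrow> two_iso \<Gamma> \<Lambda> l m \<and> two_iso \<Theta> \<Omega> l' m'"
proof -
  have "pts (\<Gamma> \<uplus> \<Theta>) = Lft ` pts \<Gamma> \<union> Rgt ` pts \<Theta>" by (simp add: djunion_def)
  hence "(\<forall>p \<in> pts (\<Gamma> \<uplus> \<Theta>). (sum_map l l' p, sum_map m m' p) \<in> rel (\<Lambda> \<uplus> \<Omega>)) \<longleftrightarrow>
      (\<forall>x \<in> pts \<Gamma>. (l x, m x) \<in> rel \<Lambda>) \<and> (\<forall>y \<in> pts \<Theta>. (l' y, m' y) \<in> rel \<Omega>)"
    by (simp add: ball_Un djunion_simps)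
  thus ?thesis
    using assms sum_map_mor[OF assms(1,3)] sum_map_mor[OF assms(2,4)] by (simp add: two_iso_def)
qed

lemma sum_map_lifts:
  assumes "l \<in> lifts \<Gamma> \<Lambda> \<Lambda>' f k" "m \<in> lifts \<Theta> \<Omega> \<Omega>' g k'" "is_mor \<Lambda> \<Lambda>' f" "is_mor \<Omega> \<Omega>' g"
  shows "sum_map l m \<in> lifts (\<Gamma> \<uplus> \<Theta>) (\<Lambda> \<uplus> \<Omega>) (\<Lambda>' \<uplus> \<Omega>') (sum_map f g) (sum_map k k')"
proof -
  note l = liftsD[OF assms(1)] and m = liftsD[OF assms(2)]
  show ?thesis
    using sum_map_mor[OF l(1) m(1)] l(2) m(2)
      sum_map_two_iso_iff[OF mor_comp[OF l(1) assms(3)] two_isoD(2)[OF l(2)] mor_comp[OF m(1) assms(4)] two_isoD(2)[OF m(2)]]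
    by (simp add: lifts_def sum_map_comp)
qed

text \<open>The map \<open>sum_map f g\<close> keeps sides, and its composite with \<open>l\<close>
  is 2-isomorphic to the identity, whose blocks lie on one side. Hence \<open>l\<close> cannot
  exchange the sides and restricts to a lift on each of them. The splitting is an equality on points
  only.\<close>

lemma lifts_splitE:
  assumes l: "l \<in> lifts (\<Gamma> \<uplus> \<Theta>) (\<Lambda> \<uplus> \<Omega>) (\<Lambda>' \<uplus> \<Omega>') (sum_map f g) id"
    and p: "is_partition \<Gamma>" "is_partition \<Theta>" and f: "is_mor \<Lambda> \<Lambda>' f" and g: "is_mor \<Omega> \<Omega>' g"
  obtains l1 l2 where "l1 \<in> lifts \<Gamma> \<Lambda> \<Lambda>' f id" "l2 \<in> lifts \<Theta> \<Omega> \<Omega>' g id"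
    "\<And>q. q \<in> pts (\<Gamma> \<uplus> \<Theta>) \<Longrightarrow> l q = sum_map l1 l2 q"
proof -
  note m = liftsD[OF l]
  note M = is_morD[OF m(1)]
  \<comment> \<open>If the value lay on the right, its image under \<open>sum_map f g\<close> would
    be on the right too and could not be related to \<open>Lft x\<close>.\<close>
  have L: "\<exists>y. l (Lft x) = Lft y \<and> y \<in> pts \<Lambda> \<and> (f y, x) \<in> rel \<Lambda>'" if "x \<in> pts \<Gamma>" for x
  proof -
    have "Lft x \<in> pts (\<Gamma> \<uplus> \<Theta>)" using that by (simp add: djunion_simps)
    hence "l (Lft x) \<in> pts (\<Lambda> \<uplus> \<Omega>)" and e: "(sum_map f g (l (Lft x)), Lft x) \<in> rel (\<Lambda>' \<uplus> \<Omega>')"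
      using M(6) two_isoD(3)[OF m(2)] by fastforce+
    thus ?thesis by (elim djunion_ptsE) (auto simp: djunion_simps)
  qed
  have R: "\<exists>y. l (Rgt x) = Rgt y \<and> y \<in> pts \<Omega> \<and> (g y, x) \<in> rel \<Omega>'" if "x \<in> pts \<Theta>" for x
  proof -
    have "Rgt x \<in> pts (\<Gamma> \<uplus> \<Theta>)" using that by (simp add: djunion_simps)
    hence "l (Rgt x) \<in> pts (\<Lambda> \<uplus> \<Omega>)" and e: "(sum_map f g (l (Rgt x)), Rgt x) \<in> rel (\<Lambda>' \<uplus> \<Omega>')"
      using M(6) two_isoD(3)[OF m(2)] by fastforce+
    thus ?thesis by (elim djunion_ptsE) (auto simp: djunion_simps)
  qed
  obtain l1 where l1: "\<And>x. x \<in> pts \<Gamma> \<Longrightarrow> l (Lft x) = Lft (l1 x) \<and> l1 x \<in> pts \<Lambda> \<and> (f (l1 x), x) \<in> rel \<Lambda>'"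
    using L by metis
  obtain l2 where l2: "\<And>x. x \<in> pts \<Theta> \<Longrightarrow> l (Rgt x) = Rgt (l2 x) \<and> l2 x \<in> pts \<Omega> \<and> (g (l2 x), x) \<in> rel \<Omega>'"
    using R by metis
  have pL: "is_partition \<Lambda>" "is_partition \<Omega>" using is_morD(1) f g by blast+
  have m1: "is_mor \<Gamma> \<Lambda> l1"
  proof (rule is_morI[OF p(1) pL(1)])
    show "bij_betw l1 (pts \<Gamma>) (pts \<Lambda>)"
    proof (rule bij_betw_imageI)
      show "inj_on l1 (pts \<Gamma>)"
      proof (rule inj_onI)
        fix x y assume "x \<in> pts \<Gamma>" "y \<in> pts \<Gamma>" "l1 x = l1 y"
        thus "x = y" using inj_onD[OF M(4), of "Lft x" "Lft y"] l1 by (simp add: djunion_simps)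
      qed
      show "l1 ` pts \<Gamma> = pts \<Lambda>"
      proof
        show "l1 ` pts \<Gamma> \<subseteq> pts \<Lambda>" using l1 by auto
        show "pts \<Lambda> \<subseteq> l1 ` pts \<Gamma>"
        proof
          fix y assume "y \<in> pts \<Lambda>"
          hence "Lft y \<in> l ` pts (\<Gamma> \<uplus> \<Theta>)" using M(5) by (simp add: djunion_simps)
          then obtain q where q: "q \<in> pts (\<Gamma> \<uplus> \<Theta>)" "Lft y = l q" by blast
          from q(1) show "y \<in> l1 ` pts \<Gamma>" by (rule djunion_ptsE) (use q(2) l1 l2 in auto)
        qed
      qed
    qed
    fix x y assume xy: "(x, y) \<in> rel \<Gamma>"
    hence "x \<in> pts \<Gamma>" "y \<in> pts \<Gamma>" using is_partitionD(2)[OF p(1)] by auto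
    thus "(l1 x, l1 y) \<in> rel \<Lambda>" using M(7)[of "Lft x" "Lft y"] xy l1 by (simp add: djunion_simps)
  qed
  have m2: "is_mor \<Theta> \<Omega> l2"
  proof (rule is_morI[OF p(2) pL(2)])
    show "bij_betw l2 (pts \<Theta>) (pts \<Omega>)"
    proof (rule bij_betw_imageI)
      show "inj_on l2 (pts \<Theta>)"
      proof (rule inj_onI)
        fix x y assume "x \<in> pts \<Theta>" "y \<in> pts \<Theta>" "l2 x = l2 y"
        thus "x = y" using inj_onD[OF M(4), of "Rgt x" "Rgt y"] l2 by (simp add: djunion_simps)
      qed
      show "l2 ` pts \<Theta> = pts \<Omega>"
      proof
        show "l2 ` pts \<Theta> \<subseteq> pts \<Omega>" using l2 by auto
        show "pts \<Omega> \<subseteq> l2 ` pts \<Theta>"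
        proof
          fix y assume "y \<in> pts \<Omega>"
          hence "Rgt y \<in> l ` pts (\<Gamma> \<uplus> \<Theta>)" using M(5) by (simp add: djunion_simps)
          then obtain q where q: "q \<in> pts (\<Gamma> \<uplus> \<Theta>)" "Rgt y = l q" by blast
          from q(1) show "y \<in> l2 ` pts \<Theta>" by (rule djunion_ptsE) (use q(2) l1 l2 in auto)
        qed
      qed
    qed
    fix x y assume xy: "(x, y) \<in> rel \<Theta>"
    hence "x \<in> pts \<Theta>" "y \<in> pts \<Theta>" using is_partitionD(2)[OF p(2)] by auto
    thus "(l2 x, l2 y) \<in> rel \<Omega>" using M(7)[of "Rgt x" "Rgt y"] xy l2 by (simp add: djunion_simps)
  qed
  \<comment> \<open>That the identity is a morphism on each side is extracted from the
    2-isomorphism: its target being a morphism means that the disjoint union refines the other one,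
    and refinements of disjoint unions split.\<close>
  have idm: "is_mor \<Gamma> \<Lambda>' id" "is_mor \<Theta> \<Omega>' id"
  proof -
    have "is_mor (\<Gamma> \<uplus> \<Theta>) (\<Lambda>' \<uplus> \<Omega>') id" using two_isoD(2)[OF m(2)] .
    hence s: "\<Gamma> \<uplus> \<Theta> \<preceq> \<Lambda>' \<uplus> \<Omega>'" by (auto simp: refines_def is_mor_def bij_betw_def)
    obtain G T where "G \<preceq> \<Lambda>'" "T \<preceq> \<Omega>'" "\<Gamma> \<uplus> \<Theta> = G \<uplus> T"
      using refines_djunionE[OF s is_morD(2)[OF f] is_morD(2)[OF g]] .
    moreover from this have "\<Gamma> = G" "\<Theta> = T" using djunion_parts by metis+
    ultimately show "is_mor \<Gamma> \<Lambda>' id" "is_mor \<Theta> \<Omega>' id" using refinesD(5) by auto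
  qed
  have "l1 \<in> lifts \<Gamma> \<Lambda> \<Lambda>' f id" "l2 \<in> lifts \<Theta> \<Omega> \<Omega>' g id"
    using m1 m2 l1 l2 idm mor_comp[OF m1 f] mor_comp[OF m2 g] by (auto simp: lifts_def two_iso_def)
  moreover have "l q = sum_map l1 l2 q" if "q \<in> pts (\<Gamma> \<uplus> \<Theta>)" for q
    using that by (rule djunion_ptsE) (use l1 l2 in auto)
  ultimately show ?thesis using that by blast
qed

section \<open>The empty partition and the coherence isomorphisms\<close>

lemma indiscrete_partition: "is_partition (indiscrete m)"
  by (rule is_partitionI) (auto simp: indiscrete_def)

lemma refines_indiscrete_0: "\<Gamma> \<preceq> indiscrete 0 \<longleftrightarrow> \<Gamma> = (indiscrete 0 :: 'u set_partition)"
  using refines_refl[OF indiscrete_partition[of 0]]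
  by (auto simp: refines_iff indiscrete_def intro!: partition_eqI)

lemma inj_assoc_map: "inj_on assoc_map (pts ((\<Lambda> \<uplus> \<Omega>) \<uplus> \<Theta>))"
  and inj_swap_map: "inj_on swap_map (pts (\<Lambda> \<uplus> \<Omega>))"
  and inj_unit_map: "inj_on unit_map (pts (indiscrete 0 \<uplus> \<Lambda>))" "inj_on unit_map (pts (\<Lambda> \<uplus> indiscrete 0))"
  by (auto simp: inj_on_def djunion_def indiscrete_def)

lemma transport_assoc_map: "transport assoc_map ((\<Lambda> \<uplus> \<Omega>) \<uplus> \<Theta>) = \<Lambda> \<uplus> (\<Omega> \<uplus> \<Theta>)"
  and transport_swap_map: "transport swap_map (\<Lambda> \<uplus> \<Omega>) = \<Omega> \<uplus> \<Lambda>"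
  and transport_unit_map: "transport unit_map (indiscrete 0 \<uplus> \<Lambda>) = \<Lambda>" "transport unit_map (\<Lambda> \<uplus> indiscrete 0) = \<Lambda>"
  by (auto simp: transport_def djunion_def indiscrete_def image_Un image_image map_prod_def case_prod_unfold
      intro!: partition_eqI)

lemma assoc_map_iso:
  assumes "is_partition \<Lambda>" "is_partition \<Omega>" "is_partition \<Theta>"
  shows "is_iso ((\<Lambda> \<uplus> \<Omega>) \<uplus> \<Theta>) (\<Lambda> \<uplus> (\<Omega> \<uplus> \<Theta>)) assoc_map"
  using iso_transport[OF djunion_partition[OF djunion_partition[OF assms(1,2)] assms(3)] inj_assoc_map]
  by (simp add: transport_assoc_map)

lemma swap_map_iso:
  assumes "is_partition \<Lambda>" "is_partition \<Omega>"
  shows "is_iso (\<Lambda> \<uplus> \<Omega>) (\<Omega> \<uplus> \<Lambda>) swap_map"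
  using iso_transport[OF djunion_partition[OF assms] inj_swap_map] by (simp add: transport_swap_map)

lemma unit_map_iso:
  assumes "is_partition \<Lambda>"
  shows "is_iso (indiscrete 0 \<uplus> \<Lambda>) \<Lambda> unit_map" "is_iso (\<Lambda> \<uplus> indiscrete 0) \<Lambda> unit_map"
  using iso_transport[OF djunion_partition[OF indiscrete_partition assms] inj_unit_map(1)]
    iso_transport[OF djunion_partition[OF assms indiscrete_partition] inj_unit_map(2)]
  by (simp_all add: transport_unit_map)

section \<open>PD of a lax symmetric monoidal partition functor\<close>

locale lax_functor =
  fixes R :: "('u, 'a, 'z) lax_pfun_scheme"
  assumes lax: "lax_partition_functor R"
begin

lemmas lax_ax = lax[unfolded lax_partition_functor_def]

sublocale part_functor R
  by unfold_locales (rule lax_ax[THEN conjunct1])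

lemma unit_hom: "lx_unit R \<in> add_hom \<Z> (pf_val R (indiscrete 0))"
  using lax_ax[THEN conjunct2, THEN conjunct1] .

lemma prod_hom_right: "is_partition \<Lambda> \<Longrightarrow> is_partition \<Omega> \<Longrightarrow> x \<in> pf_carrier R \<Lambda> \<Longrightarrow>
    lx_prod R \<Lambda> \<Omega> x \<in> add_hom (pf_val R \<Omega>) (pf_val R (\<Lambda> \<uplus> \<Omega>))"
  and prod_hom_left: "is_partition \<Lambda> \<Longrightarrow> is_partition \<Omega> \<Longrightarrow> y \<in> pf_carrier R \<Omega> \<Longrightarrow>
    (\<lambda>x. lx_prod R \<Lambda> \<Omega> x y) \<in> add_hom (pf_val R \<Lambda>) (pf_val R (\<Lambda> \<uplus> \<Omega>))"
  using lax_ax[THEN conjunct2, THEN conjunct2, THEN conjunct1] by blast+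

lemma prod_res: "is_mor \<Lambda> \<Lambda>' f \<Longrightarrow> is_mor \<Omega> \<Omega>' g \<Longrightarrow> x \<in> pf_carrier R \<Lambda>' \<Longrightarrow> y \<in> pf_carrier R \<Omega>' \<Longrightarrow>
    pf_res R (\<Lambda> \<uplus> \<Omega>) (\<Lambda>' \<uplus> \<Omega>') (sum_map f g) (lx_prod R \<Lambda>' \<Omega>' x y) =
      lx_prod R \<Lambda> \<Omega> (pf_res R \<Lambda> \<Lambda>' f x) (pf_res R \<Omega> \<Omega>' g y)"
  and prod_tr: "is_mor \<Lambda> \<Lambda>' f \<Longrightarrow> is_mor \<Omega> \<Omega>' g \<Longrightarrow> x' \<in> pf_carrier R \<Lambda> \<Longrightarrow> y' \<in> pf_carrier R \<Omega> \<Longrightarrow>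
    pf_tr R (\<Lambda> \<uplus> \<Omega>) (\<Lambda>' \<uplus> \<Omega>') (sum_map f g) (lx_prod R \<Lambda> \<Omega> x' y') =
      lx_prod R \<Lambda>' \<Omega>' (pf_tr R \<Lambda> \<Lambda>' f x') (pf_tr R \<Omega> \<Omega>' g y')"
  using lax_ax[THEN conjunct2, THEN conjunct2, THEN conjunct2, THEN conjunct1] by blast+

lemma prod_assoc: "is_partition \<Lambda> \<Longrightarrow> is_partition \<Omega> \<Longrightarrow> is_partition \<Theta> \<Longrightarrow>
    x \<in> pf_carrier R \<Lambda> \<Longrightarrow> y \<in> pf_carrier R \<Omega> \<Longrightarrow> z \<in> pf_carrier R \<Theta> \<Longrightarrow>
    pf_tr R ((\<Lambda> \<uplus> \<Omega>) \<uplus> \<Theta>) (\<Lambda> \<uplus> (\<Omega> \<uplus> \<Theta>)) assoc_map (lx_prod R (\<Lambda> \<uplus> \<Omega>) \<Theta> (lx_prod R \<Lambda> \<Omega> x y) z) =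
      lx_prod R \<Lambda> (\<Omega> \<uplus> \<Theta>) x (lx_prod R \<Omega> \<Theta> y z)"
  using lax_ax[THEN conjunct2, THEN conjunct2, THEN conjunct2, THEN conjunct2, THEN conjunct1] by blast

lemma prod_unit: "is_partition \<Lambda> \<Longrightarrow> x \<in> pf_carrier R \<Lambda> \<Longrightarrow>
    pf_tr R (indiscrete 0 \<uplus> \<Lambda>) \<Lambda> unit_map (lx_prod R (indiscrete 0) \<Lambda> (lx_unit R 1) x) = x"
  "is_partition \<Lambda> \<Longrightarrow> x \<in> pf_carrier R \<Lambda> \<Longrightarrow>
    pf_tr R (\<Lambda> \<uplus> indiscrete 0) \<Lambda> unit_map (lx_prod R \<Lambda> (indiscrete 0) x (lx_unit R 1)) = x"
  using lax_ax[THEN conjunct2, THEN conjunct2, THEN conjunct2, THEN conjunct2, THEN conjunct2, THEN conjunct1] by blast+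

lemma prod_sym: "is_partition \<Lambda> \<Longrightarrow> is_partition \<Omega> \<Longrightarrow> x \<in> pf_carrier R \<Lambda> \<Longrightarrow> y \<in> pf_carrier R \<Omega> \<Longrightarrow>
    pf_tr R (\<Lambda> \<uplus> \<Omega>) (\<Omega> \<uplus> \<Lambda>) swap_map (lx_prod R \<Lambda> \<Omega> x y) = lx_prod R \<Omega> \<Lambda> y x"
  using lax_ax[THEN conjunct2, THEN conjunct2, THEN conjunct2, THEN conjunct2, THEN conjunct2, THEN conjunct2] by blast

lemma unit_closed: "lx_unit R k \<in> pf_carrier R (indiscrete 0)"
  using add_hom_closed[OF unit_hom] by simp

lemma prod_closed: "is_partition \<Lambda> \<Longrightarrow> is_partition \<Omega> \<Longrightarrow> x \<in> pf_carrier R \<Lambda> \<Longrightarrow> y \<in> pf_carrier R \<Omega> \<Longrightarrow>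
    lx_prod R \<Lambda> \<Omega> x y \<in> pf_carrier R (\<Lambda> \<uplus> \<Omega>)"
  using add_hom_closed[OF prod_hom_right] .

text \<open>The product of a proper transfer with \<open>y\<close> is a transfer along \<Omega>
  \<uplus> \<Theta> < \<Gamma> \<uplus> \<Theta>, by naturality of products in transfers with the
  identity on the other factor. This refinement is again proper, so the product vanishes in the
  quotient.\<close>

lemma qmap_prod_tr:
  assumes "\<Omega> \<prec> \<Gamma>" "is_partition \<Theta>" "w \<in> pf_carrier R \<Omega>" "y \<in> pf_carrier R \<Theta>"
  shows "qmap R (\<Gamma> \<uplus> \<Theta>) (lx_prod R \<Gamma> \<Theta> (pf_tr R \<Omega> \<Gamma> id w) y) = \<zero>\<^bsub>bar R (\<Gamma> \<uplus> \<Theta>)\<^esub>"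
    "qmap R (\<Theta> \<uplus> \<Gamma>) (lx_prod R \<Theta> \<Gamma> y (pf_tr R \<Omega> \<Gamma> id w)) = \<zero>\<^bsub>bar R (\<Theta> \<uplus> \<Gamma>)\<^esub>"
proof -
  note m = strictly_refinesD(2)[OF assms(1)] and i = mor_id[OF assms(2)]
  note p = refinesD(1)[OF strictly_refinesD(1)[OF assms(1)]]
  have "lx_prod R \<Gamma> \<Theta> (pf_tr R \<Omega> \<Gamma> id w) y = pf_tr R (\<Omega> \<uplus> \<Theta>) (\<Gamma> \<uplus> \<Theta>) id (lx_prod R \<Omega> \<Theta> w y)"
    using prod_tr[OF m i assms(3,4)] tr_id[OF assms(2,4)] by simp
  thus "qmap R (\<Gamma> \<uplus> \<Theta>) (lx_prod R \<Gamma> \<Theta> (pf_tr R \<Omega> \<Gamma> id w) y) = \<zero>\<^bsub>bar R (\<Gamma> \<uplus> \<Theta>)\<^esub>"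
    using qmap_tr[OF djunion_strictly_refines(1)[OF assms(2,1)] prod_closed[OF p assms(2,3,4)]] by simp
  have "lx_prod R \<Theta> \<Gamma> y (pf_tr R \<Omega> \<Gamma> id w) = pf_tr R (\<Theta> \<uplus> \<Omega>) (\<Theta> \<uplus> \<Gamma>) id (lx_prod R \<Theta> \<Omega> y w)"
    using prod_tr[OF i m assms(4,3)] tr_id[OF assms(2,4)] by simp
  thus "qmap R (\<Theta> \<uplus> \<Gamma>) (lx_prod R \<Theta> \<Gamma> y (pf_tr R \<Omega> \<Gamma> id w)) = \<zero>\<^bsub>bar R (\<Theta> \<uplus> \<Gamma>)\<^esub>"
    using qmap_tr[OF djunion_strictly_refines(2)[OF assms(2,1)] prod_closed[OF assms(2) p assms(4,3)]] by simp
qed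

text \<open>Independence of representatives is shown in one variable at a time: with the other
  variable fixed, the product is additive and kills proper transfers. The second variable is changed
  first, with \<open>x'\<close> still in place.\<close>

lemma bar_prod_qmap:
  assumes "is_partition \<Gamma>" "is_partition \<Theta>" "x \<in> pf_carrier R \<Gamma>" "y \<in> pf_carrier R \<Theta>"
  shows "bar_prod R \<Gamma> \<Theta> (qmap R \<Gamma> x) (qmap R \<Theta> y) = qmap R (\<Gamma> \<uplus> \<Theta>) (lx_prod R \<Gamma> \<Theta> x y)"
proof -
  note p = djunion_partition[OF assms(1,2)]
  let ?h = "\<lambda>(x, y). qmap R (\<Gamma> \<uplus> \<Theta>) (lx_prod R \<Gamma> \<Theta> x y)"
  have "?h (x', y') = ?h (x, y)" if x': "x' \<in> qmap R \<Gamma> x" and y': "y' \<in> qmap R \<Theta> y" for x' y'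
  proof -
    have c: "x' \<in> pf_carrier R \<Gamma>" using qmap_subset[OF assms(1,3)] x' by blast
    have "qmap R (\<Gamma> \<uplus> \<Theta>) (lx_prod R \<Gamma> \<Theta> x' y') = qmap R (\<Gamma> \<uplus> \<Theta>) (lx_prod R \<Gamma> \<Theta> x' y)"
      by (rule qmap_const[OF assms(2) bar_group[OF p] _ _ assms(4) y',
            OF add_hom_comp[OF prod_hom_right[OF assms(1,2) c] qmap_hom[OF p]]])
        (rule qmap_prod_tr(2)[OF _ assms(1) _ c])
    also have "\<dots> = qmap R (\<Gamma> \<uplus> \<Theta>) (lx_prod R \<Gamma> \<Theta> x y)"
      by (rule qmap_const[OF assms(1) bar_group[OF p] _ _ assms(3) x',
            OF add_hom_comp[OF prod_hom_left[OF assms(1,2,4)] qmap_hom[OF p]]])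
        (rule qmap_prod_tr(1)[OF _ assms(2) _ assms(4)])
    finally show ?thesis by simp
  qed
  hence "?h ` (qmap R \<Gamma> x \<times> qmap R \<Theta> y) = {?h (x, y)}"
    using qmap_self[OF assms(1,3)] qmap_self[OF assms(2,4)] by blast
  thus ?thesis by (simp add: bar_prod_def induced_def)
qed

lemma bar_prod_closed:
  assumes "is_partition \<Gamma>" "is_partition \<Theta>" "a \<in> carrier (bar R \<Gamma>)" "b \<in> carrier (bar R \<Theta>)"
  shows "bar_prod R \<Gamma> \<Theta> a b \<in> carrier (bar R (\<Gamma> \<uplus> \<Theta>))"
  using bar_cases[OF assms(3)] bar_cases[OF assms(4)] bar_prod_qmap[OF assms(1,2)] prod_closed[OF assms(1,2)] qmap_closed
  by metis

lemma bar_prod_hom_right: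
  assumes "is_partition \<Gamma>" "is_partition \<Theta>" "a \<in> carrier (bar R \<Gamma>)"
  shows "bar_prod R \<Gamma> \<Theta> a \<in> add_hom (bar R \<Theta>) (bar R (\<Gamma> \<uplus> \<Theta>))"
proof (rule add_homI)
  note p = djunion_partition[OF assms(1,2)]
  fix b c assume b: "b \<in> carrier (bar R \<Theta>)" and c: "c \<in> carrier (bar R \<Theta>)"
  show "bar_prod R \<Gamma> \<Theta> a b \<in> carrier (bar R (\<Gamma> \<uplus> \<Theta>))" using bar_prod_closed[OF assms b] .
  obtain x where x: "x \<in> pf_carrier R \<Gamma>" "a = qmap R \<Gamma> x" using assms(3) by (rule bar_cases)
  obtain y where y: "y \<in> pf_carrier R \<Theta>" "b = qmap R \<Theta> y" using b by (rule bar_cases)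
  obtain z where z: "z \<in> pf_carrier R \<Theta>" "c = qmap R \<Theta> z" using c by (rule bar_cases)
  note yz = abelian_groupE(1)[OF val_group[OF assms(2)] y(1) z(1)]
  show "bar_prod R \<Gamma> \<Theta> a (b \<oplus>\<^bsub>bar R \<Theta>\<^esub> c) = bar_prod R \<Gamma> \<Theta> a b \<oplus>\<^bsub>bar R (\<Gamma> \<uplus> \<Theta>)\<^esub> bar_prod R \<Gamma> \<Theta> a c"
    using add_hom_add[OF add_hom_comp[OF prod_hom_right[OF assms(1,2) x(1)] qmap_hom[OF p]] y(1) z(1)]
      bar_prod_qmap[OF assms(1,2) x(1)] y z yz x(2) add_hom_add[OF qmap_hom[OF assms(2)] y(1) z(1), symmetric]
    by simp
qed

lemma bar_prod_hom_left:
  assumes "is_partition \<Gamma>" "is_partition \<Theta>" "b \<in> carrier (bar R \<Theta>)"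
  shows "(\<lambda>a. bar_prod R \<Gamma> \<Theta> a b) \<in> add_hom (bar R \<Gamma>) (bar R (\<Gamma> \<uplus> \<Theta>))"
proof (rule add_homI)
  note p = djunion_partition[OF assms(1,2)]
  fix a c assume a: "a \<in> carrier (bar R \<Gamma>)" and c: "c \<in> carrier (bar R \<Gamma>)"
  show "bar_prod R \<Gamma> \<Theta> a b \<in> carrier (bar R (\<Gamma> \<uplus> \<Theta>))" using bar_prod_closed[OF assms(1,2) a assms(3)] .
  obtain x where x: "x \<in> pf_carrier R \<Theta>" "b = qmap R \<Theta> x" using assms(3) by (rule bar_cases)
  obtain y where y: "y \<in> pf_carrier R \<Gamma>" "a = qmap R \<Gamma> y" using a by (rule bar_cases)
  obtain z where z: "z \<in> pf_carrier R \<Gamma>" "c = qmap R \<Gamma> z" using c by (rule bar_cases)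
  note yz = abelian_groupE(1)[OF val_group[OF assms(1)] y(1) z(1)]
  show "bar_prod R \<Gamma> \<Theta> (a \<oplus>\<^bsub>bar R \<Gamma>\<^esub> c) b = bar_prod R \<Gamma> \<Theta> a b \<oplus>\<^bsub>bar R (\<Gamma> \<uplus> \<Theta>)\<^esub> bar_prod R \<Gamma> \<Theta> c b"
    using add_hom_add[OF add_hom_comp[OF prod_hom_left[OF assms(1,2) x(1)] qmap_hom[OF p]] y(1) z(1)]
      bar_prod_qmap[OF assms(1,2) _ x(1)] y z yz x(2) add_hom_add[OF qmap_hom[OF assms(1)] y(1) z(1), symmetric]
    by simp
qed

lemma bar_tr_prod:
  assumes "is_iso \<Gamma> \<Gamma>' f" "is_iso \<Theta> \<Theta>' g" "a \<in> carrier (bar R \<Gamma>)" "b \<in> carrier (bar R \<Theta>)"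
  shows "bar_tr R (\<Gamma> \<uplus> \<Theta>) (\<Gamma>' \<uplus> \<Theta>') (sum_map f g) (bar_prod R \<Gamma> \<Theta> a b) =
    bar_prod R \<Gamma>' \<Theta>' (bar_tr R \<Gamma> \<Gamma>' f a) (bar_tr R \<Theta> \<Theta>' g b)"
proof -
  note f = isoD(1)[OF assms(1)] and g = isoD(1)[OF assms(2)]
  note p = is_morD(1)[OF f] is_morD(1)[OF g] and p' = is_morD(2)[OF f] is_morD(2)[OF g]
  obtain x where x: "x \<in> pf_carrier R \<Gamma>" "a = qmap R \<Gamma> x" using assms(3) by (rule bar_cases)
  obtain y where y: "y \<in> pf_carrier R \<Theta>" "b = qmap R \<Theta> y" using assms(4) by (rule bar_cases)
  show ?thesis
    using x y bar_prod_qmap[OF p x(1) y(1)] bar_tr_qmap[OF sum_map_iso[OF assms(1,2)] prod_closed[OF p x(1) y(1)]]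
      prod_tr[OF f g x(1) y(1)] bar_tr_qmap[OF assms(1) x(1)] bar_tr_qmap[OF assms(2) y(1)]
      bar_prod_qmap[OF p' tr_closed[OF f x(1)] tr_closed[OF g y(1)]] by simp
qed

section \<open>External products on PD and their naturality\<close>

lemma PD_prod_apply:
  "\<Gamma> \<preceq> \<Lambda> \<Longrightarrow> \<Theta> \<preceq> \<Omega> \<Longrightarrow> PD_prod R \<Lambda> \<Omega> x y (\<Gamma> \<uplus> \<Theta>) = bar_prod R \<Gamma> \<Theta> (x \<Gamma>) (y \<Theta>)"
  by (simp add: PD_prod_def djunion_refines)

lemma PD_prod_extensional: "PD_prod R \<Lambda> \<Omega> x y \<in> extensional {\<Delta>. \<Delta> \<preceq> \<Lambda> \<uplus> \<Omega>}"
  by (simp add: PD_prod_def)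

lemma djunion_eqI:
  assumes "is_partition \<Lambda>" "is_partition \<Omega>"
    "x \<in> extensional {\<Delta>. \<Delta> \<preceq> \<Lambda> \<uplus> \<Omega>}" "y \<in> extensional {\<Delta>. \<Delta> \<preceq> \<Lambda> \<uplus> \<Omega>}"
    "\<And>\<Gamma> \<Theta>. \<Gamma> \<preceq> \<Lambda> \<Longrightarrow> \<Theta> \<preceq> \<Omega> \<Longrightarrow> x (\<Gamma> \<uplus> \<Theta>) = y (\<Gamma> \<uplus> \<Theta>)"
  shows "x = y"
  using assms(3,4) by (rule PD_val_eqI) (metis assms(1,2,5) refines_djunionE)

text \<open>A block permutation of a disjoint union preserves both sides, so invariance of the
  product follows from that of the two factors. The two halves need not extend to permutations that
  are carried along explicitly: they enter as morphisms 2-isomorphic to the identity, at which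
  families take the same values.\<close>

lemma PD_prod_closed:
  assumes p: "is_partition \<Lambda>" "is_partition \<Omega>"
    and x: "x \<in> carrier (PD_val R \<Lambda>)" and y: "y \<in> carrier (PD_val R \<Omega>)"
  shows "PD_prod R \<Lambda> \<Omega> x y \<in> carrier (PD_val R (\<Lambda> \<uplus> \<Omega>))"
proof (rule PD_val_memI[OF PD_prod_extensional])
  fix \<Delta> assume \<Delta>: "\<Delta> \<preceq> \<Lambda> \<uplus> \<Omega>"
  then obtain \<Gamma> \<Theta> where G: "\<Gamma> \<preceq> \<Lambda>" "\<Theta> \<preceq> \<Omega>" "\<Delta> = \<Gamma> \<uplus> \<Theta>" using refines_djunionE p by blast
  show "PD_prod R \<Lambda> \<Omega> x y \<Delta> \<in> carrier (bar R \<Delta>)"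
    unfolding G(3) PD_prod_apply[OF G(1,2)]
    using bar_prod_closed[OF refinesD(1)[OF G(1)] refinesD(1)[OF G(2)] PD_val_memD(2)[OF x G(1)] PD_val_memD(2)[OF y G(2)]] .
  fix \<sigma> assume \<sigma>: "\<sigma> \<in> block_perms (\<Lambda> \<uplus> \<Omega>)"
  let ?\<Delta>' = "transport (inv_into UNIV \<sigma>) \<Delta>"
  note b = block_perm_iso[OF \<sigma> \<Delta>]
  obtain \<Gamma>' \<Theta>' where G': "\<Gamma>' \<preceq> \<Lambda>" "\<Theta>' \<preceq> \<Omega>" "?\<Delta>' = \<Gamma>' \<uplus> \<Theta>'" using refines_djunionE[OF b(1) p] .
  note r' = refinesD(1)[OF G'(1)] refinesD(1)[OF G'(2)]
  have b2: "is_iso (\<Gamma>' \<uplus> \<Theta>') (\<Gamma> \<uplus> \<Theta>) \<sigma>" using b(2) unfolding G'(3) unfolding G(3) .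
  note pp = djunion_partition[OF p]
  have m: "is_mor (\<Gamma>' \<uplus> \<Theta>') (\<Lambda> \<uplus> \<Omega>) \<sigma>" using mor_coarsen[OF isoD(1)[OF b(2)] \<Delta>] G'(3) by simp
  have "two_iso (\<Gamma>' \<uplus> \<Theta>') (\<Lambda> \<uplus> \<Omega>) \<sigma> id"
    using two_iso_comp_right[OF block_perms_two_iso[OF pp \<sigma>] refinesD(5)[OF b(1)]] G'(3) by simp
  \<comment> \<open>The permutation is regarded as a lift of the identity along the identity of the
    disjoint union, so that the splitting of lifts applies to it.\<close>
  hence "\<sigma> \<in> lifts (\<Gamma>' \<uplus> \<Theta>') (\<Lambda> \<uplus> \<Omega>) (\<Lambda> \<uplus> \<Omega>) (sum_map id id) id" using m by (simp add: lifts_def)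
  then obtain s1 s2 where s: "s1 \<in> lifts \<Gamma>' \<Lambda> \<Lambda> id id" "s2 \<in> lifts \<Theta>' \<Omega> \<Omega> id id"
    and eq: "\<And>q. q \<in> pts (\<Gamma>' \<uplus> \<Theta>') \<Longrightarrow> \<sigma> q = sum_map s1 s2 q"
    using lifts_splitE[OF _ r' mor_id[OF p(1)] mor_id[OF p(2)]] by blast
  have s1: "is_mor \<Gamma>' \<Lambda> s1" "two_iso \<Gamma>' \<Lambda> s1 id" and s2: "is_mor \<Theta>' \<Omega> s2" "two_iso \<Theta>' \<Omega> s2 id"
    using s by (auto simp: lifts_def)
  have "\<Gamma> \<uplus> \<Theta> = transport \<sigma> (\<Gamma>' \<uplus> \<Theta>')" using isoD(2)[OF b(2)] G(3) G'(3) by simp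
  also have "\<dots> = transport s1 \<Gamma>' \<uplus> transport s2 \<Theta>'"
    unfolding transport_sum_map[symmetric] using eq by (intro transport_cong djunion_partition r')
  finally have t: "transport s1 \<Gamma>' = \<Gamma>" "transport s2 \<Theta>' = \<Theta>" using djunion_parts by metis+
  have i1: "is_iso \<Gamma>' \<Gamma> s1" and i2: "is_iso \<Theta>' \<Theta> s2" using mor_iso_transport s1(1) s2(1) t by metis+
  have xs: "bar_tr R \<Gamma>' \<Gamma> s1 (x \<Gamma>') = x \<Gamma>"
    using bar_tr_PD_at[OF x s1(1)] PD_at_two_iso[OF x s1(2)] PD_at_id[OF x G'(1)] t by simp
  have ys: "bar_tr R \<Theta>' \<Theta> s2 (y \<Theta>') = y \<Theta>"
    using bar_tr_PD_at[OF y s2(1)] PD_at_two_iso[OF y s2(2)] PD_at_id[OF y G'(2)] t by simp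
  note cx = PD_val_memD(2)[OF x G'(1)] and cy = PD_val_memD(2)[OF y G'(2)]
  have "bar_tr R (\<Gamma>' \<uplus> \<Theta>') (\<Gamma> \<uplus> \<Theta>) \<sigma> (bar_prod R \<Gamma>' \<Theta>' (x \<Gamma>') (y \<Theta>')) =
      bar_tr R (\<Gamma>' \<uplus> \<Theta>') (\<Gamma> \<uplus> \<Theta>) (sum_map s1 s2) (bar_prod R \<Gamma>' \<Theta>' (x \<Gamma>') (y \<Theta>'))"
    using b2 eq bar_prod_closed[OF r' cx cy] by (intro bar_tr_cong)
  also have "\<dots> = bar_prod R \<Gamma> \<Theta> (x \<Gamma>) (y \<Theta>)" using bar_tr_prod[OF i1 i2 cx cy] xs ys by simp
  finally show "bar_tr R ?\<Delta>' \<Delta> \<sigma> (PD_prod R \<Lambda> \<Omega> x y ?\<Delta>') = PD_prod R \<Lambda> \<Omega> x y \<Delta>"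
    unfolding G(3) G'(3)[unfolded G(3)] PD_prod_apply[OF G(1,2)] PD_prod_apply[OF G'(1,2)] .
qed

text \<open>On disjoint unions of morphisms the family of a product is the product of the families.
  The value is verified through its defining equation, since transfer along an isomorphism is
  compatible with products.\<close>

lemma PD_at_prod:
  assumes x: "x \<in> carrier (PD_val R \<Lambda>)" and y: "y \<in> carrier (PD_val R \<Omega>)"
    and k: "is_mor \<Gamma> \<Lambda> k" "is_mor \<Theta> \<Omega> k'"
  shows "PD_at R (\<Gamma> \<uplus> \<Theta>) (sum_map k k') (PD_prod R \<Lambda> \<Omega> x y) =
    bar_prod R \<Gamma> \<Theta> (PD_at R \<Gamma> k x) (PD_at R \<Theta> k' y)"
proof (rule PD_at_unique)
  note p = is_morD(1)[OF k(1)] is_morD(1)[OF k(2)]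
  note i = mor_iso_transport[OF k(1)] mor_iso_transport[OF k(2)]
  note c = PD_at_closed[OF x k(1)] PD_at_closed[OF y k(2)]
  note r = mor_transport_refines[OF k(1)] mor_transport_refines[OF k(2)]
  show "is_iso (\<Gamma> \<uplus> \<Theta>) (transport (sum_map k k') (\<Gamma> \<uplus> \<Theta>)) (sum_map k k')"
    using mor_iso_transport[OF sum_map_mor[OF k]] .
  show "bar_prod R \<Gamma> \<Theta> (PD_at R \<Gamma> k x) (PD_at R \<Theta> k' y) \<in> carrier (bar R (\<Gamma> \<uplus> \<Theta>))" using bar_prod_closed[OF p c] .
  show "bar_tr R (\<Gamma> \<uplus> \<Theta>) (transport (sum_map k k') (\<Gamma> \<uplus> \<Theta>)) (sum_map k k')
      (bar_prod R \<Gamma> \<Theta> (PD_at R \<Gamma> k x) (PD_at R \<Theta> k' y)) = PD_prod R \<Lambda> \<Omega> x y (transport (sum_map k k') (\<Gamma> \<uplus> \<Theta>))"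
    unfolding transport_sum_map bar_tr_prod[OF i c] PD_prod_apply[OF r] bar_tr_PD_at[OF x k(1)] bar_tr_PD_at[OF y k(2)] ..
qed

lemma PD_prod_res:
  assumes f: "is_mor \<Lambda> \<Lambda>' f" and g: "is_mor \<Omega> \<Omega>' g"
    and x: "x \<in> carrier (PD_val R \<Lambda>')" and y: "y \<in> carrier (PD_val R \<Omega>')"
  shows "PD_res R (\<Lambda> \<uplus> \<Omega>) (\<Lambda>' \<uplus> \<Omega>') (sum_map f g) (PD_prod R \<Lambda>' \<Omega>' x y) =
    PD_prod R \<Lambda> \<Omega> (PD_res R \<Lambda> \<Lambda>' f x) (PD_res R \<Omega> \<Omega>' g y)"
proof -
  note p = is_morD(1)[OF f] is_morD(1)[OF g] and p' = is_morD(2)[OF f] is_morD(2)[OF g]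
  note c = PD_prod_closed[OF p' x y] and m = sum_map_mor[OF f g]
  note rx = PD_res_closed[OF x f] and ry = PD_res_closed[OF y g]
  show ?thesis
  proof (rule PD_at_eqI[OF PD_res_closed[OF c m] PD_prod_closed[OF p rx ry]])
    fix \<Delta> assume \<Delta>: "\<Delta> \<preceq> \<Lambda> \<uplus> \<Omega>"
    then obtain \<Gamma> \<Theta> where G: "\<Gamma> \<preceq> \<Lambda>" "\<Theta> \<preceq> \<Omega>" "\<Delta> = \<Gamma> \<uplus> \<Theta>" using refines_djunionE p by blast
    note k = refinesD(5)[OF G(1)] refinesD(5)[OF G(2)]
    have "PD_at R \<Delta> id (PD_res R (\<Lambda> \<uplus> \<Omega>) (\<Lambda>' \<uplus> \<Omega>') (sum_map f g) (PD_prod R \<Lambda>' \<Omega>' x y)) =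
        bar_prod R \<Gamma> \<Theta> (PD_at R \<Gamma> f x) (PD_at R \<Theta> g y)"
      using PD_at_res[OF c m refinesD(5)[OF \<Delta>]] PD_at_prod[OF x y mor_comp[OF k(1) f] mor_comp[OF k(2) g]] G(3) by simp
    moreover have "PD_at R \<Delta> id (PD_prod R \<Lambda> \<Omega> (PD_res R \<Lambda> \<Lambda>' f x) (PD_res R \<Omega> \<Omega>' g y)) =
        bar_prod R \<Gamma> \<Theta> (PD_at R \<Gamma> f x) (PD_at R \<Theta> g y)"
      using PD_at_prod[OF rx ry k] PD_at_res[OF x f k(1)] PD_at_res[OF y g k(2)] G(3) by simp
    ultimately show "PD_at R \<Delta> id (PD_res R (\<Lambda> \<uplus> \<Omega>) (\<Lambda>' \<uplus> \<Omega>') (sum_map f g) (PD_prod R \<Lambda>' \<Omega>' x y)) =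
        PD_at R \<Delta> id (PD_prod R \<Lambda> \<Omega> (PD_res R \<Lambda> \<Lambda>' f x) (PD_res R \<Omega> \<Omega>' g y))" by simp
  qed
qed

text \<open>Classes of lifts along f \<uplus> g are pairs of classes of lifts along f and g.
  Grouping by the first member and using additivity of the product in each variable factors the sum
  over pairs into the product of two sums.\<close>

lemma PD_prod_tr:
  assumes f: "is_mor \<Lambda> \<Lambda>' f" and g: "is_mor \<Omega> \<Omega>' g"
    and x: "x \<in> carrier (PD_val R \<Lambda>)" and y: "y \<in> carrier (PD_val R \<Omega>)"
  shows "PD_tr R (\<Lambda> \<uplus> \<Omega>) (\<Lambda>' \<uplus> \<Omega>') (sum_map f g) (PD_prod R \<Lambda> \<Omega> x y) =
    PD_prod R \<Lambda>' \<Omega>' (PD_tr R \<Lambda> \<Lambda>' f x) (PD_tr R \<Omega> \<Omega>' g y)"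
proof -
  note p = is_morD(1)[OF f] is_morD(1)[OF g] and p' = is_morD(2)[OF f] is_morD(2)[OF g]
  note c = PD_prod_closed[OF p x y] and m = sum_map_mor[OF f g]
  note rx = PD_tr_closed[OF x f] and ry = PD_tr_closed[OF y g]
  show ?thesis
  proof (rule PD_at_eqI[OF PD_tr_closed[OF c m] PD_prod_closed[OF p' rx ry]])
    fix \<Delta> assume \<Delta>: "\<Delta> \<preceq> \<Lambda>' \<uplus> \<Omega>'"
    then obtain \<Gamma> \<Theta> where G: "\<Gamma> \<preceq> \<Lambda>'" "\<Theta> \<preceq> \<Omega>'" "\<Delta> = \<Gamma> \<uplus> \<Theta>" using refines_djunionE p' by blast
    note k = refinesD(5)[OF G(1)] refinesD(5)[OF G(2)]
    note q = refinesD(1)[OF G(1)] refinesD(1)[OF G(2)]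
    note grp = bar_group[OF djunion_partition[OF q]]
    let ?L1 = "lifts \<Gamma> \<Lambda> \<Lambda>' f id" and ?L2 = "lifts \<Theta> \<Omega> \<Omega>' g id"
      and ?L = "lifts (\<Gamma> \<uplus> \<Theta>) (\<Lambda> \<uplus> \<Omega>) (\<Lambda>' \<uplus> \<Omega>') (sum_map f g) id"
    let ?B = "bar R (\<Gamma> \<uplus> \<Theta>)" and ?\<kappa> = "mor_class (\<Gamma> \<uplus> \<Theta>) (\<Lambda> \<uplus> \<Omega>)"
    let ?v = "\<lambda>l. PD_at R (\<Gamma> \<uplus> \<Theta>) l (PD_prod R \<Lambda> \<Omega> x y)"
    \<comment> \<open>The left half of a lift, up to choice. Only its class is used, and by
      \<open>split\<close> and \<open>iff\<close> that is determined by the class of the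
      lift.\<close>
    define P where "P l = (SOME l1. l1 \<in> ?L1 \<and> (\<exists>l2 \<in> ?L2. \<forall>q \<in> pts (\<Gamma> \<uplus> \<Theta>). l q = sum_map l1 l2 q))" for l
    have P: "P l \<in> ?L1 \<and> (\<exists>l2 \<in> ?L2. \<forall>q \<in> pts (\<Gamma> \<uplus> \<Theta>). l q = sum_map (P l) l2 q)" if L: "l \<in> ?L" for l
    proof -
      obtain l1 l2 where "l1 \<in> ?L1" "l2 \<in> ?L2" "\<And>q. q \<in> pts (\<Gamma> \<uplus> \<Theta>) \<Longrightarrow> l q = sum_map l1 l2 q"
        by (rule lifts_splitE[OF L q f g]) simp
      hence "\<exists>l1. l1 \<in> ?L1 \<and> (\<exists>l2 \<in> ?L2. \<forall>q \<in> pts (\<Gamma> \<uplus> \<Theta>). l q = sum_map l1 l2 q)" by blast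
      thus ?thesis unfolding P_def by (rule someI_ex)
    qed
    have split: "\<exists>l2 \<in> ?L2. ?\<kappa> l = ?\<kappa> (sum_map (P l) l2)" if l: "l \<in> ?L" for l
    proof -
      obtain l2 where l2: "l2 \<in> ?L2" "\<And>q. q \<in> pts (\<Gamma> \<uplus> \<Theta>) \<Longrightarrow> l q = sum_map (P l) l2 q" using P[OF l] by blast
      note lm = liftsD(1)[OF l]
      have "two_iso (\<Gamma> \<uplus> \<Theta>) (\<Lambda> \<uplus> \<Omega>) l (sum_map (P l) l2)" using l2(2) by (rule two_iso_cong[OF lm])
      thus ?thesis using mor_class_eq_iff[OF lm two_isoD(2)] l2(1) by blast
    qed
    have iff: "?\<kappa> (sum_map l l') = ?\<kappa> (sum_map m m') \<longleftrightarrow>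
        mor_class \<Gamma> \<Lambda> l = mor_class \<Gamma> \<Lambda> m \<and> mor_class \<Theta> \<Omega> l' = mor_class \<Theta> \<Omega> m'"
      if "l \<in> ?L1" "l' \<in> ?L2" "m \<in> ?L1" "m' \<in> ?L2" for l l' m m'
    proof -
      note a = liftsD(1)[OF that(1)] and b = liftsD(1)[OF that(2)] and c = liftsD(1)[OF that(3)] and d = liftsD(1)[OF that(4)]
      show ?thesis
        unfolding mor_class_eq_iff[OF sum_map_mor[OF a b] sum_map_mor[OF c d]] mor_class_eq_iff[OF a c] mor_class_eq_iff[OF b d]
          sum_map_two_iso_iff[OF a c b d] ..
    qed
    have vc: "?v l \<in> carrier ?B" if "l \<in> ?L" for l using PD_at_closed[OF c liftsD(1)[OF that]] .
    have vcong: "?v l = ?v m" if "l \<in> ?L" "m \<in> ?L" "?\<kappa> l = ?\<kappa> m" for l m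
      using PD_at_class[OF c liftsD(1)[OF that(1)] liftsD(1)[OF that(2)] that(3)] .
    have sm: "sum_map l1 l2 \<in> ?L" if "l1 \<in> ?L1" "l2 \<in> ?L2" for l1 l2 using sum_map_lifts[OF that f g] by simp
    have "lift_sum R (\<Gamma> \<uplus> \<Theta>) (\<Lambda> \<uplus> \<Omega>) (\<Lambda>' \<uplus> \<Omega>') (sum_map f g) id (PD_prod R \<Lambda> \<Omega> x y) =
        class_sum ?B (mor_class \<Gamma> \<Lambda>) ?L1 (\<lambda>l1. class_sum ?B ?\<kappa> {l \<in> ?L. mor_class \<Gamma> \<Lambda> (P l) = mor_class \<Gamma> \<Lambda> l1} ?v)"
      unfolding lift_sum_def
    proof (rule class_sum_fibres[OF grp finite_mor_class[OF liftsD(1)] finite_mor_class[OF liftsD(1)] _ _ vcong vc])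
      show "P l \<in> ?L1" if "l \<in> ?L" for l using P[OF that] by blast
      show "mor_class \<Gamma> \<Lambda> (P l) = mor_class \<Gamma> \<Lambda> (P m)" if "l \<in> ?L" "m \<in> ?L" "?\<kappa> l = ?\<kappa> m" for l m
        using split[OF that(1)] split[OF that(2)] that(3) iff P[OF that(1)] P[OF that(2)] by metis
    qed
    also have "\<dots> = class_sum ?B (mor_class \<Gamma> \<Lambda>) ?L1
        (\<lambda>l1. bar_prod R \<Gamma> \<Theta> (PD_at R \<Gamma> l1 x) (lift_sum R \<Theta> \<Omega> \<Omega>' g id y))"
    proof (rule class_sum_cong[OF grp])
      fix l1 assume l1: "l1 \<in> ?L1"
      note m1 = liftsD(1)[OF l1]
      note c1 = PD_at_closed[OF x m1]
      have "bar_prod R \<Gamma> \<Theta> (PD_at R \<Gamma> l1 x) (lift_sum R \<Theta> \<Omega> \<Omega>' g id y) =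
          class_sum ?B (mor_class \<Theta> \<Omega>) ?L2 (\<lambda>l2. bar_prod R \<Gamma> \<Theta> (PD_at R \<Gamma> l1 x) (PD_at R \<Theta> l2 y))"
        unfolding lift_sum_def using PD_at_closed[OF y liftsD(1)]
        by (rule class_sum_hom[OF bar_group[OF q(2)] grp bar_prod_hom_right[OF q c1]])
      also have "\<dots> = class_sum ?B ?\<kappa> {l \<in> ?L. mor_class \<Gamma> \<Lambda> (P l) = mor_class \<Gamma> \<Lambda> l1} ?v"
      proof (rule class_sum_bij[OF grp, where F = "\<lambda>l2. sum_map l1 l2"])
        fix l2 assume l2: "l2 \<in> ?L2"
        note s = sm[OF l1 l2]
        obtain l2' where "l2' \<in> ?L2" "?\<kappa> (sum_map l1 l2) = ?\<kappa> (sum_map (P (sum_map l1 l2)) l2')" using split[OF s] by blast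
        hence "mor_class \<Gamma> \<Lambda> (P (sum_map l1 l2)) = mor_class \<Gamma> \<Lambda> l1" using iff[OF l1 l2] P[OF s] by metis
        thus "sum_map l1 l2 \<in> {l \<in> ?L. mor_class \<Gamma> \<Lambda> (P l) = mor_class \<Gamma> \<Lambda> l1}" using s by blast
        show "bar_prod R \<Gamma> \<Theta> (PD_at R \<Gamma> l1 x) (PD_at R \<Theta> l2 y) = ?v (sum_map l1 l2)"
          using PD_at_prod[OF x y m1 liftsD(1)[OF l2]] by simp
        fix m2 assume m2: "m2 \<in> ?L2"
        show "?\<kappa> (sum_map l1 l2) = ?\<kappa> (sum_map l1 m2)" if "mor_class \<Theta> \<Omega> l2 = mor_class \<Theta> \<Omega> m2"
          using iff[OF l1 l2 l1 m2] that by simp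
        show "mor_class \<Theta> \<Omega> l2 = mor_class \<Theta> \<Omega> m2" if "?\<kappa> (sum_map l1 l2) = ?\<kappa> (sum_map l1 m2)"
          using iff[OF l1 l2 l1 m2] that by simp
      next
        fix l assume "l \<in> {l \<in> ?L. mor_class \<Gamma> \<Lambda> (P l) = mor_class \<Gamma> \<Lambda> l1}"
        hence l: "l \<in> ?L" and e: "mor_class \<Gamma> \<Lambda> (P l) = mor_class \<Gamma> \<Lambda> l1" by auto
        obtain l2 where l2: "l2 \<in> ?L2" "?\<kappa> l = ?\<kappa> (sum_map (P l) l2)" using split[OF l] by blast
        have "?\<kappa> (sum_map l1 l2) = ?\<kappa> l" using iff[OF l1 l2(1) _ l2(1), of "P l"] P[OF l] e l2(2) by simp
        thus "\<exists>l2 \<in> ?L2. ?\<kappa> (sum_map l1 l2) = ?\<kappa> l" using l2(1) by blast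
        show "?v l \<in> carrier ?B" using vc[OF l] .
        fix m assume "m \<in> {l \<in> ?L. mor_class \<Gamma> \<Lambda> (P l) = mor_class \<Gamma> \<Lambda> l1}" "?\<kappa> l = ?\<kappa> m"
        thus "?v l = ?v m" using vcong[OF l] by blast
      qed
      finally show "class_sum ?B ?\<kappa> {l \<in> ?L. mor_class \<Gamma> \<Lambda> (P l) = mor_class \<Gamma> \<Lambda> l1} ?v =
          bar_prod R \<Gamma> \<Theta> (PD_at R \<Gamma> l1 x) (lift_sum R \<Theta> \<Omega> \<Omega>' g id y)" by simp
      show "bar_prod R \<Gamma> \<Theta> (PD_at R \<Gamma> l1 x) (lift_sum R \<Theta> \<Omega> \<Omega>' g id y) \<in> carrier ?B"
        using bar_prod_closed[OF q c1 add_hom_closed[OF lift_sum_hom[OF k(2) g] y]] .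
    qed
    also have "\<dots> = bar_prod R \<Gamma> \<Theta> (lift_sum R \<Gamma> \<Lambda> \<Lambda>' f id x) (lift_sum R \<Theta> \<Omega> \<Omega>' g id y)"
      unfolding lift_sum_def[of R \<Gamma> \<Lambda> \<Lambda>' f id x]
      by (rule class_sum_hom[OF bar_group[OF q(1)] grp
            bar_prod_hom_left[OF q add_hom_closed[OF lift_sum_hom[OF k(2) g] y]] PD_at_closed[OF x liftsD(1)], symmetric])
    finally have L: "PD_at R \<Delta> id (PD_tr R (\<Lambda> \<uplus> \<Omega>) (\<Lambda>' \<uplus> \<Omega>') (sum_map f g) (PD_prod R \<Lambda> \<Omega> x y)) =
        bar_prod R \<Gamma> \<Theta> (lift_sum R \<Gamma> \<Lambda> \<Lambda>' f id x) (lift_sum R \<Theta> \<Omega> \<Omega>' g id y)"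
      using PD_at_tr[OF c m refinesD(5)[OF \<Delta>]] G(3) by simp
    show "PD_at R \<Delta> id (PD_tr R (\<Lambda> \<uplus> \<Omega>) (\<Lambda>' \<uplus> \<Omega>') (sum_map f g) (PD_prod R \<Lambda> \<Omega> x y)) =
        PD_at R \<Delta> id (PD_prod R \<Lambda>' \<Omega>' (PD_tr R \<Lambda> \<Lambda>' f x) (PD_tr R \<Omega> \<Omega>' g y))"
      unfolding L using PD_at_prod[OF rx ry k] PD_at_tr[OF x f k(1)] PD_at_tr[OF y g k(2)] G(3) by simp
  qed
qed

lemma PD_tr_iso_apply:
  assumes "x \<in> carrier (PD_val R \<Lambda>)" "is_iso \<Lambda> \<Omega> f" "\<Gamma> \<preceq> \<Lambda>"
  shows "PD_tr R \<Lambda> \<Omega> f x (transport f \<Gamma>) = bar_tr R \<Gamma> (transport f \<Gamma>) f (x \<Gamma>)"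
proof -
  note f = isoD(1)[OF assms(2)]
  note fG = mor_refines[OF f assms(3)]
  note r = mor_transport_refines[OF fG] and i = mor_iso_transport[OF fG]
  note c = PD_tr_closed[OF assms(1) f]
  let ?g = "inv_into (pts \<Lambda>) f"
  have g: "is_mor (transport f \<Gamma>) \<Lambda> ?g" using mor_refines[OF isoD(1)[OF iso_inv[OF assms(2)]] r] .
  have "PD_tr R \<Lambda> \<Omega> f x (transport f \<Gamma>) = PD_at R (transport f \<Gamma>) ?g x"
    using PD_at_id[OF c r] PD_at_tr_iso[OF assms(1,2) refinesD(5)[OF r]] by simp
  also have "\<dots> = bar_tr R \<Gamma> (transport f \<Gamma>) f (PD_at R \<Gamma> (?g \<circ> f) x)" using PD_at_iso[OF assms(1) i g] by simp
  also have "PD_at R \<Gamma> (?g \<circ> f) x = PD_at R \<Gamma> id x"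
    using mor_inv_into(2)[OF f] refinesD(3)[OF assms(3)]
    by (intro PD_at_two_iso[OF assms(1)] two_iso_sym[OF two_iso_cong[OF refinesD(5)[OF assms(3)]]]) simp
  finally show ?thesis using PD_at_id[OF assms(1,3)] by simp
qed

text \<open>Every refinement of the target is the image of its preimage, a refinement of the source.
  Hence an equation for a transfer along an isomorphism, such as the coherence laws, can be checked
  component by component in the quotients.\<close>

lemma PD_tr_iso_eqI:
  assumes "x \<in> carrier (PD_val R \<Lambda>)" "is_iso \<Lambda> \<Omega> f" "y \<in> extensional {\<Gamma>. \<Gamma> \<preceq> \<Omega>}"
    "\<And>\<Gamma>. \<Gamma> \<preceq> \<Lambda> \<Longrightarrow> bar_tr R \<Gamma> (transport f \<Gamma>) f (x \<Gamma>) = y (transport f \<Gamma>)"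
  shows "PD_tr R \<Lambda> \<Omega> f x = y"
proof (rule PD_val_eqI[OF PD_val_memD(1)[OF PD_tr_closed[OF assms(1) isoD(1)[OF assms(2)]]] assms(3)])
  fix \<Gamma> assume "\<Gamma> \<preceq> \<Omega>"
  hence "\<Gamma> \<preceq> transport f \<Lambda>" using isoD(2)[OF assms(2)] by simp
  note m = mor_refines_transport_inv[OF isoD(1)[OF assms(2)] this]
  show "PD_tr R \<Lambda> \<Omega> f x \<Gamma> = y \<Gamma>"
    using PD_tr_iso_apply[OF assms(1,2) m(3)] assms(4)[OF m(3)] isoD(2)[OF m(4)] by simp
qed

lemma PD_prod_assoc:
  assumes p: "is_partition \<Lambda>" "is_partition \<Omega>" "is_partition \<Theta>"
    and x: "x \<in> carrier (PD_val R \<Lambda>)" and y: "y \<in> carrier (PD_val R \<Omega>)" and z: "z \<in> carrier (PD_val R \<Theta>)"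
  shows "PD_tr R ((\<Lambda> \<uplus> \<Omega>) \<uplus> \<Theta>) (\<Lambda> \<uplus> (\<Omega> \<uplus> \<Theta>)) assoc_map (PD_prod R (\<Lambda> \<uplus> \<Omega>) \<Theta> (PD_prod R \<Lambda> \<Omega> x y) z) =
      PD_prod R \<Lambda> (\<Omega> \<uplus> \<Theta>) x (PD_prod R \<Omega> \<Theta> y z)"
proof (rule PD_tr_iso_eqI[OF _ assoc_map_iso[OF p] PD_prod_extensional])
  show "PD_prod R (\<Lambda> \<uplus> \<Omega>) \<Theta> (PD_prod R \<Lambda> \<Omega> x y) z \<in> carrier (PD_val R ((\<Lambda> \<uplus> \<Omega>) \<uplus> \<Theta>))"
    using PD_prod_closed[OF djunion_partition[OF p(1,2)] p(3) PD_prod_closed[OF p(1,2) x y] z] .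
  fix \<Delta> assume \<Delta>: "\<Delta> \<preceq> (\<Lambda> \<uplus> \<Omega>) \<uplus> \<Theta>"
  obtain D C where D: "D \<preceq> \<Lambda> \<uplus> \<Omega>" "C \<preceq> \<Theta>" "\<Delta> = D \<uplus> C" using refines_djunionE[OF \<Delta> djunion_partition[OF p(1,2)] p(3)] .
  obtain A B where A: "A \<preceq> \<Lambda>" "B \<preceq> \<Omega>" "D = A \<uplus> B" using refines_djunionE[OF D(1) p(1,2)] .
  note q = refinesD(1)[OF A(1)] refinesD(1)[OF A(2)] refinesD(1)[OF D(2)]
  obtain a where a: "a \<in> pf_carrier R A" "x A = qmap R A a" using PD_val_memD(2)[OF x A(1)] by (rule bar_cases)
  obtain b where b: "b \<in> pf_carrier R B" "y B = qmap R B b" using PD_val_memD(2)[OF y A(2)] by (rule bar_cases)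
  obtain c where c: "c \<in> pf_carrier R C" "z C = qmap R C c" using PD_val_memD(2)[OF z D(2)] by (rule bar_cases)
  note ab = prod_closed[OF q(1,2) a(1) b(1)] and bc = prod_closed[OF q(2,3) b(1) c(1)]
  note pab = djunion_partition[OF q(1,2)] and pbc = djunion_partition[OF q(2,3)]
  have 1: "PD_prod R (\<Lambda> \<uplus> \<Omega>) \<Theta> (PD_prod R \<Lambda> \<Omega> x y) z \<Delta> =
      qmap R ((A \<uplus> B) \<uplus> C) (lx_prod R (A \<uplus> B) C (lx_prod R A B a b) c)"
    unfolding D(3) PD_prod_apply[OF D(1,2)] unfolding A(3) PD_prod_apply[OF A(1,2)] a(2) b(2) c(2)
      bar_prod_qmap[OF q(1,2) a(1) b(1)] bar_prod_qmap[OF pab q(3) ab c(1)] ..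
  have 2: "PD_prod R \<Lambda> (\<Omega> \<uplus> \<Theta>) x (PD_prod R \<Omega> \<Theta> y z) (A \<uplus> (B \<uplus> C)) =
      qmap R (A \<uplus> (B \<uplus> C)) (lx_prod R A (B \<uplus> C) a (lx_prod R B C b c))"
    unfolding PD_prod_apply[OF A(1) djunion_refines[OF A(2) D(2)]] PD_prod_apply[OF A(2) D(2)] a(2) b(2) c(2)
      bar_prod_qmap[OF q(2,3) b(1) c(1)] bar_prod_qmap[OF q(1) pbc a(1) bc] ..
  have t: "transport assoc_map \<Delta> = A \<uplus> (B \<uplus> C)" by (simp add: D(3) A(3) transport_assoc_map)
  show "bar_tr R \<Delta> (transport assoc_map \<Delta>) assoc_map (PD_prod R (\<Lambda> \<uplus> \<Omega>) \<Theta> (PD_prod R \<Lambda> \<Omega> x y) z \<Delta>) =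
      PD_prod R \<Lambda> (\<Omega> \<uplus> \<Theta>) x (PD_prod R \<Omega> \<Theta> y z) (transport assoc_map \<Delta>)"
    unfolding t 1 2 unfolding D(3) A(3)
      bar_tr_qmap[OF assoc_map_iso[OF q] prod_closed[OF pab q(3) ab c(1)]] prod_assoc[OF q a(1) b(1) c(1)] ..
qed

lemma PD_unit_apply: "PD_unit R k (indiscrete 0) = qmap R (indiscrete 0) (lx_unit R k)"
  unfolding PD_unit_def PD_eta_apply[OF refines_refl[OF indiscrete_partition]]
    res_id[OF indiscrete_partition unit_closed] ..

lemma PD_unit_closed: "PD_unit R k \<in> carrier (PD_val R (indiscrete 0))"
  unfolding PD_unit_def using PD_eta_closed[OF unit_closed] .

lemma PD_prod_unit:
  assumes p: "is_partition \<Lambda>" and x: "x \<in> carrier (PD_val R \<Lambda>)"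
  shows "PD_tr R (indiscrete 0 \<uplus> \<Lambda>) \<Lambda> unit_map (PD_prod R (indiscrete 0) \<Lambda> (PD_unit R 1) x) = x"
    "PD_tr R (\<Lambda> \<uplus> indiscrete 0) \<Lambda> unit_map (PD_prod R \<Lambda> (indiscrete 0) x (PD_unit R 1)) = x"
proof -
  note i = indiscrete_partition[of 0] and u = unit_closed[of 1]
  note ri = refines_refl[OF i]
  show "PD_tr R (indiscrete 0 \<uplus> \<Lambda>) \<Lambda> unit_map (PD_prod R (indiscrete 0) \<Lambda> (PD_unit R 1) x) = x"
  proof (rule PD_tr_iso_eqI[OF PD_prod_closed[OF i p PD_unit_closed x] unit_map_iso(1)[OF p] PD_val_memD(1)[OF x]])
    fix \<Delta> assume \<Delta>: "\<Delta> \<preceq> indiscrete 0 \<uplus> \<Lambda>"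
    obtain I \<Gamma> where "I \<preceq> indiscrete 0" and G: "\<Gamma> \<preceq> \<Lambda>" and e: "\<Delta> = I \<uplus> \<Gamma>" using refines_djunionE[OF \<Delta> i p] .
    \<comment> \<open>The empty partition has no refinement but itself, so the only freedom is in
      the second part.\<close>
    hence D: "\<Delta> = indiscrete 0 \<uplus> \<Gamma>" by (simp add: refines_indiscrete_0)
    note q = refinesD(1)[OF G]
    obtain a where a: "a \<in> pf_carrier R \<Gamma>" "x \<Gamma> = qmap R \<Gamma> a" using PD_val_memD(2)[OF x G] by (rule bar_cases)
    show "bar_tr R \<Delta> (transport unit_map \<Delta>) unit_map (PD_prod R (indiscrete 0) \<Lambda> (PD_unit R 1) x \<Delta>) = x (transport unit_map \<Delta>)"
      unfolding D transport_unit_map PD_prod_apply[OF ri G] PD_unit_apply a(2) bar_prod_qmap[OF i q u a(1)]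
        bar_tr_qmap[OF unit_map_iso(1)[OF q] prod_closed[OF i q u a(1)]] prod_unit(1)[OF q a(1)] ..
  qed
  show "PD_tr R (\<Lambda> \<uplus> indiscrete 0) \<Lambda> unit_map (PD_prod R \<Lambda> (indiscrete 0) x (PD_unit R 1)) = x"
  proof (rule PD_tr_iso_eqI[OF PD_prod_closed[OF p i x PD_unit_closed] unit_map_iso(2)[OF p] PD_val_memD(1)[OF x]])
    fix \<Delta> assume \<Delta>: "\<Delta> \<preceq> \<Lambda> \<uplus> indiscrete 0"
    obtain I \<Gamma> where "I \<preceq> indiscrete 0" and G: "\<Gamma> \<preceq> \<Lambda>" and e: "\<Delta> = \<Gamma> \<uplus> I" using refines_djunionE[OF \<Delta> p i] .
    hence D: "\<Delta> = \<Gamma> \<uplus> indiscrete 0" by (simp add: refines_indiscrete_0)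
    note q = refinesD(1)[OF G]
    obtain a where a: "a \<in> pf_carrier R \<Gamma>" "x \<Gamma> = qmap R \<Gamma> a" using PD_val_memD(2)[OF x G] by (rule bar_cases)
    show "bar_tr R \<Delta> (transport unit_map \<Delta>) unit_map (PD_prod R \<Lambda> (indiscrete 0) x (PD_unit R 1) \<Delta>) = x (transport unit_map \<Delta>)"
      unfolding D transport_unit_map PD_prod_apply[OF G ri] PD_unit_apply a(2) bar_prod_qmap[OF q i a(1) u]
        bar_tr_qmap[OF unit_map_iso(2)[OF q] prod_closed[OF q i a(1) u]] prod_unit(2)[OF q a(1)] ..
  qed
qed

lemma PD_prod_sym:
  assumes p: "is_partition \<Lambda>" "is_partition \<Omega>"
    and x: "x \<in> carrier (PD_val R \<Lambda>)" and y: "y \<in> carrier (PD_val R \<Omega>)"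
  shows "PD_tr R (\<Lambda> \<uplus> \<Omega>) (\<Omega> \<uplus> \<Lambda>) swap_map (PD_prod R \<Lambda> \<Omega> x y) = PD_prod R \<Omega> \<Lambda> y x"
proof (rule PD_tr_iso_eqI[OF PD_prod_closed[OF p x y] swap_map_iso[OF p] PD_prod_extensional])
  fix \<Delta> assume \<Delta>: "\<Delta> \<preceq> \<Lambda> \<uplus> \<Omega>"
  obtain A B where A: "A \<preceq> \<Lambda>" "B \<preceq> \<Omega>" "\<Delta> = A \<uplus> B" using refines_djunionE[OF \<Delta> p] .
  note q = refinesD(1)[OF A(1)] refinesD(1)[OF A(2)]
  obtain a where a: "a \<in> pf_carrier R A" "x A = qmap R A a" using PD_val_memD(2)[OF x A(1)] by (rule bar_cases)
  obtain b where b: "b \<in> pf_carrier R B" "y B = qmap R B b" using PD_val_memD(2)[OF y A(2)] by (rule bar_cases)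
  show "bar_tr R \<Delta> (transport swap_map \<Delta>) swap_map (PD_prod R \<Lambda> \<Omega> x y \<Delta>) = PD_prod R \<Omega> \<Lambda> y x (transport swap_map \<Delta>)"
    unfolding A(3) transport_swap_map PD_prod_apply[OF A(1,2)] PD_prod_apply[OF A(2,1)] a(2) b(2)
      bar_prod_qmap[OF q a(1) b(1)] bar_prod_qmap[OF q(2,1) b(1) a(1)]
      bar_tr_qmap[OF swap_map_iso[OF q] prod_closed[OF q a(1) b(1)]] prod_sym[OF q a(1) b(1)] ..
qed

lemma PD_prod_homs:
  assumes p: "is_partition \<Lambda>" "is_partition \<Omega>"
  shows "x \<in> carrier (PD_val R \<Lambda>) \<Longrightarrow> PD_prod R \<Lambda> \<Omega> x \<in> add_hom (PD_val R \<Omega>) (PD_val R (\<Lambda> \<uplus> \<Omega>))"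
    "y \<in> carrier (PD_val R \<Omega>) \<Longrightarrow> (\<lambda>x. PD_prod R \<Lambda> \<Omega> x y) \<in> add_hom (PD_val R \<Lambda>) (PD_val R (\<Lambda> \<uplus> \<Omega>))"
proof -
  have e: "u \<oplus>\<^bsub>PD_val R \<Psi>\<^esub> v \<in> extensional {\<Delta>. \<Delta> \<preceq> \<Psi>}" for u v \<Psi> by (simp add: PD_val_ops)
  show "PD_prod R \<Lambda> \<Omega> x \<in> add_hom (PD_val R \<Omega>) (PD_val R (\<Lambda> \<uplus> \<Omega>))" if x: "x \<in> carrier (PD_val R \<Lambda>)"
  proof (rule add_homI)
    fix y z assume y: "y \<in> carrier (PD_val R \<Omega>)" and z: "z \<in> carrier (PD_val R \<Omega>)"
    show "PD_prod R \<Lambda> \<Omega> x y \<in> carrier (PD_val R (\<Lambda> \<uplus> \<Omega>))" using PD_prod_closed[OF p x y] .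
    show "PD_prod R \<Lambda> \<Omega> x (y \<oplus>\<^bsub>PD_val R \<Omega>\<^esub> z) = PD_prod R \<Lambda> \<Omega> x y \<oplus>\<^bsub>PD_val R (\<Lambda> \<uplus> \<Omega>)\<^esub> PD_prod R \<Lambda> \<Omega> x z"
    proof (rule djunion_eqI[OF p PD_prod_extensional e])
      fix \<Gamma> \<Theta> assume G: "\<Gamma> \<preceq> \<Lambda>" "\<Theta> \<preceq> \<Omega>"
      show "PD_prod R \<Lambda> \<Omega> x (y \<oplus>\<^bsub>PD_val R \<Omega>\<^esub> z) (\<Gamma> \<uplus> \<Theta>) = (PD_prod R \<Lambda> \<Omega> x y \<oplus>\<^bsub>PD_val R (\<Lambda> \<uplus> \<Omega>)\<^esub> PD_prod R \<Lambda> \<Omega> x z) (\<Gamma> \<uplus> \<Theta>)"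
        using add_hom_add[OF bar_prod_hom_right[OF refinesD(1)[OF G(1)] refinesD(1)[OF G(2)] PD_val_memD(2)[OF x G(1)]]
            PD_val_memD(2)[OF y G(2)] PD_val_memD(2)[OF z G(2)]] G djunion_refines[OF G]
        by (simp add: PD_prod_apply PD_val_ops)
    qed
  qed
  show "(\<lambda>x. PD_prod R \<Lambda> \<Omega> x y) \<in> add_hom (PD_val R \<Lambda>) (PD_val R (\<Lambda> \<uplus> \<Omega>))" if y: "y \<in> carrier (PD_val R \<Omega>)"
  proof (rule add_homI)
    fix x z assume x: "x \<in> carrier (PD_val R \<Lambda>)" and z: "z \<in> carrier (PD_val R \<Lambda>)"
    show "PD_prod R \<Lambda> \<Omega> x y \<in> carrier (PD_val R (\<Lambda> \<uplus> \<Omega>))" using PD_prod_closed[OF p x y] .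
    show "PD_prod R \<Lambda> \<Omega> (x \<oplus>\<^bsub>PD_val R \<Lambda>\<^esub> z) y = PD_prod R \<Lambda> \<Omega> x y \<oplus>\<^bsub>PD_val R (\<Lambda> \<uplus> \<Omega>)\<^esub> PD_prod R \<Lambda> \<Omega> z y"
    proof (rule djunion_eqI[OF p PD_prod_extensional e])
      fix \<Gamma> \<Theta> assume G: "\<Gamma> \<preceq> \<Lambda>" "\<Theta> \<preceq> \<Omega>"
      show "PD_prod R \<Lambda> \<Omega> (x \<oplus>\<^bsub>PD_val R \<Lambda>\<^esub> z) y (\<Gamma> \<uplus> \<Theta>) = (PD_prod R \<Lambda> \<Omega> x y \<oplus>\<^bsub>PD_val R (\<Lambda> \<uplus> \<Omega>)\<^esub> PD_prod R \<Lambda> \<Omega> z y) (\<Gamma> \<uplus> \<Theta>)"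
        using add_hom_add[OF bar_prod_hom_left[OF refinesD(1)[OF G(1)] refinesD(1)[OF G(2)] PD_val_memD(2)[OF y G(2)]]
            PD_val_memD(2)[OF x G(1)] PD_val_memD(2)[OF z G(1)]] G djunion_refines[OF G]
        by (simp add: PD_prod_apply PD_val_ops)
    qed
  qed
qed

end

section \<open>The monad structure maps as lax symmetric monoidal morphisms\<close>

definition is_PD_lax :: "('u, 'a, 'y) lax_pfun_scheme \<Rightarrow> ('u, 'u set_partition \<Rightarrow> 'a set, 'z) lax_pfun_scheme \<Rightarrow> bool" where
  "is_PD_lax M N \<longleftrightarrow> is_PD M N \<and> lx_unit N = PD_unit M \<and> lx_prod N = PD_prod M"

lemma is_PD_laxD:
  assumes "is_PD_lax M N"
  shows "is_PD M N" "lx_unit N = PD_unit M" "lx_prod N = PD_prod M"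
  using assms by (auto simp: is_PD_lax_def)

lemma lax_functorD: "lax_partition_functor R \<Longrightarrow> lax_functor R"
  by (simp add: lax_functor_def)

lemma lax_partition_functorD: "lax_partition_functor R \<Longrightarrow> partition_functor R"
  by (simp add: lax_partition_functor_def)

theorem (in lax_functor) PD_lax_partition_functor:
  assumes N: "is_PD_lax R N"
  shows "lax_partition_functor N"
proof -
  note S = is_PD_simps[OF is_PD_laxD(1)[OF N]] is_PD_laxD(2,3)[OF N]
  have "PD_unit R \<in> add_hom \<Z> (PD_val R (indiscrete 0))"
    using add_hom_comp[OF unit_hom PD_eta_hom[OF indiscrete_partition]] by (simp add: PD_unit_def[abs_def])
  thus ?thesis
    unfolding lax_partition_functor_def S
    by (intro conjI allI impI ballI; (elim conjE)?)
      (rule PD_partition_functor[OF is_PD_laxD(1)[OF N]] PD_prod_homs PD_prod_res PD_prod_tr PD_prod_assoc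
        PD_prod_unit PD_prod_sym | assumption)+
qed

lemma lax_morphismD:
  assumes "lax_morphism R S \<phi>"
  shows "pf_morphism R S \<phi>" "\<phi> (indiscrete 0) (lx_unit R k) = lx_unit S k"
    "is_partition \<Lambda> \<Longrightarrow> is_partition \<Omega> \<Longrightarrow> x \<in> pf_carrier R \<Lambda> \<Longrightarrow> y \<in> pf_carrier R \<Omega> \<Longrightarrow>
      \<phi> (\<Lambda> \<uplus> \<Omega>) (lx_prod R \<Lambda> \<Omega> x y) = lx_prod S \<Lambda> \<Omega> (\<phi> \<Lambda> x) (\<phi> \<Omega> y)"
  using assms unfolding lax_morphism_def by blast+

lemma mor_eqD: "mor_eq M \<phi> \<psi> \<Longrightarrow> is_partition \<Lambda> \<Longrightarrow> x \<in> pf_carrier M \<Lambda> \<Longrightarrow> \<phi> \<Lambda> x = \<psi> \<Lambda> x"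
  by (simp add: mor_eq_def)

lemma (in lax_functor) comp_map_prod:
  assumes N: "lax_partition_functor N" and p: "is_partition \<Lambda>" "is_partition \<Omega>"
    and x: "x \<in> carrier (PD_val R \<Lambda>)" and y: "y \<in> carrier (PD_val R \<Omega>)"
    and \<alpha>: "\<And>\<Gamma> \<Theta> a b. is_partition \<Gamma> \<Longrightarrow> is_partition \<Theta> \<Longrightarrow> a \<in> carrier (bar R \<Gamma>) \<Longrightarrow> b \<in> carrier (bar R \<Theta>) \<Longrightarrow>
      \<alpha> (\<Gamma> \<uplus> \<Theta>) (bar_prod R \<Gamma> \<Theta> a b) = bar_prod N \<Gamma> \<Theta> (\<alpha> \<Gamma> a) (\<alpha> \<Theta> b)"
  shows "comp_map \<alpha> (\<Lambda> \<uplus> \<Omega>) (PD_prod R \<Lambda> \<Omega> x y) = PD_prod N \<Lambda> \<Omega> (comp_map \<alpha> \<Lambda> x) (comp_map \<alpha> \<Omega> y)"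
proof -
  interpret N: lax_functor N using lax_functorD[OF N] .
  show ?thesis
  proof (rule djunion_eqI[OF p comp_map_extensional N.PD_prod_extensional])
    fix \<Gamma> \<Theta> assume G: "\<Gamma> \<preceq> \<Lambda>" "\<Theta> \<preceq> \<Omega>"
    show "comp_map \<alpha> (\<Lambda> \<uplus> \<Omega>) (PD_prod R \<Lambda> \<Omega> x y) (\<Gamma> \<uplus> \<Theta>) = PD_prod N \<Lambda> \<Omega> (comp_map \<alpha> \<Lambda> x) (comp_map \<alpha> \<Omega> y) (\<Gamma> \<uplus> \<Theta>)"
      unfolding comp_map_apply[OF djunion_refines[OF G]] N.PD_prod_apply[OF G] PD_prod_apply[OF G] comp_map_apply[OF G(1)] comp_map_apply[OF G(2)]
      by (rule \<alpha>[OF refinesD(1)[OF G(1)] refinesD(1)[OF G(2)] PD_val_memD(2)[OF x G(1)] PD_val_memD(2)[OF y G(2)]])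
  qed
qed

theorem (in lax_functor) PD_map_lax_morphism:
  assumes N: "lax_partition_functor N" and \<phi>: "lax_morphism R N \<phi>" and R': "is_PD_lax R R'" and N': "is_PD_lax N N'"
  shows "lax_morphism R' N' (PD_map N \<phi>)"
  unfolding lax_morphism_def
proof (intro conjI allI impI ballI)
  interpret N: lax_functor N using lax_functorD[OF N] .
  note S = is_PD_simps[OF is_PD_laxD(1)[OF R']] is_PD_laxD(2,3)[OF R'] is_PD_simps[OF is_PD_laxD(1)[OF N']] is_PD_laxD(2,3)[OF N']
  note phi = lax_morphismD[OF \<phi>]
  show "pf_morphism R' N' (PD_map N \<phi>)"
    using PD_map_morphism[OF pf N.pf phi(1) is_PD_laxD(1)[OF R'] is_PD_laxD(1)[OF N']] .
  \<comment> \<open>The unit of PD is \<eta> applied to the given unit, so this is naturality of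
    \<eta> at the empty partition.\<close>
  show "PD_map N \<phi> (indiscrete 0) (lx_unit R' k) = lx_unit N' k" for k
    using mor_eqD[OF PD_eta_natural[OF N.pf phi(1)] indiscrete_partition unit_closed[of k]] phi(2)[of k]
    by (simp add: S PD_unit_def mor_comp_def)
  fix \<Lambda> \<Omega> x y assume "is_partition \<Lambda> \<and> is_partition \<Omega>" and x: "x \<in> pf_carrier R' \<Lambda>" and y: "y \<in> pf_carrier R' \<Omega>"
  hence p: "is_partition \<Lambda>" "is_partition \<Omega>" by auto
  have "bar_map N \<phi> (\<Gamma> \<uplus> \<Theta>) (bar_prod R \<Gamma> \<Theta> a b) = bar_prod N \<Gamma> \<Theta> (bar_map N \<phi> \<Gamma> a) (bar_map N \<phi> \<Theta> b)"
    if q: "is_partition \<Gamma>" "is_partition \<Theta>" and a: "a \<in> carrier (bar R \<Gamma>)" and b: "b \<in> carrier (bar R \<Theta>)" for \<Gamma> \<Theta> a b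
  proof -
    obtain u where u: "u \<in> pf_carrier R \<Gamma>" "a = qmap R \<Gamma> u" using a by (rule bar_cases)
    obtain v where v: "v \<in> pf_carrier R \<Theta>" "b = qmap R \<Theta> v" using b by (rule bar_cases)
    note uv = prod_closed[OF q u(1) v(1)] and pq = djunion_partition[OF q]
    note bm = bar_map_qmap[OF N.pf phi(1)]
    show ?thesis
      unfolding u(2) v(2) bar_prod_qmap[OF q u(1) v(1)] bm[OF pq uv] bm[OF q(1) u(1)] bm[OF q(2) v(1)]
        N.bar_prod_qmap[OF q pf_morphismD(2)[OF phi(1) q(1) u(1)] pf_morphismD(2)[OF phi(1) q(2) v(1)]]
        phi(3)[OF q u(1) v(1)] ..
  qed
  thus "PD_map N \<phi> (\<Lambda> \<uplus> \<Omega>) (lx_prod R' \<Lambda> \<Omega> x y) = lx_prod N' \<Lambda> \<Omega> (PD_map N \<phi> \<Lambda> x) (PD_map N \<phi> \<Omega> y)"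
    unfolding S PD_map_comp_map using x y unfolding S by (intro comp_map_prod[OF N p])
qed

theorem (in lax_functor) PD_eta_lax_morphism:
  assumes R': "is_PD_lax R R'"
  shows "lax_morphism R R' (PD_eta R)"
  unfolding lax_morphism_def
proof (intro conjI allI impI ballI)
  note S = is_PD_simps[OF is_PD_laxD(1)[OF R']] is_PD_laxD(2,3)[OF R']
  show "pf_morphism R R' (PD_eta R)" using PD_eta_morphism[OF is_PD_laxD(1)[OF R']] .
  show "PD_eta R (indiscrete 0) (lx_unit R k) = lx_unit R' k" for k by (simp add: S PD_unit_def)
  fix \<Lambda> \<Omega> x y assume "is_partition \<Lambda> \<and> is_partition \<Omega>" and x: "x \<in> pf_carrier R \<Lambda>" and y: "y \<in> pf_carrier R \<Omega>"
  hence p: "is_partition \<Lambda>" "is_partition \<Omega>" by auto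
  show "PD_eta R (\<Lambda> \<uplus> \<Omega>) (lx_prod R \<Lambda> \<Omega> x y) = lx_prod R' \<Lambda> \<Omega> (PD_eta R \<Lambda> x) (PD_eta R \<Omega> y)"
    unfolding S
  proof (rule djunion_eqI[OF p _ PD_prod_extensional])
    fix \<Gamma> \<Theta> assume G: "\<Gamma> \<preceq> \<Lambda>" "\<Theta> \<preceq> \<Omega>"
    note k = refinesD(5)[OF G(1)] refinesD(5)[OF G(2)] and q = refinesD(1)[OF G(1)] refinesD(1)[OF G(2)]
    show "PD_eta R (\<Lambda> \<uplus> \<Omega>) (lx_prod R \<Lambda> \<Omega> x y) (\<Gamma> \<uplus> \<Theta>) = PD_prod R \<Lambda> \<Omega> (PD_eta R \<Lambda> x) (PD_eta R \<Omega> y) (\<Gamma> \<uplus> \<Theta>)"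
      unfolding PD_prod_apply[OF G] PD_eta_apply[OF djunion_refines[OF G]] PD_eta_apply[OF G(1)] PD_eta_apply[OF G(2)]
        bar_prod_qmap[OF q res_closed[OF k(1) x] res_closed[OF k(2) y]] prod_res[OF k x y, unfolded sum_map_id] ..
  qed (simp add: PD_eta_def)
qed

theorem (in lax_functor) PD_mu_lax_morphism:
  assumes R': "is_PD_lax R R'" and R'': "is_PD_lax R' R''"
  shows "lax_morphism R'' R' PD_mu"
  unfolding lax_morphism_def
proof (intro conjI allI impI ballI)
  interpret R': lax_functor R' using lax_functorD[OF PD_lax_partition_functor[OF R']] .
  note P' = is_PD_laxD(1)[OF R'] and P'' = is_PD_laxD(1)[OF R'']
  note S = is_PD_simps[OF P'] is_PD_laxD(2,3)[OF R'] is_PD_simps[OF P''] is_PD_laxD(2,3)[OF R'']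
  show "pf_morphism R'' R' PD_mu" using PD_mu_morphism[OF pf P' P''] .
  \<comment> \<open>The unit of the twofold construction is \<eta> of the unit of the onefold one,
    and \<mu> after \<eta> is the identity.\<close>
  show "PD_mu (indiscrete 0) (lx_unit R'' k) = lx_unit R' k" for k
    using mor_eqD[OF PD_mu_eta[OF P'] indiscrete_partition R'.unit_closed[of k]]
    by (simp add: S PD_unit_def[of R'] mor_comp_def mor_id_def)
  fix \<Lambda> \<Omega> x y assume "is_partition \<Lambda> \<and> is_partition \<Omega>" and x: "x \<in> pf_carrier R'' \<Lambda>" and y: "y \<in> pf_carrier R'' \<Omega>"
  hence p: "is_partition \<Lambda>" "is_partition \<Omega>" by auto
  have "bar_proj (\<Gamma> \<uplus> \<Theta>) (bar_prod R' \<Gamma> \<Theta> a b) = bar_prod R \<Gamma> \<Theta> (bar_proj \<Gamma> a) (bar_proj \<Theta> b)"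
    if q: "is_partition \<Gamma>" "is_partition \<Theta>" and a: "a \<in> carrier (bar R' \<Gamma>)" and b: "b \<in> carrier (bar R' \<Theta>)" for \<Gamma> \<Theta> a b
  proof -
    obtain u where u: "u \<in> pf_carrier R' \<Gamma>" "a = qmap R' \<Gamma> u" using a by (rule R'.bar_cases)
    obtain v where v: "v \<in> pf_carrier R' \<Theta>" "b = qmap R' \<Theta> v" using b by (rule R'.bar_cases)
    have u': "u \<in> carrier (PD_val R \<Gamma>)" and v': "v \<in> carrier (PD_val R \<Theta>)" using u v S by auto
    show ?thesis
      unfolding u(2) v(2) R'.bar_prod_qmap[OF q u(1) v(1)] S(5) bar_proj_qmap[OF P' q(1) u'] bar_proj_qmap[OF P' q(2) v']
        bar_proj_qmap[OF P' djunion_partition[OF q] PD_prod_closed[OF q u' v']]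
      by (rule PD_prod_apply[OF refines_refl[OF q(1)] refines_refl[OF q(2)]])
  qed
  thus "PD_mu (\<Lambda> \<uplus> \<Omega>) (lx_prod R'' \<Lambda> \<Omega> x y) = lx_prod R' \<Lambda> \<Omega> (PD_mu \<Lambda> x) (PD_mu \<Omega> y)"
    unfolding S(5) S(10) PD_mu_comp_map using x y unfolding S(6) by (intro R'.comp_map_prod[OF lax p])
qed

section \<open>PD of a partition ring\<close>

lemma ring_hom_of_comp:
  assumes "f \<in> ring_hom A B" "g \<in> ring_hom B C"
  shows "(\<lambda>x. g (f x)) \<in> ring_hom A C"
  using ring_hom_trans[OF assms] by (simp add: comp_def)

text \<open>In this order: closure under products, the one as an element, associativity, the left
  unit law, commutativity, left and right distributivity.\<close>

lemmas cringD = cring.cring_simprules(5,6,11,12,14,13,25)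

locale ring_functor =
  fixes R :: "('u, 'a, 'z) lax_pfun_scheme"
  assumes pring: "partition_ring R"
begin

lemmas ring_ax = pring[unfolded partition_ring_def]

sublocale lax_functor R
  by unfold_locales (rule ring_ax[THEN conjunct1])

lemma val_cring: "is_partition \<Lambda> \<Longrightarrow> cring (pf_val R \<Lambda>)"
  using ring_ax[THEN conjunct2, THEN conjunct1] by blast

lemma res_ring_hom: "is_mor \<Lambda> \<Omega> f \<Longrightarrow> pf_res R \<Lambda> \<Omega> f \<in> ring_hom (pf_val R \<Omega>) (pf_val R \<Lambda>)"
  using ring_ax[THEN conjunct2, THEN conjunct2, THEN conjunct1] by blast

lemma prod_mult: "is_partition \<Lambda> \<Longrightarrow> is_partition \<Omega> \<Longrightarrow> x \<in> pf_carrier R \<Lambda> \<Longrightarrow> x' \<in> pf_carrier R \<Lambda> \<Longrightarrow>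
    y \<in> pf_carrier R \<Omega> \<Longrightarrow> y' \<in> pf_carrier R \<Omega> \<Longrightarrow>
    lx_prod R \<Lambda> \<Omega> (x \<otimes>\<^bsub>pf_val R \<Lambda>\<^esub> x') (y \<otimes>\<^bsub>pf_val R \<Omega>\<^esub> y') =
      lx_prod R \<Lambda> \<Omega> x y \<otimes>\<^bsub>pf_val R (\<Lambda> \<uplus> \<Omega>)\<^esub> lx_prod R \<Lambda> \<Omega> x' y'"
  and prod_one: "is_partition \<Lambda> \<Longrightarrow> is_partition \<Omega> \<Longrightarrow>
    lx_prod R \<Lambda> \<Omega> \<one>\<^bsub>pf_val R \<Lambda>\<^esub> \<one>\<^bsub>pf_val R \<Omega>\<^esub> = \<one>\<^bsub>pf_val R (\<Lambda> \<uplus> \<Omega>)\<^esub>"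
  using ring_ax[THEN conjunct2, THEN conjunct2, THEN conjunct2, THEN conjunct1] by blast+

lemma frobenius: "is_mor \<Lambda> \<Omega> f \<Longrightarrow> a \<in> pf_carrier R \<Omega> \<Longrightarrow> b \<in> pf_carrier R \<Lambda> \<Longrightarrow>
    pf_tr R \<Lambda> \<Omega> f (pf_res R \<Lambda> \<Omega> f a \<otimes>\<^bsub>pf_val R \<Lambda>\<^esub> b) = a \<otimes>\<^bsub>pf_val R \<Omega>\<^esub> pf_tr R \<Lambda> \<Omega> f b"
  using ring_ax[THEN conjunct2, THEN conjunct2, THEN conjunct2, THEN conjunct2] by blast

text \<open>By Frobenius reciprocity, the image of transfer is an ideal.\<close>

lemma tr_ideal_ideal:
  assumes p: "is_partition \<Gamma>"
  shows "ideal (tr_ideal R \<Gamma>) (pf_val R \<Gamma>)"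
proof -
  note c = cringD[OF val_cring[OF p]]
  have l: "x \<otimes>\<^bsub>pf_val R \<Gamma>\<^esub> a \<in> tr_ideal R \<Gamma>" if a: "a \<in> tr_ideal R \<Gamma>" and x: "x \<in> pf_carrier R \<Gamma>" for a x
  proof (rule tr_ideal_map[OF p val_group[OF p] _ tr_ideal_subgroup[OF p] _ a])
    show "(\<lambda>a. x \<otimes>\<^bsub>pf_val R \<Gamma>\<^esub> a) \<in> add_hom (pf_val R \<Gamma>) (pf_val R \<Gamma>)"
      using x by (intro add_homI c(1) c(7))
    fix \<Omega> y assume O: "\<Omega> \<prec> \<Gamma>" and y: "y \<in> pf_carrier R \<Omega>"
    note m = strictly_refinesD(2)[OF O]
    have z: "pf_res R \<Omega> \<Gamma> id x \<otimes>\<^bsub>pf_val R \<Omega>\<^esub> y \<in> pf_carrier R \<Omega>"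
      using cringD(1)[OF val_cring[OF is_morD(1)[OF m]] res_closed[OF m x] y] .
    show "x \<otimes>\<^bsub>pf_val R \<Gamma>\<^esub> pf_tr R \<Omega> \<Gamma> id y \<in> tr_ideal R \<Gamma>"
      using tr_in_tr_ideal[OF O z] frobenius[OF m x y] by simp
  qed
  have "a \<in> pf_carrier R \<Gamma>" if "a \<in> tr_ideal R \<Gamma>" for a
    using additive_subgroup.a_subset[OF tr_ideal_subgroup[OF p]] that by blast
  hence "a \<otimes>\<^bsub>pf_val R \<Gamma>\<^esub> x \<in> tr_ideal R \<Gamma>" if "a \<in> tr_ideal R \<Gamma>" "x \<in> pf_carrier R \<Gamma>" for a x
    using l[OF that] c(5)[OF _ that(2), of a] that(1) by simp
  thus ?thesis
    using l cring.axioms(1)[OF val_cring[OF p]] additive_subgroup.a_subgroup[OF tr_ideal_subgroup[OF p]]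
    by (intro idealI)
qed

lemma bar_cring: "is_partition \<Gamma> \<Longrightarrow> cring (bar R \<Gamma>)"
  unfolding bar_def by (rule ideal.quotient_is_cring[OF tr_ideal_ideal val_cring])

lemma qmap_ring_hom: "is_partition \<Gamma> \<Longrightarrow> qmap R \<Gamma> \<in> ring_hom (pf_val R \<Gamma>) (bar R \<Gamma>)"
  using ideal.rcos_ring_hom[OF tr_ideal_ideal] by (simp add: bar_def qmap_def[abs_def])

text \<open>The quotient map is a surjective ring homomorphism, so multiplicativity of
  \<open>h\<close> can be read off from representatives.\<close>

lemma bar_ring_homI:
  assumes p: "is_partition \<Gamma>" and g: "g \<in> ring_hom (pf_val R \<Gamma>) S"
    and h: "\<And>x. x \<in> pf_carrier R \<Gamma> \<Longrightarrow> h (qmap R \<Gamma> x) = g x"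
  shows "h \<in> ring_hom (bar R \<Gamma>) S"
proof (rule ring_hom_memI)
  note q = qmap_ring_hom[OF p] and c = cringD[OF val_cring[OF p]]
  show "h \<one>\<^bsub>bar R \<Gamma>\<^esub> = \<one>\<^bsub>S\<^esub>"
    using ring_hom_one[OF q] h[OF c(2)] ring_hom_one[OF g] by simp
  fix a assume "a \<in> carrier (bar R \<Gamma>)"
  then obtain x where x: "x \<in> pf_carrier R \<Gamma>" "a = qmap R \<Gamma> x" by (rule bar_cases)
  show "h a \<in> carrier S" using h x ring_hom_closed[OF g] by simp
  fix b assume "b \<in> carrier (bar R \<Gamma>)"
  then obtain y where y: "y \<in> pf_carrier R \<Gamma>" "b = qmap R \<Gamma> y" by (rule bar_cases)
  show "h (a \<otimes>\<^bsub>bar R \<Gamma>\<^esub> b) = h a \<otimes>\<^bsub>S\<^esub> h b"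
    using ring_hom_mult[OF q x(1) y(1), symmetric] h[OF c(1)[OF x(1) y(1)]] h x y ring_hom_mult[OF g x(1) y(1)] by simp
  show "h (a \<oplus>\<^bsub>bar R \<Gamma>\<^esub> b) = h a \<oplus>\<^bsub>S\<^esub> h b"
    using ring_hom_add[OF q x(1) y(1), symmetric] h[OF abelian_groupE(1)[OF val_group[OF p] x(1) y(1)]] h x y
      ring_hom_add[OF g x(1) y(1)] by simp
qed

text \<open>A transfer need not be multiplicative, but along an isomorphism it is restriction along
  the inverse, and restrictions are ring homomorphisms. Hence the invariants in PD form a subring of
  the product.\<close>

lemma bar_tr_ring_hom:
  assumes "is_iso \<Gamma> \<Gamma>' f"
  shows "bar_tr R \<Gamma> \<Gamma>' f \<in> ring_hom (bar R \<Gamma>) (bar R \<Gamma>')"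
proof (rule bar_ring_homI)
  note m = isoD(1)[OF assms]
  show "is_partition \<Gamma>" using is_morD(1)[OF m] .
  show "(\<lambda>x. qmap R \<Gamma>' (pf_res R \<Gamma>' \<Gamma> (inv_into (pts \<Gamma>) f) x)) \<in> ring_hom (pf_val R \<Gamma>) (bar R \<Gamma>')"
    using ring_hom_of_comp[OF res_ring_hom[OF isoD(1)[OF iso_inv[OF assms]]] qmap_ring_hom[OF is_morD(2)[OF m]]] .
  show "bar_tr R \<Gamma> \<Gamma>' f (qmap R \<Gamma> x) = qmap R \<Gamma>' (pf_res R \<Gamma>' \<Gamma> (inv_into (pts \<Gamma>) f) x)" if "x \<in> pf_carrier R \<Gamma>" for x
    using bar_tr_qmap[OF assms that] tr_iso[OF assms that] by simp
qed

section \<open>The ring structure on the values of PD\<close>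

lemma PD_mult_closed:
  assumes x: "x \<in> carrier (PD_val R \<Lambda>)" and y: "y \<in> carrier (PD_val R \<Lambda>)"
  shows "x \<otimes>\<^bsub>PD_val R \<Lambda>\<^esub> y \<in> carrier (PD_val R \<Lambda>)"
proof (rule PD_val_memI)
  fix \<Gamma> assume r: "\<Gamma> \<preceq> \<Lambda>"
  show "(x \<otimes>\<^bsub>PD_val R \<Lambda>\<^esub> y) \<Gamma> \<in> carrier (bar R \<Gamma>)"
    using cringD(1)[OF bar_cring[OF refinesD(1)[OF r]] PD_val_memD(2)[OF x r] PD_val_memD(2)[OF y r]] r by (simp add: PD_val_ops)
  fix \<sigma> assume \<sigma>: "\<sigma> \<in> block_perms \<Lambda>"
  note b = block_perm_iso[OF \<sigma> r]
  show "bar_tr R (transport (inv_into UNIV \<sigma>) \<Gamma>) \<Gamma> \<sigma>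
      ((x \<otimes>\<^bsub>PD_val R \<Lambda>\<^esub> y) (transport (inv_into UNIV \<sigma>) \<Gamma>)) = (x \<otimes>\<^bsub>PD_val R \<Lambda>\<^esub> y) \<Gamma>"
    using ring_hom_mult[OF bar_tr_ring_hom[OF b(2)] PD_val_memD(2)[OF x b(1)] PD_val_memD(2)[OF y b(1)]]
      PD_val_memD(3)[OF x \<sigma> r] PD_val_memD(3)[OF y \<sigma> r] r b(1)
    by (simp add: PD_val_ops)
qed (simp add: PD_val_ops)

lemma PD_one_closed: "\<one>\<^bsub>PD_val R \<Lambda>\<^esub> \<in> carrier (PD_val R \<Lambda>)"
proof (rule PD_val_memI)
  fix \<Gamma> assume r: "\<Gamma> \<preceq> \<Lambda>"
  show "\<one>\<^bsub>PD_val R \<Lambda>\<^esub> \<Gamma> \<in> carrier (bar R \<Gamma>)"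
    using cringD(2)[OF bar_cring[OF refinesD(1)[OF r]]] r by (simp add: PD_val_ops)
  fix \<sigma> assume \<sigma>: "\<sigma> \<in> block_perms \<Lambda>"
  note b = block_perm_iso[OF \<sigma> r]
  show "bar_tr R (transport (inv_into UNIV \<sigma>) \<Gamma>) \<Gamma> \<sigma> (\<one>\<^bsub>PD_val R \<Lambda>\<^esub> (transport (inv_into UNIV \<sigma>) \<Gamma>)) = \<one>\<^bsub>PD_val R \<Lambda>\<^esub> \<Gamma>"
    using ring_hom_one[OF bar_tr_ring_hom[OF b(2)]] r b(1) by (simp add: PD_val_ops)
qed (simp add: PD_val_ops)

lemma PD_cring:
  assumes "is_partition \<Lambda>"
  shows "cring (PD_val R \<Lambda>)"
proof (rule cringI[OF PD_group[OF assms] comm_monoidI])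
  have C: "cring (bar R \<Gamma>)" if "\<Gamma> \<preceq> \<Lambda>" for \<Gamma> using bar_cring refinesD(1)[OF that] .
  fix x y z assume x: "x \<in> carrier (PD_val R \<Lambda>)" and y: "y \<in> carrier (PD_val R \<Lambda>)" and z: "z \<in> carrier (PD_val R \<Lambda>)"
  note X = PD_val_memD(2)[OF x] and Y = PD_val_memD(2)[OF y] and Z = PD_val_memD(2)[OF z]
  show "x \<otimes>\<^bsub>PD_val R \<Lambda>\<^esub> y \<in> carrier (PD_val R \<Lambda>)" using PD_mult_closed[OF x y] .
  show "x \<otimes>\<^bsub>PD_val R \<Lambda>\<^esub> y \<otimes>\<^bsub>PD_val R \<Lambda>\<^esub> z = x \<otimes>\<^bsub>PD_val R \<Lambda>\<^esub> (y \<otimes>\<^bsub>PD_val R \<Lambda>\<^esub> z)"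
    by (rule PD_val_eqI[of _ \<Lambda>]) (simp_all add: PD_val_ops cringD(3)[OF C X Y Z])
  show "(x \<oplus>\<^bsub>PD_val R \<Lambda>\<^esub> y) \<otimes>\<^bsub>PD_val R \<Lambda>\<^esub> z = x \<otimes>\<^bsub>PD_val R \<Lambda>\<^esub> z \<oplus>\<^bsub>PD_val R \<Lambda>\<^esub> y \<otimes>\<^bsub>PD_val R \<Lambda>\<^esub> z"
    by (rule PD_val_eqI[of _ \<Lambda>]) (simp_all add: PD_val_ops cringD(6)[OF C X Y Z])
  show "\<one>\<^bsub>PD_val R \<Lambda>\<^esub> \<otimes>\<^bsub>PD_val R \<Lambda>\<^esub> x = x"
    by (rule PD_val_eqI[OF _ PD_val_memD(1)[OF x]]) (simp_all add: PD_val_ops cringD(4)[OF C X])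
  show "x \<otimes>\<^bsub>PD_val R \<Lambda>\<^esub> y = y \<otimes>\<^bsub>PD_val R \<Lambda>\<^esub> x"
    using cringD(5)[OF C X Y] by (intro PD_val_eqI[of _ \<Lambda>]) (simp_all add: PD_val_ops)
qed (rule PD_one_closed)

lemma PD_at_ring_hom:
  assumes k: "is_mor \<Gamma> \<Lambda> k"
  shows "PD_at R \<Gamma> k \<in> ring_hom (PD_val R \<Lambda>) (bar R \<Gamma>)"
proof (rule ring_hom_memI)
  note r = mor_transport_refines[OF k]
  note h = bar_tr_ring_hom[OF iso_inv[OF mor_iso_transport[OF k]]]
  show "PD_at R \<Gamma> k \<one>\<^bsub>PD_val R \<Lambda>\<^esub> = \<one>\<^bsub>bar R \<Gamma>\<^esub>"
    unfolding PD_at_eq[OF PD_one_closed k] using ring_hom_one[OF h] r by (simp add: PD_val_ops)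
  fix x y assume x: "x \<in> carrier (PD_val R \<Lambda>)" and y: "y \<in> carrier (PD_val R \<Lambda>)"
  show "PD_at R \<Gamma> k x \<in> carrier (bar R \<Gamma>)" using PD_at_closed[OF x k] .
  show "PD_at R \<Gamma> k (x \<otimes>\<^bsub>PD_val R \<Lambda>\<^esub> y) = PD_at R \<Gamma> k x \<otimes>\<^bsub>bar R \<Gamma>\<^esub> PD_at R \<Gamma> k y"
    unfolding PD_at_eq[OF PD_mult_closed[OF x y] k] PD_at_eq[OF x k] PD_at_eq[OF y k]
    using ring_hom_mult[OF h PD_val_memD(2)[OF x r] PD_val_memD(2)[OF y r]] r by (simp add: PD_val_ops)
  show "PD_at R \<Gamma> k (x \<oplus>\<^bsub>PD_val R \<Lambda>\<^esub> y) = PD_at R \<Gamma> k x \<oplus>\<^bsub>bar R \<Gamma>\<^esub> PD_at R \<Gamma> k y"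
    using add_hom_add[OF PD_at_hom[OF k] x y] .
qed

lemma PD_res_ring_hom:
  assumes f: "is_mor \<Lambda> \<Omega> f"
  shows "PD_res R \<Lambda> \<Omega> f \<in> ring_hom (PD_val R \<Omega>) (PD_val R \<Lambda>)"
proof (rule ring_hom_memI)
  show "PD_res R \<Lambda> \<Omega> f \<one>\<^bsub>PD_val R \<Omega>\<^esub> = \<one>\<^bsub>PD_val R \<Lambda>\<^esub>"
  proof (rule PD_at_eqI[OF PD_res_closed[OF PD_one_closed f] PD_one_closed])
    fix \<Gamma> assume "\<Gamma> \<preceq> \<Lambda>"
    note k = refinesD(5)[OF this]
    show "PD_at R \<Gamma> id (PD_res R \<Lambda> \<Omega> f \<one>\<^bsub>PD_val R \<Omega>\<^esub>) = PD_at R \<Gamma> id \<one>\<^bsub>PD_val R \<Lambda>\<^esub>"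
      unfolding PD_at_res[OF PD_one_closed f k] ring_hom_one[OF PD_at_ring_hom[OF mor_comp[OF k f]]]
        ring_hom_one[OF PD_at_ring_hom[OF k]] ..
  qed
  fix x y assume x: "x \<in> carrier (PD_val R \<Omega>)" and y: "y \<in> carrier (PD_val R \<Omega>)"
  note rx = PD_res_closed[OF x f] and ry = PD_res_closed[OF y f] and xy = PD_mult_closed[OF x y]
  show "PD_res R \<Lambda> \<Omega> f x \<in> carrier (PD_val R \<Lambda>)" using rx .
  show "PD_res R \<Lambda> \<Omega> f (x \<oplus>\<^bsub>PD_val R \<Omega>\<^esub> y) = PD_res R \<Lambda> \<Omega> f x \<oplus>\<^bsub>PD_val R \<Lambda>\<^esub> PD_res R \<Lambda> \<Omega> f y"
    using add_hom_add[OF PD_res_hom[OF f] x y] .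
  show "PD_res R \<Lambda> \<Omega> f (x \<otimes>\<^bsub>PD_val R \<Omega>\<^esub> y) = PD_res R \<Lambda> \<Omega> f x \<otimes>\<^bsub>PD_val R \<Lambda>\<^esub> PD_res R \<Lambda> \<Omega> f y"
  proof (rule PD_at_eqI[OF PD_res_closed[OF xy f] PD_mult_closed[OF rx ry]])
    fix \<Gamma> assume "\<Gamma> \<preceq> \<Lambda>"
    note k = refinesD(5)[OF this]
    show "PD_at R \<Gamma> id (PD_res R \<Lambda> \<Omega> f (x \<otimes>\<^bsub>PD_val R \<Omega>\<^esub> y)) =
        PD_at R \<Gamma> id (PD_res R \<Lambda> \<Omega> f x \<otimes>\<^bsub>PD_val R \<Lambda>\<^esub> PD_res R \<Lambda> \<Omega> f y)"
      unfolding PD_at_res[OF xy f k] ring_hom_mult[OF PD_at_ring_hom[OF mor_comp[OF k f]] x y]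
        ring_hom_mult[OF PD_at_ring_hom[OF k] rx ry] PD_at_res[OF x f k] PD_at_res[OF y f k] ..
  qed
qed

text \<open>At a lift l of the identity, the restriction of a has the value a[f l] = a[id], since f
  l is 2-isomorphic to the identity. This factor is the same for all lifts and can be taken out of
  the sum.\<close>

lemma PD_frobenius:
  assumes f: "is_mor \<Lambda> \<Omega> f" and a: "a \<in> carrier (PD_val R \<Omega>)" and b: "b \<in> carrier (PD_val R \<Lambda>)"
  shows "PD_tr R \<Lambda> \<Omega> f (PD_res R \<Lambda> \<Omega> f a \<otimes>\<^bsub>PD_val R \<Lambda>\<^esub> b) = a \<otimes>\<^bsub>PD_val R \<Omega>\<^esub> PD_tr R \<Lambda> \<Omega> f b"
proof -
  note ra = PD_res_closed[OF a f] and tb = PD_tr_closed[OF b f]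
  note rab = PD_mult_closed[OF ra b]
  show ?thesis
  proof (rule PD_at_eqI[OF PD_tr_closed[OF rab f] PD_mult_closed[OF a tb]])
    fix \<Gamma> assume "\<Gamma> \<preceq> \<Omega>"
    note k = refinesD(5)[OF this] and p = refinesD(1)[OF this]
    note c = cringD[OF bar_cring[OF p]] and g = bar_group[OF p]
    let ?L = "lifts \<Gamma> \<Lambda> \<Omega> f id" and ?a = "PD_at R \<Gamma> id a"
    note ca = PD_at_closed[OF a k]
    have "lift_sum R \<Gamma> \<Lambda> \<Omega> f id (PD_res R \<Lambda> \<Omega> f a \<otimes>\<^bsub>PD_val R \<Lambda>\<^esub> b) =
        class_sum (bar R \<Gamma>) (mor_class \<Gamma> \<Lambda>) ?L (\<lambda>l. ?a \<otimes>\<^bsub>bar R \<Gamma>\<^esub> PD_at R \<Gamma> l b)"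
      unfolding lift_sum_def
    proof (rule class_sum_cong[OF g])
      fix l assume "l \<in> ?L"
      note l = liftsD[OF this]
      show "?a \<otimes>\<^bsub>bar R \<Gamma>\<^esub> PD_at R \<Gamma> l b \<in> carrier (bar R \<Gamma>)" using c(1)[OF ca PD_at_closed[OF b l(1)]] .
      show "PD_at R \<Gamma> l (PD_res R \<Lambda> \<Omega> f a \<otimes>\<^bsub>PD_val R \<Lambda>\<^esub> b) = ?a \<otimes>\<^bsub>bar R \<Gamma>\<^esub> PD_at R \<Gamma> l b"
        unfolding ring_hom_mult[OF PD_at_ring_hom[OF l(1)] ra b] PD_at_res[OF a f l(1)] PD_at_two_iso[OF a l(2)] ..
    qed
    also have "\<dots> = ?a \<otimes>\<^bsub>bar R \<Gamma>\<^esub> lift_sum R \<Gamma> \<Lambda> \<Omega> f id b"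
      unfolding lift_sum_def
    proof (rule class_sum_hom[OF g g _ PD_at_closed[OF b liftsD(1)], symmetric])
      show "(\<lambda>z. ?a \<otimes>\<^bsub>bar R \<Gamma>\<^esub> z) \<in> add_hom (bar R \<Gamma>) (bar R \<Gamma>)" using ca by (intro add_homI c(1) c(7))
    qed
    finally show "PD_at R \<Gamma> id (PD_tr R \<Lambda> \<Omega> f (PD_res R \<Lambda> \<Omega> f a \<otimes>\<^bsub>PD_val R \<Lambda>\<^esub> b)) =
        PD_at R \<Gamma> id (a \<otimes>\<^bsub>PD_val R \<Omega>\<^esub> PD_tr R \<Lambda> \<Omega> f b)"
      unfolding PD_at_tr[OF rab f k] ring_hom_mult[OF PD_at_ring_hom[OF k] a tb] PD_at_tr[OF b f k] .
  qed
qed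

lemma bar_prod_mult:
  assumes p: "is_partition \<Gamma>" "is_partition \<Theta>" and "a \<in> carrier (bar R \<Gamma>)" "a' \<in> carrier (bar R \<Gamma>)"
    "b \<in> carrier (bar R \<Theta>)" "b' \<in> carrier (bar R \<Theta>)"
  shows "bar_prod R \<Gamma> \<Theta> (a \<otimes>\<^bsub>bar R \<Gamma>\<^esub> a') (b \<otimes>\<^bsub>bar R \<Theta>\<^esub> b') =
    bar_prod R \<Gamma> \<Theta> a b \<otimes>\<^bsub>bar R (\<Gamma> \<uplus> \<Theta>)\<^esub> bar_prod R \<Gamma> \<Theta> a' b'"
proof -
  obtain x where x: "x \<in> pf_carrier R \<Gamma>" "a = qmap R \<Gamma> x" using assms(3) by (rule bar_cases)
  obtain x' where x': "x' \<in> pf_carrier R \<Gamma>" "a' = qmap R \<Gamma> x'" using assms(4) by (rule bar_cases)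
  obtain y where y: "y \<in> pf_carrier R \<Theta>" "b = qmap R \<Theta> y" using assms(5) by (rule bar_cases)
  obtain y' where y': "y' \<in> pf_carrier R \<Theta>" "b' = qmap R \<Theta> y'" using assms(6) by (rule bar_cases)
  note xx = cringD(1)[OF val_cring[OF p(1)] x(1) x'(1)] and yy = cringD(1)[OF val_cring[OF p(2)] y(1) y'(1)]
  show ?thesis
    unfolding x(2) x'(2) y(2) y'(2) ring_hom_mult[OF qmap_ring_hom[OF p(1)] x(1) x'(1), symmetric]
      ring_hom_mult[OF qmap_ring_hom[OF p(2)] y(1) y'(1), symmetric] bar_prod_qmap[OF p xx yy]
      bar_prod_qmap[OF p x(1) y(1)] bar_prod_qmap[OF p x'(1) y'(1)] prod_mult[OF p x(1) x'(1) y(1) y'(1)]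
      ring_hom_mult[OF qmap_ring_hom[OF djunion_partition[OF p]] prod_closed[OF p x(1) y(1)] prod_closed[OF p x'(1) y'(1)]] ..
qed

lemma bar_prod_one:
  assumes p: "is_partition \<Gamma>" "is_partition \<Theta>"
  shows "bar_prod R \<Gamma> \<Theta> \<one>\<^bsub>bar R \<Gamma>\<^esub> \<one>\<^bsub>bar R \<Theta>\<^esub> = \<one>\<^bsub>bar R (\<Gamma> \<uplus> \<Theta>)\<^esub>"
  unfolding ring_hom_one[OF qmap_ring_hom[OF p(1)], symmetric] ring_hom_one[OF qmap_ring_hom[OF p(2)], symmetric]
    bar_prod_qmap[OF p cringD(2)[OF val_cring[OF p(1)]] cringD(2)[OF val_cring[OF p(2)]]] prod_one[OF p]
    ring_hom_one[OF qmap_ring_hom[OF djunion_partition[OF p]]] ..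

lemma PD_prod_mult:
  assumes p: "is_partition \<Lambda>" "is_partition \<Omega>"
    and x: "x \<in> carrier (PD_val R \<Lambda>)" "x' \<in> carrier (PD_val R \<Lambda>)" and y: "y \<in> carrier (PD_val R \<Omega>)" "y' \<in> carrier (PD_val R \<Omega>)"
  shows "PD_prod R \<Lambda> \<Omega> (x \<otimes>\<^bsub>PD_val R \<Lambda>\<^esub> x') (y \<otimes>\<^bsub>PD_val R \<Omega>\<^esub> y') =
    PD_prod R \<Lambda> \<Omega> x y \<otimes>\<^bsub>PD_val R (\<Lambda> \<uplus> \<Omega>)\<^esub> PD_prod R \<Lambda> \<Omega> x' y'"
proof (rule djunion_eqI[OF p PD_prod_extensional])
  show "PD_prod R \<Lambda> \<Omega> x y \<otimes>\<^bsub>PD_val R (\<Lambda> \<uplus> \<Omega>)\<^esub> PD_prod R \<Lambda> \<Omega> x' y' \<in> extensional {\<Delta>. \<Delta> \<preceq> \<Lambda> \<uplus> \<Omega>}" by (simp add: PD_val_ops)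
  fix \<Gamma> \<Theta> assume G: "\<Gamma> \<preceq> \<Lambda>" "\<Theta> \<preceq> \<Omega>"
  show "PD_prod R \<Lambda> \<Omega> (x \<otimes>\<^bsub>PD_val R \<Lambda>\<^esub> x') (y \<otimes>\<^bsub>PD_val R \<Omega>\<^esub> y') (\<Gamma> \<uplus> \<Theta>) =
      (PD_prod R \<Lambda> \<Omega> x y \<otimes>\<^bsub>PD_val R (\<Lambda> \<uplus> \<Omega>)\<^esub> PD_prod R \<Lambda> \<Omega> x' y') (\<Gamma> \<uplus> \<Theta>)"
    using bar_prod_mult[OF refinesD(1)[OF G(1)] refinesD(1)[OF G(2)] PD_val_memD(2)[OF x(1) G(1)] PD_val_memD(2)[OF x(2) G(1)]
        PD_val_memD(2)[OF y(1) G(2)] PD_val_memD(2)[OF y(2) G(2)]] G djunion_refines[OF G]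
    by (simp add: PD_prod_apply PD_val_ops)
qed

lemma PD_prod_one:
  assumes p: "is_partition \<Lambda>" "is_partition \<Omega>"
  shows "PD_prod R \<Lambda> \<Omega> \<one>\<^bsub>PD_val R \<Lambda>\<^esub> \<one>\<^bsub>PD_val R \<Omega>\<^esub> = \<one>\<^bsub>PD_val R (\<Lambda> \<uplus> \<Omega>)\<^esub>"
proof (rule djunion_eqI[OF p PD_prod_extensional])
  show "\<one>\<^bsub>PD_val R (\<Lambda> \<uplus> \<Omega>)\<^esub> \<in> extensional {\<Delta>. \<Delta> \<preceq> \<Lambda> \<uplus> \<Omega>}" by (simp add: PD_val_ops)
  fix \<Gamma> \<Theta> assume G: "\<Gamma> \<preceq> \<Lambda>" "\<Theta> \<preceq> \<Omega>"
  show "PD_prod R \<Lambda> \<Omega> \<one>\<^bsub>PD_val R \<Lambda>\<^esub> \<one>\<^bsub>PD_val R \<Omega>\<^esub> (\<Gamma> \<uplus> \<Theta>) = \<one>\<^bsub>PD_val R (\<Lambda> \<uplus> \<Omega>)\<^esub> (\<Gamma> \<uplus> \<Theta>)"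
    using bar_prod_one[OF refinesD(1)[OF G(1)] refinesD(1)[OF G(2)]] G djunion_refines[OF G]
    by (simp add: PD_prod_apply PD_val_ops)
qed

lemma comp_map_ring_hom:
  assumes "\<And>x. x \<in> carrier (PD_val R \<Lambda>) \<Longrightarrow> comp_map \<alpha> \<Lambda> x \<in> carrier (PD_val N \<Lambda>)"
    "\<And>\<Gamma>. is_partition \<Gamma> \<Longrightarrow> \<alpha> \<Gamma> \<in> ring_hom (bar R \<Gamma>) (bar N \<Gamma>)"
  shows "comp_map \<alpha> \<Lambda> \<in> ring_hom (PD_val R \<Lambda>) (PD_val N \<Lambda>)"
proof (rule ring_hom_memI)
  have h: "\<alpha> \<Gamma> \<in> ring_hom (bar R \<Gamma>) (bar N \<Gamma>)" if "\<Gamma> \<preceq> \<Lambda>" for \<Gamma> using assms(2) refinesD(1)[OF that] .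
  show "comp_map \<alpha> \<Lambda> \<one>\<^bsub>PD_val R \<Lambda>\<^esub> = \<one>\<^bsub>PD_val N \<Lambda>\<^esub>"
    by (rule PD_val_eqI[OF comp_map_extensional]) (simp_all add: comp_map_apply PD_val_ops ring_hom_one[OF h])
  fix x y assume x: "x \<in> carrier (PD_val R \<Lambda>)" and y: "y \<in> carrier (PD_val R \<Lambda>)"
  note X = PD_val_memD(2)[OF x] and Y = PD_val_memD(2)[OF y]
  show "comp_map \<alpha> \<Lambda> x \<in> carrier (PD_val N \<Lambda>)" using assms(1)[OF x] .
  show "comp_map \<alpha> \<Lambda> (x \<otimes>\<^bsub>PD_val R \<Lambda>\<^esub> y) = comp_map \<alpha> \<Lambda> x \<otimes>\<^bsub>PD_val N \<Lambda>\<^esub> comp_map \<alpha> \<Lambda> y"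
    by (rule PD_val_eqI[OF comp_map_extensional]) (simp_all add: comp_map_apply PD_val_ops ring_hom_mult[OF h X Y])
  show "comp_map \<alpha> \<Lambda> (x \<oplus>\<^bsub>PD_val R \<Lambda>\<^esub> y) = comp_map \<alpha> \<Lambda> x \<oplus>\<^bsub>PD_val N \<Lambda>\<^esub> comp_map \<alpha> \<Lambda> y"
    by (rule PD_val_eqI[OF comp_map_extensional]) (simp_all add: comp_map_apply PD_val_ops ring_hom_add[OF h X Y])
qed

theorem PD_partition_ring:
  assumes N: "is_PD_lax R N"
  shows "partition_ring N"
proof -
  note S = is_PD_simps[OF is_PD_laxD(1)[OF N]] is_PD_laxD(2,3)[OF N]
  show ?thesis
    unfolding partition_ring_def S
    by (intro conjI allI impI ballI; (elim conjE)?)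
      (rule PD_lax_partition_functor[OF N] PD_cring PD_res_ring_hom PD_prod_mult PD_prod_one PD_frobenius | assumption)+
qed

theorem PD_map_ring_morphism:
  assumes N: "partition_ring N" and \<phi>: "ring_morphism R N \<phi>" and R': "is_PD_lax R R'" and N': "is_PD_lax N N'"
  shows "ring_morphism R' N' (PD_map N \<phi>)"
  unfolding ring_morphism_def
proof (intro conjI allI impI)
  interpret N: ring_functor N using N by (simp add: ring_functor_def)
  note S = is_PD_simps[OF is_PD_laxD(1)[OF R']] is_PD_simps[OF is_PD_laxD(1)[OF N']]
  have \<phi>l: "lax_morphism R N \<phi>" and \<phi>r: "\<And>\<Lambda>. is_partition \<Lambda> \<Longrightarrow> \<phi> \<Lambda> \<in> ring_hom (pf_val R \<Lambda>) (pf_val N \<Lambda>)"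
    using \<phi> by (auto simp: ring_morphism_def)
  note \<phi>p = lax_morphismD(1)[OF \<phi>l]
  show l: "lax_morphism R' N' (PD_map N \<phi>)" using PD_map_lax_morphism[OF N.lax \<phi>l R' N'] .
  fix \<Lambda> :: "'u set_partition" assume p: "is_partition \<Lambda>"
  show "PD_map N \<phi> \<Lambda> \<in> ring_hom (pf_val R' \<Lambda>) (pf_val N' \<Lambda>)"
    unfolding S PD_map_comp_map
  proof (rule comp_map_ring_hom)
    show "comp_map (bar_map N \<phi>) \<Lambda> x \<in> carrier (PD_val N \<Lambda>)" if "x \<in> carrier (PD_val R \<Lambda>)" for x
      using pf_morphismD(2)[OF lax_morphismD(1)[OF l] p, of x] that by (simp add: S PD_map_comp_map)
    show "bar_map N \<phi> \<Gamma> \<in> ring_hom (bar R \<Gamma>) (bar N \<Gamma>)" if q: "is_partition \<Gamma>" for \<Gamma>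
      using ring_hom_of_comp[OF \<phi>r[OF q] N.qmap_ring_hom[OF q]] bar_map_qmap[OF N.pf \<phi>p q] by (rule bar_ring_homI[OF q])
  qed
qed

theorem PD_eta_ring_morphism:
  assumes R': "is_PD_lax R R'"
  shows "ring_morphism R R' (PD_eta R)"
  unfolding ring_morphism_def
proof (intro conjI allI impI)
  show "lax_morphism R R' (PD_eta R)" using PD_eta_lax_morphism[OF R'] .
  fix \<Lambda> :: "'u set_partition" assume "is_partition \<Lambda>"
  show "PD_eta R \<Lambda> \<in> ring_hom (pf_val R \<Lambda>) (pf_val R' \<Lambda>)"
    unfolding is_PD_simps[OF is_PD_laxD(1)[OF R']]
  proof (rule ring_hom_memI)
    have h: "(\<lambda>z. qmap R \<Gamma> (pf_res R \<Gamma> \<Lambda> id z)) \<in> ring_hom (pf_val R \<Lambda>) (bar R \<Gamma>)" if "\<Gamma> \<preceq> \<Lambda>" for \<Gamma>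
      using ring_hom_of_comp[OF res_ring_hom[OF refinesD(5)[OF that]] qmap_ring_hom[OF refinesD(1)[OF that]]] .
    have e: "PD_eta R \<Lambda> z \<in> extensional {\<Gamma>. \<Gamma> \<preceq> \<Lambda>}" for z by (simp add: PD_eta_def)
    show "PD_eta R \<Lambda> \<one>\<^bsub>pf_val R \<Lambda>\<^esub> = \<one>\<^bsub>PD_val R \<Lambda>\<^esub>"
      by (rule PD_val_eqI[OF e]) (simp_all add: PD_eta_apply PD_val_ops ring_hom_one[OF h])
    fix x y assume x: "x \<in> pf_carrier R \<Lambda>" and y: "y \<in> pf_carrier R \<Lambda>"
    show "PD_eta R \<Lambda> x \<in> carrier (PD_val R \<Lambda>)" using PD_eta_closed[OF x] .
    show "PD_eta R \<Lambda> (x \<otimes>\<^bsub>pf_val R \<Lambda>\<^esub> y) = PD_eta R \<Lambda> x \<otimes>\<^bsub>PD_val R \<Lambda>\<^esub> PD_eta R \<Lambda> y"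
      by (rule PD_val_eqI[OF e]) (simp_all add: PD_eta_apply PD_val_ops ring_hom_mult[OF h x y])
    show "PD_eta R \<Lambda> (x \<oplus>\<^bsub>pf_val R \<Lambda>\<^esub> y) = PD_eta R \<Lambda> x \<oplus>\<^bsub>PD_val R \<Lambda>\<^esub> PD_eta R \<Lambda> y"
      by (rule PD_val_eqI[OF e]) (simp_all add: PD_eta_apply PD_val_ops ring_hom_add[OF h x y])
  qed
qed

text \<open>The ring structure of PD is componentwise, so taking the top component is a ring
  homomorphism; it stays one after passing to the quotient, and \<mu> consists of such maps.\<close>

theorem PD_mu_ring_morphism:
  assumes R': "is_PD_lax R R'" and R'': "is_PD_lax R' R''"
  shows "ring_morphism R'' R' PD_mu"
  unfolding ring_morphism_def
proof (intro conjI allI impI)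
  interpret R': ring_functor R' using PD_partition_ring[OF R'] by (simp add: ring_functor_def)
  note P' = is_PD_laxD(1)[OF R'] and P'' = is_PD_laxD(1)[OF R'']
  show l: "lax_morphism R'' R' PD_mu" using PD_mu_lax_morphism[OF R' R''] .
  fix \<Lambda> :: "'u set_partition" assume p: "is_partition \<Lambda>"
  show "PD_mu \<Lambda> \<in> ring_hom (pf_val R'' \<Lambda>) (pf_val R' \<Lambda>)"
    unfolding is_PD_simps(1)[OF P''] is_PD_simps(1)[OF P'] PD_mu_comp_map
  proof (rule R'.comp_map_ring_hom)
    show "comp_map bar_proj \<Lambda> x \<in> carrier (PD_val R \<Lambda>)" if "x \<in> carrier (PD_val R' \<Lambda>)" for x
      using pf_morphismD(2)[OF lax_morphismD(1)[OF l] p, of x] that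
      by (simp add: is_PD_simps(1)[OF P''] is_PD_simps(1)[OF P'] PD_mu_comp_map)
    fix \<Gamma> :: "'u set_partition" assume q: "is_partition \<Gamma>"
    show "bar_proj \<Gamma> \<in> ring_hom (bar R' \<Gamma>) (bar R \<Gamma>)"
    proof (rule R'.bar_ring_homI[OF q])
      note r = refines_refl[OF q]
      show "(\<lambda>x. x \<Gamma>) \<in> ring_hom (pf_val R' \<Gamma>) (bar R \<Gamma>)"
        unfolding is_PD_simps(1)[OF P'] using PD_val_memD(2)[OF _ r] r by (intro ring_hom_memI) (auto simp: PD_val_ops)
      show "bar_proj \<Gamma> (qmap R' \<Gamma> x) = x \<Gamma>" if "x \<in> pf_carrier R' \<Gamma>" for x
        using bar_proj_qmap[OF P' q, of x] that by (simp add: is_PD_simps(1)[OF P'])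
    qed
  qed
qed

end

section \<open>PD of a partition power functor\<close>

lemma refines_indiscrete_1: "\<Gamma> \<preceq> indiscrete 1 \<longleftrightarrow> \<Gamma> = (indiscrete 1 :: 'u set_partition)"
proof
  assume r: "\<Gamma> \<preceq> indiscrete 1"
  have "(Num 1, Num 1) \<in> rel \<Gamma>"
    using is_partitionD(3)[OF refinesD(1)[OF r]] refinesD(3)[OF r] by (simp add: indiscrete_def)
  thus "\<Gamma> = indiscrete 1"
    using refinesD(3,4)[OF r] by (intro partition_eqI) (auto simp: indiscrete_def)
qed (use refines_refl[OF indiscrete_partition] in auto)

lemma merge_map_mor: "is_mor (indiscrete i \<uplus> indiscrete j) (indiscrete (i + j)) (merge_map i)"
proof (rule is_morI[OF djunion_partition[OF indiscrete_partition indiscrete_partition] indiscrete_partition])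
  have pts: "pts (indiscrete i \<uplus> indiscrete j) = Lft ` Num ` {1..i} \<union> Rgt ` Num ` {1..j}"
    by (simp add: djunion_def indiscrete_def)
  have "merge_map i ` pts (indiscrete i \<uplus> indiscrete j) = Num ` ({1..i} \<union> (+) i ` {1..j})"
    unfolding pts by (simp only: image_Un image_image merge_map.simps)
  also have "{1..i} \<union> (+) i ` {1..j} = {1..i + j}" by auto
  finally have img: "merge_map i ` pts (indiscrete i \<uplus> indiscrete j) = pts (indiscrete (i + j))" by (simp add: indiscrete_def)
  have "inj_on (merge_map i) (pts (indiscrete i \<uplus> indiscrete j))"
    unfolding pts by (auto simp: inj_on_def)
  thus "bij_betw (merge_map i) (pts (indiscrete i \<uplus> indiscrete j)) (pts (indiscrete (i + j)))"
    using img by (simp add: bij_betw_def)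
  fix p q assume "(p, q) \<in> rel (indiscrete i \<uplus> indiscrete j)"
  hence "p \<in> pts (indiscrete i \<uplus> indiscrete j)" "q \<in> pts (indiscrete i \<uplus> indiscrete j)"
    using is_partitionD(2)[OF djunion_partition[OF indiscrete_partition indiscrete_partition]] by blast+
  hence "merge_map i p \<in> pts (indiscrete (i + j))" "merge_map i q \<in> pts (indiscrete (i + j))" using img by blast+
  thus "(merge_map i p, merge_map i q) \<in> rel (indiscrete (i + j))" by (simp add: indiscrete_def)
qed

text \<open>The partition of one point has no proper refinement, so nothing is divided out and an
  element of PD at it has a single component. This bijection carries the power operations over to
  PD.\<close>

lemma (in part_functor)
  shows PD_eta_1_inj: "inj_on (PD_eta M (indiscrete 1)) (pf_carrier M (indiscrete 1))"
    and PD_eta_1_surj: "x \<in> carrier (PD_val M (indiscrete 1)) \<Longrightarrow>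
      \<exists>a \<in> pf_carrier M (indiscrete 1). x = PD_eta M (indiscrete 1) a"
proof -
  note p = indiscrete_partition[of 1]
  note r = refines_refl[OF p]
  have no: "\<not> \<Omega> \<prec> indiscrete 1" for \<Omega> :: "'u set_partition"
    using refines_indiscrete_1[of \<Omega>] by (auto simp: strictly_refines_def)
  \<comment> \<open>Every homomorphism out of M(1) is constant on cosets, since there are no proper
    transfers into it; applied to the identity this makes the cosets singletons.\<close>
  have h: "(\<lambda>x. x) \<in> add_hom (pf_val M (indiscrete 1)) (pf_val M (indiscrete 1))" by (simp add: hom_def)
  show "inj_on (PD_eta M (indiscrete 1)) (pf_carrier M (indiscrete 1))"
  proof (rule inj_onI)
    fix a b assume a: "a \<in> pf_carrier M (indiscrete 1)" and b: "b \<in> pf_carrier M (indiscrete 1)"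
      and e: "PD_eta M (indiscrete 1) a = PD_eta M (indiscrete 1) b"
    have "qmap M (indiscrete 1) a = qmap M (indiscrete 1) b"
      using fun_cong[OF e, of "indiscrete 1"] unfolding PD_eta_apply[OF r] res_id[OF p a] res_id[OF p b] .
    hence "a \<in> qmap M (indiscrete 1) b" using qmap_self[OF p a] by simp
    thus "a = b" using no by (intro qmap_const[OF p val_group[OF p] h _ b]) auto
  qed
  show "\<exists>a \<in> pf_carrier M (indiscrete 1). x = PD_eta M (indiscrete 1) a" if x: "x \<in> carrier (PD_val M (indiscrete 1))"
  proof -
    obtain a where a: "a \<in> pf_carrier M (indiscrete 1)" "x (indiscrete 1) = qmap M (indiscrete 1) a"
      using PD_val_memD(2)[OF x r] by (rule bar_cases)
    have "x = PD_eta M (indiscrete 1) a"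
    proof (rule PD_val_eqI[OF PD_val_memD(1)[OF x]])
      show "PD_eta M (indiscrete 1) a \<in> extensional {\<Gamma>. \<Gamma> \<preceq> indiscrete 1}" by (simp add: PD_eta_def)
      fix \<Gamma> :: "'u set_partition" assume "\<Gamma> \<preceq> indiscrete 1"
      hence G: "\<Gamma> = indiscrete 1" by (simp only: refines_indiscrete_1)
      show "x \<Gamma> = PD_eta M (indiscrete 1) a \<Gamma>"
        unfolding G PD_eta_apply[OF r] res_id[OF p a(1)] using a(2) .
    qed
    thus ?thesis using a(1) by blast
  qed
qed

definition is_PD_power :: "('u, 'a, 'y) power_pfun_scheme \<Rightarrow> ('u, 'u set_partition \<Rightarrow> 'a set, 'z) power_pfun_scheme \<Rightarrow> bool" where
  "is_PD_power M N \<longleftrightarrow> is_PD_lax M N \<and> pw_op N = PD_pow M"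

lemma is_PD_powerD:
  assumes "is_PD_power M N"
  shows "is_PD_lax M N" "pw_op N = PD_pow M"
  using assms by (auto simp: is_PD_power_def)

locale power_functor =
  fixes R :: "('u, 'a, 'z) power_pfun_scheme"
  assumes ppf: "partition_power_functor R"
begin

lemmas power_ax = ppf[unfolded partition_power_functor_def]

sublocale ring_functor R
  by unfold_locales (rule power_ax[THEN conjunct1])

lemma pow_closed: "a \<in> pf_carrier R (indiscrete 1) \<Longrightarrow> pw_op R m a \<in> pf_carrier R (indiscrete m)"
  using power_ax[THEN conjunct2, THEN conjunct1] by blast

lemma pow_mult: "a \<in> pf_carrier R (indiscrete 1) \<Longrightarrow> b \<in> pf_carrier R (indiscrete 1) \<Longrightarrow>
    pw_op R m (a \<otimes>\<^bsub>pf_val R (indiscrete 1)\<^esub> b) = pw_op R m a \<otimes>\<^bsub>pf_val R (indiscrete m)\<^esub> pw_op R m b"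
  using power_ax[THEN conjunct2, THEN conjunct2, THEN conjunct1] by blast

lemma pow_0: "a \<in> pf_carrier R (indiscrete 1) \<Longrightarrow> pw_op R 0 a = \<one>\<^bsub>pf_val R (indiscrete 0)\<^esub>"
  using power_ax[THEN conjunct2, THEN conjunct2, THEN conjunct2, THEN conjunct1] by blast

lemma pow_one: "pw_op R m \<one>\<^bsub>pf_val R (indiscrete 1)\<^esub> = \<one>\<^bsub>pf_val R (indiscrete m)\<^esub>"
  using power_ax[THEN conjunct2, THEN conjunct2, THEN conjunct2, THEN conjunct2, THEN conjunct1] by blast

lemma pow_1: "a \<in> pf_carrier R (indiscrete 1) \<Longrightarrow> pw_op R 1 a = a"
  using power_ax[THEN conjunct2, THEN conjunct2, THEN conjunct2, THEN conjunct2, THEN conjunct2, THEN conjunct1] by blast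

lemma pow_res: "a \<in> pf_carrier R (indiscrete 1) \<Longrightarrow>
    pf_res R (indiscrete i \<uplus> indiscrete j) (indiscrete (i + j)) (merge_map i) (pw_op R (i + j) a) =
      lx_prod R (indiscrete i) (indiscrete j) (pw_op R i a) (pw_op R j a)"
  using power_ax[THEN conjunct2, THEN conjunct2, THEN conjunct2, THEN conjunct2, THEN conjunct2, THEN conjunct2, THEN conjunct1] by blast

lemma pow_add: "a \<in> pf_carrier R (indiscrete 1) \<Longrightarrow> b \<in> pf_carrier R (indiscrete 1) \<Longrightarrow>
    pw_op R m (a \<oplus>\<^bsub>pf_val R (indiscrete 1)\<^esub> b) =
      (\<Oplus>\<^bsub>pf_val R (indiscrete m)\<^esub> i \<in> {0..m}.
         pf_tr R (indiscrete i \<uplus> indiscrete (m - i)) (indiscrete m) (merge_map i)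
           (lx_prod R (indiscrete i) (indiscrete (m - i)) (pw_op R i a) (pw_op R (m - i) b)))"
  using power_ax[THEN conjunct2, THEN conjunct2, THEN conjunct2, THEN conjunct2, THEN conjunct2, THEN conjunct2, THEN conjunct2] by blast

text \<open>Together with \<open>eta_1_cases\<close> this replaces the inverse of \<eta> in the
  definition: every argument is written as \<eta> of some element, and the operation is transported
  along \<eta>.\<close>

lemma PD_pow_eta:
  "a \<in> pf_carrier R (indiscrete 1) \<Longrightarrow> PD_pow R m (PD_eta R (indiscrete 1) a) = PD_eta R (indiscrete m) (pw_op R m a)"
  by (simp only: PD_pow_def the_inv_into_f_f[OF PD_eta_1_inj])

lemma eta_1_cases:
  assumes "x \<in> carrier (PD_val R (indiscrete 1))"
  obtains a where "a \<in> pf_carrier R (indiscrete 1)" "x = PD_eta R (indiscrete 1) a"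
  using PD_eta_1_surj[OF assms] by blast

text \<open>Every element of PD(R)(1) comes from R(1), and \<eta> is already known to respect sums,
  products, units, restrictions, transfers and external products. Each axiom is therefore the image
  under \<eta> of the same axiom for \<open>R\<close>.\<close>

theorem PD_partition_power_functor:
  assumes N: "is_PD_power R N"
  shows "partition_power_functor N"
proof -
  note L = is_PD_powerD(1)[OF N]
  note S = is_PD_simps[OF is_PD_laxD(1)[OF L]] is_PD_laxD(2,3)[OF L] is_PD_powerD(2)[OF N]
  note ip = indiscrete_partition
  note eta = PD_eta_ring_morphism[OF L]
  have er: "PD_eta R \<Lambda> \<in> ring_hom (pf_val R \<Lambda>) (PD_val R \<Lambda>)" if "is_partition \<Lambda>" for \<Lambda>
    using eta that S by (simp add: ring_morphism_def)
  note el = lax_morphismD[OF PD_eta_lax_morphism[OF L], unfolded S]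
  note E = ring_hom_mult[OF er[OF ip]] ring_hom_add[OF er[OF ip]] ring_hom_one[OF er[OF ip]]
  show ?thesis
    unfolding partition_power_functor_def S
  proof (intro conjI allI ballI funcsetI)
    show "partition_ring N" using PD_partition_ring[OF L] .
    fix m
    show "PD_pow R m \<one>\<^bsub>PD_val R (indiscrete 1)\<^esub> = \<one>\<^bsub>PD_val R (indiscrete m)\<^esub>"
      using PD_pow_eta[OF cringD(2)[OF val_cring[OF ip]]] E(3) pow_one by metis
    fix x assume "x \<in> carrier (PD_val R (indiscrete 1))"
    then obtain a where a: "a \<in> pf_carrier R (indiscrete 1)" and x: "x = PD_eta R (indiscrete 1) a" by (rule eta_1_cases)
    show "PD_pow R m x \<in> carrier (PD_val R (indiscrete m))"
      unfolding x PD_pow_eta[OF a] using PD_eta_closed[OF pow_closed[OF a]] .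
    show "PD_pow R 0 x = \<one>\<^bsub>PD_val R (indiscrete 0)\<^esub>" unfolding x PD_pow_eta[OF a] pow_0[OF a] E(3) ..
    show "PD_pow R 1 x = x" unfolding x PD_pow_eta[OF a] pow_1[OF a] ..
    show "PD_res R (indiscrete i \<uplus> indiscrete j) (indiscrete (i + j)) (merge_map i) (PD_pow R (i + j) x) =
        PD_prod R (indiscrete i) (indiscrete j) (PD_pow R i x) (PD_pow R j x)" for i j
      unfolding x PD_pow_eta[OF a] PD_eta_res[OF pow_closed[OF a] merge_map_mor, symmetric] pow_res[OF a]
        el(3)[OF ip ip pow_closed[OF a] pow_closed[OF a]] ..
    fix y assume "y \<in> carrier (PD_val R (indiscrete 1))"
    then obtain b where b: "b \<in> pf_carrier R (indiscrete 1)" and y: "y = PD_eta R (indiscrete 1) b" by (rule eta_1_cases)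
    show "PD_pow R m (x \<otimes>\<^bsub>PD_val R (indiscrete 1)\<^esub> y) = PD_pow R m x \<otimes>\<^bsub>PD_val R (indiscrete m)\<^esub> PD_pow R m y"
      unfolding x y E(1)[OF a b, symmetric] PD_pow_eta[OF cringD(1)[OF val_cring[OF ip] a b]] pow_mult[OF a b]
        PD_pow_eta[OF a] PD_pow_eta[OF b] E(1)[OF pow_closed[OF a] pow_closed[OF b]] ..
    let ?t = "\<lambda>i. pf_tr R (indiscrete i \<uplus> indiscrete (m - i)) (indiscrete m) (merge_map i)
        (lx_prod R (indiscrete i) (indiscrete (m - i)) (pw_op R i a) (pw_op R (m - i) b))"
    note pc = prod_closed[OF ip ip pow_closed[OF a] pow_closed[OF b]]
    have mm: "is_mor (indiscrete i \<uplus> indiscrete (m - i)) (indiscrete m) (merge_map i)" if "i \<in> {0..m}" for i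
      using merge_map_mor[of i "m - i"] that by simp
    \<comment> \<open>The addition formula holds in R(m). It is pushed through \<eta> by additivity,
      and then each summand by compatibility of \<eta> with the transfer along the merging map and
      with the external product.\<close>
    have "PD_pow R m (x \<oplus>\<^bsub>PD_val R (indiscrete 1)\<^esub> y) = PD_eta R (indiscrete m) (finsum (pf_val R (indiscrete m)) ?t {0..m})"
      unfolding x y E(2)[OF a b, symmetric] PD_pow_eta[OF abelian_groupE(1)[OF val_group[OF ip] a b]] pow_add[OF a b] ..
    also have "\<dots> = (\<Oplus>\<^bsub>PD_val R (indiscrete m)\<^esub> i \<in> {0..m}. PD_eta R (indiscrete m) (?t i))"
      using tr_closed[OF mm pc] by (intro add_hom_finsum[OF val_group[OF ip] PD_group[OF ip] PD_eta_hom[OF ip]])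
    also have "\<dots> = (\<Oplus>\<^bsub>PD_val R (indiscrete m)\<^esub> i \<in> {0..m}.
        PD_tr R (indiscrete i \<uplus> indiscrete (m - i)) (indiscrete m) (merge_map i)
          (PD_prod R (indiscrete i) (indiscrete (m - i)) (PD_pow R i x) (PD_pow R (m - i) y)))"
    proof (rule finsum_cong_set[OF PD_group[OF ip] refl])
      fix i assume i: "i \<in> {0..m}"
      show eq: "PD_eta R (indiscrete m) (?t i) = PD_tr R (indiscrete i \<uplus> indiscrete (m - i)) (indiscrete m) (merge_map i)
          (PD_prod R (indiscrete i) (indiscrete (m - i)) (PD_pow R i x) (PD_pow R (m - i) y))"
        unfolding PD_eta_tr[OF pc mm[OF i]] el(3)[OF ip ip pow_closed[OF a] pow_closed[OF b]] x y PD_pow_eta[OF a] PD_pow_eta[OF b] ..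
      show "PD_tr R (indiscrete i \<uplus> indiscrete (m - i)) (indiscrete m) (merge_map i)
          (PD_prod R (indiscrete i) (indiscrete (m - i)) (PD_pow R i x) (PD_pow R (m - i) y)) \<in> carrier (PD_val R (indiscrete m))"
        unfolding eq[symmetric] using PD_eta_closed[OF tr_closed[OF mm[OF i] pc]] .
    qed
    finally show "PD_pow R m (x \<oplus>\<^bsub>PD_val R (indiscrete 1)\<^esub> y) = (\<Oplus>\<^bsub>PD_val R (indiscrete m)\<^esub> i \<in> {0..m}.
        PD_tr R (indiscrete i \<uplus> indiscrete (m - i)) (indiscrete m) (merge_map i)
          (PD_prod R (indiscrete i) (indiscrete (m - i)) (PD_pow R i x) (PD_pow R (m - i) y)))" .
  qed
qed

text \<open>Naturality of \<eta> at one point and at m points moves the map past both occurrences of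
  \<eta>; what is left is that \<phi> commutes with the operations.\<close>

theorem PD_map_power_morphism:
  assumes N: "partition_power_functor N" and \<phi>: "power_morphism R N \<phi>" and R': "is_PD_power R R'" and N': "is_PD_power N N'"
  shows "power_morphism R' N' (PD_map N \<phi>)"
  unfolding power_morphism_def
proof (intro conjI allI ballI)
  interpret N: power_functor N using N by (simp add: power_functor_def)
  note ip = indiscrete_partition
  have \<phi>r: "ring_morphism R N \<phi>" and \<phi>w: "\<And>m a. a \<in> pf_carrier R (indiscrete 1) \<Longrightarrow> \<phi> (indiscrete m) (pw_op R m a) = pw_op N m (\<phi> (indiscrete 1) a)"
    using \<phi> by (auto simp: power_morphism_def)
  have \<phi>p: "pf_morphism R N \<phi>" using \<phi>r by (simp add: ring_morphism_def lax_morphism_def)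
  note L = is_PD_powerD(1)[OF R'] is_PD_powerD(1)[OF N']
  note S = is_PD_simps[OF is_PD_laxD(1)[OF L(1)]] is_PD_powerD(2)[OF R'] is_PD_powerD(2)[OF N']
  show "ring_morphism R' N' (PD_map N \<phi>)" using PD_map_ring_morphism[OF N.pring \<phi>r L] .
  have nat: "PD_map N \<phi> \<Lambda> (PD_eta R \<Lambda> z) = PD_eta N \<Lambda> (\<phi> \<Lambda> z)" if "is_partition \<Lambda>" "z \<in> pf_carrier R \<Lambda>" for \<Lambda> z
    using mor_eqD[OF PD_eta_natural[OF N.pf \<phi>p] that] by (simp add: mor_comp_def)
  fix m x assume "x \<in> pf_carrier R' (indiscrete 1)"
  hence "x \<in> carrier (PD_val R (indiscrete 1))" by (simp add: S)
  then obtain a where a: "a \<in> pf_carrier R (indiscrete 1)" and x: "x = PD_eta R (indiscrete 1) a" by (rule eta_1_cases)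
  show "PD_map N \<phi> (indiscrete m) (pw_op R' m x) = pw_op N' m (PD_map N \<phi> (indiscrete 1) x)"
    unfolding S x PD_pow_eta[OF a] nat[OF ip pow_closed[OF a]] nat[OF ip a] N.PD_pow_eta[OF pf_morphismD(2)[OF \<phi>p ip a]] \<phi>w[OF a] ..
qed

theorem PD_eta_power_morphism:
  assumes R': "is_PD_power R R'"
  shows "power_morphism R R' (PD_eta R)"
  unfolding power_morphism_def is_PD_powerD(2)[OF R']
  using PD_eta_ring_morphism[OF is_PD_powerD(1)[OF R']] by (simp del: One_nat_def add: PD_pow_eta)

text \<open>On an argument \<eta> a the operation of the twofold construction is \<eta> of the
  operation at a, and \<mu> cancels \<eta> on both sides.\<close>

theorem PD_mu_power_morphism:
  assumes R': "is_PD_power R R'" and R'': "is_PD_power R' R''"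
  shows "power_morphism R'' R' PD_mu"
  unfolding power_morphism_def
proof (intro conjI allI ballI)
  interpret R': power_functor R' using PD_partition_power_functor[OF R'] by (simp add: power_functor_def)
  note ip = indiscrete_partition
  note L = is_PD_powerD(1)[OF R'] is_PD_powerD(1)[OF R'']
  note S = is_PD_simps[OF is_PD_laxD(1)[OF L(2)]] is_PD_powerD(2)[OF R'']
  show "ring_morphism R'' R' PD_mu" using PD_mu_ring_morphism[OF L] .
  have unit: "PD_mu \<Lambda> (PD_eta R' \<Lambda> z) = z" if "is_partition \<Lambda>" "z \<in> pf_carrier R' \<Lambda>" for \<Lambda> z
    using mor_eqD[OF PD_mu_eta[OF is_PD_laxD(1)[OF L(1)]] that] by (simp add: mor_comp_def mor_id_def)
  fix m x assume "x \<in> pf_carrier R'' (indiscrete 1)"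
  hence "x \<in> carrier (PD_val R' (indiscrete 1))" by (simp add: S)
  then obtain a where a: "a \<in> pf_carrier R' (indiscrete 1)" and x: "x = PD_eta R' (indiscrete 1) a" by (rule R'.eta_1_cases)
  show "PD_mu (indiscrete m) (pw_op R'' m x) = pw_op R' m (PD_mu (indiscrete 1) x)"
    unfolding S x R'.PD_pow_eta[OF a] unit[OF ip R'.pow_closed[OF a]] unit[OF ip a] ..
qed

end

section \<open>The monads\<close>

lemma is_PD_PD: "is_PD M (PD M)"
  by (simp add: is_PD_def PD_def)

lemma is_PD_PD_lax: "is_PD R (PD_lax R)" "is_PD_lax R (PD_lax R)"
  by (simp_all add: is_PD_def is_PD_lax_def PD_lax_def)

lemma is_PD_PD_power: "is_PD R (PD_power R)" "is_PD_power R (PD_power R)"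
  by (simp_all add: is_PD_def is_PD_lax_def is_PD_power_def PD_power_def)

lemma ring_functorD:
  "partition_ring R \<Longrightarrow> ring_functor R" "partition_ring R \<Longrightarrow> lax_partition_functor R"
  "ring_morphism R S \<phi> \<Longrightarrow> lax_morphism R S \<phi>"
  by (simp_all add: ring_functor_def partition_ring_def ring_morphism_def)

lemma power_functorD:
  "partition_power_functor R \<Longrightarrow> power_functor R" "partition_power_functor R \<Longrightarrow> partition_ring R"
  "power_morphism R S \<phi> \<Longrightarrow> ring_morphism R S \<phi>"
  by (simp_all add: power_functor_def partition_power_functor_def power_morphism_def)

lemmas ring_underlying = part_functorD lax_functorD lax_partition_functorD lax_morphismD(1) ring_functorD
lemmas power_underlying = ring_underlying power_functorD

text \<open>Equality of morphisms is equality on elements and ignores additional structure. These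
  laws therefore apply to all four categories after the objects and morphisms have been replaced by
  the underlying partition functors.\<close>

lemmas PD_monad_laws = part_functor.PD_map_id part_functor.PD_map_comp part_functor.PD_eta_natural
  part_functor.PD_mu_natural part_functor.PD_mu_assoc part_functor.PD_mu_map_eta part_functor.PD_mu_eta

theorem theorem1p1:
  shows "(  (\<forall>M :: ('u, 'a) pfun. partition_functor M \<longrightarrow> partition_functor (PD M))
     \<and> (\<forall>(M :: ('u, 'a) pfun) (N :: ('u, 'b) pfun) \<phi>. partition_functor M \<and> partition_functor N \<and> pf_morphism M N \<phi> \<longrightarrow>
           pf_morphism (PD M) (PD N) (PD_map N \<phi>))
     \<and> (\<forall>M :: ('u, 'a) pfun. partition_functor M \<longrightarrow> mor_eq (PD M) (PD_map M mor_id) mor_id)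
     \<and> (\<forall>(M :: ('u, 'a) pfun) (N :: ('u, 'b) pfun) (L :: ('u, 'c) pfun) \<phi> \<psi>.
           partition_functor M \<and> partition_functor N \<and> partition_functor L \<and> pf_morphism M N \<phi> \<and> pf_morphism N L \<psi> \<longrightarrow>
           mor_eq (PD M) (PD_map L (\<psi> \<bullet> \<phi>)) (PD_map L \<psi> \<bullet> PD_map N \<phi>))
     \<and> (\<forall>M :: ('u, 'a) pfun. partition_functor M \<longrightarrow> pf_morphism M (PD M) (PD_eta M))
     \<and> (\<forall>(M :: ('u, 'a) pfun) (N :: ('u, 'b) pfun) \<phi>. partition_functor M \<and> partition_functor N \<and> pf_morphism M N \<phi> \<longrightarrow>
           mor_eq M (PD_eta N \<bullet> \<phi>) (PD_map N \<phi> \<bullet> PD_eta M))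
     \<and> (\<forall>M :: ('u, 'a) pfun. partition_functor M \<longrightarrow> pf_morphism (PD (PD M)) (PD M) PD_mu)
     \<and> (\<forall>(M :: ('u, 'a) pfun) (N :: ('u, 'b) pfun) \<phi>. partition_functor M \<and> partition_functor N \<and> pf_morphism M N \<phi> \<longrightarrow>
           mor_eq (PD (PD M)) (PD_mu \<bullet> PD_map (PD N) (PD_map N \<phi>)) (PD_map N \<phi> \<bullet> PD_mu))
     \<and> (\<forall>M :: ('u, 'a) pfun. partition_functor M \<longrightarrow>
           mor_eq (PD (PD (PD M))) (PD_mu \<bullet> PD_map (PD M) PD_mu) (PD_mu \<bullet> PD_mu))
     \<and> (\<forall>M :: ('u, 'a) pfun. partition_functor M \<longrightarrow>
           mor_eq (PD M) (PD_mu \<bullet> PD_map (PD M) (PD_eta M)) mor_id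
         \<and> mor_eq (PD M) (PD_mu \<bullet> PD_eta (PD M)) mor_id))
   \<and> (  (\<forall>M :: ('u, 'a) lax_pfun. lax_partition_functor M \<longrightarrow> lax_partition_functor (PD_lax M))
     \<and> (\<forall>(M :: ('u, 'a) lax_pfun) (N :: ('u, 'b) lax_pfun) \<phi>. lax_partition_functor M \<and> lax_partition_functor N \<and> lax_morphism M N \<phi> \<longrightarrow>
           lax_morphism (PD_lax M) (PD_lax N) (PD_map N \<phi>))
     \<and> (\<forall>M :: ('u, 'a) lax_pfun. lax_partition_functor M \<longrightarrow> mor_eq (PD_lax M) (PD_map M mor_id) mor_id)
     \<and> (\<forall>(M :: ('u, 'a) lax_pfun) (N :: ('u, 'b) lax_pfun) (L :: ('u, 'c) lax_pfun) \<phi> \<psi>.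
           lax_partition_functor M \<and> lax_partition_functor N \<and> lax_partition_functor L \<and> lax_morphism M N \<phi> \<and> lax_morphism N L \<psi> \<longrightarrow>
           mor_eq (PD_lax M) (PD_map L (\<psi> \<bullet> \<phi>)) (PD_map L \<psi> \<bullet> PD_map N \<phi>))
     \<and> (\<forall>M :: ('u, 'a) lax_pfun. lax_partition_functor M \<longrightarrow> lax_morphism M (PD_lax M) (PD_eta M))
     \<and> (\<forall>(M :: ('u, 'a) lax_pfun) (N :: ('u, 'b) lax_pfun) \<phi>. lax_partition_functor M \<and> lax_partition_functor N \<and> lax_morphism M N \<phi> \<longrightarrow>
           mor_eq M (PD_eta N \<bullet> \<phi>) (PD_map N \<phi> \<bullet> PD_eta M))
     \<and> (\<forall>M :: ('u, 'a) lax_pfun. lax_partition_functor M \<longrightarrow> lax_morphism (PD_lax (PD_lax M)) (PD_lax M) PD_mu)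
     \<and> (\<forall>(M :: ('u, 'a) lax_pfun) (N :: ('u, 'b) lax_pfun) \<phi>. lax_partition_functor M \<and> lax_partition_functor N \<and> lax_morphism M N \<phi> \<longrightarrow>
           mor_eq (PD_lax (PD_lax M)) (PD_mu \<bullet> PD_map (PD_lax N) (PD_map N \<phi>)) (PD_map N \<phi> \<bullet> PD_mu))
     \<and> (\<forall>M :: ('u, 'a) lax_pfun. lax_partition_functor M \<longrightarrow>
           mor_eq (PD_lax (PD_lax (PD_lax M))) (PD_mu \<bullet> PD_map (PD_lax M) PD_mu) (PD_mu \<bullet> PD_mu))
     \<and> (\<forall>M :: ('u, 'a) lax_pfun. lax_partition_functor M \<longrightarrow>
           mor_eq (PD_lax M) (PD_mu \<bullet> PD_map (PD_lax M) (PD_eta M)) mor_id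
         \<and> mor_eq (PD_lax M) (PD_mu \<bullet> PD_eta (PD_lax M)) mor_id))
   \<and> (  (\<forall>M :: ('u, 'a) lax_pfun. partition_ring M \<longrightarrow> partition_ring (PD_lax M))
     \<and> (\<forall>(M :: ('u, 'a) lax_pfun) (N :: ('u, 'b) lax_pfun) \<phi>. partition_ring M \<and> partition_ring N \<and> ring_morphism M N \<phi> \<longrightarrow>
           ring_morphism (PD_lax M) (PD_lax N) (PD_map N \<phi>))
     \<and> (\<forall>M :: ('u, 'a) lax_pfun. partition_ring M \<longrightarrow> mor_eq (PD_lax M) (PD_map M mor_id) mor_id)
     \<and> (\<forall>(M :: ('u, 'a) lax_pfun) (N :: ('u, 'b) lax_pfun) (L :: ('u, 'c) lax_pfun) \<phi> \<psi>.
           partition_ring M \<and> partition_ring N \<and> partition_ring L \<and> ring_morphism M N \<phi> \<and> ring_morphism N L \<psi> \<longrightarrow>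
           mor_eq (PD_lax M) (PD_map L (\<psi> \<bullet> \<phi>)) (PD_map L \<psi> \<bullet> PD_map N \<phi>))
     \<and> (\<forall>M :: ('u, 'a) lax_pfun. partition_ring M \<longrightarrow> ring_morphism M (PD_lax M) (PD_eta M))
     \<and> (\<forall>(M :: ('u, 'a) lax_pfun) (N :: ('u, 'b) lax_pfun) \<phi>. partition_ring M \<and> partition_ring N \<and> ring_morphism M N \<phi> \<longrightarrow>
           mor_eq M (PD_eta N \<bullet> \<phi>) (PD_map N \<phi> \<bullet> PD_eta M))
     \<and> (\<forall>M :: ('u, 'a) lax_pfun. partition_ring M \<longrightarrow> ring_morphism (PD_lax (PD_lax M)) (PD_lax M) PD_mu)
     \<and> (\<forall>(M :: ('u, 'a) lax_pfun) (N :: ('u, 'b) lax_pfun) \<phi>. partition_ring M \<and> partition_ring N \<and> ring_morphism M N \<phi> \<longrightarrow>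
           mor_eq (PD_lax (PD_lax M)) (PD_mu \<bullet> PD_map (PD_lax N) (PD_map N \<phi>)) (PD_map N \<phi> \<bullet> PD_mu))
     \<and> (\<forall>M :: ('u, 'a) lax_pfun. partition_ring M \<longrightarrow>
           mor_eq (PD_lax (PD_lax (PD_lax M))) (PD_mu \<bullet> PD_map (PD_lax M) PD_mu) (PD_mu \<bullet> PD_mu))
     \<and> (\<forall>M :: ('u, 'a) lax_pfun. partition_ring M \<longrightarrow>
           mor_eq (PD_lax M) (PD_mu \<bullet> PD_map (PD_lax M) (PD_eta M)) mor_id
         \<and> mor_eq (PD_lax M) (PD_mu \<bullet> PD_eta (PD_lax M)) mor_id))
   \<and> (  (\<forall>M :: ('u, 'a) power_pfun. partition_power_functor M \<longrightarrow> partition_power_functor (PD_power M))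
     \<and> (\<forall>(M :: ('u, 'a) power_pfun) (N :: ('u, 'b) power_pfun) \<phi>. partition_power_functor M \<and> partition_power_functor N \<and> power_morphism M N \<phi> \<longrightarrow>
           power_morphism (PD_power M) (PD_power N) (PD_map N \<phi>))
     \<and> (\<forall>M :: ('u, 'a) power_pfun. partition_power_functor M \<longrightarrow> mor_eq (PD_power M) (PD_map M mor_id) mor_id)
     \<and> (\<forall>(M :: ('u, 'a) power_pfun) (N :: ('u, 'b) power_pfun) (L :: ('u, 'c) power_pfun) \<phi> \<psi>.
           partition_power_functor M \<and> partition_power_functor N \<and> partition_power_functor L \<and> power_morphism M N \<phi> \<and> power_morphism N L \<psi> \<longrightarrow>
           mor_eq (PD_power M) (PD_map L (\<psi> \<bullet> \<phi>)) (PD_map L \<psi> \<bullet> PD_map N \<phi>))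
     \<and> (\<forall>M :: ('u, 'a) power_pfun. partition_power_functor M \<longrightarrow> power_morphism M (PD_power M) (PD_eta M))
     \<and> (\<forall>(M :: ('u, 'a) power_pfun) (N :: ('u, 'b) power_pfun) \<phi>. partition_power_functor M \<and> partition_power_functor N \<and> power_morphism M N \<phi> \<longrightarrow>
           mor_eq M (PD_eta N \<bullet> \<phi>) (PD_map N \<phi> \<bullet> PD_eta M))
     \<and> (\<forall>M :: ('u, 'a) power_pfun. partition_power_functor M \<longrightarrow> power_morphism (PD_power (PD_power M)) (PD_power M) PD_mu)
     \<and> (\<forall>(M :: ('u, 'a) power_pfun) (N :: ('u, 'b) power_pfun) \<phi>. partition_power_functor M \<and> partition_power_functor N \<and> power_morphism M N \<phi> \<longrightarrow>
           mor_eq (PD_power (PD_power M)) (PD_mu \<bullet> PD_map (PD_power N) (PD_map N \<phi>)) (PD_map N \<phi> \<bullet> PD_mu))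
     \<and> (\<forall>M :: ('u, 'a) power_pfun. partition_power_functor M \<longrightarrow>
           mor_eq (PD_power (PD_power (PD_power M))) (PD_mu \<bullet> PD_map (PD_power M) PD_mu) (PD_mu \<bullet> PD_mu))
     \<and> (\<forall>M :: ('u, 'a) power_pfun. partition_power_functor M \<longrightarrow>
           mor_eq (PD_power M) (PD_mu \<bullet> PD_map (PD_power M) (PD_eta M)) mor_id
         \<and> mor_eq (PD_power M) (PD_mu \<bullet> PD_eta (PD_power M)) mor_id))"
  \<comment> \<open>The closure and morphism statements are particular to each category; the
    remaining conjuncts are the common laws, reached through the forgetful implications.\<close>
  by (intro conjI allI impI; (elim conjE)?;
      ((rule part_functor.PD_partition_functor PD_map_morphism part_functor.PD_eta_morphism PD_mu_morphism PD_monad_laws;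
        (assumption | rule is_PD_PD part_functorD)+; fail)
    | (rule lax_functor.PD_lax_partition_functor lax_functor.PD_map_lax_morphism lax_functor.PD_eta_lax_morphism
          lax_functor.PD_mu_lax_morphism ring_functor.PD_partition_ring ring_functor.PD_map_ring_morphism
          ring_functor.PD_eta_ring_morphism ring_functor.PD_mu_ring_morphism PD_monad_laws;
        (assumption | rule is_PD_PD_lax ring_underlying)+; fail)
    | (rule power_functor.PD_partition_power_functor power_functor.PD_map_power_morphism
          power_functor.PD_eta_power_morphism power_functor.PD_mu_power_morphism PD_monad_laws;
        (assumption | rule is_PD_PD_power power_underlying)+; fail)))


end
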